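(* Let $(M,\tau)$ be a von Neumann algebra with a normal faithful trace-state. Assume $Y_j=Y_j^*\in M$, $1\le j\le n$, are algebraically free and $\{Y_1,\dots,Y_n\}$ generates $M$, and let $K=K^*\in\mathrm{Vect}\,\mathbb{C}\langle Y_1,\dots,Y_n\rangle$. If $K$ is trace-preserving, then $D_K^{\varepsilon}$ exponentiates to a one-parameter group of trace-preserving automorphisms of $M$.
   Context: $\mathbb{C}_{\langle n\rangle}=\mathbb{C}\langle X_1,\dots,X_n\rangle$ is the ring of noncommutative polynomials; $\mathbb{C}\langle Y_1,\dots,Y_n\rangle$ is the unital subalgebra of $M$ generated by the $Y_j$. Algebraically free means that evaluation $P\mapsto P(Y_1,\dots,Y_n)$ is injective on $\mathbb{C}_{\langle n\rangle}$. "Generates" is as a von Neumann algebra. $\mathrm{Vect}\,\mathbb{C}\langle Y_1,\dots,Y_n\rangle$ is the set of $n$-tuples $K=(K_1,\dots,K_n)$ of elements of $\mathbb{C}\langle Y_1,\dots,Y_n\rangle$, and $K^*=(K_1^*,\dots,K_n^* )$. The partial cyclic derivatives $\delta_j:\mathbb{C}_{\langle n\rangle}\to\mathbb{C}_{\langle n\rangle}$ are the linear maps with $\delta_j1=0$ and $\delta_jX_{i_1}\cdots X_{i_p}=\sum_{k:\,i_k=j}X_{i_{k+1}}\cdots X_{i_p}X_{i_1}\cdots X_{i_{k-1}}$. $K$ is called trace-preserving if $\sum_{1\le j\le n}\tau((\delta_jP)(Y_1,\dots,Y_n)K_j)=0$ for all $P\in\mathbb{C}_{\langle n\rangle}$.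 $D_K^{\varepsilon}$ is the derivation of $\mathbb{C}\langle Y_1,\dots,Y_n\rangle$ with $D_K^{\varepsilon}Y_j=K_j$, viewed as a densely defined operator in $L^2(M,\tau)$ with domain $\mathbb{C}\langle Y_1,\dots,Y_n\rangle$. $M$ acts on $L^2(M,\tau)$ by left multiplication. "$D_K^{\varepsilon}$ exponentiates to a one-parameter group of trace-preserving automorphisms of $M$" means: the closure $\overline{H}$ of $H=-iD_K^{\varepsilon}$ is selfadjoint in $L^2(M,\tau)$ and $\exp(tD_K^{\varepsilon})(x):=e^{it\overline{H}}\,x\,e^{-it\overline{H}}$, $x\in M$, $t\in\mathbb{R}$, defines a one-parameter group of automorphisms of $M$ with $\tau\circ\exp(tD_K^{\varepsilon})=\tau$. *)

theory Defs
  imports "HOL-Analysis.Analysis" "HOL-Library.Poly_Mapping" "HOL-Library.FuncSet"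
begin

section \<open>Complex Hilbert spaces\<close>

text \<open>The inner product is linear in the first argument. The class \<^class>\<open>banach\<close> supplies the
  norm topology and completeness.\<close>

class complex_hilbert = banach +
  fixes scaleC :: "complex \<Rightarrow> 'a \<Rightarrow> 'a" (infixr "*\<^sub>C" 75)
    and cinner :: "'a \<Rightarrow> 'a \<Rightarrow> complex"
  assumes scaleC_add_right: "c *\<^sub>C (x + y) = c *\<^sub>C x + c *\<^sub>C y"
    and scaleC_add_left: "(c + d) *\<^sub>C x = c *\<^sub>C x + d *\<^sub>C x"
    and scaleC_scaleC: "c *\<^sub>C (d *\<^sub>C x) = (c * d) *\<^sub>C x"
    and scaleR_scaleC: "r *\<^sub>R x = complex_of_real r *\<^sub>C x"
    and cinner_add_left: "cinner (x + y) z = cinner x z + cinner y z"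
    and cinner_scaleC_left: "cinner (c *\<^sub>C x) y = c * cinner x y"
    and cinner_commute: "cinner x y = cnj (cinner y x)"
    and cinner_self: "cinner x x = complex_of_real ((norm x)\<^sup>2)"


section \<open>Bounded operators and von Neumann algebras\<close>

definition bounded_clinear ::
    "('a::complex_hilbert \<Rightarrow> 'b::complex_hilbert) \<Rightarrow> bool" where
  "bounded_clinear T \<longleftrightarrow> bounded_linear T \<and> (\<forall>c x. T (c *\<^sub>C x) = c *\<^sub>C T x)"

definition adj :: "('a::complex_hilbert \<Rightarrow> 'a) \<Rightarrow> 'a \<Rightarrow> 'a" where
  "adj T = (THE S. \<forall>x y. cinner (T x) y = cinner x (S y))"

definition unital_subalgebra :: "('a::complex_hilbert \<Rightarrow> 'a) set \<Rightarrow> bool" where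
  "unital_subalgebra A \<longleftrightarrow>
     (\<forall>S\<in>A. bounded_clinear S) \<and> id \<in> A \<and>
     (\<forall>S\<in>A. \<forall>T\<in>A. (\<lambda>x. S x + T x) \<in> A) \<and>
     (\<forall>c. \<forall>S\<in>A. (\<lambda>x. c *\<^sub>C S x) \<in> A) \<and>
     (\<forall>S\<in>A. \<forall>T\<in>A. S \<circ> T \<in> A)"

definition commutant :: "('a::complex_hilbert \<Rightarrow> 'a) set \<Rightarrow> ('a \<Rightarrow> 'a) set" where
  "commutant A = {T. bounded_clinear T \<and> (\<forall>S\<in>A. T \<circ> S = S \<circ> T)}"

definition von_neumann_algebra :: "('a::complex_hilbert \<Rightarrow> 'a) set \<Rightarrow> bool" where
  "von_neumann_algebra M \<longleftrightarrow>
     unital_subalgebra M \<and> (\<forall>T\<in>M. adj T \<in> M) \<and> commutant (commutant M) = M"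

text \<open>The coarsest topology on the bounded operators for which every functional
  \<open>T \<mapsto> \<Sum>n. \<langle>T (\<xi> n), \<zeta> n\<rangle>\<close> with square-summable \<open>\<xi>\<close>, \<open>\<zeta>\<close> is continuous.\<close>

definition ultraweak_topology :: "('a::complex_hilbert \<Rightarrow> 'a) topology" where
  "ultraweak_topology = topology_generated_by
     {{T. bounded_clinear T \<and> suminf (\<lambda>n. cinner (T (\<xi> n)) (\<zeta> n)) \<in> W} | \<xi> \<zeta> W.
        summable (\<lambda>n. (norm (\<xi> n))\<^sup>2) \<and> summable (\<lambda>n. (norm (\<zeta> n))\<^sup>2) \<and> open W}"

text \<open>Normality is ultraweak continuity.\<close>

definition normal_faithful_trace_state ::
    "('a::complex_hilbert \<Rightarrow> 'a) set \<Rightarrow> (('a \<Rightarrow> 'a) \<Rightarrow> complex) \<Rightarrow> bool" where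
  "normal_faithful_trace_state M \<tau> \<longleftrightarrow>
     (\<forall>S\<in>M. \<forall>T\<in>M. \<tau> (\<lambda>x. S x + T x) = \<tau> S + \<tau> T) \<and>
     (\<forall>c. \<forall>S\<in>M. \<tau> (\<lambda>x. c *\<^sub>C S x) = c * \<tau> S) \<and>
     (\<forall>S\<in>M. \<tau> (adj S \<circ> S) \<in> nonneg_Reals) \<and>
     \<tau> id = 1 \<and>
     (\<forall>S\<in>M. \<forall>T\<in>M. \<tau> (S \<circ> T) = \<tau> (T \<circ> S)) \<and>
     (\<forall>S\<in>M. \<tau> (adj S \<circ> S) = 0 \<longrightarrow> S = (\<lambda>x. 0)) \<and>
     continuous_map (subtopology ultraweak_topology M) euclidean \<tau>"


section \<open>The space \<open>L\<^sup>2(M,\<tau>)\<close>\<close>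

text \<open>\<open>\<eta>\<close> exhibits the Hilbert space \<open>'l\<close> as the completion of \<open>M\<close> with respect to the inner
  product \<open>\<langle>S, T\<rangle> = \<tau> (T\<^sup>* S)\<close>. This determines \<open>('l, \<eta>)\<close> up to a unique unitary, and results are
  stated for every such completion, because a type cannot depend on \<open>M\<close> and \<open>\<tau>\<close>.\<close>

definition L2_completion ::
    "('a::complex_hilbert \<Rightarrow> 'a) set \<Rightarrow> (('a \<Rightarrow> 'a) \<Rightarrow> complex)
      \<Rightarrow> (('a \<Rightarrow> 'a) \<Rightarrow> 'l::complex_hilbert) \<Rightarrow> bool" where
  "L2_completion M \<tau> \<eta> \<longleftrightarrow>
     (\<forall>S\<in>M. \<forall>T\<in>M. \<eta> (\<lambda>x. S x + T x) = \<eta> S + \<eta> T) \<and>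
     (\<forall>c. \<forall>S\<in>M. \<eta> (\<lambda>x. c *\<^sub>C S x) = c *\<^sub>C \<eta> S) \<and>
     (\<forall>S\<in>M. \<forall>T\<in>M. cinner (\<eta> S) (\<eta> T) = \<tau> (adj T \<circ> S)) \<and>
     closure (\<eta> ` M) = UNIV"

definition left_mult ::
    "('a::complex_hilbert \<Rightarrow> 'a) set \<Rightarrow> (('a \<Rightarrow> 'a) \<Rightarrow> 'l::complex_hilbert)
      \<Rightarrow> ('a \<Rightarrow> 'a) \<Rightarrow> 'l \<Rightarrow> 'l" where
  "left_mult M \<eta> S = (THE L. bounded_clinear L \<and> (\<forall>T\<in>M. L (\<eta> T) = \<eta> (S \<circ> T)))"


section \<open>Unbounded operators\<close>

text \<open>Unbounded operators are given by their graphs, so the closure of a closable operator is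
  the topological \<^const>\<open>closure\<close> of its graph.\<close>

definition densely_defined_operator :: "('l::complex_hilbert \<times> 'l) set \<Rightarrow> bool" where
  "densely_defined_operator G \<longleftrightarrow>
     single_valued G \<and> (0, 0) \<in> G \<and>
     (\<forall>(u, v)\<in>G. \<forall>(u', v')\<in>G. (u + u', v + v') \<in> G) \<and>
     (\<forall>c. \<forall>(u, v)\<in>G. (c *\<^sub>C u, c *\<^sub>C v) \<in> G) \<and>
     closure (Domain G) = UNIV"

definition graph_adjoint :: "('l::complex_hilbert \<times> 'l) set \<Rightarrow> ('l \<times> 'l) set" where
  "graph_adjoint G = {(\<xi>, \<zeta>). \<forall>(u, v)\<in>G. cinner v \<xi> = cinner u \<zeta>}"

definition selfadjoint_operator :: "('l::complex_hilbert \<times> 'l) set \<Rightarrow> bool" where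
  "selfadjoint_operator G \<longleftrightarrow> densely_defined_operator G \<and> graph_adjoint G = G"

definition unitary :: "('l::complex_hilbert \<Rightarrow> 'l) \<Rightarrow> bool" where
  "unitary U \<longleftrightarrow> bounded_clinear U \<and> surj U \<and> (\<forall>x y. cinner (U x) (U y) = cinner x y)"

definition unitary_group :: "(real \<Rightarrow> 'l::complex_hilbert \<Rightarrow> 'l) \<Rightarrow> bool" where
  "unitary_group U \<longleftrightarrow>
     (\<forall>t. unitary (U t)) \<and> U 0 = id \<and> (\<forall>s t. U (s + t) = U s \<circ> U t) \<and>
     (\<forall>\<xi>. continuous_on UNIV (\<lambda>t. U t \<xi>))"

definition generator :: "(real \<Rightarrow> 'l::complex_hilbert \<Rightarrow> 'l) \<Rightarrow> ('l \<times> 'l) set" where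
  "generator U = {(\<xi>, \<zeta>). ((\<lambda>t. (U t \<xi> - \<xi>) /\<^sub>R t) \<longlongrightarrow> \<zeta>) (at 0)}"

text \<open>For selfadjoint \<open>H\<close>, \<open>exp_i H t\<close> is the unitary \<open>exp (\<i> t H)\<close>: by Stone's theorem there is
  exactly one strongly continuous one-parameter unitary group with generator \<open>\<i> H\<close>.\<close>

definition exp_i :: "('l::complex_hilbert \<times> 'l) set \<Rightarrow> real \<Rightarrow> 'l \<Rightarrow> 'l" where
  "exp_i H = (THE U. unitary_group U \<and> generator U = {(\<xi>, \<i> *\<^sub>C \<zeta>) | \<xi> \<zeta>. (\<xi>, \<zeta>) \<in> H})"


section \<open>Noncommutative polynomials\<close>

text \<open>Variables are indexed by a finite type \<open>'n\<close>; the word \<open>[i\<^sub>1, \<dots>, i\<^sub>p]\<close> stands for the monomial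
  \<open>X\<^bsub>i\<^sub>1\<^esub> \<cdots> X\<^bsub>i\<^sub>p\<^esub>\<close>. Only the linear structure of the free algebra is needed.\<close>

type_synonym 'n ncpoly = "'n list \<Rightarrow>\<^sub>0 complex"

definition nc_eval :: "('n::finite \<Rightarrow> 'a::complex_hilbert \<Rightarrow> 'a) \<Rightarrow> 'n ncpoly \<Rightarrow> 'a \<Rightarrow> 'a" where
  "nc_eval Y P =
     (\<lambda>x. \<Sum>w\<in>Poly_Mapping.keys P. Poly_Mapping.lookup P w *\<^sub>C foldr (\<circ>) (map Y w) id x)"

definition cyclic_derivative :: "'n::finite \<Rightarrow> 'n ncpoly \<Rightarrow> 'n ncpoly" where
  "cyclic_derivative j P =
     (\<Sum>w\<in>Poly_Mapping.keys P. \<Sum>k | k < length w \<and> w ! k = j.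
        Poly_Mapping.single (drop (Suc k) w @ take k w) (Poly_Mapping.lookup P w))"

definition algebraically_free :: "('n::finite \<Rightarrow> 'a::complex_hilbert \<Rightarrow> 'a) \<Rightarrow> bool" where
  "algebraically_free Y \<longleftrightarrow> inj (nc_eval Y)"

definition generated_algebra ::
    "('n::finite \<Rightarrow> 'a::complex_hilbert \<Rightarrow> 'a) \<Rightarrow> ('a \<Rightarrow> 'a) set" where
  "generated_algebra Y = unital_subalgebra hull range Y"

definition trace_preserving ::
    "(('a::complex_hilbert \<Rightarrow> 'a) \<Rightarrow> complex) \<Rightarrow> ('n::finite \<Rightarrow> 'a \<Rightarrow> 'a)
      \<Rightarrow> ('n \<Rightarrow> 'a \<Rightarrow> 'a) \<Rightarrow> bool" where
  "trace_preserving \<tau> Y K \<longleftrightarrow>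
     (\<forall>P. (\<Sum>j\<in>UNIV. \<tau> (nc_eval Y (cyclic_derivative j P) \<circ> K j)) = 0)"


section \<open>The derivation and its exponential\<close>

definition derivation_on ::
    "('a::complex_hilbert \<Rightarrow> 'a) set \<Rightarrow> (('a \<Rightarrow> 'a) \<Rightarrow> 'a \<Rightarrow> 'a) \<Rightarrow> bool" where
  "derivation_on A D \<longleftrightarrow>
     D \<in> A \<rightarrow>\<^sub>E A \<and>
     (\<forall>S\<in>A. \<forall>T\<in>A. D (\<lambda>x. S x + T x) = (\<lambda>x. D S x + D T x)) \<and>
     (\<forall>c. \<forall>S\<in>A. D (\<lambda>x. c *\<^sub>C S x) = (\<lambda>x. c *\<^sub>C D S x)) \<and>
     (\<forall>S\<in>A. \<forall>T\<in>A. D (S \<circ> T) = (\<lambda>x. (D S \<circ> T) x + (S \<circ> D T) x))"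

text \<open>Uniqueness holds because the \<open>Y j\<close> generate the algebra, existence because they are
  algebraically free.\<close>

definition vect_derivation ::
    "('n::finite \<Rightarrow> 'a::complex_hilbert \<Rightarrow> 'a) \<Rightarrow> ('n \<Rightarrow> 'a \<Rightarrow> 'a)
      \<Rightarrow> ('a \<Rightarrow> 'a) \<Rightarrow> 'a \<Rightarrow> 'a" where
  "vect_derivation Y K =
     (THE D. derivation_on (generated_algebra Y) D \<and> (\<forall>j. D (Y j) = K j))"

definition trace_preserving_automorphism_group ::
    "('a::complex_hilbert \<Rightarrow> 'a) set \<Rightarrow> (('a \<Rightarrow> 'a) \<Rightarrow> complex)
      \<Rightarrow> (real \<Rightarrow> ('a \<Rightarrow> 'a) \<Rightarrow> 'a \<Rightarrow> 'a) \<Rightarrow> bool" where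
  "trace_preserving_automorphism_group M \<tau> \<alpha> \<longleftrightarrow>
     (\<forall>t. bij_betw (\<alpha> t) M M \<and>
        (\<forall>S\<in>M. \<forall>T\<in>M. \<alpha> t (\<lambda>x. S x + T x) = (\<lambda>x. \<alpha> t S x + \<alpha> t T x)) \<and>
        (\<forall>c. \<forall>S\<in>M. \<alpha> t (\<lambda>x. c *\<^sub>C S x) = (\<lambda>x. c *\<^sub>C \<alpha> t S x)) \<and>
        (\<forall>S\<in>M. \<forall>T\<in>M. \<alpha> t (S \<circ> T) = \<alpha> t S \<circ> \<alpha> t T) \<and>
        (\<forall>S\<in>M. \<alpha> t (adj S) = adj (\<alpha> t S)) \<and>
        (\<forall>S\<in>M. \<tau> (\<alpha> t S) = \<tau> S)) \<and>
     (\<forall>S\<in>M. \<alpha> 0 S = S) \<and>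
     (\<forall>s t. \<forall>S\<in>M. \<alpha> (s + t) S = \<alpha> s (\<alpha> t S))"

text \<open>\<open>A\<close> is the domain of the derivation \<open>D\<close> and \<open>H\<close> the closure of \<open>-\<i> D\<close> in \<open>L\<^sup>2(M,\<tau>)\<close>. The
  automorphisms \<open>\<alpha> t\<close> are determined by the displayed identity, since \<^const>\<open>left_mult\<close> is
  faithful.\<close>

definition exponentiates ::
    "('a::complex_hilbert \<Rightarrow> 'a) set \<Rightarrow> (('a \<Rightarrow> 'a) \<Rightarrow> complex)
      \<Rightarrow> (('a \<Rightarrow> 'a) \<Rightarrow> 'l::complex_hilbert)
      \<Rightarrow> ('a \<Rightarrow> 'a) set \<Rightarrow> (('a \<Rightarrow> 'a) \<Rightarrow> 'a \<Rightarrow> 'a) \<Rightarrow> bool" where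
  "exponentiates M \<tau> \<eta> A D \<longleftrightarrow>
     (let H = closure {(\<eta> S, (- \<i>) *\<^sub>C \<eta> (D S)) | S. S \<in> A} in
        selfadjoint_operator H \<and>
        (\<exists>\<alpha>. (\<forall>t. \<forall>S\<in>M. left_mult M \<eta> (\<alpha> t S) = exp_i H t \<circ> left_mult M \<eta> S \<circ> exp_i H (- t)) \<and>
             trace_preserving_automorphism_group M \<tau> \<alpha>))"

end

theory Submission imports Defs begin

text \<open>Trace preservation says that \<open>\<tau> \<circ> D = 0\<close>, so \<open>D\<close> is antisymmetric in \<open>L\<^sup>2(M,\<tau>)\<close>. Since \<open>D\<close> raises
  degrees by a bounded amount, the series \<open>\<Sum>k. t^k/k! D^k a\<close> converges in operator norm for all
  polynomials \<open>a\<close> and all \<open>t\<close> in an interval around \<open>0\<close> that does not depend on \<open>a\<close>. It defines a local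
  group of isometries, which extends to a unitary group \<open>U\<close>; a vector orthogonal to the range of
  \<open>-\<i> D \<plusminus> \<i>\<close> would be an eigenvector of \<open>(U t)\<^sup>*\<close> with eigenvalue of modulus different from \<open>1\<close>, so \<open>-\<i> D\<close> is
  essentially self-adjoint and \<open>U\<close> is its exponential. Multiplicativity of the series shows that \<open>U t\<close>
  conjugates left multiplication by a self-adjoint polynomial into left multiplication by an element
  of \<open>M\<close>. This passes to all of \<open>M\<close> by Kaplansky's trick: approximating \<open>z\<close> in trace norm by polynomials
  \<open>a\<close>, the operators \<open>2 a / (1 + a\<^sup>2)\<close> and their images are contractions, and bounded subsets of \<open>M\<close> are
  complete in trace norm because \<open>\<tau>\<close> is normal.\<close>

section \<open>Hilbert spaces\<close>

text \<open>Iterating the derivation k times on a polynomial of degree p multiplies the coefficient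
  bounds by a product of the growing degrees p, p + d, ..., p + (k - 1) d. This product is at most
  2^(p + k) k! d^k, so division by k! leaves a geometric series whose ratio does not see p. That is
  why the flow first exists only for small t, and why every statement about a large t is reached
  through powers of the unitary at a small one. The second obstacle is that the flow controls
  polynomials in the trace norm, while membership in \<open>M\<close> requires operator-norm bounds
  that survive a limit. The transform a / (1 + a^2) has norm at most 1/2 whatever the norm of a, it
  is Lipschitz for the trace norm, and the resolvent in it is determined by algebraic equations, so
  an intertwining relation for a passes to its transform. Normality of the trace acts twice: it
  makes the polynomials dense in L2, and it identifies weak cluster points with L2 limits.\<close>

lemma scaleC_one [simp]: "1 *\<^sub>C (x::'a::complex_hilbert) = x"
  using scaleR_scaleC[of 1 x] by simp

lemma scaleC_zero_left [simp]: "0 *\<^sub>C (x::'a::complex_hilbert) = 0"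
  using scaleR_scaleC[of 0 x] by simp

lemma scaleC_zero_right [simp]: "c *\<^sub>C (0::'a::complex_hilbert) = 0"
  using scaleC_add_right[of c 0 "0::'a"] by simp

lemma scaleC_minus_one: "(- 1) *\<^sub>C (x::'a::complex_hilbert) = - x"
  using scaleR_scaleC[of "-1" x] by simp

lemma scaleC_minus_right [simp]: "c *\<^sub>C (- x) = - (c *\<^sub>C (x::'a::complex_hilbert))"
  using scaleC_add_right[of c x "- x"] by (simp add: eq_neg_iff_add_eq_0 add.commute)

lemma scaleC_minus_left [simp]: "(- c) *\<^sub>C x = - (c *\<^sub>C (x::'a::complex_hilbert))"
  using scaleC_add_left[of c "- c" x] by (simp add: eq_neg_iff_add_eq_0 add.commute)

lemma scaleC_diff_right: "c *\<^sub>C (x - y) = c *\<^sub>C x - c *\<^sub>C (y::'a::complex_hilbert)"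
  using scaleC_add_right[of c x "- y"] by simp

lemma scaleC_sum_right: "c *\<^sub>C (\<Sum>i\<in>I. f i) = (\<Sum>i\<in>I. c *\<^sub>C (f i::'a::complex_hilbert))"
  by (induction I rule: infinite_finite_induct) (auto simp: scaleC_add_right)

lemma cinner_scaleC_right: "cinner x (c *\<^sub>C y) = cnj c * cinner x (y::'a::complex_hilbert)"
  by (metis cinner_commute cinner_scaleC_left complex_cnj_mult)

lemma cinner_add_right: "cinner x (y + z) = cinner x y + cinner x (z::'a::complex_hilbert)"
  by (metis cinner_commute cinner_add_left complex_cnj_add)

lemma cinner_zero_left [simp]: "cinner 0 (x::'a::complex_hilbert) = 0"
  using cinner_add_left[of 0 0 x] by simp

lemma cinner_zero_right [simp]: "cinner (x::'a::complex_hilbert) 0 = 0"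
  using cinner_add_right[of x 0 0] by simp

lemma cinner_minus_left [simp]: "cinner (- x) y = - cinner x (y::'a::complex_hilbert)"
  using cinner_add_left[of x "- x" y] by (simp add: eq_neg_iff_add_eq_0 add.commute)

lemma cinner_minus_right [simp]: "cinner x (- y) = - cinner x (y::'a::complex_hilbert)"
  using cinner_add_right[of x y "- y"] by (simp add: eq_neg_iff_add_eq_0 add.commute)

lemma cinner_diff_left: "cinner (x - y) z = cinner x z - cinner y (z::'a::complex_hilbert)"
  using cinner_add_left[of x "- y" z] by simp

lemma cinner_diff_right: "cinner x (y - z) = cinner x y - cinner x (z::'a::complex_hilbert)"
  using cinner_add_right[of x y "- z"] by simp

lemmas cinner_simps = cinner_add_left cinner_add_right cinner_diff_left cinner_diff_right
  cinner_scaleC_left cinner_scaleC_right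

lemma norm_sq_cinner: "(norm (x::'a::complex_hilbert))\<^sup>2 = Re (cinner x x)"
  by (simp add: cinner_self)

lemma norm_scaleC [simp]: "norm (c *\<^sub>C x) = cmod c * norm (x::'a::complex_hilbert)"
proof -
  have "complex_of_real ((norm (c *\<^sub>C x))\<^sup>2) = (c * cnj c) * complex_of_real ((norm x)\<^sup>2)"
    by (simp add: cinner_scaleC_left cinner_scaleC_right mult.assoc del: of_real_power flip: cinner_self)
  also have "\<dots> = complex_of_real ((cmod c * norm x)\<^sup>2)"
    using complex_norm_square[of c] by (simp add: power_mult_distrib)
  finally have "(norm (c *\<^sub>C x))\<^sup>2 = (cmod c * norm x)\<^sup>2"
    using of_real_eq_iff by blast
  then show ?thesis
    by (simp add: power2_eq_iff_nonneg)
qed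

lemma norm_add_sq:
  "(norm (x + y))\<^sup>2 = (norm x)\<^sup>2 + 2 * Re (cinner x y) + (norm (y::'a::complex_hilbert))\<^sup>2"
proof -
  have "Re (cinner y x) = Re (cinner x y)"
    by (metis cinner_commute complex_cnj(1) cnj.sel(1))
  then show ?thesis by (simp add: norm_sq_cinner cinner_simps)
qed

lemma norm_diff_sq:
  "(norm (x - y))\<^sup>2 = (norm x)\<^sup>2 - 2 * Re (cinner x y) + (norm (y::'a::complex_hilbert))\<^sup>2"
  using norm_add_sq[of x "- y"] by simp

lemma parallelogram_law:
  "(norm (x + y))\<^sup>2 + (norm (x - y))\<^sup>2 = 2 * (norm x)\<^sup>2 + 2 * (norm (y::'a::complex_hilbert))\<^sup>2"
  by (simp add: norm_add_sq norm_diff_sq)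

lemma norm_cinner_le: "cmod (cinner x y) \<le> norm x * norm (y::'a::complex_hilbert)"
proof (cases "y = 0")
  case False
  define c where "c = cinner x y"
  define N where "N = (norm y)\<^sup>2"
  have N: "N > 0" using False by (simp add: N_def)
  \<comment> \<open>\<open>d *\<^sub>C y\<close> is the projection of \<open>x\<close> on the line
    spanned by \<open>y\<close>; the inequality expresses that the remainder has nonnegative squared
    length.\<close>
  define d where "d = c / complex_of_real N"
  have "0 \<le> (norm (x - d *\<^sub>C y))\<^sup>2" by simp
  also have "\<dots> = (norm x)\<^sup>2 - 2 * Re (cnj d * c) + (cmod d)\<^sup>2 * N"
    by (simp add: norm_diff_sq cinner_scaleC_right c_def power_mult_distrib N_def)
  also have "Re (cnj d * c) = (cmod c)\<^sup>2 / N"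
    by (simp add: d_def cmod_power2 add_divide_distrib flip: power2_eq_square)
  also have "(cmod d)\<^sup>2 * N = (cmod c)\<^sup>2 / N"
    using N by (simp add: d_def norm_divide power2_eq_square)
  finally have "(cmod c)\<^sup>2 \<le> (norm x)\<^sup>2 * N"
    using N by (simp add: field_simps)
  then have "(cmod c)\<^sup>2 \<le> (norm x * norm y)\<^sup>2" by (simp add: N_def power_mult_distrib)
  then show ?thesis unfolding c_def by (simp add: power2_le_iff_abs_le)
qed simp

lemma bounded_bilinear_cinner: "bounded_bilinear (cinner :: 'a::complex_hilbert \<Rightarrow> 'a \<Rightarrow> complex)"
  by (rule bounded_bilinear.intro)
     (auto simp: cinner_simps scaleR_scaleC scaleR_conv_of_real intro!: exI[of _ 1] norm_cinner_le)

lemmas tendsto_cinner = bounded_bilinear.tendsto[OF bounded_bilinear_cinner]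
lemmas continuous_on_cinner = bounded_bilinear.continuous_on[OF bounded_bilinear_cinner]

lemma bounded_linear_scaleC: "bounded_linear (\<lambda>x::'a::complex_hilbert. c *\<^sub>C x)"
  by (rule bounded_linear_intro[of _ "cmod c"])
     (auto simp: scaleC_add_right scaleR_scaleC scaleC_scaleC mult.commute)

lemma cinner_ext: "(\<And>y. cinner x y = cinner z y) \<Longrightarrow> x = (z::'a::complex_hilbert)"
proof -
  assume "\<And>y. cinner x y = cinner z y"
  then have "cinner (x - z) (x - z) = 0" by (simp add: cinner_diff_left)
  then show ?thesis by (simp add: cinner_self)
qed

lemma cinner_ext_right: "(\<And>y. cinner y x = cinner y z) \<Longrightarrow> x = (z::'a::complex_hilbert)"
  using cinner_ext[of x z] cinner_commute by metis

definition csubspace :: "'a::complex_hilbert set \<Rightarrow> bool" where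
  "csubspace E \<longleftrightarrow> 0 \<in> E \<and> (\<forall>x\<in>E. \<forall>y\<in>E. x + y \<in> E) \<and> (\<forall>c. \<forall>x\<in>E. c *\<^sub>C x \<in> E)"

lemma csubspace_diff: "csubspace E \<Longrightarrow> x \<in> E \<Longrightarrow> y \<in> E \<Longrightarrow> x - y \<in> E"
  unfolding csubspace_def by (metis diff_conv_add_uminus scaleC_minus_one)

lemma csubspace_closure:
  assumes "csubspace E" shows "csubspace (closure E)"
  unfolding csubspace_def
proof (intro conjI ballI allI)
  show "0 \<in> closure E" using assms closure_subset unfolding csubspace_def by blast
next
  fix x y assume "x \<in> closure E" "y \<in> closure E"
  then obtain f g where "\<And>n. f n \<in> E" "f \<longlonglongrightarrow> x" "\<And>n. g n \<in> E" "g \<longlonglongrightarrow> y"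
    unfolding closure_sequential by blast
  then show "x + y \<in> closure E"
    unfolding closure_sequential using assms
    by (intro exI[of _ "\<lambda>n. f n + g n"]) (auto simp: csubspace_def intro: tendsto_add)
next
  fix c x assume "x \<in> closure E"
  then obtain f where "\<And>n. f n \<in> E" "f \<longlonglongrightarrow> x"
    unfolding closure_sequential by blast
  then show "c *\<^sub>C x \<in> closure E"
    unfolding closure_sequential using assms
    by (intro exI[of _ "\<lambda>n. c *\<^sub>C f n"])
       (auto simp: csubspace_def intro: bounded_linear.tendsto[OF bounded_linear_scaleC])
qed

text \<open>A minimizing sequence is Cauchy by the parallelogram law, and its limit is the foot of the
  perpendicular.\<close>

theorem orthogonal_projection_exists:
  fixes E :: "'a::complex_hilbert set"
  assumes E: "csubspace E" and cl: "closed E"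
  shows "\<exists>e\<in>E. \<forall>f\<in>E. cinner (x - e) f = 0"
proof -
  define d where "d = (INF e\<in>E. (norm (x - e))\<^sup>2)"
  have E0: "E \<noteq> {}" using E by (auto simp: csubspace_def)
  have bdd: "bdd_below ((\<lambda>e. (norm (x - e))\<^sup>2) ` E)" by (rule bdd_belowI2[of _ 0]) simp
  have dle: "d \<le> (norm (x - e))\<^sup>2" if "e \<in> E" for e
    unfolding d_def by (rule cINF_lower[OF bdd that])
  have "\<exists>e\<in>E. (norm (x - e))\<^sup>2 < d + 1 / real (Suc n)" for n
  proof -
    have "(INF e\<in>E. (norm (x - e))\<^sup>2) < d + 1 / real (Suc n)" unfolding d_def by simp
    then show ?thesis using cINF_less_iff[OF E0 bdd] by blast
  qed
  then obtain s where s: "\<And>n. s n \<in> E" "\<And>n. (norm (x - s n))\<^sup>2 < d + 1 / real (Suc n)" by metis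
  have key: "(norm (s m - s n))\<^sup>2 \<le> 2 / real (Suc m) + 2 / real (Suc n)" for m n
  proof -
    \<comment> \<open>The midpoint stays in \<open>E\<close>, so its squared distance from
      \<open>x\<close> is at least \<open>d\<close>; the parallelogram law then bounds the gap by
      the two excesses over \<open>d\<close>.\<close>
    have mid: "(1/2::complex) *\<^sub>C (s m + s n) \<in> E" using E s(1) by (auto simp: csubspace_def)
    have "(x - s m) + (x - s n) = (2::complex) *\<^sub>C (x - (1/2::complex) *\<^sub>C (s m + s n))"
      using scaleC_add_left[of 1 1 x] by (simp add: scaleC_diff_right scaleC_scaleC)
    then have "(norm ((x - s m) + (x - s n)))\<^sup>2 = 4 * (norm (x - (1/2::complex) *\<^sub>C (s m + s n)))\<^sup>2"
      by (simp add: power_mult_distrib)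
    then have "(norm ((x - s m) + (x - s n)))\<^sup>2 \<ge> 4 * d" using dle[OF mid] by simp
    moreover have "(norm ((x - s m) - (x - s n)))\<^sup>2 = (norm (s m - s n))\<^sup>2"
      by (simp add: norm_minus_commute)
    ultimately show ?thesis
      using parallelogram_law[of "x - s m" "x - s n"] s(2)[of m] s(2)[of n] by simp
  qed
  have "Cauchy s"
  proof (rule CauchyI)
    fix e :: real assume e: "e > 0"
    obtain N where N: "4 / e\<^sup>2 < real N" using reals_Archimedean2 by blast
    have "norm (s m - s n) < e" if "m \<ge> N" "n \<ge> N" for m n
    proof -
      have Np: "real N > 0" using N e by (meson divide_pos_pos less_trans zero_less_numeral zero_less_power)
      have "2 / real (Suc m) \<le> 2 / real N" "2 / real (Suc n) \<le> 2 / real N"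
        using that Np by (auto intro!: divide_left_mono)
      then have "(norm (s m - s n))\<^sup>2 \<le> 4 / real N" using key[of m n] by simp
      also have "\<dots> < e\<^sup>2" using N e Np by (simp add: field_simps)
      finally show ?thesis using e by (simp add: power2_less_imp_less)
    qed
    then show "\<exists>M. \<forall>m\<ge>M. \<forall>n\<ge>M. norm (s m - s n) < e" by blast
  qed
  then obtain e where e: "s \<longlonglongrightarrow> e" using Cauchy_convergent_iff convergent_def by blast
  have eE: "e \<in> E" using closed_sequentially[OF cl] s(1) e by blast
  have "(\<lambda>n. (norm (x - s n))\<^sup>2) \<longlonglongrightarrow> (norm (x - e))\<^sup>2" by (intro tendsto_intros e)
  moreover have "(\<lambda>n. d + 1 / real (Suc n)) \<longlonglongrightarrow> d + 0"
    by (intro tendsto_add tendsto_const LIMSEQ_Suc[OF lim_1_over_n])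
  ultimately have min: "(norm (x - e))\<^sup>2 \<le> d"
    using s(2) by (intro LIMSEQ_le[of _ "(norm (x - e))\<^sup>2" _ d]) (auto intro: less_imp_le)
  have "cinner (x - e) f = 0" if f: "f \<in> E" for f
  proof (cases "f = 0")
    case False
    define c where "c = cinner (x - e) f"
    define N where "N = (norm f)\<^sup>2"
    have N: "N > 0" using False by (simp add: N_def)
    \<comment> \<open>Moving \<open>e\<close> by \<open>k *\<^sub>C f\<close> would change the
      squared distance by -|c|^2 / N, so minimality forces \<open>c = 0\<close>.\<close>
    define k where "k = c / complex_of_real N"
    have "e + k *\<^sub>C f \<in> E" using E eE f by (auto simp: csubspace_def)
    then have "(norm (x - e))\<^sup>2 \<le> (norm ((x - e) - k *\<^sub>C f))\<^sup>2"
      using dle min by (metis diff_diff_eq order_trans)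
    also have "\<dots> = (norm (x - e))\<^sup>2 - 2 * Re (cnj k * c) + (cmod k)\<^sup>2 * N"
      by (simp add: norm_diff_sq cinner_scaleC_right c_def power_mult_distrib N_def)
    also have "Re (cnj k * c) = (cmod c)\<^sup>2 / N"
      by (simp add: k_def cmod_power2 add_divide_distrib flip: power2_eq_square)
    also have "(cmod k)\<^sup>2 * N = (cmod c)\<^sup>2 / N"
      using N by (simp add: k_def norm_divide power2_eq_square)
    finally have "(cmod c)\<^sup>2 \<le> 0" using N by (simp add: field_simps)
    then show ?thesis by (simp add: c_def)
  qed simp
  then show ?thesis using eE by blast
qed

text \<open>Projecting a vector on the closure of \<open>E\<close> leaves a remainder orthogonal to
  \<open>E\<close>, which the hypothesis annihilates.\<close>

lemma dense_if_orthogonal_trivial: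
  fixes E :: "'a::complex_hilbert set"
  assumes E: "csubspace E" and triv: "\<And>x. (\<And>f. f \<in> E \<Longrightarrow> cinner f x = 0) \<Longrightarrow> x = 0"
  shows "closure E = UNIV"
proof -
  have "x \<in> closure E" for x
  proof -
    obtain e where e: "e \<in> closure E" "\<And>f. f \<in> closure E \<Longrightarrow> cinner (x - e) f = 0"
      using orthogonal_projection_exists[OF csubspace_closure[OF E] closed_closure] by blast
    have "x - e = 0"
    proof (rule triv)
      fix f assume "f \<in> E"
      then have "cinner (x - e) f = 0" using e(2) closure_subset by blast
      then show "cinner f (x - e) = 0" by (metis cinner_commute complex_cnj_zero)
    qed
    then show ?thesis using e(1) by simp
  qed
  then show ?thesis by blast
qed

text \<open>The kernel of a nonzero \<open>f\<close> is a closed subspace of codimension one, and a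
  rescaled vector orthogonal to it represents \<open>f\<close>.\<close>

theorem riesz_representation:
  fixes f :: "'a::complex_hilbert \<Rightarrow> complex"
  assumes add: "\<And>x y. f (x + y) = f x + f y" and scale: "\<And>c x. f (c *\<^sub>C x) = c * f x"
    and bound: "\<And>x. cmod (f x) \<le> C * norm x"
  shows "\<exists>v. \<forall>x. f x = cinner x v"
proof (cases "\<forall>x. f x = 0")
  case True then show ?thesis by (intro exI[of _ 0]) simp
next
  case False
  then obtain x0 where x0: "f x0 \<noteq> 0" by blast
  have diff: "f (x - y) = f x - f y" for x y
    using add[of "x - y" y] by simp
  define E where "E = {x. f x = 0}"
  have E: "csubspace E" unfolding csubspace_def E_def using scale[of 0 0] by (auto simp: add scale)
  have "bounded_linear f"
    by (rule bounded_linear_intro[of _ C])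
       (auto simp: add scale scaleR_scaleC scaleR_conv_of_real bound mult.commute)
  then have cont: "continuous_on UNIV f" by (simp add: linear_continuous_on)
  have cl: "closed E" unfolding E_def
    by (rule closed_Collect_eq[OF cont continuous_on_const])
  obtain e where e: "e \<in> E" "\<And>g. g \<in> E \<Longrightarrow> cinner (x0 - e) g = 0"
    using orthogonal_projection_exists[OF E cl] by blast
  define z where "z = x0 - e"
  have fz: "f z \<noteq> 0" using x0 e(1) by (simp add: z_def diff E_def)
  then have z0: "z \<noteq> 0" using scale[of 0 0] by auto
  define N where "N = complex_of_real ((norm z)\<^sup>2)"
  have N: "N \<noteq> 0" "cinner z z = N" using z0 by (auto simp: N_def cinner_self)
  have "f x = cinner x (cnj (f z / N) *\<^sub>C z)" for x
  proof -
    \<comment> \<open>This combination of \<open>x\<close> and \<open>z\<close> is killed by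
      \<open>f\<close>; its orthogonality to \<open>z\<close> expresses \<open>f x\<close> through
      the inner product with \<open>z\<close>.\<close>
    have "f z *\<^sub>C x - f x *\<^sub>C z \<in> E" by (simp add: E_def diff scale)
    then have "cinner z (f z *\<^sub>C x - f x *\<^sub>C z) = 0" using e(2) z_def by blast
    then have "cinner (f z *\<^sub>C x - f x *\<^sub>C z) z = 0" by (metis cinner_commute complex_cnj_zero)
    then have "f z * cinner x z = f x * N" by (simp add: cinner_simps N)
    then show ?thesis using N by (simp add: cinner_scaleC_right field_simps)
  qed
  then show ?thesis by blast
qed

section \<open>Bounded operators, adjoints and extension from dense subspaces\<close>

lemma bounded_clinear_bounded_linear: "bounded_clinear T \<Longrightarrow> bounded_linear T"
  by (simp add: bounded_clinear_def)

lemma bounded_clinear_scaleC: "bounded_clinear T \<Longrightarrow> T (c *\<^sub>C x) = c *\<^sub>C T x"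
  by (simp add: bounded_clinear_def)

lemma bounded_clinear_add: "bounded_clinear T \<Longrightarrow> T (x + y) = T x + T y"
  by (rule linear_simps(1)[OF bounded_clinear_bounded_linear])

lemma bounded_clinear_diff: "bounded_clinear T \<Longrightarrow> T (x - y) = T x - T y"
  by (rule linear_simps(2)[OF bounded_clinear_bounded_linear])

lemma bounded_clinear_zero: "bounded_clinear T \<Longrightarrow> T 0 = 0"
  using bounded_clinear_scaleC[of T 0 0] by simp

lemma bounded_clinear_tendsto: "bounded_clinear T \<Longrightarrow> (f \<longlongrightarrow> l) F \<Longrightarrow> ((\<lambda>n. T (f n)) \<longlongrightarrow> T l) F"
  using bounded_linear.tendsto bounded_clinear_def by blast

lemma bounded_clinear_bound: "bounded_clinear T \<Longrightarrow> \<exists>C>0. \<forall>x. norm (T x) \<le> C * norm x"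
  using bounded_linear.pos_bounded[of T] by (auto simp: bounded_clinear_def mult.commute)

lemma bounded_clinearI:
  assumes "\<And>x y. T (x + y) = T x + T y" "\<And>c x. T (c *\<^sub>C x) = c *\<^sub>C T x" "\<And>x. norm (T x) \<le> C * norm x"
  shows "bounded_clinear T"
  unfolding bounded_clinear_def
  using assms by (auto intro!: bounded_linear_intro[of _ C] simp: scaleR_scaleC mult.commute)

lemma bounded_clinear_id: "bounded_clinear id"
  by (rule bounded_clinearI[of _ 1]) auto

lemma bounded_clinear_comp: "bounded_clinear S \<Longrightarrow> bounded_clinear T \<Longrightarrow> bounded_clinear (S \<circ> T)"
  unfolding bounded_clinear_def by (auto intro: bounded_linear_compose simp: comp_def)

lemma bounded_clinear_plus:
  "bounded_clinear S \<Longrightarrow> bounded_clinear T \<Longrightarrow> bounded_clinear (\<lambda>x. S x + T x)"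
  unfolding bounded_clinear_def by (auto intro: bounded_linear_add simp: scaleC_add_right)

lemma bounded_clinear_scale: "bounded_clinear T \<Longrightarrow> bounded_clinear (\<lambda>x. c *\<^sub>C T x)"
  unfolding bounded_clinear_def
  using bounded_linear_compose[OF bounded_linear_scaleC[of c]]
  by (auto simp: comp_def scaleC_scaleC mult.commute)

lemma sesquilinear_form_operator:
  fixes f :: "'a::complex_hilbert \<Rightarrow> 'a \<Rightarrow> complex"
  assumes "\<And>x y z. f (x + y) z = f x z + f y z" "\<And>c x z. f (c *\<^sub>C x) z = c * f x z"
    and "\<And>x y z. f z (x + y) = f z x + f z y" "\<And>c x z. f z (c *\<^sub>C x) = cnj c * f z x"
    and bound: "\<And>x y. cmod (f x y) \<le> C * norm x * norm y"
  shows "\<exists>T. bounded_clinear T \<and> (\<forall>x y. f x y = cinner (T x) y)"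
proof -
  \<comment> \<open>The conjugate makes the form linear in its second argument, as the Riesz
    representation requires.\<close>
  have "\<exists>v. \<forall>y. cnj (f x y) = cinner y v" for x
    by (rule riesz_representation[where C = "C * norm x"]) (use assms in auto)
  then obtain T where T: "\<And>x y. cnj (f x y) = cinner y (T x)" by metis
  have T': "f x y = cinner (T x) y" for x y
    using T[of x y] by (metis cinner_commute complex_cnj_cnj)
  have "norm (T x) \<le> C * norm x" for x
  proof (cases "T x = 0")
    \<comment> \<open>\<open>C\<close> carries no sign assumption; its nonnegativity is extracted
      from the bound at the pair (x, x).\<close>
    case True
    have "0 \<le> C * norm x"
    proof (cases "x = 0")
      case False
      then have "0 \<le> C * norm x * norm x" using bound[of x x] norm_ge_zero order_trans by blast
      then show ?thesis using False by (simp add: zero_le_mult_iff)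
    qed simp
    then show ?thesis using True by simp
  next
    case False
    have "(norm (T x))\<^sup>2 = Re (f x (T x))" by (simp add: T' norm_sq_cinner)
    also have "\<dots> \<le> C * norm x * norm (T x)" using bound[of x "T x"] complex_Re_le_cmod order_trans by blast
    finally show ?thesis using False by (simp add: power2_eq_square)
  qed
  moreover have "T (x + y) = T x + T y" for x y
    by (rule cinner_ext) (simp add: cinner_add_left assms flip: T')
  moreover have "T (c *\<^sub>C x) = c *\<^sub>C T x" for c x
    by (rule cinner_ext) (simp add: cinner_scaleC_left assms flip: T')
  ultimately have "bounded_clinear T"
    by (intro bounded_clinearI[of _ C])
  then show ?thesis using T' by blast
qed

lemma adj_unique:
  assumes "\<And>x y. cinner (T x) y = cinner x (S y)" shows "adj T = S"
  unfolding adj_def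
proof (rule the_equality)
  fix S' assume "\<forall>x y. cinner (T x) y = cinner x (S' y)"
  then have "cinner x (S' y) = cinner x (S y)" for x y using assms by metis
  then show "S' = S" by (intro ext cinner_ext_right) blast
qed (use assms in blast)

lemma adj_properties:
  assumes T: "bounded_clinear T"
  shows "bounded_clinear (adj T) \<and> (\<forall>x y. cinner (T x) y = cinner x (adj T y))"
proof -
  obtain C where C: "C > 0" "\<And>x. norm (T x) \<le> C * norm x" using bounded_clinear_bound[OF T] by blast
  have "\<exists>S. bounded_clinear S \<and> (\<forall>x y. cinner x (T y) = cinner (S x) y)"
  proof (rule sesquilinear_form_operator[where C = C])
    show "cmod (cinner x (T y)) \<le> C * norm x * norm y" for x y
      using norm_cinner_le[of x "T y"] C(2)[of y] mult_left_mono[OF C(2)[of y] norm_ge_zero[of x]]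
      by (simp add: mult.assoc mult.left_commute)
  qed (auto simp: cinner_simps bounded_clinear_add[OF T] bounded_clinear_scaleC[OF T])
  then obtain S where S: "bounded_clinear S" "\<And>x y. cinner x (T y) = cinner (S x) y" by blast
  have *: "cinner (T x) y = cinner x (S y)" for x y
    using S(2)[of y x] cinner_commute[of "T x" y] cinner_commute[of x "S y"] by simp
  then have "adj T = S" by (rule adj_unique)
  then show ?thesis using S(1) * by blast
qed

lemma bounded_clinear_adj: "bounded_clinear T \<Longrightarrow> bounded_clinear (adj T)"
  using adj_properties[of T] by blast

lemma cinner_adj: "bounded_clinear T \<Longrightarrow> cinner (T x) y = cinner x (adj T y)"
  using adj_properties[of T] by blast

lemma cinner_adj': "bounded_clinear T \<Longrightarrow> cinner x (T y) = cinner (adj T x) y"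
  using cinner_adj[of T y x] cinner_commute[of x "T y"] cinner_commute[of "adj T x" y] by simp

lemma adj_adj: "bounded_clinear T \<Longrightarrow> adj (adj T) = T"
  by (rule adj_unique) (simp add: cinner_adj'[of T])

lemma adj_comp: "bounded_clinear S \<Longrightarrow> bounded_clinear T \<Longrightarrow> adj (S \<circ> T) = adj T \<circ> adj S"
  by (rule adj_unique) (simp add: cinner_adj[of S] cinner_adj[of T])

lemma adj_plus: "bounded_clinear S \<Longrightarrow> bounded_clinear T \<Longrightarrow> adj (\<lambda>x. S x + T x) = (\<lambda>x. adj S x + adj T x)"
  by (rule adj_unique) (simp add: cinner_adj[of S] cinner_adj[of T] cinner_simps)

lemma adj_scale: "bounded_clinear T \<Longrightarrow> adj (\<lambda>x. c *\<^sub>C T x) = (\<lambda>x. cnj c *\<^sub>C adj T x)"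
  by (rule adj_unique) (simp add: cinner_adj[of T] cinner_simps)

lemma adj_id: "adj id = id"
  by (rule adj_unique) simp

lemma adj_bound:
  assumes T: "bounded_clinear T" and b: "\<And>x. norm (T x) \<le> C * norm x"
  shows "norm (adj T x) \<le> C * norm x"
proof (cases "adj T x = 0")
  case True
  have "0 \<le> C * norm x" using b[of x] norm_ge_zero order_trans by blast
  then show ?thesis using True by simp
next
  case False
  have "(norm (adj T x))\<^sup>2 = Re (cinner (T (adj T x)) x)" by (simp add: norm_sq_cinner cinner_adj[OF T])
  also have "\<dots> \<le> norm (T (adj T x)) * norm x" using norm_cinner_le complex_Re_le_cmod order_trans by blast
  also have "\<dots> \<le> C * norm (adj T x) * norm x" by (rule mult_right_mono[OF b]) simp
  finally show ?thesis using False by (simp add: power2_eq_square mult.commute mult.left_commute)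
qed

lemma bounded_clinear_eq_on_dense:
  assumes "bounded_clinear S" "bounded_clinear T" "closure X = UNIV" "\<And>x. x \<in> X \<Longrightarrow> S x = T x"
  shows "S = T"
proof
  fix x
  obtain f where f: "\<And>n. f n \<in> X" "f \<longlonglongrightarrow> x" using assms(3) closure_sequential[of x X] by auto
  have "(\<lambda>n. S (f n)) \<longlonglongrightarrow> T x"
    using bounded_clinear_tendsto[OF assms(2) f(2)] assms(4) f(1) by simp
  then show "S x = T x" using LIMSEQ_unique bounded_clinear_tendsto[OF assms(1) f(2)] by blast
qed

lemma dense_orthogonal_zero:
  fixes x :: "'a::complex_hilbert"
  assumes "closure X = UNIV" "\<And>u. u \<in> X \<Longrightarrow> cinner u x = 0" shows "x = 0"
proof -
  obtain f where f: "\<And>n. f n \<in> X" "f \<longlonglongrightarrow> x" using assms(1) closure_sequential[of x X] by auto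
  have "(\<lambda>n. cinner (f n) x) \<longlonglongrightarrow> cinner x x" by (rule tendsto_cinner[OF f(2) tendsto_const])
  then have "cinner x x = 0" using assms(2) f(1) LIMSEQ_unique[OF _ tendsto_const] by simp
  then show ?thesis by (simp add: cinner_self)
qed

text \<open>A three-epsilon argument: the uniform bound on \<open>B n\<close> transports convergence
  from a nearby point of \<open>X\<close> to \<open>v\<close>.\<close>

lemma bounded_clinear_strong_limit:
  assumes B: "\<And>n. bounded_clinear (B n)" "bounded_clinear T"
    and b: "\<And>n x. norm (B n x) \<le> C * norm x"
    and X: "closure X = UNIV" and lim: "\<And>x. x \<in> X \<Longrightarrow> (\<lambda>n. B n x) \<longlonglongrightarrow> T x"
  shows "(\<lambda>n. B n v) \<longlonglongrightarrow> T v"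
proof (rule LIMSEQ_I)
  fix e :: real assume e: "e > 0"
  obtain K where K: "K > 0" "\<And>x. norm (T x) \<le> K * norm x" using bounded_clinear_bound[OF B(2)] by blast
  \<comment> \<open>Replacing \<open>v\<close> by \<open>x\<close> costs at most (|C| + K) d, which
    this choice keeps below e / 2; the other half is for convergence at \<open>x\<close>. The
    summand 1 keeps the later cancellation safe.\<close>
  define d where "d = e / (2 * (\<bar>C\<bar> + K + 1))"
  have d: "d > 0" using e K by (simp add: d_def)
  obtain x where x: "x \<in> X" "norm (v - x) < d"
    using X d closure_approachable[of v X] by (auto simp: dist_norm norm_minus_commute)
  obtain N where N: "\<And>n. n \<ge> N \<Longrightarrow> norm (B n x - T x) < e / 2"
    using LIMSEQ_D[OF lim[OF x(1)], of "e / 2"] e by auto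
  have "norm (B n v - T v) < e" if "n \<ge> N" for n
  proof -
    have eq: "B n v - T v = B n (v - x) + (B n x - T x) - T (v - x)"
      by (simp add: bounded_clinear_diff[OF B(1)] bounded_clinear_diff[OF B(2)])
    have "norm (B n v - T v) \<le> norm (B n (v - x)) + norm (B n x - T x) + norm (T (v - x))"
      unfolding eq
      using norm_triangle_ineq4[of "B n (v - x) + (B n x - T x)" "T (v - x)"]
        norm_triangle_ineq[of "B n (v - x)" "B n x - T x"] by linarith
    also have "\<dots> < \<bar>C\<bar> * d + e / 2 + K * d"
    proof -
      have "norm (B n (v - x)) \<le> \<bar>C\<bar> * norm (v - x)"
        by (rule order_trans[OF b]) (simp add: mult_right_mono)
      also have "\<dots> \<le> \<bar>C\<bar> * d" using x(2) by (intro mult_left_mono) auto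
      finally have 1: "norm (B n (v - x)) \<le> \<bar>C\<bar> * d" .
      have "norm (T (v - x)) \<le> K * d"
        using K(2)[of "v - x"] x(2) K(1) by (meson less_imp_le mult_left_mono order_trans)
      then show ?thesis using 1 N[OF that] by simp
    qed
    also have "\<dots> \<le> e"
    proof -
      have "(\<bar>C\<bar> + K) * d \<le> (\<bar>C\<bar> + K + 1) * d" using d by (intro mult_right_mono) auto
      also have "\<dots> = e / 2"
      proof -
        have "\<bar>C\<bar> + K + 1 \<noteq> 0" using K(1) by linarith
        moreover have "w * (e / (2 * w)) = e / 2" if "w \<noteq> 0" for w :: real using that by simp
        ultimately show ?thesis unfolding d_def by blast
      qed
      finally show ?thesis by (simp add: algebra_simps)
    qed
    finally show ?thesis .
  qed
  then show "\<exists>no. \<forall>n\<ge>no. norm (B n v - T v) < e" by blast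
qed

text \<open>The index set \<open>I\<close> parametrises the graph \<open>{(h i, g i) | i \<in> I}\<close> of the map to be extended.\<close>

lemma extend_from_dense:
  fixes h :: "'i \<Rightarrow> 'l::complex_hilbert" and g :: "'i \<Rightarrow> 'k::complex_hilbert"
  assumes dense: "closure (h ` I) = UNIV"
    and add: "\<And>i j. i \<in> I \<Longrightarrow> j \<in> I \<Longrightarrow> \<exists>k\<in>I. h k = h i + h j \<and> g k = g i + g j"
    and scale: "\<And>c i. i \<in> I \<Longrightarrow> \<exists>k\<in>I. h k = c *\<^sub>C h i \<and> g k = c *\<^sub>C g i"
    and bound: "\<And>i. i \<in> I \<Longrightarrow> norm (g i) \<le> C * norm (h i)"
  shows "\<exists>F. bounded_clinear F \<and> (\<forall>i\<in>I. F (h i) = g i) \<and> (\<forall>x. norm (F x) \<le> C * norm x)"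
proof -
  have diff: "\<exists>k\<in>I. h k = h i - h j \<and> g k = g i - g j" if ij: "i \<in> I" "j \<in> I" for i j
  proof -
    obtain j' where "j' \<in> I" "h j' = - h j" "g j' = - g j"
      using scale[OF ij(2), of "- 1"] by auto
    then show ?thesis using add[OF ij(1), of j'] by auto
  qed
  have bdiff: "norm (g i - g j) \<le> C * norm (h i - h j)" if ij: "i \<in> I" "j \<in> I" for i j
  proof -
    obtain k where "k \<in> I" "h k = h i - h j" "g k = g i - g j" using diff[OF ij] by blast
    then show ?thesis using bound[of k] by simp
  qed
  have "\<exists>s. (\<forall>n. s n \<in> I) \<and> (\<lambda>n. h (s n)) \<longlonglongrightarrow> x" for x
  proof -
    have "x \<in> closure (h ` I)" using dense by simp
    then obtain f where f: "\<And>n. f n \<in> h ` I" "f \<longlonglongrightarrow> x" unfolding closure_sequential by blast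
    have "\<forall>n. \<exists>i. i \<in> I \<and> f n = h i" using f(1) by blast
    from choice[OF this] obtain s where s: "\<forall>n. s n \<in> I \<and> f n = h (s n)" by blast
    then have "f = (\<lambda>n. h (s n))" by (intro ext) simp
    then show ?thesis using s f(2) by (intro exI[of _ s]) simp
  qed
  then obtain s where s: "\<And>x n. s x n \<in> I" "\<And>x. (\<lambda>n. h (s x n)) \<longlonglongrightarrow> x" by metis
  \<comment> \<open>Index sequences with the same limit under \<open>h\<close> cannot be told apart
    by \<open>g\<close>. Hence the value of \<open>F\<close> does not depend on the chosen sequence,
    and linearity can be checked along sums and multiples of sequences.\<close>
  have lim0: "(\<lambda>n. g (r n) - g (q n)) \<longlonglongrightarrow> 0"
    if "\<And>n. r n \<in> I" "\<And>n. q n \<in> I" "(\<lambda>n. h (r n)) \<longlonglongrightarrow> x" "(\<lambda>n. h (q n)) \<longlonglongrightarrow> x" for r q x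
  proof -
    have "(\<lambda>n. C * norm (h (r n) - h (q n))) \<longlonglongrightarrow> C * norm (x - x)"
      by (intro tendsto_intros that)
    then have "(\<lambda>n. C * norm (h (r n) - h (q n))) \<longlonglongrightarrow> 0" by simp
    then show ?thesis by (rule Lim_null_comparison[rotated]) (use bdiff that in auto)
  qed
  have "convergent (\<lambda>n. g (s x n))" for x
  proof (rule Cauchy_convergent, rule CauchyI)
    fix e :: real assume e: "e > 0"
    have "Cauchy (\<lambda>n. h (s x n))" using s(2) LIMSEQ_imp_Cauchy by blast
    then obtain N where N: "\<And>m n. m \<ge> N \<Longrightarrow> n \<ge> N \<Longrightarrow> norm (h (s x m) - h (s x n)) < e / (\<bar>C\<bar> + 1)"
      using CauchyD[of "\<lambda>n. h (s x n)" "e / (\<bar>C\<bar> + 1)"] e by force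
    have "norm (g (s x m) - g (s x n)) < e" if "m \<ge> N" "n \<ge> N" for m n
    proof -
      have "norm (g (s x m) - g (s x n)) \<le> C * norm (h (s x m) - h (s x n))" by (rule bdiff[OF s(1) s(1)])
      also have "\<dots> \<le> (\<bar>C\<bar> + 1) * norm (h (s x m) - h (s x n))" by (rule mult_right_mono) auto
      also have "\<dots> < (\<bar>C\<bar> + 1) * (e / (\<bar>C\<bar> + 1))" by (rule mult_strict_left_mono[OF N[OF that]]) auto
      also have "\<dots> = e"
      proof -
        have "\<bar>C\<bar> + 1 \<noteq> 0" by linarith
        then show ?thesis by simp
      qed
      finally show ?thesis .
    qed
    then show "\<exists>M. \<forall>m\<ge>M. \<forall>n\<ge>M. norm (g (s x m) - g (s x n)) < e" by blast
  qed
  then obtain F where F: "\<And>x. (\<lambda>n. g (s x n)) \<longlonglongrightarrow> F x" unfolding convergent_def by metis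
  have uniq: "(\<lambda>n. g (r n)) \<longlonglongrightarrow> F x" if "\<And>n. r n \<in> I" "(\<lambda>n. h (r n)) \<longlonglongrightarrow> x" for r x
    using tendsto_add[OF lim0[OF that(1) s(1) that(2) s(2)] F[of x]] by simp
  have Fadd: "F (x + y) = F x + F y" for x y
  proof -
    have "\<forall>n. \<exists>k. k \<in> I \<and> h k = h (s x n) + h (s y n) \<and> g k = g (s x n) + g (s y n)"
      using add[OF s(1) s(1)] by blast
    from choice[OF this] obtain k where k: "\<And>n. k n \<in> I" "\<And>n. h (k n) = h (s x n) + h (s y n)"
      "\<And>n. g (k n) = g (s x n) + g (s y n)" by blast
    have "(\<lambda>n. g (k n)) \<longlonglongrightarrow> F (x + y)"
      by (rule uniq[OF k(1)]) (simp add: k(2) s(2) tendsto_add)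
    moreover have "(\<lambda>n. g (k n)) \<longlonglongrightarrow> F x + F y" by (simp add: k(3) F tendsto_add)
    ultimately show ?thesis by (rule LIMSEQ_unique)
  qed
  have Fscale: "F (c *\<^sub>C x) = c *\<^sub>C F x" for c x
  proof -
    have "\<forall>n. \<exists>k. k \<in> I \<and> h k = c *\<^sub>C h (s x n) \<and> g k = c *\<^sub>C g (s x n)"
      using scale[OF s(1)] by blast
    from choice[OF this] obtain k where k: "\<And>n. k n \<in> I" "\<And>n. h (k n) = c *\<^sub>C h (s x n)"
      "\<And>n. g (k n) = c *\<^sub>C g (s x n)" by blast
    have "(\<lambda>n. g (k n)) \<longlonglongrightarrow> F (c *\<^sub>C x)"
      by (rule uniq[OF k(1)]) (simp add: k(2) s(2) bounded_linear.tendsto[OF bounded_linear_scaleC])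
    moreover have "(\<lambda>n. g (k n)) \<longlonglongrightarrow> c *\<^sub>C F x"
      by (simp add: k(3) F bounded_linear.tendsto[OF bounded_linear_scaleC])
    ultimately show ?thesis by (rule LIMSEQ_unique)
  qed
  have Fbound: "norm (F x) \<le> C * norm x" for x
    by (rule LIMSEQ_le[OF tendsto_norm[OF F] tendsto_mult_left[OF tendsto_norm[OF s(2)]]])
       (use bound s(1) in blast)
  have "F (h i) = g i" if "i \<in> I" for i
    using uniq[of "\<lambda>_. i" "h i"] that LIMSEQ_unique[OF _ tendsto_const] by simp
  then show ?thesis using Fadd Fscale Fbound bounded_clinearI[of F C] by blast
qed

section \<open>Square-summable sequences and density in the bicommutant\<close>

text \<open>The third conjunct recognises \<open>P x\<close> as any point of \<open>E\<close> with
  orthogonal remainder; commutation relations for \<open>P\<close> are verified through it.\<close>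

lemma projection_operator:
  fixes E :: "'a::complex_hilbert set"
  assumes E: "csubspace E" and cl: "closed E"
  shows "\<exists>P. bounded_clinear P \<and> (\<forall>x. P x \<in> E) \<and> (\<forall>x e. e \<in> E \<longrightarrow> (\<forall>f\<in>E. cinner (x - e) f = 0) \<longrightarrow> P x = e)
    \<and> (\<forall>x. \<forall>f\<in>E. cinner (x - P x) f = 0)"
proof -
  have "\<forall>x. \<exists>e. e \<in> E \<and> (\<forall>f\<in>E. cinner (x - e) f = 0)"
    using orthogonal_projection_exists[OF E cl] by blast
  from choice[OF this] obtain P where P: "\<And>x. P x \<in> E" "\<And>x f. f \<in> E \<Longrightarrow> cinner (x - P x) f = 0"
    by blast
  have uniq: "P x = e" if e: "e \<in> E" "\<And>f. f \<in> E \<Longrightarrow> cinner (x - e) f = 0" for x e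
  proof -
    have d: "P x - e \<in> E" using csubspace_diff[OF E P(1) e(1)] .
    have "cinner (P x - e) (P x - e) = cinner (x - e) (P x - e) - cinner (x - P x) (P x - e)"
      by (simp add: cinner_diff_left)
    also have "\<dots> = 0" using e(2)[OF d] P(2)[OF d] by simp
    finally show ?thesis by (simp add: cinner_self)
  qed
  have "P (x + y) = P x + P y" for x y
  proof (rule uniq)
    show "P x + P y \<in> E" using E P(1) by (auto simp: csubspace_def)
    show "cinner (x + y - (P x + P y)) f = 0" if "f \<in> E" for f
      using P(2)[OF that, of x] P(2)[OF that, of y] by (simp add: cinner_simps algebra_simps)
  qed
  moreover have "P (c *\<^sub>C x) = c *\<^sub>C P x" for c x
  proof (rule uniq)
    show "c *\<^sub>C P x \<in> E" using E P(1) by (auto simp: csubspace_def)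
    show "cinner (c *\<^sub>C x - c *\<^sub>C P x) f = 0" if "f \<in> E" for f
      using P(2)[OF that, of x] by (simp add: cinner_simps)
  qed
  moreover have "norm (P x) \<le> 1 * norm x" for x
  proof -
    have "cinner (x - P x) (P x) = 0" using P by blast
    then have "(norm x)\<^sup>2 = (norm (x - P x))\<^sup>2 + (norm (P x))\<^sup>2"
      using norm_add_sq[of "x - P x" "P x"] by simp
    then have "(norm (P x))\<^sup>2 \<le> (norm x)\<^sup>2" by simp
    then show ?thesis by (simp add: power2_le_iff_abs_le)
  qed
  ultimately have "bounded_clinear P" by (rule bounded_clinearI)
  then show ?thesis using P uniq by blast
qed

section \<open>The Hilbert space of square-summable sequences\<close>

typedef (overloaded) 'a l2seq = "{f :: nat \<Rightarrow> 'a::complex_hilbert. summable (\<lambda>n. (norm (f n))\<^sup>2)}"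
  morphisms coord Abs_l2seq
  by (rule exI[of _ "\<lambda>_. 0"]) simp

lemma summable_coord: "summable (\<lambda>n. (norm (coord x n))\<^sup>2)"
  using coord[of x] by simp

lemma coord_Abs: "summable (\<lambda>n. (norm (f n))\<^sup>2) \<Longrightarrow> coord (Abs_l2seq f) = f"
  by (rule Abs_l2seq_inverse) simp

lemma l2seq_eqI: "(\<And>n. coord x n = coord y n) \<Longrightarrow> x = y"
  using coord_inject[of x y] by (simp add: fun_eq_iff)

lemma square_summable_scaled:
  fixes f :: "nat \<Rightarrow> 'a::complex_hilbert"
  assumes "summable (\<lambda>n. (norm (f n))\<^sup>2)" "\<And>n. norm (g n) \<le> C * norm (f n)"
  shows "summable (\<lambda>n. (norm (g n))\<^sup>2)"
proof (rule summable_comparison_test'[where N = 0 and g = "\<lambda>n. C\<^sup>2 * (norm (f n))\<^sup>2"])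
  show "summable (\<lambda>n. C\<^sup>2 * (norm (f n))\<^sup>2)" using assms(1) by (rule summable_mult)
  show "norm ((norm (g n))\<^sup>2) \<le> C\<^sup>2 * (norm (f n))\<^sup>2" for n
    using power_mono[OF assms(2)[of n], of 2] by (simp add: power_mult_distrib)
qed

lemma square_summable_add:
  fixes f :: "nat \<Rightarrow> 'a::complex_hilbert"
  assumes "summable (\<lambda>n. (norm (f n))\<^sup>2)" "summable (\<lambda>n. (norm (g n))\<^sup>2)"
  shows "summable (\<lambda>n. (norm (f n + g n))\<^sup>2)"
proof (rule summable_comparison_test'[where N = 0 and g = "\<lambda>n. 2 * (norm (f n))\<^sup>2 + 2 * (norm (g n))\<^sup>2"])
  show "summable (\<lambda>n. 2 * (norm (f n))\<^sup>2 + 2 * (norm (g n))\<^sup>2)"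
    using assms by (intro summable_add summable_mult)
  show "norm ((norm (f n + g n))\<^sup>2) \<le> 2 * (norm (f n))\<^sup>2 + 2 * (norm (g n))\<^sup>2" for n
    using parallelogram_law[of "f n" "g n"] zero_le_power2[of "norm (f n - g n)"]
    by (simp only: real_norm_def abs_power2)
qed

lemma norm_cinner_le_squares:
  "cmod (cinner x y) \<le> (norm x)\<^sup>2 + (norm (y::'a::complex_hilbert))\<^sup>2"
proof -
  have "cmod (cinner x y) \<le> norm x * norm y" by (rule norm_cinner_le)
  also have "\<dots> \<le> (norm x)\<^sup>2 + (norm y)\<^sup>2"
    using sum_squares_bound[of "norm x" "norm y"] mult_nonneg_nonneg[OF norm_ge_zero[of x] norm_ge_zero[of y]] by linarith
  finally show ?thesis .
qed

lemma summable_cinner: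
  fixes f :: "nat \<Rightarrow> 'a::complex_hilbert"
  assumes "summable (\<lambda>n. (norm (f n))\<^sup>2)" "summable (\<lambda>n. (norm (g n))\<^sup>2)"
  shows "summable (\<lambda>n. cmod (cinner (f n) (g n)))"
  by (rule summable_comparison_test'[where N = 0 and g = "\<lambda>n. (norm (f n))\<^sup>2 + (norm (g n))\<^sup>2"])
     (auto intro: summable_add assms norm_cinner_le_squares)

instantiation l2seq :: (complex_hilbert) real_normed_vector
begin

definition "0 = Abs_l2seq (\<lambda>_. 0)"
definition "x + y = Abs_l2seq (\<lambda>n. coord x n + coord y n)"
definition "- x = Abs_l2seq (\<lambda>n. - coord x n)"
definition "x - y = Abs_l2seq (\<lambda>n. coord x n - coord y n)" for x y :: "'a l2seq"
definition "r *\<^sub>R x = Abs_l2seq (\<lambda>n. r *\<^sub>R coord x n)"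
definition "norm x = sqrt (suminf (\<lambda>n. (norm (coord x n))\<^sup>2))" for x :: "'a l2seq"
definition "sgn x = inverse (norm x) *\<^sub>R x" for x :: "'a l2seq"
definition "dist x y = norm (x - y)" for x y :: "'a l2seq"
definition "uniformity = (INF e\<in>{0 <..}. principal {(x, y::'a l2seq). dist x y < e})"
definition "open U = (\<forall>x\<in>U. \<forall>\<^sub>F (x', y) in uniformity. x' = x \<longrightarrow> y \<in> U)" for U :: "'a l2seq set"

lemma coord_zero [simp]: "coord (0::'a l2seq) n = 0"
  by (simp add: zero_l2seq_def coord_Abs)

lemma coord_add [simp]: "coord (x + y) n = coord x n + coord (y::'a l2seq) n"
  unfolding plus_l2seq_def by (subst coord_Abs) (auto intro: square_summable_add summable_coord)

lemma coord_scaleR [simp]: "coord (r *\<^sub>R x) n = r *\<^sub>R coord (x::'a l2seq) n"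
  unfolding scaleR_l2seq_def
  by (subst coord_Abs, rule square_summable_scaled[OF summable_coord[of x], of _ "\<bar>r\<bar>"]) auto

lemma coord_uminus [simp]: "coord (- x) n = - coord (x::'a l2seq) n"
  unfolding uminus_l2seq_def by (subst coord_Abs) (auto simp: summable_coord)

lemma coord_diff [simp]: "coord (x - y) n = coord x n - coord (y::'a l2seq) n"
  unfolding minus_l2seq_def
  using square_summable_add[OF summable_coord[of x] summable_coord[of "- y"]]
  by (subst coord_Abs) auto

lemma norm_l2seq_sq: "(norm x)\<^sup>2 = (suminf (\<lambda>n. (norm (coord x n))\<^sup>2))" for x :: "'a l2seq"
  unfolding norm_l2seq_def by (simp add: suminf_nonneg summable_coord)

lemma partial_norm_le: "L2_set (\<lambda>n. norm (coord x n)) {..<N} \<le> norm x" for x :: "'a l2seq"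
  unfolding L2_set_def norm_l2seq_def
  by (rule real_sqrt_le_mono, rule sum_le_suminf) (auto simp: summable_coord)

text \<open>Norm estimates are made on finite sections, where the inequalities for
  \<open>L2_set\<close> such as Minkowski's are available, and pass to the whole sequence from
  there.\<close>

lemma norm_l2seq_leI:
  fixes x :: "'a l2seq"
  assumes "\<And>N. L2_set (\<lambda>n. norm (coord x n)) {..<N} \<le> B" shows "norm x \<le> B"
proof -
  have B: "B \<ge> 0" using assms[of 0] by simp
  have "(\<Sum>n<N. (norm (coord x n))\<^sup>2) \<le> B\<^sup>2" for N
    using assms[of N] B unfolding L2_set_def by (metis real_sqrt_le_iff real_sqrt_abs abs_of_nonneg)
  then have "(suminf (\<lambda>n. (norm (coord x n))\<^sup>2)) \<le> B\<^sup>2" by (intro suminf_le_const summable_coord)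
  then show ?thesis unfolding norm_l2seq_def using B real_le_lsqrt suminf_nonneg[OF summable_coord] by simp
qed

lemma norm_l2seq_triangle: "norm (x + y) \<le> norm x + norm y" for x y :: "'a l2seq"
proof (rule norm_l2seq_leI)
  fix N
  have "L2_set (\<lambda>n. norm (coord (x + y) n)) {..<N}
      \<le> L2_set (\<lambda>n. norm (coord x n) + norm (coord y n)) {..<N}"
    by (rule L2_set_mono) (auto intro: norm_triangle_ineq)
  also have "\<dots> \<le> L2_set (\<lambda>n. norm (coord x n)) {..<N} + L2_set (\<lambda>n. norm (coord y n)) {..<N}"
    by (rule L2_set_triangle_ineq)
  also have "\<dots> \<le> norm x + norm y" by (intro add_mono partial_norm_le)
  finally show "L2_set (\<lambda>n. norm (coord (x + y) n)) {..<N} \<le> norm x + norm y" .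
qed

lemma norm_coord_le: "norm (coord x n) \<le> norm x" for x :: "'a l2seq"
proof -
  have "norm (coord x n) \<le> L2_set (\<lambda>n. norm (coord x n)) {..<Suc n}"
    by (rule member_le_L2_set) auto
  then show ?thesis using partial_norm_le order_trans by blast
qed

lemma norm_l2seq_scaleR: "norm (r *\<^sub>R x) = \<bar>r\<bar> * norm x" for x :: "'a l2seq"
  unfolding norm_l2seq_def coord_scaleR norm_scaleR power_mult_distrib
  by (simp add: suminf_mult summable_coord real_sqrt_mult)

lemma norm_l2seq_eq_0: "norm x = 0 \<longleftrightarrow> x = 0" for x :: "'a l2seq"
proof
  assume "norm x = 0"
  then have "norm (coord x n) \<le> 0" for n using norm_coord_le[of x n] by simp
  then show "x = 0" by (intro l2seq_eqI) simp
qed (simp add: norm_l2seq_def)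

text \<open>Coordinates are dominated by the norm, hence converge; letting \<open>m\<close> tend to
  infinity in a finite section keeps the Cauchy estimate uniformly in the length of the section. The
  explicit epsilon form is used because the type has no topology until the instance proof is
  finished.\<close>

lemma l2seq_complete:
  fixes X :: "nat \<Rightarrow> 'a l2seq"
  assumes X: "\<And>e. e > 0 \<Longrightarrow> \<exists>K. \<forall>k\<ge>K. \<forall>m\<ge>K. norm (X k - X m) < e"
  shows "\<exists>x. \<forall>e>0. \<exists>K. \<forall>k\<ge>K. norm (X k - x) \<le> e"
proof -
  have "Cauchy (\<lambda>k. coord (X k) n)" for n
  proof (rule CauchyI)
    fix e :: real assume "e > 0"
    then obtain K where "\<forall>k\<ge>K. \<forall>m\<ge>K. norm (X k - X m) < e" using X by blast
    moreover have "norm (coord (X k) n - coord (X m) n) \<le> norm (X k - X m)" for k m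
      using norm_coord_le[of "X k - X m" n] by simp
    ultimately show "\<exists>M. \<forall>k\<ge>M. \<forall>m\<ge>M. norm (coord (X k) n - coord (X m) n) < e"
      using le_less_trans by blast
  qed
  then have "\<forall>n. \<exists>l. (\<lambda>k. coord (X k) n) \<longlonglongrightarrow> l" using Cauchy_convergent_iff convergent_def by blast
  from choice[OF this] obtain f where f: "\<And>n. (\<lambda>k. coord (X k) n) \<longlonglongrightarrow> f n" by blast
  have bound: "L2_set (\<lambda>n. norm (coord (X k) n - f n)) {..<N} \<le> e"
    if K: "\<forall>k\<ge>K. \<forall>m\<ge>K. norm (X k - X m) < e" and k: "k \<ge> K" for e K k N
  proof (rule LIMSEQ_le_const2)
    show "(\<lambda>m. L2_set (\<lambda>n. norm (coord (X k) n - coord (X m) n)) {..<N})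
        \<longlonglongrightarrow> L2_set (\<lambda>n. norm (coord (X k) n - f n)) {..<N}"
      unfolding L2_set_def by (intro tendsto_intros f)
    have "L2_set (\<lambda>n. norm (coord (X k) n - coord (X m) n)) {..<N} \<le> norm (X k - X m)" for m
      using partial_norm_le[of "X k - X m" N] by simp
    then show "\<exists>K. \<forall>m\<ge>K. L2_set (\<lambda>n. norm (coord (X k) n - coord (X m) n)) {..<N} \<le> e"
      using K k order_trans less_imp_le by meson
  qed
  have sum: "summable (\<lambda>n. (norm (f n))\<^sup>2)"
  proof -
    obtain K where K: "\<forall>k\<ge>K. \<forall>m\<ge>K. norm (X k - X m) < 1" using X[of 1] by auto
    have "(\<Sum>n<N. (norm (coord (X K) n - f n))\<^sup>2) \<le> 1" for N
      using bound[OF K, of K N] unfolding L2_set_def by simp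
    then have "summable (\<lambda>n. (norm (coord (X K) n - f n))\<^sup>2)"
      by (intro summableI_nonneg_bounded[where x = 1]) auto
    \<comment> \<open>The limit is rewritten as -(X K - f) + X K, a sum of two square-summable
      sequences.\<close>
    then have "summable (\<lambda>n. (norm (- (coord (X K) n - f n)))\<^sup>2)"
      by (simp only: norm_minus_cancel)
    from square_summable_add[OF this summable_coord[of "X K"]] show ?thesis by simp
  qed
  have "\<exists>K. \<forall>k\<ge>K. norm (X k - Abs_l2seq f) \<le> e" if e: "e > 0" for e
  proof -
    obtain K where K: "\<forall>k\<ge>K. \<forall>m\<ge>K. norm (X k - X m) < e" using X[OF e] by auto
    have "norm (X k - Abs_l2seq f) \<le> e" if "k \<ge> K" for k
      using bound[OF K that] by (intro norm_l2seq_leI) (simp add: coord_Abs[OF sum])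
    then show ?thesis by blast
  qed
  then show ?thesis by blast
qed

instance
proof
  fix x y z :: "'a l2seq" and r s :: real
  show "x + y + z = x + (y + z)" by (rule l2seq_eqI) simp
  show "x + y = y + x" by (rule l2seq_eqI) simp
  show "0 + x = x" by (rule l2seq_eqI) simp
  show "- x + x = 0" by (rule l2seq_eqI) simp
  show "x - y = x + - y" by (rule l2seq_eqI) simp
  show "r *\<^sub>R (x + y) = r *\<^sub>R x + r *\<^sub>R y" by (rule l2seq_eqI) (simp add: scaleR_add_right)
  show "(r + s) *\<^sub>R x = r *\<^sub>R x + s *\<^sub>R x" by (rule l2seq_eqI) (simp add: scaleR_add_left)
  show "r *\<^sub>R s *\<^sub>R x = (r * s) *\<^sub>R x" by (rule l2seq_eqI) simp
  show "1 *\<^sub>R x = x" by (rule l2seq_eqI) simp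
  show "dist x y = norm (x - y)" by (rule dist_l2seq_def)
  show "sgn x = inverse (norm x) *\<^sub>R x" by (rule sgn_l2seq_def)
  show "uniformity = (INF e\<in>{0 <..}. principal {(x, y::'a l2seq). dist x y < e})"
    by (rule uniformity_l2seq_def)
  show "open U = (\<forall>x\<in>U. \<forall>\<^sub>F (x', y) in uniformity. x' = x \<longrightarrow> y \<in> U)" for U :: "'a l2seq set"
    by (rule open_l2seq_def)
  show "norm x = 0 \<longleftrightarrow> x = 0" by (rule norm_l2seq_eq_0)
  show "norm (x + y) \<le> norm x + norm y" by (rule norm_l2seq_triangle)
  show "norm (r *\<^sub>R x) = \<bar>r\<bar> * norm x" by (rule norm_l2seq_scaleR)
qed

end

instance l2seq :: (complex_hilbert) banach
proof
  fix X :: "nat \<Rightarrow> 'a l2seq"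
  assume "Cauchy X"
  then have "\<exists>K. \<forall>k\<ge>K. \<forall>m\<ge>K. norm (X k - X m) < e" if "e > 0" for e
    using that unfolding Cauchy_def dist_l2seq_def by blast
  then obtain x where x: "\<forall>e>0. \<exists>K. \<forall>k\<ge>K. norm (X k - x) \<le> e" using l2seq_complete by metis
  have "X \<longlonglongrightarrow> x"
  proof (rule metric_LIMSEQ_I)
    fix r :: real assume "r > 0"
    then obtain K where "\<forall>k\<ge>K. norm (X k - x) \<le> r / 2" using x by (meson half_gt_zero)
    then show "\<exists>no. \<forall>n\<ge>no. dist (X n) x < r" unfolding dist_l2seq_def
      using \<open>r > 0\<close> by (intro exI[of _ K]) (auto intro: le_less_trans)
  qed
  then show "convergent X" unfolding convergent_def by blast
qed

instantiation l2seq :: (complex_hilbert) complex_hilbert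
begin

definition "c *\<^sub>C x = Abs_l2seq (\<lambda>n. c *\<^sub>C coord x n)"
definition "cinner x y = (suminf (\<lambda>n. cinner (coord x n) (coord y n)))" for x y :: "'a l2seq"

lemma coord_scaleC [simp]: "coord (c *\<^sub>C x) n = c *\<^sub>C coord (x::'a l2seq) n"
  unfolding scaleC_l2seq_def
  by (subst coord_Abs, rule square_summable_scaled[OF summable_coord[of x], of _ "cmod c"]) auto

instance
proof
  fix x y z :: "'a l2seq" and r :: real and c d :: complex
  show "c *\<^sub>C (x + y) = c *\<^sub>C x + c *\<^sub>C y" by (rule l2seq_eqI) (simp add: scaleC_add_right)
  show "(c + d) *\<^sub>C x = c *\<^sub>C x + d *\<^sub>C x" by (rule l2seq_eqI) (simp add: scaleC_add_left)
  show "c *\<^sub>C d *\<^sub>C x = (c * d) *\<^sub>C x" by (rule l2seq_eqI) (simp add: scaleC_scaleC)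
  show "r *\<^sub>R x = complex_of_real r *\<^sub>C x" by (rule l2seq_eqI) (simp add: scaleR_scaleC)
  have sum: "summable (\<lambda>n. cinner (coord u n) (coord v n))" for u v :: "'a l2seq"
    by (rule summable_norm_cancel) (intro summable_cinner summable_coord)
  show "cinner (x + y) z = cinner x z + cinner y z"
    unfolding cinner_l2seq_def coord_add cinner_add_left by (rule suminf_add[OF sum sum, symmetric])
  show "cinner (c *\<^sub>C x) y = c * cinner x y"
    unfolding cinner_l2seq_def coord_scaleC cinner_scaleC_left by (rule suminf_mult[OF sum])
  show "cinner x y = cnj (cinner y x)"
  proof -
    have "(\<lambda>n. cnj (cinner (coord y n) (coord x n))) sums cnj (cinner y x)"
      unfolding sums_cnj cinner_l2seq_def by (rule summable_sums[OF sum])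
    moreover have "cnj (cinner (coord y n) (coord x n)) = cinner (coord x n) (coord y n)" for n
      using cinner_commute[of "coord x n" "coord y n"] by simp
    ultimately show ?thesis unfolding cinner_l2seq_def[of x y] by (simp add: sums_iff)
  qed
  show "cinner x x = complex_of_real ((norm x)\<^sup>2)"
    unfolding norm_l2seq_sq cinner_l2seq_def cinner_self
    by (rule suminf_of_real[OF summable_coord, symmetric])
qed

end


section \<open>Amplifications T tensor 1 and approximation in the bicommutant\<close>

definition amplify :: "('a::complex_hilbert \<Rightarrow> 'a) \<Rightarrow> 'a l2seq \<Rightarrow> 'a l2seq" where
  "amplify T x = Abs_l2seq (\<lambda>n. T (coord x n))"

definition l2_inj :: "nat \<Rightarrow> 'a::complex_hilbert \<Rightarrow> 'a l2seq" where
  "l2_inj m u = Abs_l2seq (\<lambda>n. if n = m then u else 0)"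

lemma coord_l2_inj: "coord (l2_inj m u) n = (if n = m then u else 0)"
  unfolding l2_inj_def
  by (subst coord_Abs, rule summable_finite[of "{m}"]) auto

lemma coord_amplify: "bounded_clinear T \<Longrightarrow> coord (amplify T x) n = T (coord x n)"
proof -
  assume "bounded_clinear T"
  then obtain C where "\<And>v. norm (T v) \<le> C * norm v" using bounded_clinear_bound by blast
  then have "summable (\<lambda>n. (norm (T (coord x n)))\<^sup>2)"
    by (intro square_summable_scaled[OF summable_coord[of x], of _ C])
  then show ?thesis by (simp add: amplify_def coord_Abs)
qed

lemma bounded_clinear_amplify:
  assumes T: "bounded_clinear T" shows "bounded_clinear (amplify T)"
proof -
  obtain C where C: "C > 0" "\<And>v. norm (T v) \<le> C * norm v" using bounded_clinear_bound[OF T] by blast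
  show ?thesis
  proof (rule bounded_clinearI[of _ C])
    show "amplify T (x + y) = amplify T x + amplify T y" for x y
      by (rule l2seq_eqI) (simp add: coord_amplify[OF T] bounded_clinear_add[OF T])
    show "amplify T (c *\<^sub>C x) = c *\<^sub>C amplify T x" for c x
      by (rule l2seq_eqI) (simp add: coord_amplify[OF T] bounded_clinear_scaleC[OF T])
    show "norm (amplify T x) \<le> C * norm x" for x
    proof (rule norm_l2seq_leI)
      fix N
      have "L2_set (\<lambda>n. norm (coord (amplify T x) n)) {..<N} \<le> L2_set (\<lambda>n. C * norm (coord x n)) {..<N}"
        by (rule L2_set_mono) (auto simp: coord_amplify[OF T] C(2))
      also have "\<dots> = C * L2_set (\<lambda>n. norm (coord x n)) {..<N}"
        using C(1) by (simp add: L2_set_right_distrib)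
      also have "\<dots> \<le> C * norm x" using C(1) partial_norm_le by (intro mult_left_mono) auto
      finally show "L2_set (\<lambda>n. norm (coord (amplify T x) n)) {..<N} \<le> C * norm x" .
    qed
  qed
qed

lemma cinner_amplify:
  assumes T: "bounded_clinear T"
  shows "cinner (amplify T x) y = cinner x (amplify (adj T) y)"
  unfolding cinner_l2seq_def
  by (simp add: coord_amplify[OF T] coord_amplify[OF bounded_clinear_adj[OF T]] cinner_adj[OF T])

lemma cinner_l2_inj: "cinner (l2_inj m u) x = cinner u (coord x m)"
proof -
  have "(\<lambda>n. cinner (coord (l2_inj m u) n) (coord x n)) sums (\<Sum>n\<in>{m}. cinner (coord (l2_inj m u) n) (coord x n))"
    by (rule sums_finite) (auto simp: coord_l2_inj)
  then show ?thesis unfolding cinner_l2seq_def by (simp add: sums_iff coord_l2_inj)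
qed

lemma bounded_clinear_coord: "bounded_clinear (\<lambda>x. coord x m)"
  by (rule bounded_clinearI[of _ 1]) (auto simp: norm_coord_le)

lemma bounded_clinear_l2_inj: "bounded_clinear (l2_inj m)"
proof (rule bounded_clinearI[of _ 1])
  show "l2_inj m (u + v) = l2_inj m u + l2_inj m v" for u v
    by (rule l2seq_eqI) (simp add: coord_l2_inj)
  show "l2_inj m (c *\<^sub>C u) = c *\<^sub>C l2_inj m u" for c u
    by (rule l2seq_eqI) (simp add: coord_l2_inj)
  show "norm (l2_inj m u) \<le> 1 * norm u" for u
  proof -
    have "(norm (l2_inj m u))\<^sup>2 = (norm u)\<^sup>2"
      by (simp only: norm_sq_cinner cinner_l2_inj coord_l2_inj if_True refl)
    then show ?thesis by (simp add: power2_eq_iff_nonneg)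
  qed
qed

text \<open>A vector orthogonal to every summand has zero coordinates, so the subspace on which the
  operators agree is dense.\<close>

lemma bounded_clinear_eq_on_l2_inj:
  assumes S: "bounded_clinear S" and T: "bounded_clinear T"
    and eq: "\<And>m u. S (l2_inj m u) = T (l2_inj m u)"
  shows "S = T"
proof -
  define E where "E = {x. S x = T x}"
  have "csubspace E" unfolding csubspace_def E_def
    by (auto simp: bounded_clinear_add[OF S] bounded_clinear_add[OF T] bounded_clinear_zero[OF S]
        bounded_clinear_zero[OF T] bounded_clinear_scaleC[OF S] bounded_clinear_scaleC[OF T])
  then have "closure E = UNIV"
  proof (rule dense_if_orthogonal_trivial)
    fix x :: "'a l2seq" assume x: "\<And>f. f \<in> E \<Longrightarrow> cinner f x = 0"
    have "cinner u (coord x m) = 0" for u m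
      using x[of "l2_inj m u"] eq by (simp add: E_def cinner_l2_inj)
    then have "cinner (coord x m) (coord x m) = 0" for m by blast
    then have "coord x m = 0" for m by (simp add: cinner_self)
    then show "x = 0" by (intro l2seq_eqI) simp
  qed
  then show ?thesis by (rule bounded_clinear_eq_on_dense[OF S T]) (simp add: E_def)
qed

lemma unital_subalgebraD:
  assumes "unital_subalgebra A"
  shows "S \<in> A \<Longrightarrow> bounded_clinear S" "id \<in> A" "S \<in> A \<Longrightarrow> T \<in> A \<Longrightarrow> (\<lambda>x. S x + T x) \<in> A"
    "S \<in> A \<Longrightarrow> (\<lambda>x. c *\<^sub>C S x) \<in> A" "S \<in> A \<Longrightarrow> T \<in> A \<Longrightarrow> S \<circ> T \<in> A"
  using assms unfolding unital_subalgebra_def by blast+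

text \<open>The matrix entries of the projection onto the closure of \<open>{a \<Xi> | a \<in> A}\<close> commute with \<open>G\<close>, hence
  with \<open>x\<close>.\<close>

theorem bicommutant_approx:
  fixes \<Xi> :: "nat \<Rightarrow> 'a::complex_hilbert"
  assumes G: "\<And>T. T \<in> G \<Longrightarrow> bounded_clinear T" "\<And>T. T \<in> G \<Longrightarrow> adj T \<in> G"
    and A: "unital_subalgebra A" "G \<subseteq> A" and x: "x \<in> commutant (commutant G)"
    and \<Xi>: "summable (\<lambda>n. (norm (\<Xi> n))\<^sup>2)" and e: "e > 0"
  shows "\<exists>a\<in>A. suminf (\<lambda>n. (norm (x (\<Xi> n) - a (\<Xi> n)))\<^sup>2) < e"
proof -
  define \<xi> where "\<xi> = Abs_l2seq \<Xi>"
  have \<xi>: "coord \<xi> n = \<Xi> n" for n by (simp add: \<xi>_def coord_Abs[OF \<Xi>])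
  have bA: "bounded_clinear a" if "a \<in> A" for a using unital_subalgebraD(1)[OF A(1) that] .
  have bx: "bounded_clinear x" using x by (simp add: commutant_def)
  define E where "E = (\<lambda>a. amplify a \<xi>) ` A"
  have E: "csubspace E"
    unfolding csubspace_def
  proof (intro conjI ballI allI)
    have "amplify (\<lambda>v. 0 *\<^sub>C id v) \<xi> = 0"
      by (rule l2seq_eqI) (subst coord_amplify[OF bounded_clinear_scale[OF bounded_clinear_id]], simp)
    moreover have "(\<lambda>v. 0 *\<^sub>C id v) \<in> A" by (intro unital_subalgebraD[OF A(1)])
    ultimately show "0 \<in> E" unfolding E_def by (rule image_eqI[OF sym])
  next
    fix y z assume "y \<in> E" "z \<in> E"
    then obtain a b where ab: "a \<in> A" "b \<in> A" "y = amplify a \<xi>" "z = amplify b \<xi>" unfolding E_def by blast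
    have "amplify (\<lambda>v. a v + b v) \<xi> = y + z"
      by (rule l2seq_eqI)
         (simp add: ab coord_amplify[OF bA] coord_amplify[OF bounded_clinear_plus[OF bA bA]])
    from image_eqI[where f = "\<lambda>a. amplify a \<xi>", OF this[symmetric] unital_subalgebraD(3)[OF A(1) ab(1,2)]]
    show "y + z \<in> E" unfolding E_def .
  next
    fix c y assume "y \<in> E"
    then obtain a where a: "a \<in> A" "y = amplify a \<xi>" unfolding E_def by blast
    have "amplify (\<lambda>v. c *\<^sub>C a v) \<xi> = c *\<^sub>C y"
      by (rule l2seq_eqI)
         (simp add: a coord_amplify[OF bA] coord_amplify[OF bounded_clinear_scale[OF bA]])
    from image_eqI[where f = "\<lambda>a. amplify a \<xi>", OF this[symmetric] unital_subalgebraD(4)[OF A(1) a(1)]]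
    show "c *\<^sub>C y \<in> E" unfolding E_def .
  qed
  obtain P where P0: "bounded_clinear P \<and> (\<forall>x. P x \<in> closure E)
    \<and> (\<forall>x e. e \<in> closure E \<longrightarrow> (\<forall>f\<in>closure E. cinner (x - e) f = 0) \<longrightarrow> P x = e)
    \<and> (\<forall>x. \<forall>f\<in>closure E. cinner (x - P x) f = 0)"
    using projection_operator[OF csubspace_closure[OF E] closed_closure] by (rule exE)
  have P: "bounded_clinear P" "\<And>v. P v \<in> closure E"
    "\<And>v f. f \<in> closure E \<Longrightarrow> cinner (v - P v) f = 0" using P0 by simp_all
  have Puniq: "P v = w" if "w \<in> closure E" "\<And>f. f \<in> closure E \<Longrightarrow> cinner (v - w) f = 0" for v w
    using P0 that by simp
  have inv: "amplify T v \<in> closure E" if T: "T \<in> G" and v: "v \<in> closure E" for T v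
  proof -
    have invE: "amplify T w \<in> E" if w: "w \<in> E" for w
    proof -
      obtain a where a: "a \<in> A" "w = amplify a \<xi>" using w unfolding E_def by blast
      have Ta: "T \<circ> a \<in> A" using unital_subalgebraD(5)[OF A(1)] A(2) T a(1) by blast
      have "amplify (T \<circ> a) \<xi> = amplify T w"
        by (rule l2seq_eqI) (simp add: a coord_amplify[OF bA[OF Ta]] coord_amplify[OF bA] coord_amplify[OF G(1)[OF T]])
      from image_eqI[where f = "\<lambda>a. amplify a \<xi>", OF this[symmetric] Ta] show ?thesis unfolding E_def .
    qed
    obtain f where f: "\<forall>n. f n \<in> E" "f \<longlonglongrightarrow> v" using v unfolding closure_sequential by blast
    have "(\<lambda>n. amplify T (f n)) \<longlonglongrightarrow> amplify T v"
      by (rule bounded_clinear_tendsto[OF bounded_clinear_amplify[OF G(1)[OF T]] f(2)])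
    moreover have "\<forall>n. amplify T (f n) \<in> E" using invE f(1) by simp
    ultimately show ?thesis unfolding closure_sequential by (intro exI[of _ "\<lambda>n. amplify T (f n)"] conjI)
  qed
  \<comment> \<open>Invariance under \<open>T\<close> puts the candidate into the closure, and
    invariance under \<open>adj T\<close> keeps the remainder orthogonal. This is where closure of
    \<open>G\<close> under adjoints enters.\<close>
  have comm: "P (amplify T v) = amplify T (P v)" if T: "T \<in> G" for T v
  proof (rule Puniq)
    show "amplify T (P v) \<in> closure E" by (rule inv[OF T P(2)])
    show "cinner (amplify T v - amplify T (P v)) f = 0" if f: "f \<in> closure E" for f
      using P(3)[OF inv[OF G(2)[OF T] f], of v]
      by (simp add: cinner_amplify[OF G(1)[OF T]] cinner_diff_left)
  qed
  define entry where "entry m n u = coord (P (l2_inj n u)) m" for m n u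
  have bentry: "bounded_clinear (entry m n)" for m n
    using bounded_clinear_comp[OF bounded_clinear_coord[of m] bounded_clinear_comp[OF P(1) bounded_clinear_l2_inj[of n]]]
    by (simp add: comp_def entry_def[abs_def])
  have amp_inj: "amplify T (l2_inj n u) = l2_inj n (T u)" if "bounded_clinear T" for T :: "'a \<Rightarrow> 'a" and n u
    by (rule l2seq_eqI) (simp add: coord_amplify[OF that] coord_l2_inj bounded_clinear_zero[OF that])
  have "entry m n \<in> commutant G" for m n
    unfolding commutant_def
  proof (intro CollectI conjI ballI ext)
    fix T u assume T: "T \<in> G"
    show "(entry m n \<circ> T) u = (T \<circ> entry m n) u"
      by (simp add: entry_def amp_inj[OF G(1)[OF T], symmetric] comm[OF T] coord_amplify[OF G(1)[OF T]])
  qed (rule bentry)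
  then have "x \<circ> entry m n = entry m n \<circ> x" for m n
    using x unfolding commutant_def[of "commutant G"] by simp
  from fun_cong[OF this] have xentry: "x (entry m n u) = entry m n (x u)" for m n u by simp
  have "P \<circ> amplify x = amplify x \<circ> P"
  proof (rule bounded_clinear_eq_on_l2_inj)
    show "(P \<circ> amplify x) (l2_inj n u) = (amplify x \<circ> P) (l2_inj n u)" for n u
      using xentry[of _ n u] by (intro l2seq_eqI) (simp add: amp_inj[OF bx] coord_amplify[OF bx] entry_def)
  qed (auto intro: bounded_clinear_comp P(1) bounded_clinear_amplify bx)
  then have "P (amplify x \<xi>) = amplify x (P \<xi>)" by (simp add: fun_eq_iff)
  \<comment> \<open>\<open>A\<close> contains the identity, so the vector itself lies in the cyclic
    subspace; commutation with \<open>P\<close> then keeps its image under the amplified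
    \<open>x\<close> in the closure.\<close>
  moreover have "P \<xi> = \<xi>"
  proof (rule Puniq)
    have "amplify id \<xi> = \<xi>" by (rule l2seq_eqI) (simp add: coord_amplify[OF bounded_clinear_id])
    from image_eqI[where f = "\<lambda>a. amplify a \<xi>", OF this[symmetric] unital_subalgebraD(2)[OF A(1)]] have "\<xi> \<in> E" unfolding E_def .
    then show "\<xi> \<in> closure E" using closure_subset by blast
  qed simp
  ultimately have "amplify x \<xi> \<in> closure E" using P(2)[of "amplify x \<xi>"] by simp
  then obtain a where a: "a \<in> A" "dist (amplify a \<xi>) (amplify x \<xi>) < sqrt e"
    unfolding closure_approachable E_def using e by (auto dest!: spec[of _ "sqrt e"])
  have "suminf (\<lambda>n. (norm (x (\<Xi> n) - a (\<Xi> n)))\<^sup>2) = (norm (amplify x \<xi> - amplify a \<xi>))\<^sup>2"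
    by (simp add: norm_l2seq_sq coord_amplify[OF bx] coord_amplify[OF bA[OF a(1)]] \<xi>)
  also have "\<dots> < (sqrt e)\<^sup>2"
    using a(2) by (intro power_strict_mono) (auto simp: dist_norm norm_minus_commute)
  also have "\<dots> = e" using e by simp
  finally show ?thesis using a(1) by blast
qed

section \<open>Ultraweak continuity of the trace\<close>

definition ultraweak_functional ::
    "(nat \<Rightarrow> 'a::complex_hilbert) \<Rightarrow> (nat \<Rightarrow> 'a) \<Rightarrow> ('a \<Rightarrow> 'a) \<Rightarrow> complex" where
  "ultraweak_functional \<xi> \<zeta> T = suminf (\<lambda>n. cinner (T (\<xi> n)) (\<zeta> n))"

definition square_summable :: "(nat \<Rightarrow> 'a::complex_hilbert) \<Rightarrow> bool" where
  "square_summable \<xi> \<longleftrightarrow> summable (\<lambda>n. (norm (\<xi> n))\<^sup>2)"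

lemma square_summable_image:
  assumes "bounded_clinear T" "square_summable \<xi>" shows "square_summable (\<lambda>n. T (\<xi> n))"
proof -
  obtain C where C: "\<And>v. norm (T v) \<le> C * norm v" using bounded_clinear_bound[OF assms(1)] by blast
  show ?thesis unfolding square_summable_def
    by (rule square_summable_scaled[OF assms(2)[unfolded square_summable_def] C])
qed

lemma summable_ultraweak:
  assumes "bounded_clinear T" "square_summable \<xi>" "square_summable \<zeta>"
  shows "summable (\<lambda>n. cmod (cinner (T (\<xi> n)) (\<zeta> n)))"
  by (rule summable_cinner[OF square_summable_image[OF assms(1,2), unfolded square_summable_def]
        assms(3)[unfolded square_summable_def]])

lemma ultraweak_functional_scale:
  assumes "bounded_clinear T" "square_summable \<xi>" "square_summable \<zeta>"
  shows "ultraweak_functional \<xi> \<zeta> (\<lambda>x. c *\<^sub>C T x) = c * ultraweak_functional \<xi> \<zeta> T"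
  unfolding ultraweak_functional_def cinner_scaleC_left
  by (rule suminf_mult[OF summable_norm_cancel[OF summable_ultraweak[OF assms]]])

text \<open>The generating sets are only a subbase. Induction over the generated topology produces
  finitely many functionals with a common tolerance around each point.\<close>

lemma ultraweak_open_basic:
  assumes "openin ultraweak_topology U" "T0 \<in> U"
  shows "\<exists>F \<epsilon>. finite F \<and> \<epsilon> > 0 \<and> (\<forall>(\<xi>,\<zeta>)\<in>F. square_summable \<xi> \<and> square_summable \<zeta>) \<and>
    (\<forall>T. bounded_clinear T \<longrightarrow> (\<forall>(\<xi>,\<zeta>)\<in>F. cmod (ultraweak_functional \<xi> \<zeta> T - ultraweak_functional \<xi> \<zeta> T0) < \<epsilon>)
      \<longrightarrow> T \<in> U)"
proof -
  define Q where "Q F \<epsilon> U T0 \<longleftrightarrow> finite F \<and> \<epsilon> > (0::real) \<and> (\<forall>(\<xi>,\<zeta>)\<in>F. square_summable \<xi> \<and> square_summable \<zeta>) \<and>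
    (\<forall>T. bounded_clinear T \<longrightarrow> (\<forall>(\<xi>,\<zeta>)\<in>F. cmod (ultraweak_functional \<xi> \<zeta> T - ultraweak_functional \<xi> \<zeta> T0) < \<epsilon>)
      \<longrightarrow> T \<in> U)" for F \<epsilon> U and T0 :: "'a \<Rightarrow> 'a"
  have "generate_topology_on {{T. bounded_clinear T \<and> suminf (\<lambda>n. cinner (T (\<xi> n)) (\<zeta> n)) \<in> W} | \<xi> \<zeta> W.
        summable (\<lambda>n. (norm (\<xi> n))\<^sup>2) \<and> summable (\<lambda>n. (norm (\<zeta> n))\<^sup>2) \<and> open W} U"
    using assms(1) unfolding ultraweak_topology_def openin_topology_generated_by_iff .
  then have "\<forall>T0\<in>U. \<exists>F \<epsilon>. Q F \<epsilon> U T0"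
  proof (induction rule: generate_topology_on.induct)
    case Empty
    then show ?case by simp
  next
    case (Int a b)
    show ?case
    proof
      fix T0 assume "T0 \<in> a \<inter> b"
      then obtain F \<epsilon> F' \<epsilon>' where "Q F \<epsilon> a T0" "Q F' \<epsilon>' b T0" using Int by blast
      then have "Q (F \<union> F') (min \<epsilon> \<epsilon>') (a \<inter> b) T0"
        unfolding Q_def split_beta ball_Un min_less_iff_conj by simp
      then show "\<exists>F \<epsilon>. Q F \<epsilon> (a \<inter> b) T0" by blast
    qed
  next
    case (UN K)
    show ?case
    proof
      fix T0 assume "T0 \<in> \<Union>K"
      then obtain k F \<epsilon> where k: "k \<in> K" "Q F \<epsilon> k T0" using UN by blast
      then have "Q F \<epsilon> (\<Union>K) T0" unfolding Q_def by blast
      then show "\<exists>F \<epsilon>. Q F \<epsilon> (\<Union>K) T0" by blast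
    qed
  next
    case (Basis s)
    then obtain \<xi> \<zeta> W where s: "s = {T. bounded_clinear T \<and> ultraweak_functional \<xi> \<zeta> T \<in> W}"
      "square_summable \<xi>" "square_summable \<zeta>" "open W"
      unfolding ultraweak_functional_def square_summable_def by blast
    show ?case
    proof
      fix T0 assume "T0 \<in> s"
      then have "ultraweak_functional \<xi> \<zeta> T0 \<in> W" using s(1) by simp
      then obtain \<epsilon> where e: "\<epsilon> > 0" "ball (ultraweak_functional \<xi> \<zeta> T0) \<epsilon> \<subseteq> W"
        using s(4) open_contains_ball by blast
      have "Q {(\<xi>, \<zeta>)} \<epsilon> s T0" unfolding Q_def
      proof (intro conjI allI impI)
        fix T :: "'a \<Rightarrow> 'a"
        assume T: "bounded_clinear T"
          "\<forall>(\<xi>', \<zeta>')\<in>{(\<xi>, \<zeta>)}. cmod (ultraweak_functional \<xi>' \<zeta>' T - ultraweak_functional \<xi>' \<zeta>' T0) < \<epsilon>"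
        then have "ultraweak_functional \<xi> \<zeta> T \<in> ball (ultraweak_functional \<xi> \<zeta> T0) \<epsilon>"
          by (simp add: dist_norm norm_minus_commute)
        then show "T \<in> s" using T(1) e(2) s(1) by blast
      qed (use s e in auto)
      then show "\<exists>F \<epsilon>. Q F \<epsilon> s T0" by blast
    qed
  qed
  then show ?thesis using assms(2) unfolding Q_def by blast
qed

text \<open>One sequence has to dominate finitely many others for all operators at once, so the
  sequences are interleaved: one on the even positions, the previous one on the odd
  positions.\<close>

lemma interleave_square_summable:
  fixes F :: "(nat \<Rightarrow> 'a::complex_hilbert) set"
  assumes "finite F" "\<And>\<xi>. \<xi> \<in> F \<Longrightarrow> square_summable \<xi>"
  shows "\<exists>\<Xi>. square_summable \<Xi> \<and> (\<forall>T::'a \<Rightarrow> 'a. bounded_clinear T \<longrightarrow>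
    (\<Sum>\<xi>\<in>F. suminf (\<lambda>n. (norm (T (\<xi> n)))\<^sup>2)) \<le> suminf (\<lambda>n. (norm (T (\<Xi> n)))\<^sup>2))"
  using assms
proof (induction F rule: finite_induct)
  case empty
  have "square_summable (\<lambda>_. 0 :: 'a)" by (simp add: square_summable_def)
  moreover have "0 \<le> suminf (\<lambda>n. (norm (T 0))\<^sup>2)" if "bounded_clinear T" for T :: "'a \<Rightarrow> 'a"
    using bounded_clinear_zero[OF that] by simp
  ultimately show ?case by (intro exI[of _ "\<lambda>_. 0"]) simp
next
  case (insert \<xi> F)
  have "\<exists>\<Xi>. square_summable \<Xi> \<and> (\<forall>T::'a \<Rightarrow> 'a. bounded_clinear T \<longrightarrow>
    (\<Sum>\<xi>\<in>F. suminf (\<lambda>n. (norm (T (\<xi> n)))\<^sup>2)) \<le> suminf (\<lambda>n. (norm (T (\<Xi> n)))\<^sup>2))"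
    by (rule insert.IH) (use insert.prems in simp)
  then obtain \<Xi> where \<Xi>0: "square_summable \<Xi> \<and> (\<forall>T::'a \<Rightarrow> 'a. bounded_clinear T \<longrightarrow>
    (\<Sum>\<xi>\<in>F. suminf (\<lambda>n. (norm (T (\<xi> n)))\<^sup>2)) \<le> suminf (\<lambda>n. (norm (T (\<Xi> n)))\<^sup>2))"
    by (rule exE)
  then have \<Xi>: "square_summable \<Xi>" by simp
  have \<Xi>': "(\<Sum>\<xi>\<in>F. suminf (\<lambda>n. (norm (T (\<xi> n)))\<^sup>2)) \<le> suminf (\<lambda>n. (norm (T (\<Xi> n)))\<^sup>2)"
    if "bounded_clinear T" for T :: "'a \<Rightarrow> 'a" using \<Xi>0 that by simp
  have \<xi>: "square_summable \<xi>" by (rule insert.prems) simp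
  define \<Theta> where "\<Theta> n = (if even n then \<xi> (n div 2) else \<Xi> ((n - 1) div 2))" for n
  have sums: "(\<lambda>n. (norm (T (\<Theta> n)))\<^sup>2) sums
      (suminf (\<lambda>n. (norm (T (\<Xi> n)))\<^sup>2) + suminf (\<lambda>n. (norm (T (\<xi> n)))\<^sup>2))"
    if T: "bounded_clinear T" for T :: "'a \<Rightarrow> 'a"
  proof -
    have "(\<lambda>n. (norm (T (\<Theta> n)))\<^sup>2) =
      (\<lambda>n. if even n then (norm (T (\<xi> (n div 2))))\<^sup>2 else (norm (T (\<Xi> ((n - 1) div 2))))\<^sup>2)"
      by (rule ext) (simp add: \<Theta>_def)
    then show ?thesis
      using sums_if[OF summable_sums summable_sums,
          OF square_summable_image[OF T \<Xi>, unfolded square_summable_def]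
             square_summable_image[OF T \<xi>, unfolded square_summable_def]] by simp
  qed
  have "square_summable \<Theta>"
    using sums_summable[OF sums[OF bounded_clinear_id]] unfolding square_summable_def by simp
  moreover have "(\<Sum>\<xi>\<in>insert \<xi> F. suminf (\<lambda>n. (norm (T (\<xi> n)))\<^sup>2)) \<le> suminf (\<lambda>n. (norm (T (\<Theta> n)))\<^sup>2)"
    if T: "bounded_clinear T" for T :: "'a \<Rightarrow> 'a"
  proof -
    have "suminf (\<lambda>n. (norm (T (\<Theta> n)))\<^sup>2) = suminf (\<lambda>n. (norm (T (\<Xi> n)))\<^sup>2) + suminf (\<lambda>n. (norm (T (\<xi> n)))\<^sup>2)"
      by (rule sums_unique[OF sums[OF T], symmetric])
    then show ?thesis using \<Xi>'[OF T] insert.hyps by simp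
  qed
  ultimately show ?case by (intro exI[of _ \<Theta>]) simp
qed

section \<open>Tracial von Neumann algebras and estimates from normality\<close>

locale tracial_algebra =
  fixes M :: "('a::complex_hilbert \<Rightarrow> 'a) set"
    and \<tau> :: "('a \<Rightarrow> 'a) \<Rightarrow> complex"
    and \<eta> :: "('a \<Rightarrow> 'a) \<Rightarrow> 'l::complex_hilbert"
  assumes vN: "von_neumann_algebra M"
    and trace: "normal_faithful_trace_state M \<tau>"
    and L2: "L2_completion M \<tau> \<eta>"
begin

lemma M_sub: "unital_subalgebra M" using vN by (simp add: von_neumann_algebra_def)

lemmas M_bounded = unital_subalgebraD(1)[OF M_sub]
  and M_id = unital_subalgebraD(2)[OF M_sub]
  and M_plus = unital_subalgebraD(3)[OF M_sub]
  and M_scale = unital_subalgebraD(4)[OF M_sub]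
  and M_comp = unital_subalgebraD(5)[OF M_sub]

lemma M_adj: "T \<in> M \<Longrightarrow> adj T \<in> M" using vN by (simp add: von_neumann_algebra_def)

lemma M_diff: "S \<in> M \<Longrightarrow> T \<in> M \<Longrightarrow> (\<lambda>x. S x - T x) \<in> M"
  using M_plus[OF _ M_scale[of T "-1"]] by simp

lemma M_zero: "(\<lambda>x. 0) \<in> M"
  using M_scale[OF M_id, of 0] by simp

lemma M_bicommutant: "bounded_clinear T \<Longrightarrow> (\<And>S. S \<in> commutant M \<Longrightarrow> T \<circ> S = S \<circ> T) \<Longrightarrow> T \<in> M"
  using vN unfolding von_neumann_algebra_def commutant_def by blast

lemma \<tau>_plus: "S \<in> M \<Longrightarrow> T \<in> M \<Longrightarrow> \<tau> (\<lambda>x. S x + T x) = \<tau> S + \<tau> T"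
  and \<tau>_scale: "S \<in> M \<Longrightarrow> \<tau> (\<lambda>x. c *\<^sub>C S x) = c * \<tau> S"
  and \<tau>_id: "\<tau> id = 1"
  and \<tau>_commute: "S \<in> M \<Longrightarrow> T \<in> M \<Longrightarrow> \<tau> (S \<circ> T) = \<tau> (T \<circ> S)"
  and \<tau>_faithful: "S \<in> M \<Longrightarrow> \<tau> (adj S \<circ> S) = 0 \<Longrightarrow> S = (\<lambda>x. 0)"
  and \<tau>_normal: "continuous_map (subtopology ultraweak_topology M) euclidean \<tau>"
  using trace unfolding normal_faithful_trace_state_def by blast+

lemma \<tau>_zero: "\<tau> (\<lambda>x. 0) = 0"
  using \<tau>_scale[OF M_id, of 0] by simp

lemma \<eta>_plus: "S \<in> M \<Longrightarrow> T \<in> M \<Longrightarrow> \<eta> (\<lambda>x. S x + T x) = \<eta> S + \<eta> T"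
  and \<eta>_scale: "S \<in> M \<Longrightarrow> \<eta> (\<lambda>x. c *\<^sub>C S x) = c *\<^sub>C \<eta> S"
  and cinner_\<eta>: "S \<in> M \<Longrightarrow> T \<in> M \<Longrightarrow> cinner (\<eta> S) (\<eta> T) = \<tau> (adj T \<circ> S)"
  and \<eta>_dense: "closure (\<eta> ` M) = UNIV"
  using L2 unfolding L2_completion_def by blast+

lemma \<eta>_zero: "\<eta> (\<lambda>x. 0) = 0"
  using \<eta>_scale[OF M_id, of 0] by simp

lemma \<eta>_diff: "S \<in> M \<Longrightarrow> T \<in> M \<Longrightarrow> \<eta> (\<lambda>x. S x - T x) = \<eta> S - \<eta> T"
  using \<eta>_plus[OF _ M_scale[of T "-1"]] \<eta>_scale[of T "-1"] by simp

lemma norm_\<eta>: "S \<in> M \<Longrightarrow> (norm (\<eta> S))\<^sup>2 = Re (\<tau> (adj S \<circ> S))"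
  by (simp add: norm_sq_cinner cinner_\<eta>)

lemma \<eta>_inj:
  assumes "S \<in> M" "T \<in> M" "\<eta> S = \<eta> T" shows "S = T"
proof -
  have "\<eta> (\<lambda>x. S x - T x) = 0" using \<eta>_diff[OF assms(1,2)] assms(3) by simp
  then have "\<tau> (adj (\<lambda>x. S x - T x) \<circ> (\<lambda>x. S x - T x)) = 0"
    using cinner_\<eta>[OF M_diff[OF assms(1,2)] M_diff[OF assms(1,2)]] by simp
  then have "(\<lambda>x. S x - T x) = (\<lambda>x. 0)" using \<tau>_faithful[OF M_diff[OF assms(1,2)]] by blast
  then show ?thesis by (metis eq_iff_diff_eq_0 ext)
qed

lemma \<tau>_eq_cinner: "S \<in> M \<Longrightarrow> \<tau> S = cinner (\<eta> S) (\<eta> id)"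
  using cinner_\<eta>[OF _ M_id] by (simp add: adj_id)

lemma norm_\<eta>_adj: assumes S: "S \<in> M" shows "norm (\<eta> (adj S)) = norm (\<eta> S)"
proof -
  have "(norm (\<eta> (adj S)))\<^sup>2 = (norm (\<eta> S))\<^sup>2"
    using \<tau>_commute[OF S M_adj[OF S]] by (simp only: norm_\<eta>[OF S] norm_\<eta>[OF M_adj[OF S]] adj_adj[OF M_bounded[OF S]])
  then show ?thesis by (simp add: power2_eq_iff_nonneg)
qed

text \<open>Continuity at zero confines the trace to the unit disc on a basic neighbourhood;
  homogeneity converts this into a bound by finitely many functionals.\<close>

lemma \<tau>_ultraweak_bound:
  "\<exists>F C. finite F \<and> C \<ge> 0 \<and> (\<forall>(\<xi>,\<zeta>)\<in>F. square_summable \<xi> \<and> square_summable \<zeta>) \<and>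
    (\<forall>T\<in>M. cmod (\<tau> T) \<le> C * (\<Sum>(\<xi>,\<zeta>)\<in>F. cmod (ultraweak_functional \<xi> \<zeta> T)))"
proof -
  have "openin (subtopology ultraweak_topology M) {T \<in> topspace (subtopology ultraweak_topology M). \<tau> T \<in> ball 0 1}"
    by (rule openin_continuous_map_preimage[OF \<tau>_normal]) simp
  then obtain U where U: "openin ultraweak_topology U"
    "{T \<in> topspace (subtopology ultraweak_topology M). \<tau> T \<in> ball 0 1} = U \<inter> M"
    unfolding openin_subtopology by blast
  have "(\<lambda>x::'a. 0::'a) \<in> topspace ultraweak_topology"
  proof -
    have "{T::'a \<Rightarrow> 'a. bounded_clinear T} \<in> {{T. bounded_clinear T \<and> suminf (\<lambda>n. cinner (T (\<xi> n)) (\<zeta> n)) \<in> W} | \<xi> \<zeta> W.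
        summable (\<lambda>n. (norm (\<xi> n))\<^sup>2) \<and> summable (\<lambda>n. (norm (\<zeta> n))\<^sup>2) \<and> open W}"
      by (intro CollectI exI[of _ "\<lambda>_. 0"] exI[of _ UNIV]) auto
    then show ?thesis using M_bounded[OF M_zero]
      unfolding ultraweak_topology_def topology_generated_by_topspace by blast
  qed
  then have "(\<lambda>x. 0) \<in> {T \<in> topspace (subtopology ultraweak_topology M). \<tau> T \<in> ball 0 1}"
    by (simp add: topspace_subtopology M_zero \<tau>_zero)
  then have "(\<lambda>x. 0) \<in> U" unfolding U(2) by (rule IntD1)
  from ultraweak_open_basic[OF U(1) this] obtain F \<epsilon> where F: "finite F" "\<epsilon> > 0"
    "\<forall>(\<xi>,\<zeta>)\<in>F. square_summable \<xi> \<and> square_summable \<zeta>"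
    "\<forall>T. bounded_clinear T \<longrightarrow> (\<forall>(\<xi>,\<zeta>)\<in>F. cmod (ultraweak_functional \<xi> \<zeta> T - ultraweak_functional \<xi> \<zeta> (\<lambda>x. 0)) < \<epsilon>)
      \<longrightarrow> T \<in> U" by (elim exE conjE)
  have uf0: "ultraweak_functional \<xi> \<zeta> (\<lambda>x. 0) = 0" for \<xi> \<zeta> :: "nat \<Rightarrow> 'a"
    by (simp add: ultraweak_functional_def)
  have "cmod (\<tau> T) \<le> 1 / \<epsilon> * (\<Sum>(\<xi>,\<zeta>)\<in>F. cmod (ultraweak_functional \<xi> \<zeta> T))" if T: "T \<in> M" for T
  proof (rule field_le_epsilon)
    fix d :: real assume d: "d > 0"
    \<comment> \<open>The slack keeps \<open>s\<close> positive even if all the functionals vanish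
      at \<open>T\<close>, so that rescaling by \<open>\<epsilon> / s\<close> makes sense; it is
      removed by letting \<open>d\<close> tend to zero.\<close>
    define s where "s = (\<Sum>(\<xi>,\<zeta>)\<in>F. cmod (ultraweak_functional \<xi> \<zeta> T)) + \<epsilon> * d"
    have s0: "(\<Sum>(\<xi>,\<zeta>)\<in>F. cmod (ultraweak_functional \<xi> \<zeta> T)) \<ge> 0" by (rule sum_nonneg) auto
    have ed: "\<epsilon> * d > 0" using F(2) d by simp
    have s: "s > 0" using s0 ed by (simp add: s_def)
    define c where "c = complex_of_real (\<epsilon> / s)"
    have cT: "(\<lambda>x. c *\<^sub>C T x) \<in> M" by (rule M_scale[OF T])
    have "\<forall>(\<xi>,\<zeta>)\<in>F. cmod (ultraweak_functional \<xi> \<zeta> (\<lambda>x. c *\<^sub>C T x) - ultraweak_functional \<xi> \<zeta> (\<lambda>x. 0)) < \<epsilon>"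
    proof (rule ballI)
      fix p assume p: "p \<in> F"
      obtain \<xi> \<zeta> where p': "p = (\<xi>, \<zeta>)" by (cases p)
      have ss: "square_summable \<xi>" "square_summable \<zeta>" using F(3) p p' by auto
      have "cmod (ultraweak_functional \<xi> \<zeta> T) \<le> (\<Sum>(\<xi>,\<zeta>)\<in>F. cmod (ultraweak_functional \<xi> \<zeta> T))"
        using member_le_sum[OF p, of "\<lambda>(\<xi>,\<zeta>). cmod (ultraweak_functional \<xi> \<zeta> T)"] F(1) by (simp add: p' split_beta)
      then have "cmod (ultraweak_functional \<xi> \<zeta> T) < s" using ed by (simp add: s_def)
      then have "(\<epsilon> / s) * cmod (ultraweak_functional \<xi> \<zeta> T) < (\<epsilon> / s) * s"
        using F(2) s by (intro mult_strict_left_mono) auto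
      then have "cmod (c * ultraweak_functional \<xi> \<zeta> T) < \<epsilon>"
        using s F(2) by (simp add: norm_mult c_def norm_divide)
      then show "case p of (\<xi>,\<zeta>) \<Rightarrow> cmod (ultraweak_functional \<xi> \<zeta> (\<lambda>x. c *\<^sub>C T x) - ultraweak_functional \<xi> \<zeta> (\<lambda>x. 0)) < \<epsilon>"
        by (simp add: p' uf0 ultraweak_functional_scale[OF M_bounded[OF T] ss])
    qed
    from F(4)[THEN spec, THEN mp, THEN mp, OF M_bounded[OF cT] this]
    have "(\<lambda>x. c *\<^sub>C T x) \<in> U \<inter> M" using cT by (rule IntI)
    then have "cmod (\<tau> (\<lambda>x. c *\<^sub>C T x)) < 1" unfolding U(2)[symmetric] by simp
    then have "(\<epsilon> / s) * cmod (\<tau> T) < 1" using s F(2) by (simp add: \<tau>_scale[OF T] norm_mult c_def norm_divide)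
    then have "cmod (\<tau> T) < s / \<epsilon>" using s F(2) by (simp add: field_simps)
    also have "s / \<epsilon> = 1 / \<epsilon> * (\<Sum>(\<xi>,\<zeta>)\<in>F. cmod (ultraweak_functional \<xi> \<zeta> T)) + d"
      using F(2) by (simp add: s_def add_divide_distrib)
    finally show "cmod (\<tau> T) \<le> 1 / \<epsilon> * (\<Sum>(\<xi>,\<zeta>)\<in>F. cmod (ultraweak_functional \<xi> \<zeta> T)) + d" by simp
  qed
  moreover have "1 / \<epsilon> \<ge> 0" using F(2) by simp
  ultimately show ?thesis using F(1,3) by blast
qed

text \<open>On \<open>adj T \<circ> T\<close> each functional becomes a sum of inner products of
  image vectors of \<open>T\<close>, hence is bounded by sums of squares. The resulting ultrastrong
  seminorm is exactly what the bicommutant approximation makes small.\<close>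

lemma norm_\<eta>_ultrastrong_bound:
  "\<exists>\<Xi> C. C \<ge> 0 \<and> square_summable \<Xi> \<and> (\<forall>T\<in>M. (norm (\<eta> T))\<^sup>2 \<le> C * suminf (\<lambda>n. (norm (T (\<Xi> n)))\<^sup>2))"
proof -
  obtain F C where F: "finite F" "C \<ge> 0" "\<forall>(\<xi>,\<zeta>)\<in>F. square_summable \<xi> \<and> square_summable \<zeta>"
    "\<And>T. T \<in> M \<Longrightarrow> cmod (\<tau> T) \<le> C * (\<Sum>(\<xi>,\<zeta>)\<in>F. cmod (ultraweak_functional \<xi> \<zeta> T))"
    using \<tau>_ultraweak_bound by meson
  have ssF: "square_summable \<xi>" if "\<xi> \<in> fst ` F \<union> snd ` F" for \<xi> using F(3) that by auto
  have finF: "finite (fst ` F \<union> snd ` F)" using F(1) by simp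
  have "\<exists>\<Xi>. square_summable \<Xi> \<and> (\<forall>T::'a \<Rightarrow> 'a. bounded_clinear T \<longrightarrow>
      (\<Sum>\<xi>\<in>fst ` F \<union> snd ` F. suminf (\<lambda>n. (norm (T (\<xi> n)))\<^sup>2)) \<le> suminf (\<lambda>n. (norm (T (\<Xi> n)))\<^sup>2))"
    by (rule interleave_square_summable[OF finF ssF])
  then obtain \<Xi> where \<Xi>: "square_summable \<Xi>"
    "\<forall>T::'a \<Rightarrow> 'a. bounded_clinear T \<longrightarrow>
      (\<Sum>\<xi>\<in>fst ` F \<union> snd ` F. suminf (\<lambda>n. (norm (T (\<xi> n)))\<^sup>2)) \<le> suminf (\<lambda>n. (norm (T (\<Xi> n)))\<^sup>2)"
    by (elim exE conjE)
  define N where "N T \<xi> = suminf (\<lambda>n. (norm (T (\<xi> n)))\<^sup>2)" for T :: "'a \<Rightarrow> 'a" and \<xi> :: "nat \<Rightarrow> 'a"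
  \<comment> \<open>Each of the \<open>card F\<close> pairs contributes two sequences, and each of
    them is dominated by the interleaved one; hence the factor 2.\<close>
  have "(norm (\<eta> T))\<^sup>2 \<le> (C * (2 * real (card F))) * N T \<Xi>" if T: "T \<in> M" for T
  proof -
    have bT: "bounded_clinear T" by (rule M_bounded[OF T])
    have TT: "adj T \<circ> T \<in> M" by (intro M_comp M_adj T)
    have NX: "N T \<xi> \<le> N T \<Xi>" if "\<xi> \<in> fst ` F \<union> snd ` F" for \<xi>
    proof -
      have "N T \<xi> \<le> (\<Sum>\<xi>\<in>fst ` F \<union> snd ` F. N T \<xi>)"
      proof (rule member_le_sum[OF that])
        fix \<xi>' assume "\<xi>' \<in> (fst ` F \<union> snd ` F) - {\<xi>}"
        then have "square_summable \<xi>'" using F(3) by auto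
        from square_summable_image[OF bT this] show "0 \<le> N T \<xi>'"
          unfolding N_def square_summable_def by (intro suminf_nonneg) auto
      qed (use F(1) in simp)
      then show ?thesis using \<Xi>(2)[rule_format, OF bT] unfolding N_def by linarith
    qed
    have each: "cmod (ultraweak_functional \<xi> \<zeta> (adj T \<circ> T)) \<le> 2 * N T \<Xi>" if p: "(\<xi>,\<zeta>) \<in> F" for \<xi> \<zeta>
    proof -
      have ss: "square_summable \<xi>" "square_summable \<zeta>" using F(3) p by auto
      have s1: "summable (\<lambda>n. (norm (T (\<xi> n)))\<^sup>2)" "summable (\<lambda>n. (norm (T (\<zeta> n)))\<^sup>2)"
        using square_summable_image[OF bT ss(1)] square_summable_image[OF bT ss(2)] by (auto simp: square_summable_def)
      have "ultraweak_functional \<xi> \<zeta> (adj T \<circ> T) = suminf (\<lambda>n. cinner (T (\<xi> n)) (T (\<zeta> n)))"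
        unfolding ultraweak_functional_def by (simp add: cinner_adj'[OF bT])
      also have "cmod \<dots> \<le> suminf (\<lambda>n. (norm (T (\<xi> n)))\<^sup>2 + (norm (T (\<zeta> n)))\<^sup>2)"
        by (rule norm_suminf_le[OF norm_cinner_le_squares summable_add[OF s1]])
      also have "\<dots> = N T \<xi> + N T \<zeta>" unfolding N_def by (rule suminf_add[OF s1, symmetric])
      also have "\<dots> \<le> 2 * N T \<Xi>" using NX[of \<xi>] NX[of \<zeta>] p by (force simp: image_iff)
      finally show ?thesis .
    qed
    have "(norm (\<eta> T))\<^sup>2 \<le> cmod (\<tau> (adj T \<circ> T))" unfolding norm_\<eta>[OF T] by (rule complex_Re_le_cmod)
    also have "\<dots> \<le> C * (\<Sum>(\<xi>,\<zeta>)\<in>F. cmod (ultraweak_functional \<xi> \<zeta> (adj T \<circ> T)))" by (rule F(4)[OF TT])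
    also have "\<dots> \<le> C * (\<Sum>p\<in>F. 2 * N T \<Xi>)"
      by (intro mult_left_mono[OF _ F(2)] sum_mono) (use each in auto)
    also have "\<dots> = (C * (2 * real (card F))) * N T \<Xi>" by simp
    finally show ?thesis .
  qed
  moreover have "C * (2 * real (card F)) \<ge> 0" using F(2) by simp
  ultimately show ?thesis using \<Xi>(1) unfolding N_def by blast
qed

text \<open>A first continuity estimate with an uncontrolled constant \<open>K\<close>. Passing to
  high powers of an operator will replace \<open>K\<close> by 1.\<close>

lemma norm_\<eta>_crude_bound: "\<exists>K\<ge>0. \<forall>T\<in>M. \<forall>c\<ge>0. (\<forall>v. norm (T v) \<le> c * norm v) \<longrightarrow> norm (\<eta> T) \<le> K * c"
proof -
  obtain \<Xi> C where C: "C \<ge> 0" "square_summable \<Xi>" "\<And>T. T \<in> M \<Longrightarrow> (norm (\<eta> T))\<^sup>2 \<le> C * suminf (\<lambda>n. (norm (T (\<Xi> n)))\<^sup>2)"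
    using norm_\<eta>_ultrastrong_bound by meson
  define s where "s = suminf (\<lambda>n. (norm (\<Xi> n))\<^sup>2)"
  have sum: "summable (\<lambda>n. (norm (\<Xi> n))\<^sup>2)" using C(2) by (simp add: square_summable_def)
  have s: "s \<ge> 0" unfolding s_def by (rule suminf_nonneg[OF sum]) auto
  have "norm (\<eta> T) \<le> sqrt (C * s) * c" if T: "T \<in> M" "c \<ge> 0" "\<And>v. norm (T v) \<le> c * norm v" for T c
  proof -
    have "suminf (\<lambda>n. (norm (T (\<Xi> n)))\<^sup>2) \<le> suminf (\<lambda>n. c\<^sup>2 * (norm (\<Xi> n))\<^sup>2)"
    proof (rule suminf_le)
      show "(norm (T (\<Xi> n)))\<^sup>2 \<le> c\<^sup>2 * (norm (\<Xi> n))\<^sup>2" for n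
        using power_mono[OF T(3)[of "\<Xi> n"], of 2] by (simp add: power_mult_distrib)
      show "summable (\<lambda>n. (norm (T (\<Xi> n)))\<^sup>2)"
        using square_summable_image[OF M_bounded[OF T(1)] C(2)] by (simp add: square_summable_def)
      show "summable (\<lambda>n. c\<^sup>2 * (norm (\<Xi> n))\<^sup>2)" by (rule summable_mult[OF sum])
    qed
    also have "\<dots> = c\<^sup>2 * s" unfolding s_def by (rule suminf_mult[OF sum])
    finally have "(norm (\<eta> T))\<^sup>2 \<le> C * (c\<^sup>2 * s)"
      using C(3)[OF T(1)] C(1) by (meson mult_left_mono order_trans)
    also have "\<dots> = (sqrt (C * s) * c)\<^sup>2" using C(1) s by (simp add: power_mult_distrib)
    finally show ?thesis by (rule power2_le_imp_le) (use C(1) s T(2) in simp)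
  qed
  then show ?thesis using C(1) s by (intro exI[of _ "sqrt (C * s)"]) auto
qed

end

section \<open>Left multiplication and bounded completeness\<close>

text \<open>The functions lie in a product of closed discs, compact by Tychonoff. The index type may
  be uncountable, so a cluster point replaces a convergent subsequence, and what it inherits is
  expressed through closed sets.\<close>

lemma cluster_point_exists:
  fixes f :: "nat \<Rightarrow> 'p \<Rightarrow> complex"
  assumes "\<And>n p. cmod (f n p) \<le> b p"
  shows "\<exists>g. (\<forall>p. cmod (g p) \<le> b p) \<and> (\<forall>C. closed C \<longrightarrow> (\<forall>\<^sub>F n in sequentially. f n \<in> C) \<longrightarrow> g \<in> C)"
proof -
  define U where "U = PiE UNIV (\<lambda>p. cball (0::complex) (b p))"
  have fU: "f n \<in> U" for n using assms by (simp add: U_def PiE_iff)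
  have "compactin (product_topology (\<lambda>_. euclidean) UNIV) U"
    unfolding U_def compactin_PiE by simp
  then have "compact U" unfolding euclidean_product_topology by simp
  then have *: "F \<noteq> bot \<Longrightarrow> eventually (\<lambda>x. x \<in> U) F \<Longrightarrow> \<exists>x\<in>U. inf (nhds x) F \<noteq> bot" for F
    unfolding compact_filter by blast
  have "\<exists>x\<in>U. inf (nhds x) (filtermap f sequentially) \<noteq> bot"
    by (rule *) (simp_all add: filtermap_bot_iff eventually_filtermap fU)
  then obtain g where g: "g \<in> U" "inf (nhds g) (filtermap f sequentially) \<noteq> bot" by (rule bexE)
  have "g \<in> C" if C: "closed C" "\<forall>\<^sub>F n in sequentially. f n \<in> C" for C
  proof (rule ccontr)
    assume "g \<notin> C"
    then have "eventually (\<lambda>h. h \<in> - C) (nhds g)"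
      using C(1) by (intro eventually_nhds_in_open) auto
    moreover have "eventually (\<lambda>h. h \<in> C) (filtermap f sequentially)"
      using C(2) by (simp add: eventually_filtermap)
    ultimately have "eventually (\<lambda>h. False) (inf (nhds g) (filtermap f sequentially))"
      unfolding eventually_inf by (intro exI[of _ "\<lambda>h. h \<in> - C"] exI[of _ "\<lambda>h. h \<in> C"]) simp
    then show False using g(2) by (simp add: trivial_limit_def)
  qed
  moreover have "cmod (g p) \<le> b p" for p using g(1) by (simp add: U_def PiE_iff)
  ultimately show ?thesis by (intro exI[of _ g]) simp
qed

context tracial_algebra begin

text \<open>The norm estimate follows from Cauchy-Schwarz applied to the iterated squares of \<open>X\<close>, because
  the crude bound only contributes a factor whose \<open>2^k\<close>-th root tends to \<open>1\<close>.\<close>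

lemma norm_\<eta>_selfadjoint_mult_le:
  assumes X: "X \<in> M" "adj X = X" and T: "T \<in> M" and c: "c \<ge> 0" "\<And>v. norm (X v) \<le> c * norm v"
  shows "norm (\<eta> (X \<circ> T)) \<le> c * norm (\<eta> T)"
proof -
  obtain K where K: "K \<ge> 0" "\<forall>T\<in>M. \<forall>c\<ge>0. (\<forall>v. norm (T v) \<le> c * norm v) \<longrightarrow> norm (\<eta> T) \<le> K * c"
    using norm_\<eta>_crude_bound by (elim exE conjE)
  obtain t where t: "t > 0" "\<forall>v. norm (T v) \<le> t * norm v"
    using bounded_clinear_bound[OF M_bounded[OF T]] by (elim exE conjE)
  define n where "n = norm (\<eta> T)"
  define g where "g X = norm (\<eta> (X \<circ> T))" for X
  have n0: "n \<ge> 0" by (simp add: n_def)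
  \<comment> \<open>One factor \<open>X\<close> is moved across the inner product, giving the
    pairing of X X T with T, to which Cauchy-Schwarz applies.\<close>
  have step: "(g X)\<^sup>2 \<le> g (X \<circ> X) * n" if X: "X \<in> M" "adj X = X" for X
  proof -
    have XT: "X \<circ> T \<in> M" "(X \<circ> X) \<circ> T \<in> M" using X(1) T by (simp_all add: M_comp)
    have "(g X)\<^sup>2 = Re (\<tau> (adj (X \<circ> T) \<circ> (X \<circ> T)))" unfolding g_def by (rule norm_\<eta>[OF XT(1)])
    also have "adj (X \<circ> T) \<circ> (X \<circ> T) = adj T \<circ> ((X \<circ> X) \<circ> T)"
      by (simp add: adj_comp[OF M_bounded[OF X(1)] M_bounded[OF T]] X(2) comp_assoc)
    also have "\<tau> \<dots> = cinner (\<eta> ((X \<circ> X) \<circ> T)) (\<eta> T)" by (rule cinner_\<eta>[OF XT(2) T, symmetric])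
    also have "Re \<dots> \<le> g (X \<circ> X) * n"
      unfolding g_def n_def using complex_Re_le_cmod norm_cinner_le by (rule order_trans)
    finally show ?thesis .
  qed
  \<comment> \<open>Each step replaces \<open>X\<close> by its square and \<open>c\<close> by its
    square, so the induction runs over all \<open>X\<close> and \<open>c\<close>. The extra factor
    \<open>n\<close> on the left is what \<open>step\<close> consumes.\<close>
  have iter: "n * g X ^ (2^k) \<le> K * t * (c * n) ^ (2^k)"
    if "X \<in> M" "adj X = X" "c \<ge> 0" "\<And>v. norm (X v) \<le> c * norm v" for X c k
    using that
  proof (induction k arbitrary: X c)
    case 0
    have "norm ((X \<circ> T) v) \<le> (c * t) * norm v" for v
    proof -
      have "norm ((X \<circ> T) v) \<le> c * norm (T v)" using 0(4)[of "T v"] by simp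
      also have "\<dots> \<le> c * (t * norm v)" using t(2) 0(3) by (intro mult_left_mono) auto
      finally show ?thesis by simp
    qed
    then have "g X \<le> K * (c * t)"
      unfolding g_def using K(2)[rule_format, OF M_comp[OF 0(1) T], of "c * t"] 0(3) t(1) by simp
    from mult_left_mono[OF this n0] show ?case by (simp add: mult_ac)
  next
    case (Suc k)
    have XX: "X \<circ> X \<in> M" "adj (X \<circ> X) = X \<circ> X"
      using Suc.prems by (simp_all add: M_comp adj_comp M_bounded)
    have bXX: "norm ((X \<circ> X) v) \<le> c\<^sup>2 * norm v" for v
    proof -
      have "norm ((X \<circ> X) v) \<le> c * norm (X v)" using Suc.prems(4)[of "X v"] by simp
      also have "\<dots> \<le> c * (c * norm v)" using Suc.prems(3,4) by (intro mult_left_mono) auto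
      finally show ?thesis by (simp add: power2_eq_square)
    qed
    have "n * g X ^ (2 ^ Suc k) = n * ((g X)\<^sup>2) ^ (2^k)" by (simp add: power_mult[symmetric])
    also have "\<dots> \<le> n * (g (X \<circ> X) * n) ^ (2^k)"
      using step[OF Suc.prems(1,2)] n0 by (intro mult_left_mono power_mono) auto
    also have "\<dots> = (n * g (X \<circ> X) ^ (2^k)) * n ^ (2^k)" by (simp add: power_mult_distrib)
    also have "\<dots> \<le> (K * t * (c\<^sup>2 * n) ^ (2^k)) * n ^ (2^k)"
      by (intro mult_right_mono Suc.IH XX bXX) (simp_all add: n0)
    also have "\<dots> = K * t * ((c\<^sup>2 * n) * n) ^ (2^k)" by (simp add: power_mult_distrib)
    also have "(c\<^sup>2 * n) * n = (c * n)\<^sup>2" by (simp add: power2_eq_square)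
    also have "((c * n)\<^sup>2) ^ (2^k) = (c * n) ^ (2 ^ Suc k)" by (simp add: power_mult[symmetric])
    finally show ?case .
  qed
  \<comment> \<open>Taking \<open>d\<close> strictly above \<open>c\<close> makes
    \<open>d * n\<close> positive even for c = 0. If the claim failed, the 2^k-th powers would grow
    beyond the fixed factor \<open>K * t\<close>.\<close>
  have lim: "g X \<le> d * n" if d: "d > c" for d
  proof (cases "n = 0")
    case True
    then have "(g X)\<^sup>2 \<le> 0" using step[OF X] by simp
    then show ?thesis using True by simp
  next
    case False
    then have n: "n > 0" using n0 by simp
    have d0: "d > 0" using d c(1) by simp
    show ?thesis
    proof (rule ccontr)
      assume "\<not> g X \<le> d * n"
      then have gd: "g X > d * n" by simp
      define r where "r = g X / (d * n)"
      have r: "r > 1" using gd d0 n by (simp add: r_def)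
      obtain k where k: "K * t / n < r ^ k" using real_arch_pow[OF r] by (rule exE)
      have "K * t / n < r ^ (2^k)"
        using k power_increasing[OF less_imp_le[OF less_exp[of k]] less_imp_le[OF r]] by linarith
      then have "K * t * (d * n) ^ (2^k) < n * g X ^ (2^k)"
        using n d0 by (simp add: r_def power_divide field_simps)
      moreover have "n * g X ^ (2^k) \<le> K * t * (d * n) ^ (2^k)"
      proof (rule iter[OF X])
        show "0 \<le> d" using d0 by simp
        show "norm (X v) \<le> d * norm v" for v
          using c(2)[of v] d mult_right_mono[of c d "norm v"] by simp
      qed
      ultimately show False by simp
    qed
  qed
  have "g X \<le> c * n"
  proof (rule field_le_epsilon)
    fix e :: real assume e: "e > 0"
    define d where "d = c + e / (n + 1)"
    have "d > c" using e n0 by (simp add: d_def)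
    from lim[OF this] have "g X \<le> d * n" .
    also have "\<dots> = c * n + e * (n / (n + 1))" by (simp add: d_def distrib_right)
    also have "e * (n / (n + 1)) \<le> e * 1" using e n0 by (intro mult_left_mono) auto
    finally show "g X \<le> c * n + e" by simp
  qed
  then show ?thesis by (simp add: g_def n_def)
qed

text \<open>As in the C*-identity, the squared norm is governed by the self-adjoint operator
  \<open>adj S \<circ> S\<close> with bound c^2.\<close>

lemma norm_\<eta>_mult_le:
  assumes S: "S \<in> M" and T: "T \<in> M" and c: "c \<ge> 0" "\<And>v. norm (S v) \<le> c * norm v"
  shows "norm (\<eta> (S \<circ> T)) \<le> c * norm (\<eta> T)"
proof -
  have SS: "adj S \<circ> S \<in> M" "adj (adj S \<circ> S) = adj S \<circ> S"
    using S by (simp_all add: M_comp M_adj adj_comp M_bounded bounded_clinear_adj adj_adj)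
  have b: "norm ((adj S \<circ> S) v) \<le> c\<^sup>2 * norm v" for v
  proof -
    have "norm ((adj S \<circ> S) v) \<le> c * norm (S v)"
      using adj_bound[OF M_bounded[OF S] c(2), of "S v"] by simp
    also have "\<dots> \<le> c * (c * norm v)" using c by (intro mult_left_mono) auto
    finally show ?thesis by (simp add: power2_eq_square)
  qed
  have ST: "S \<circ> T \<in> M" "(adj S \<circ> S) \<circ> T \<in> M" using S T by (simp_all add: M_comp M_adj)
  have "(norm (\<eta> (S \<circ> T)))\<^sup>2 = Re (\<tau> (adj (S \<circ> T) \<circ> (S \<circ> T)))" by (rule norm_\<eta>[OF ST(1)])
  also have "adj (S \<circ> T) \<circ> (S \<circ> T) = adj T \<circ> ((adj S \<circ> S) \<circ> T)"
    by (simp add: adj_comp[OF M_bounded[OF S] M_bounded[OF T]] comp_assoc)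
  also have "\<tau> \<dots> = cinner (\<eta> ((adj S \<circ> S) \<circ> T)) (\<eta> T)" by (rule cinner_\<eta>[OF ST(2) T, symmetric])
  also have "Re \<dots> \<le> norm (\<eta> ((adj S \<circ> S) \<circ> T)) * norm (\<eta> T)"
    using complex_Re_le_cmod norm_cinner_le by (rule order_trans)
  also have "\<dots> \<le> (c\<^sup>2 * norm (\<eta> T)) * norm (\<eta> T)"
    by (rule mult_right_mono[OF norm_\<eta>_selfadjoint_mult_le[OF SS T _ b]]) simp_all
  also have "\<dots> = (c * norm (\<eta> T))\<^sup>2" by (simp add: power2_eq_square)
  finally show ?thesis by (rule power2_le_imp_le) (simp add: c(1))
qed

text \<open>The adjoint turns right multiplication into left multiplication and is isometric for the
  trace norm because \<open>\<tau>\<close> is tracial.\<close>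

lemma norm_\<eta>_right_mult_le:
  assumes T: "T \<in> M" and b: "b \<in> M" and c: "c \<ge> 0" "\<And>v. norm (b v) \<le> c * norm v"
  shows "norm (\<eta> (T \<circ> b)) \<le> c * norm (\<eta> T)"
proof -
  have "norm (\<eta> (T \<circ> b)) = norm (\<eta> (adj (T \<circ> b)))" by (rule norm_\<eta>_adj[OF M_comp[OF T b], symmetric])
  also have "adj (T \<circ> b) = adj b \<circ> adj T" by (rule adj_comp[OF M_bounded[OF T] M_bounded[OF b]])
  also have "norm (\<eta> \<dots>) \<le> c * norm (\<eta> (adj T))"
    by (rule norm_\<eta>_mult_le[OF M_adj[OF b] M_adj[OF T] c(1) adj_bound[OF M_bounded[OF b] c(2)]])
  finally show ?thesis by (simp only: norm_\<eta>_adj[OF T])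
qed

lemma norm_\<eta>_id: "norm (\<eta> id) = 1"
proof -
  have "(norm (\<eta> id))\<^sup>2 = 1" using norm_\<eta>[OF M_id] by (simp add: adj_id \<tau>_id)
  then show ?thesis using norm_ge_zero[of "\<eta> id"] by (auto simp: power2_eq_1_iff simp del: norm_ge_zero)
qed

lemma norm_\<eta>_le: "S \<in> M \<Longrightarrow> c \<ge> 0 \<Longrightarrow> (\<And>v. norm (S v) \<le> c * norm v) \<Longrightarrow> norm (\<eta> S) \<le> c"
  using norm_\<eta>_mult_le[OF _ M_id, of S c] by (simp add: norm_\<eta>_id)

section \<open>Left and right multiplication on L2\<close>

abbreviation L :: "('a \<Rightarrow> 'a) \<Rightarrow> 'l \<Rightarrow> 'l" where "L \<equiv> left_mult M \<eta>"

text \<open>An extension is built for every admissible bound \<open>c\<close>. By uniqueness all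
  these extensions are \<open>L S\<close>, so it satisfies each of the bounds.\<close>

lemma left_mult_properties:
  assumes S: "S \<in> M"
  shows "bounded_clinear (L S)" "T \<in> M \<Longrightarrow> L S (\<eta> T) = \<eta> (S \<circ> T)"
    and left_mult_bound: "c \<ge> 0 \<Longrightarrow> (\<And>v. norm (S v) \<le> c * norm v) \<Longrightarrow> norm (L S x) \<le> c * norm x"
proof -
  have ex: "\<exists>F. bounded_clinear F \<and> (\<forall>T\<in>M. F (\<eta> T) = \<eta> (S \<circ> T)) \<and> (\<forall>x. norm (F x) \<le> c * norm x)"
    if c: "c \<ge> 0" "\<And>v. norm (S v) \<le> c * norm v" for c
  proof (rule extend_from_dense[OF \<eta>_dense])
    show "\<exists>k\<in>M. \<eta> k = \<eta> T + \<eta> T' \<and> \<eta> (S \<circ> k) = \<eta> (S \<circ> T) + \<eta> (S \<circ> T')" if T: "T \<in> M" "T' \<in> M" for T T'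
    proof (intro bexI[of _ "\<lambda>x. T x + T' x"] conjI)
      have "S \<circ> (\<lambda>x. T x + T' x) = (\<lambda>x. (S \<circ> T) x + (S \<circ> T') x)"
        by (rule ext) (simp add: bounded_clinear_add[OF M_bounded[OF S]])
      then show "\<eta> (S \<circ> (\<lambda>x. T x + T' x)) = \<eta> (S \<circ> T) + \<eta> (S \<circ> T')"
        using \<eta>_plus[OF M_comp[OF S T(1)] M_comp[OF S T(2)]] by simp
    qed (simp_all add: \<eta>_plus M_plus T)
    show "\<exists>k\<in>M. \<eta> k = a *\<^sub>C \<eta> T \<and> \<eta> (S \<circ> k) = a *\<^sub>C \<eta> (S \<circ> T)" if T: "T \<in> M" for a T
    proof (intro bexI[of _ "\<lambda>x. a *\<^sub>C T x"] conjI)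
      have "S \<circ> (\<lambda>x. a *\<^sub>C T x) = (\<lambda>x. a *\<^sub>C (S \<circ> T) x)"
        by (rule ext) (simp add: bounded_clinear_scaleC[OF M_bounded[OF S]])
      then show "\<eta> (S \<circ> (\<lambda>x. a *\<^sub>C T x)) = a *\<^sub>C \<eta> (S \<circ> T)"
        using \<eta>_scale[OF M_comp[OF S T]] by simp
    qed (simp_all add: \<eta>_scale M_scale T)
    show "norm (\<eta> (S \<circ> T)) \<le> c * norm (\<eta> T)" if T: "T \<in> M" for T
      by (rule norm_\<eta>_mult_le[OF S T c])
  qed
  have uniq: "L S = F" if F: "bounded_clinear F" "\<And>T. T \<in> M \<Longrightarrow> F (\<eta> T) = \<eta> (S \<circ> T)" for F
    unfolding left_mult_def
  proof (rule the_equality)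
    fix G assume G: "bounded_clinear G \<and> (\<forall>T\<in>M. G (\<eta> T) = \<eta> (S \<circ> T))"
    show "G = F"
    proof (rule bounded_clinear_eq_on_dense[OF _ F(1) \<eta>_dense])
      show "bounded_clinear G" using G by (rule conjunct1)
      fix x assume "x \<in> \<eta> ` M"
      then obtain T where "T \<in> M" "x = \<eta> T" by (elim imageE)
      then show "G x = F x" using G F(2)[of T] by simp
    qed
  qed (use F in simp)
  obtain C where C: "C > 0" "\<forall>v. norm (S v) \<le> C * norm v"
    using bounded_clinear_bound[OF M_bounded[OF S]] by (elim exE conjE)
  obtain F where F: "bounded_clinear F \<and> (\<forall>T\<in>M. F (\<eta> T) = \<eta> (S \<circ> T)) \<and> (\<forall>x. norm (F x) \<le> C * norm x)"
    using ex[of C] C by (auto elim: exE)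
  have LF: "L S = F" by (rule uniq) (use F in simp_all)
  show "bounded_clinear (L S)" "T \<in> M \<Longrightarrow> L S (\<eta> T) = \<eta> (S \<circ> T)" using F LF by simp_all
  assume c: "c \<ge> 0" "\<And>v. norm (S v) \<le> c * norm v"
  obtain G where G: "bounded_clinear G \<and> (\<forall>T\<in>M. G (\<eta> T) = \<eta> (S \<circ> T)) \<and> (\<forall>x. norm (G x) \<le> c * norm x)"
    using ex[OF c] by (rule exE)
  have LG: "L S = G" by (rule uniq) (use G in simp_all)
  show "norm (L S x) \<le> c * norm x" using G LG by simp
qed

lemmas L_bounded = left_mult_properties(1)
  and L_\<eta> = left_mult_properties(2)

lemma eq_on_\<eta>:
  assumes "bounded_clinear S" "bounded_clinear T" "\<And>a. a \<in> M \<Longrightarrow> S (\<eta> a) = T (\<eta> a)"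
  shows "S = T"
  by (rule bounded_clinear_eq_on_dense[OF assms(1,2) \<eta>_dense]) (use assms(3) in \<open>auto elim!: imageE\<close>)

lemma L_comp: "S \<in> M \<Longrightarrow> T \<in> M \<Longrightarrow> L (S \<circ> T) = L S \<circ> L T"
  by (rule eq_on_\<eta>) (simp_all add: L_\<eta> L_bounded M_comp bounded_clinear_comp comp_assoc)

lemma L_id: "L id = id"
  by (rule eq_on_\<eta>) (simp_all add: L_\<eta> L_bounded M_id bounded_clinear_id)

lemma L_plus: assumes S: "S \<in> M" and T: "T \<in> M" shows "L (\<lambda>x. S x + T x) = (\<lambda>x. L S x + L T x)"
proof (rule eq_on_\<eta>)
  fix a assume a: "a \<in> M"
  have "(\<lambda>x. S x + T x) \<circ> a = (\<lambda>x. (S \<circ> a) x + (T \<circ> a) x)" by (rule ext) simp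
  then show "L (\<lambda>x. S x + T x) (\<eta> a) = L S (\<eta> a) + L T (\<eta> a)"
    by (simp only: L_\<eta>[OF M_plus[OF S T] a] L_\<eta>[OF S a] L_\<eta>[OF T a] \<eta>_plus[OF M_comp[OF S a] M_comp[OF T a]])
qed (intro L_bounded M_plus bounded_clinear_plus S T)+

lemma L_scale: assumes S: "S \<in> M" shows "L (\<lambda>x. c *\<^sub>C S x) = (\<lambda>x. c *\<^sub>C L S x)"
proof (rule eq_on_\<eta>)
  fix a assume a: "a \<in> M"
  have "(\<lambda>x. c *\<^sub>C S x) \<circ> a = (\<lambda>x. c *\<^sub>C (S \<circ> a) x)" by (rule ext) simp
  then show "L (\<lambda>x. c *\<^sub>C S x) (\<eta> a) = c *\<^sub>C L S (\<eta> a)"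
    by (simp only: L_\<eta>[OF M_scale[OF S] a] L_\<eta>[OF S a] \<eta>_scale[OF M_comp[OF S a]])
qed (intro L_bounded M_scale bounded_clinear_scale S)+

lemma L_inj: assumes "S \<in> M" "T \<in> M" "L S = L T" shows "S = T"
proof (rule \<eta>_inj[OF assms(1,2)])
  have "L S (\<eta> id) = L T (\<eta> id)" using assms(3) by simp
  then show "\<eta> S = \<eta> T" using assms(1,2) by (simp add: L_\<eta> M_id)
qed

lemma L_adj: assumes S: "S \<in> M" shows "L (adj S) = adj (L S)"
proof -
  have bS: "bounded_clinear S" by (rule M_bounded[OF S])
  have *: "cinner (L (adj S) (\<eta> a)) (\<eta> b) = cinner (\<eta> a) (L S (\<eta> b))" if ab: "a \<in> M" "b \<in> M" for a b
  proof -
    have "adj (S \<circ> b) \<circ> a = adj b \<circ> (adj S \<circ> a)"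
      by (simp add: adj_comp[OF bS M_bounded[OF ab(2)]] comp_assoc)
    then show ?thesis
      by (simp add: L_\<eta> S M_adj ab cinner_\<eta> M_comp)
  qed
  show ?thesis
  proof (rule eq_on_\<eta>)
    fix a assume a: "a \<in> M"
    have "cinner (\<eta> b) (L (adj S) (\<eta> a) - adj (L S) (\<eta> a)) = 0" if b: "b \<in> M" for b
    proof -
      have "cinner (adj (L S) (\<eta> a)) (\<eta> b) = cinner (\<eta> a) (L S (\<eta> b))"
        by (rule cinner_adj'[OF L_bounded[OF S], symmetric])
      then have "cinner (L (adj S) (\<eta> a) - adj (L S) (\<eta> a)) (\<eta> b) = 0"
        using *[OF a b] by (simp add: cinner_diff_left)
      then show ?thesis
        using cinner_commute[of "\<eta> b" "L (adj S) (\<eta> a) - adj (L S) (\<eta> a)"] by simp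
    qed
    then have "L (adj S) (\<eta> a) - adj (L S) (\<eta> a) = 0"
      by (intro dense_orthogonal_zero[OF \<eta>_dense]) (auto elim!: imageE)
    then show "L (adj S) (\<eta> a) = adj (L S) (\<eta> a)" by simp
  qed (intro L_bounded M_adj bounded_clinear_adj S)+
qed

text \<open>Right multiplication is continuous in the vector it acts on. It converts a limit of
  vectors \<open>\<eta> (y n)\<close> into a limit of \<open>L (y n)\<close> at a fixed
  \<open>\<eta> T\<close>.\<close>

lemma right_mult_exists:
  assumes b: "b \<in> M"
  shows "\<exists>R. bounded_clinear R \<and> (\<forall>T\<in>M. R (\<eta> T) = \<eta> (T \<circ> b))"
proof -
  obtain C where C: "C > 0" "\<forall>v. norm (b v) \<le> C * norm v"
    using bounded_clinear_bound[OF M_bounded[OF b]] by (elim exE conjE)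
  have "\<exists>F. bounded_clinear F \<and> (\<forall>T\<in>M. F (\<eta> T) = \<eta> (T \<circ> b)) \<and> (\<forall>x. norm (F x) \<le> C * norm x)"
  proof (rule extend_from_dense[OF \<eta>_dense])
    show "\<exists>k\<in>M. \<eta> k = \<eta> T + \<eta> T' \<and> \<eta> (k \<circ> b) = \<eta> (T \<circ> b) + \<eta> (T' \<circ> b)" if T: "T \<in> M" "T' \<in> M" for T T'
    proof (intro bexI[of _ "\<lambda>x. T x + T' x"] conjI)
      have "(\<lambda>x. T x + T' x) \<circ> b = (\<lambda>x. (T \<circ> b) x + (T' \<circ> b) x)" by (rule ext) simp
      then show "\<eta> ((\<lambda>x. T x + T' x) \<circ> b) = \<eta> (T \<circ> b) + \<eta> (T' \<circ> b)"
        using \<eta>_plus[OF M_comp[OF T(1) b] M_comp[OF T(2) b]] by simp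
    qed (simp_all add: \<eta>_plus M_plus T)
    show "\<exists>k\<in>M. \<eta> k = a *\<^sub>C \<eta> T \<and> \<eta> (k \<circ> b) = a *\<^sub>C \<eta> (T \<circ> b)" if T: "T \<in> M" for a T
    proof (intro bexI[of _ "\<lambda>x. a *\<^sub>C T x"] conjI)
      have "(\<lambda>x. a *\<^sub>C T x) \<circ> b = (\<lambda>x. a *\<^sub>C (T \<circ> b) x)" by (rule ext) simp
      then show "\<eta> ((\<lambda>x. a *\<^sub>C T x) \<circ> b) = a *\<^sub>C \<eta> (T \<circ> b)"
        using \<eta>_scale[OF M_comp[OF T b]] by simp
    qed (simp_all add: \<eta>_scale M_scale T)
    show "norm (\<eta> (T \<circ> b)) \<le> C * norm (\<eta> T)" if T: "T \<in> M" for T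
      by (rule norm_\<eta>_right_mult_le[OF T b]) (use C in simp_all)
  qed
  then show ?thesis by (elim exE conjE) (intro exI conjI)
qed

text \<open>The limit is a cluster point of the sequence in the weak operator topology, and normality
  identifies its image under \<open>\<eta>\<close>.\<close>

theorem bounded_\<eta>_complete:
  assumes y: "\<And>n. y n \<in> M" "\<And>n v. norm (y n v) \<le> c * norm v" "c \<ge> 0"
    and lim: "(\<lambda>n. \<eta> (y n)) \<longlonglongrightarrow> w"
  shows "\<exists>z\<in>M. \<eta> z = w"
proof -
  define f where "f n p = cinner (y n (fst p)) (snd p)" for n and p :: "'a \<times> 'a"
  define b where "b p = c * norm (fst p) * norm (snd p)" for p :: "'a \<times> 'a"
  have by': "bounded_clinear (y n)" for n by (rule M_bounded[OF y(1)])
  have fb: "cmod (f n p) \<le> b p" for n p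
    unfolding f_def b_def by (rule order_trans[OF norm_cinner_le mult_right_mono[OF y(2)]]) simp
  obtain g where g: "\<forall>p. cmod (g p) \<le> b p"
    "\<forall>C. closed C \<longrightarrow> (\<forall>\<^sub>F n in sequentially. f n \<in> C) \<longrightarrow> g \<in> C"
    using cluster_point_exists[of f b, OF fb] by (elim exE conjE)
  have gC: "g \<in> C" if "closed C" "\<And>n. f n \<in> C" for C
    using g(2) that by simp
  have coord: "continuous_on UNIV (\<lambda>h::'a \<times> 'a \<Rightarrow> complex. h p)" for p by simp
  \<comment> \<open>Each linearity identity involves finitely many coordinates and is therefore a
    closed condition in the product topology, inherited by the cluster point.\<close>
  have "g \<in> {h. h (u + v, x) = h (u, x) + h (v, x)}" for u v x
    by (rule gC) (auto intro!: closed_Collect_eq continuous_intros coord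
        simp: f_def bounded_clinear_add[OF by'] cinner_add_left)
  then have g1: "g (u + v, x) = g (u, x) + g (v, x)" for u v x by simp
  have "g \<in> {h. h (k *\<^sub>C u, x) = k * h (u, x)}" for k u x
    by (rule gC) (auto intro!: closed_Collect_eq continuous_intros coord
        simp: f_def bounded_clinear_scaleC[OF by'] cinner_scaleC_left)
  then have g2: "g (k *\<^sub>C u, x) = k * g (u, x)" for k u x by simp
  have "g \<in> {h. h (x, u + v) = h (x, u) + h (x, v)}" for u v x
    by (rule gC) (auto intro!: closed_Collect_eq continuous_intros coord
        simp: f_def cinner_add_right)
  then have g3: "g (x, u + v) = g (x, u) + g (x, v)" for u v x by simp
  have "g \<in> {h. h (x, k *\<^sub>C u) = cnj k * h (x, u)}" for k u x
    by (rule gC) (auto intro!: closed_Collect_eq continuous_intros coord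
        simp: f_def cinner_scaleC_right)
  then have g4: "g (x, k *\<^sub>C u) = cnj k * g (x, u)" for k u x by simp
  have "\<exists>T. bounded_clinear T \<and> (\<forall>u v. g (u, v) = cinner (T u) v)"
  proof (rule sesquilinear_form_operator[of "\<lambda>u v. g (u, v)" c])
    show "cmod (g (u, v)) \<le> c * norm u * norm v" for u v using g(1)[rule_format, of "(u, v)"] by (simp add: b_def)
  qed (rule g1 g2 g3 g4)+
  then obtain z where z: "bounded_clinear z" "\<forall>u v. g (u, v) = cinner (z u) v" by (elim exE conjE)
  have zM: "z \<in> M"
  proof (rule M_bicommutant[OF z(1)])
    fix S assume S: "S \<in> commutant M"
    have bS: "bounded_clinear S" using S by (simp add: commutant_def)
    have "y n \<circ> S = S \<circ> y n" for n using S y(1)[of n] by (simp add: commutant_def)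
    from fun_cong[OF this] have comm: "y n (S u) = S (y n u)" for n u by simp
    \<comment> \<open>Moving the commutant element to the second slot as \<open>adj S\<close> turns
      commutation into an equation between two coordinates, again a closed condition.\<close>
    have "g \<in> {h. h (S u, v) = h (u, adj S v)}" for u v
      by (rule gC) (auto intro!: closed_Collect_eq coord simp: f_def comm cinner_adj[OF bS])
    then have "cinner (z (S u)) v = cinner (S (z u)) v" for u v
      using z(2) by (simp add: cinner_adj[OF bS])
    then have "z (S u) = S (z u)" for u by (rule cinner_ext)
    then show "z \<circ> S = S \<circ> z" by (simp add: fun_eq_iff)
  qed
  obtain F C where F: "finite F" "C \<ge> 0" "\<forall>(\<xi>,\<zeta>)\<in>F. square_summable \<xi> \<and> square_summable \<zeta>"
    "\<forall>T\<in>M. cmod (\<tau> T) \<le> C * (\<Sum>(\<xi>,\<zeta>)\<in>F. cmod (ultraweak_functional \<xi> \<zeta> T))"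
    using \<tau>_ultraweak_bound by (elim exE conjE)
  have "cinner (\<eta> a) (w - \<eta> z) = 0" if a: "a \<in> M" for a
  proof (rule ccontr)
    assume "cinner (\<eta> a) (w - \<eta> z) \<noteq> 0"
    then have "cinner (w - \<eta> z) (\<eta> a) \<noteq> 0"
      using cinner_commute[of "\<eta> a" "w - \<eta> z"] by auto
    then have d: "cmod (cinner (w - \<eta> z) (\<eta> a)) > 0" by simp
    define d where "d = cmod (cinner (w - \<eta> z) (\<eta> a)) / 2"
    have d0: "d > 0" using d by (simp add: d_def)
    have ba: "bounded_clinear a" by (rule M_bounded[OF a])
    define U where "U = {h :: 'a \<times> 'a \<Rightarrow> complex. \<forall>p. cmod (h p) \<le> b p}"
    have clU: "closed U" unfolding U_def
      by (intro closed_Collect_all closed_Collect_le continuous_intros coord)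
    define \<Phi> where "\<Phi> \<xi> \<zeta> h = suminf (\<lambda>m. h (\<xi> m, a (\<zeta> m)))" for \<xi> \<zeta> :: "nat \<Rightarrow> 'a" and h :: "'a \<times> 'a \<Rightarrow> complex"
    have sb: "summable (\<lambda>m. b (\<xi> m, a (\<zeta> m)))" if "square_summable \<xi>" "square_summable \<zeta>" for \<xi> \<zeta>
    proof (rule summable_comparison_test'[where N = 0 and g = "\<lambda>m. c * ((norm (\<xi> m))\<^sup>2 + (norm (a (\<zeta> m)))\<^sup>2)"])
      show "summable (\<lambda>m. c * ((norm (\<xi> m))\<^sup>2 + (norm (a (\<zeta> m)))\<^sup>2))"
        using that(1) square_summable_image[OF ba that(2)] unfolding square_summable_def
        by (intro summable_mult summable_add)
      fix m
      have "norm (\<xi> m) * norm (a (\<zeta> m)) \<le> (norm (\<xi> m))\<^sup>2 + (norm (a (\<zeta> m)))\<^sup>2"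
        using sum_squares_bound[of "norm (\<xi> m)" "norm (a (\<zeta> m))"]
          mult_nonneg_nonneg[OF norm_ge_zero[of "\<xi> m"] norm_ge_zero[of "a (\<zeta> m)"]] by linarith
      then show "norm (b (\<xi> m, a (\<zeta> m))) \<le> c * ((norm (\<xi> m))\<^sup>2 + (norm (a (\<zeta> m)))\<^sup>2)"
        using y(3) by (simp add: b_def mult_left_mono mult.assoc abs_mult)
    qed
    \<comment> \<open>The functional involves infinitely many coordinates. On the bounded set
      \<open>U\<close> its partial sums converge uniformly by the Weierstrass test, so it is
      continuous there.\<close>
    have cont: "continuous_on U (\<Phi> \<xi> \<zeta>)" if ss: "square_summable \<xi>" "square_summable \<zeta>" for \<xi> \<zeta>
    proof (rule uniform_limit_theorem)
      show "uniform_limit U (\<lambda>N h. \<Sum>m<N. h (\<xi> m, a (\<zeta> m))) (\<Phi> \<xi> \<zeta>) sequentially"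
        unfolding \<Phi>_def[abs_def]
      proof (rule Weierstrass_m_test[where M = "\<lambda>m. b (\<xi> m, a (\<zeta> m))"])
        show "cmod (h (\<xi> n, a (\<zeta> n))) \<le> b (\<xi> n, a (\<zeta> n))" if "h \<in> U" for n h using that by (simp add: U_def)
      qed (rule sb[OF ss])
      show "\<forall>\<^sub>F N in sequentially. continuous_on U (\<lambda>h. \<Sum>m<N. h (\<xi> m, a (\<zeta> m)))"
        by (intro always_eventually allI continuous_on_sum continuous_on_subset[OF coord]) simp
    qed simp
    have uf: "ultraweak_functional \<xi> \<zeta> (adj a \<circ> (\<lambda>x. y n x - z x)) = \<Phi> \<xi> \<zeta> (f n) - \<Phi> \<xi> \<zeta> g"
      if ss: "square_summable \<xi>" "square_summable \<zeta>" for \<xi> \<zeta> n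
    proof -
      have s1: "summable (\<lambda>m. f n (\<xi> m, a (\<zeta> m)))"
        by (rule summable_comparison_test'[where N = 0, OF sb[OF ss]]) (rule fb)
      have s2: "summable (\<lambda>m. g (\<xi> m, a (\<zeta> m)))"
        by (rule summable_comparison_test'[where N = 0, OF sb[OF ss]]) (rule g(1)[rule_format])
      have "cinner ((adj a \<circ> (\<lambda>x. y n x - z x)) (\<xi> m)) (\<zeta> m) = f n (\<xi> m, a (\<zeta> m)) - g (\<xi> m, a (\<zeta> m))" for m
        using z(2) cinner_adj'[OF ba, of "y n (\<xi> m) - z (\<xi> m)" "\<zeta> m"] by (simp add: f_def cinner_diff_left)
      then show ?thesis unfolding ultraweak_functional_def \<Phi>_def
        using suminf_diff[OF s1 s2] by simp
    qed
    \<comment> \<open>At \<open>f n\<close> this dominates the pairing of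
      \<open>\<eta> (y n) - \<eta> z\<close> with \<open>\<eta> a\<close>, and it vanishes at
      \<open>g\<close>. A gap would put \<open>g\<close> into the closed set where it is at least
      \<open>d\<close>.\<close>
    define \<Psi> where "\<Psi> h = C * (\<Sum>p\<in>F. cmod (\<Phi> (fst p) (snd p) h - \<Phi> (fst p) (snd p) g))" for h
    have "continuous_on U \<Psi>" unfolding \<Psi>_def
      using F(3) by (intro continuous_intros cont) (auto simp: split_beta)
    from continuous_closed_preimage[OF this clU, of "{d..}"] have clP: "closed (U \<inter> \<Psi> -` {d..})" by simp
    have "\<forall>\<^sub>F n in sequentially. f n \<in> U \<inter> \<Psi> -` {d..}"
    proof -
      have "(\<lambda>n. cmod (cinner (\<eta> (y n) - \<eta> z) (\<eta> a))) \<longlonglongrightarrow> cmod (cinner (w - \<eta> z) (\<eta> a))"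
        by (intro tendsto_norm tendsto_cinner tendsto_diff tendsto_const lim)
      moreover have "d < cmod (cinner (w - \<eta> z) (\<eta> a))" using d0 by (simp add: d_def)
      ultimately have "\<forall>\<^sub>F n in sequentially. d < cmod (cinner (\<eta> (y n) - \<eta> z) (\<eta> a))"
        by (rule order_tendstoD(1))
      then show ?thesis
      proof (rule eventually_mono)
        fix n assume n: "d < cmod (cinner (\<eta> (y n) - \<eta> z) (\<eta> a))"
        have T: "(\<lambda>x. y n x - z x) \<in> M" by (rule M_diff[OF y(1) zM])
        have "cinner (\<eta> (y n) - \<eta> z) (\<eta> a) = \<tau> (adj a \<circ> (\<lambda>x. y n x - z x))"
          using cinner_\<eta>[OF T a] \<eta>_diff[OF y(1) zM] by simp
        then have "d < cmod (\<tau> (adj a \<circ> (\<lambda>x. y n x - z x)))" using n by simp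
        also have "\<dots> \<le> C * (\<Sum>(\<xi>,\<zeta>)\<in>F. cmod (ultraweak_functional \<xi> \<zeta> (adj a \<circ> (\<lambda>x. y n x - z x))))"
          by (rule F(4)[rule_format, OF M_comp[OF M_adj[OF a] T]])
        also have "(\<Sum>(\<xi>,\<zeta>)\<in>F. cmod (ultraweak_functional \<xi> \<zeta> (adj a \<circ> (\<lambda>x. y n x - z x))))
          = (\<Sum>p\<in>F. cmod (\<Phi> (fst p) (snd p) (f n) - \<Phi> (fst p) (snd p) g))"
          by (rule sum.cong[OF refl]) (use F(3) uf in \<open>auto simp: split_beta\<close>)
        finally have "d \<le> \<Psi> (f n)" by (simp add: \<Psi>_def)
        then show "f n \<in> U \<inter> \<Psi> -` {d..}" using fb by (simp add: U_def)
      qed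
    qed
    from g(2)[rule_format, OF clP this] have "d \<le> \<Psi> g" by simp
    then show False using d0 by (simp add: \<Psi>_def)
  qed
  then have "w - \<eta> z = 0" by (intro dense_orthogonal_zero[OF \<eta>_dense]) (auto elim!: imageE)
  then show ?thesis using zM by (intro bexI[of _ z]) simp_all
qed

end

section \<open>The derivation on the generated algebra\<close>

definition word_operator :: "('n \<Rightarrow> 'a \<Rightarrow> 'a) \<Rightarrow> 'n list \<Rightarrow> 'a \<Rightarrow> 'a" where
  "word_operator Y w = foldr (\<circ>) (map Y w) id"

lemma word_operator_Nil: "word_operator Y [] = id"
  and word_operator_Cons: "word_operator Y (j # w) = Y j \<circ> word_operator Y w"
  by (simp_all add: word_operator_def)

lemma word_operator_append: "word_operator Y (u @ w) = word_operator Y u \<circ> word_operator Y w"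
  by (induction u) (simp_all only: append.simps word_operator_Nil word_operator_Cons comp_assoc id_comp)

text \<open>\<open>weighted Y R p c S\<close>: the operator \<open>S\<close> is a polynomial in \<open>Y\<close> of degree at most \<open>p\<close> whose
  coefficients have \<open>\<ell>\<^sup>1\<close>-norm at most \<open>c\<close>, where a word of length \<open>l\<close> has weight \<open>R ^ l\<close>.\<close>

inductive weighted ::
    "('n \<Rightarrow> 'a::complex_hilbert \<Rightarrow> 'a) \<Rightarrow> real \<Rightarrow> nat \<Rightarrow> real \<Rightarrow> ('a \<Rightarrow> 'a) \<Rightarrow> bool" for Y R where
  word: "weighted Y R (length w) (R ^ length w) (word_operator Y w)"
| plus: "weighted Y R p c S \<Longrightarrow> weighted Y R p d T \<Longrightarrow> weighted Y R p (c + d) (\<lambda>x. S x + T x)"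
| scale: "weighted Y R p c S \<Longrightarrow> weighted Y R p (cmod k * c) (\<lambda>x. k *\<^sub>C S x)"
| mono: "weighted Y R p c S \<Longrightarrow> p \<le> q \<Longrightarrow> c \<le> d \<Longrightarrow> weighted Y R q d S"

definition linear_extension :: "('n list \<Rightarrow> 'a::complex_hilbert \<Rightarrow> 'a) \<Rightarrow> 'n ncpoly \<Rightarrow> 'a \<Rightarrow> 'a" where
  "linear_extension f P = (\<lambda>x. \<Sum>w\<in>Poly_Mapping.keys P. Poly_Mapping.lookup P w *\<^sub>C f w x)"

lemma nc_eval_linear_extension: "nc_eval Y P = linear_extension (word_operator Y) P"
  by (simp add: nc_eval_def linear_extension_def word_operator_def)

lemma linear_extension_superset:
  assumes "finite V" "Poly_Mapping.keys P \<subseteq> V"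
  shows "linear_extension f P x = (\<Sum>w\<in>V. Poly_Mapping.lookup P w *\<^sub>C f w x)"
  unfolding linear_extension_def
  by (rule sum.mono_neutral_left[OF assms]) (simp add: in_keys_iff)

lemma linear_extension_plus:
  "linear_extension f (P + Q) = (\<lambda>x. linear_extension f P x + linear_extension f Q x)"
proof
  fix x
  let ?V = "Poly_Mapping.keys P \<union> Poly_Mapping.keys Q"
  have V: "finite ?V" by simp
  show "linear_extension f (P + Q) x = linear_extension f P x + linear_extension f Q x"
    using linear_extension_superset[OF V, of P f x] linear_extension_superset[OF V, of Q f x]
      linear_extension_superset[OF V Poly_Mapping.keys_add, of f x]
    by (simp add: lookup_add scaleC_add_left sum.distrib)
qed

lemma linear_extension_scale:
  "linear_extension f (Poly_Mapping.map ((*) c) P) = (\<lambda>x. c *\<^sub>C linear_extension f P x)"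
proof
  fix x
  have l: "Poly_Mapping.lookup (Poly_Mapping.map ((*) c) P) w = c * Poly_Mapping.lookup P w" for w
    by (simp add: Poly_Mapping.map.rep_eq when_def)
  have "Poly_Mapping.keys (Poly_Mapping.map ((*) c) P) \<subseteq> Poly_Mapping.keys P"
    by (auto simp: in_keys_iff l)
  from linear_extension_superset[OF finite_keys this, of f x]
  show "linear_extension f (Poly_Mapping.map ((*) c) P) x = c *\<^sub>C linear_extension f P x"
    by (simp add: l linear_extension_def scaleC_sum_right scaleC_scaleC)
qed

lemma linear_extension_single: "linear_extension f (Poly_Mapping.single w c) = (\<lambda>x. c *\<^sub>C f w x)"
proof
  fix x
  have "Poly_Mapping.keys (Poly_Mapping.single w c) \<subseteq> {w}" by simp
  from linear_extension_superset[OF _ this, of f x]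
  show "linear_extension f (Poly_Mapping.single w c) x = c *\<^sub>C f w x" by simp
qed

text \<open>The Leibniz expansion is first attached to words; algebraic freeness later allows it to
  be read as a function of the operator.\<close>

primrec word_derivative :: "('n \<Rightarrow> 'a::complex_hilbert \<Rightarrow> 'a) \<Rightarrow> ('n \<Rightarrow> 'a \<Rightarrow> 'a) \<Rightarrow> 'n list \<Rightarrow> 'a \<Rightarrow> 'a" where
  "word_derivative Y K [] = (\<lambda>x. 0)"
| "word_derivative Y K (j # w) = (\<lambda>x. K j (word_operator Y w x) + Y j (word_derivative Y K w x))"

section \<open>The polynomial algebra and its weights\<close>

locale derivation_data =
  fixes Y K :: "'n::finite \<Rightarrow> 'a::complex_hilbert \<Rightarrow> 'a"
  assumes Y_bounded: "bounded_clinear (Y j)"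
    and Y_adj: "adj (Y j) = Y j"
    and free: "algebraically_free Y"
    and K_in: "K j \<in> generated_algebra Y"
    and K_adj: "adj (K j) = K j"
begin

abbreviation A :: "('a \<Rightarrow> 'a) set" where "A \<equiv> generated_algebra Y"
abbreviation W :: "'n list \<Rightarrow> 'a \<Rightarrow> 'a" where "W \<equiv> word_operator Y"

lemma W_bounded: "bounded_clinear (W w)"
  by (induction w) (simp_all only: word_operator_Nil word_operator_Cons bounded_clinear_id bounded_clinear_comp Y_bounded)

lemma weighted_bounded: "weighted Y R p c S \<Longrightarrow> bounded_clinear S"
  by (induction rule: weighted.induct) (auto intro: W_bounded bounded_clinear_plus bounded_clinear_scale)

lemma weighted_nonneg: "weighted Y R p c S \<Longrightarrow> R \<ge> 0 \<Longrightarrow> c \<ge> 0"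
  by (induction rule: weighted.induct) auto

lemma weighted_word_comp:
  "weighted Y R p c S \<Longrightarrow> R \<ge> 0 \<Longrightarrow> weighted Y R (length w + p) (R ^ length w * c) (W w \<circ> S)"
proof (induction rule: weighted.induct)
  case (word u)
  show ?case using weighted.word[of Y R "w @ u"] by (simp only: word_operator_append power_add length_append)
next
  case (plus p c S d T)
  have "W w \<circ> (\<lambda>x. S x + T x) = (\<lambda>x. (W w \<circ> S) x + (W w \<circ> T) x)"
    by (rule ext) (simp add: bounded_clinear_add[OF W_bounded])
  then show ?case using weighted.plus[OF plus.IH] plus.prems by (simp add: distrib_left)
next
  case (scale p c S k)
  have "W w \<circ> (\<lambda>x. k *\<^sub>C S x) = (\<lambda>x. k *\<^sub>C (W w \<circ> S) x)"
    by (rule ext) (simp add: bounded_clinear_scaleC[OF W_bounded])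
  then show ?case using weighted.scale[OF scale.IH, of k] scale.prems by (simp add: mult.left_commute)
next
  case (mono p c S q d)
  show ?case
    by (rule weighted.mono[OF mono.IH[OF mono.prems]]) (use mono in \<open>auto intro: mult_left_mono\<close>)
qed

lemma weighted_comp:
  "weighted Y R p c S \<Longrightarrow> weighted Y R q d T \<Longrightarrow> R \<ge> 0 \<Longrightarrow> weighted Y R (p + q) (c * d) (S \<circ> T)"
proof (induction rule: weighted.induct)
  case (word w)
  then show ?case by (rule weighted_word_comp)
next
  case (plus p c S c' S')
  have "(\<lambda>x. S x + S' x) \<circ> T = (\<lambda>x. (S \<circ> T) x + (S' \<circ> T) x)" by (rule ext) simp
  then show ?case
    using weighted.plus[OF plus.IH(1)[OF plus.prems] plus.IH(2)[OF plus.prems]] by (simp only: distrib_right)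
next
  case (scale p c S k)
  have "(\<lambda>x. k *\<^sub>C S x) \<circ> T = (\<lambda>x. k *\<^sub>C (S \<circ> T) x)" by (rule ext) simp
  then show ?case using weighted.scale[OF scale.IH[OF scale.prems], of k] by (simp only: mult.assoc)
next
  case (mono p c S p' c')
  show ?case
  proof (rule weighted.mono[OF mono.IH[OF mono.prems]])
    show "p + q \<le> p' + q" using mono.hyps by simp
    show "c * d \<le> c' * d" by (rule mult_right_mono[OF mono.hyps(3) weighted_nonneg[OF mono.prems]])
  qed
qed

lemma weighted_subalgebra:
  assumes R: "R \<ge> 0"
  shows "unital_subalgebra {S. \<exists>p c. weighted Y R p c S}" (is "unital_subalgebra ?W")
  unfolding unital_subalgebra_def
proof (intro conjI ballI allI)
  show "bounded_clinear S" if "S \<in> ?W" for S using that weighted_bounded by auto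
  have "weighted Y R 0 1 id" using weighted.word[of Y R "[]"] by (simp add: word_operator_Nil)
  then show "id \<in> ?W" by (intro CollectI exI)
  show "(\<lambda>x. S x + T x) \<in> ?W" if ST: "S \<in> ?W" "T \<in> ?W" for S T
  proof -
    obtain p c where S: "weighted Y R p c S" using ST(1) by auto
    obtain q d where T: "weighted Y R q d T" using ST(2) by auto
    have "weighted Y R (max p q) c S" "weighted Y R (max p q) d T"
      by (rule weighted.mono[OF S], simp, simp) (rule weighted.mono[OF T], simp, simp)
    from weighted.plus[OF this] show ?thesis by (intro CollectI exI)
  qed
  show "(\<lambda>x. k *\<^sub>C S x) \<in> ?W" if S: "S \<in> ?W" for k S
  proof -
    obtain p c where S: "weighted Y R p c S" using S by auto
    from weighted.scale[OF S] show ?thesis by (intro CollectI exI)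
  qed
  show "S \<circ> T \<in> ?W" if ST: "S \<in> ?W" "T \<in> ?W" for S T
  proof -
    obtain p c where S: "weighted Y R p c S" using ST(1) by auto
    obtain q d where T: "weighted Y R q d T" using ST(2) by auto
    from weighted_comp[OF S T R] show ?thesis by (intro CollectI exI)
  qed
qed

text \<open>The description holds for every nonnegative weight, so \<open>R\<close> can be fitted to
  the operator norms of the \<open>Y j\<close> when estimates are made, and set to 1 when only the
  linear structure matters.\<close>

lemma generated_algebra_weighted:
  assumes R: "R \<ge> 0"
  shows "A = {S. \<exists>p c. weighted Y R p c S}"
proof
  let ?W = "{S. \<exists>p c. weighted Y R p c S}"
  have "range Y \<subseteq> ?W"
  proof
    fix T assume "T \<in> range Y"
    then obtain j where "T = Y j" by (elim imageE)
    then have "weighted Y R 1 R T" using weighted.word[of Y R "[j]"]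
      by (simp add: word_operator_Nil word_operator_Cons)
    then show "T \<in> ?W" by (intro CollectI exI)
  qed
  then show "A \<subseteq> ?W" unfolding generated_algebra_def by (intro hull_minimal weighted_subalgebra R)
  show "?W \<subseteq> A"
    unfolding generated_algebra_def hull_def
  proof (intro subsetI InterI)
    fix S B assume S: "S \<in> ?W" and B: "B \<in> {t. unital_subalgebra t \<and> range Y \<subseteq> t}"
    have BY: "Y j \<in> B" for j using B by auto
    have Bsub: "unital_subalgebra B" using B by simp
    have wB: "W w \<in> B" for w
      by (induction w) (simp_all only: word_operator_Nil word_operator_Cons unital_subalgebraD[OF Bsub] BY)
    obtain p c where "weighted Y R p c S" using S by auto
    then show "S \<in> B"
    proof (induction rule: weighted.induct)
      case (plus p c S d T)
      show ?case by (rule unital_subalgebraD(3)[OF Bsub plus.IH])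
    next
      case (scale p c S k)
      show ?case by (rule unital_subalgebraD(4)[OF Bsub scale.IH])
    qed (rule wB, assumption)
  qed
qed

text \<open>Products need no case of their own: the span of the words is already closed under
  composition.\<close>

lemma A_induct [consumes 1, case_names word plus scale]:
  assumes S: "S \<in> A" and w: "\<And>w. P (W w)"
    and p: "\<And>S T. S \<in> A \<Longrightarrow> T \<in> A \<Longrightarrow> P S \<Longrightarrow> P T \<Longrightarrow> P (\<lambda>x. S x + T x)"
    and s: "\<And>c S. S \<in> A \<Longrightarrow> P S \<Longrightarrow> P (\<lambda>x. c *\<^sub>C S x)"
  shows "P S"
proof -
  have A: "A = {S. \<exists>p c. weighted Y 1 p c S}" by (rule generated_algebra_weighted) simp
  obtain p c where "weighted Y 1 p c S" using S A by auto
  then show ?thesis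
  proof (induction rule: weighted.induct)
    case (plus p c S d T)
    show ?case by (rule p) (use plus A in auto)
  next
    case (scale p c S k)
    show ?case by (rule s) (use scale A in auto)
  qed (rule w, simp)
qed

lemma A_sub: "unital_subalgebra A"
  using weighted_subalgebra[of 1] generated_algebra_weighted[of 1] by simp

lemmas A_bounded = unital_subalgebraD(1)[OF A_sub]
  and A_id = unital_subalgebraD(2)[OF A_sub]
  and A_plus = unital_subalgebraD(3)[OF A_sub]
  and A_scale = unital_subalgebraD(4)[OF A_sub]
  and A_comp = unital_subalgebraD(5)[OF A_sub]

lemma A_zero: "(\<lambda>x. 0) \<in> A"
  using A_scale[OF A_id, of 0] by simp

lemma Y_in: "Y j \<in> A"
  unfolding generated_algebra_def hull_def by auto

lemma W_in: "W w \<in> A"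
  by (induction w) (simp_all only: word_operator_Nil word_operator_Cons A_id A_comp Y_in)

lemma word_derivative_in: "word_derivative Y K w \<in> A"
proof (induction w)
  case (Cons j w)
  have "(\<lambda>x. (K j \<circ> W w) x + (Y j \<circ> word_derivative Y K w) x) \<in> A"
    by (intro A_plus A_comp K_in W_in Y_in Cons)
  then show ?case by simp
qed (simp add: A_zero)

lemma A_adj: "S \<in> A \<Longrightarrow> adj S \<in> A"
proof (induction rule: A_induct)
  case (word w)
  have "adj (W w) \<in> A"
    by (induction w) (simp_all only: word_operator_Nil word_operator_Cons adj_id A_id
        adj_comp[OF Y_bounded W_bounded] Y_adj A_comp Y_in)
  then show ?case .
next
  case (plus S T)
  then show ?case by (simp add: adj_plus A_bounded A_plus)
next
  case (scale c S)
  then show ?case by (simp add: adj_scale A_bounded A_scale)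
qed

lemma A_range: "A = range (nc_eval Y)"
proof
  have "\<exists>P. S = nc_eval Y P" if "S \<in> A" for S
    using that
  proof (induction rule: A_induct)
    case (word w)
    have "nc_eval Y (Poly_Mapping.single w 1) = W w"
      by (simp add: nc_eval_linear_extension linear_extension_single)
    then show ?case by (intro exI[of _ "Poly_Mapping.single w 1"]) simp
  next
    case (plus S T)
    then obtain P Q where "S = nc_eval Y P" "T = nc_eval Y Q" by auto
    then show ?case
      by (intro exI[of _ "P + Q"]) (simp add: nc_eval_linear_extension linear_extension_plus)
  next
    case (scale c S)
    then obtain P where "S = nc_eval Y P" by auto
    then show ?case
      by (intro exI[of _ "Poly_Mapping.map ((*) c) P"]) (simp add: nc_eval_linear_extension linear_extension_scale)
  qed
  then show "A \<subseteq> range (nc_eval Y)" by auto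
next
  have "(\<lambda>x. \<Sum>w\<in>V. c w *\<^sub>C W w x) \<in> A" if "finite V" for V c
    using that
  proof (induction V rule: finite_induct)
    case (insert w V)
    have "(\<lambda>x. c w *\<^sub>C W w x + (\<Sum>w\<in>V. c w *\<^sub>C W w x)) \<in> A"
      by (rule A_plus[OF A_scale[OF W_in] insert.IH])
    then show ?case using insert.hyps by simp
  qed (simp add: A_zero)
  then show "range (nc_eval Y) \<subseteq> A"
    by (auto simp: nc_eval_linear_extension linear_extension_def)
qed

section \<open>The derivation prescribed by its values on the generators\<close>

lemma derivation_unique:
  assumes D: "derivation_on A D" "\<And>j. D (Y j) = K j" and D': "derivation_on A D'" "\<And>j. D' (Y j) = K j"
  shows "D = D'"
proof
  fix S
  \<comment> \<open>The Leibniz rule applied to id = id \<circ> id gives x = x + x.\<close>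
  have id0: "E id = (\<lambda>x. 0)" if E: "derivation_on A E" for E
  proof -
    have "\<forall>S\<in>A. \<forall>T\<in>A. E (S \<circ> T) = (\<lambda>x. (E S \<circ> T) x + (S \<circ> E T) x)"
      using E unfolding derivation_on_def by (elim conjE)
    from this[rule_format, OF A_id A_id] have "E id = (\<lambda>x. E id x + E id x)" by simp
    then have "E id x = E id x + E id x" for x by (rule fun_cong)
    then show ?thesis by (simp add: fun_eq_iff)
  qed
  show "D S = D' S"
  proof (cases "S \<in> A")
    \<comment> \<open>\<open>derivation_on\<close> demands an extensional function, so outside
      \<open>A\<close> both sides are the default value.\<close>
    case False
    have "E \<in> A \<rightarrow>\<^sub>E A" if "derivation_on A E" for E using that unfolding derivation_on_def by (rule conjunct1)
    from PiE_arb[OF this[OF D(1)] False] PiE_arb[OF this[OF D'(1)] False] show ?thesis by simp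
  next
    case True
    then show ?thesis
    proof (induction rule: A_induct)
      case (word w)
      show ?case
      proof (induction w)
        case Nil
        show ?case by (simp only: word_operator_Nil id0[OF D(1)] id0[OF D'(1)])
      next
        case (Cons j w)
        have "E (Y j \<circ> W w) = (\<lambda>x. (E (Y j) \<circ> W w) x + (Y j \<circ> E (W w)) x)" if "derivation_on A E" for E
          using that Y_in W_in unfolding derivation_on_def by simp
        from this[OF D(1)] this[OF D'(1)] show ?case by (simp only: word_operator_Cons Cons D(2) D'(2))
      qed
    next
      case (plus S T)
      have "E (\<lambda>x. S x + T x) = (\<lambda>x. E S x + E T x)" if "derivation_on A E" for E
        using that plus unfolding derivation_on_def by simp
      from this[OF D(1)] this[OF D'(1)] show ?case by (simp add: plus)
    next
      case (scale c S)
      have "E (\<lambda>x. c *\<^sub>C S x) = (\<lambda>x. c *\<^sub>C E S x)" if "derivation_on A E" for E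
        using that scale unfolding derivation_on_def by simp
      from this[OF D(1)] this[OF D'(1)] show ?case by (simp add: scale)
    qed
  qed
qed

text \<open>Freeness attaches a unique noncommutative polynomial to each element of
  \<open>A\<close>, so the word formula defines a map. The Leibniz rule is a concatenation identity
  on words and extends linearly in each factor.\<close>

lemma derivation_exists: "\<exists>D. derivation_on A D \<and> (\<forall>j. D (Y j) = K j)"
proof -
  let ?d = "word_derivative Y K"
  define D where "D = restrict (\<lambda>S. linear_extension ?d (inv (nc_eval Y) S)) A"
  have inj: "inj (nc_eval Y)" using free by (simp add: algebraically_free_def)
  have Dnc: "D (nc_eval Y P) = linear_extension ?d P" for P
    using A_range by (simp add: D_def inv_f_f[OF inj])
  have DW: "D (W w) = ?d w" for w
    using Dnc[of "Poly_Mapping.single w 1"] by (simp add: nc_eval_linear_extension linear_extension_single)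
  have Dplus: "D (\<lambda>x. S x + T x) = (\<lambda>x. D S x + D T x)" if "S \<in> A" "T \<in> A" for S T
  proof -
    obtain P where P: "S = nc_eval Y P" using \<open>S \<in> A\<close> A_range by auto
    obtain Q where Q: "T = nc_eval Y Q" using \<open>T \<in> A\<close> A_range by auto
    have "(\<lambda>x. S x + T x) = nc_eval Y (P + Q)"
      by (simp add: P Q nc_eval_linear_extension linear_extension_plus)
    then show ?thesis by (simp only: P Q Dnc linear_extension_plus)
  qed
  have Dscale: "D (\<lambda>x. c *\<^sub>C S x) = (\<lambda>x. c *\<^sub>C D S x)" if "S \<in> A" for c S
  proof -
    obtain P where P: "S = nc_eval Y P" using \<open>S \<in> A\<close> A_range by auto
    have "(\<lambda>x. c *\<^sub>C S x) = nc_eval Y (Poly_Mapping.map ((*) c) P)"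
      by (simp add: P nc_eval_linear_extension linear_extension_scale)
    then show ?thesis by (simp only: P Dnc linear_extension_scale)
  qed
  have DA: "D S \<in> A" if "S \<in> A" for S
    using that
  proof (induction rule: A_induct)
    case (word w)
    show ?case by (simp add: DW word_derivative_in)
  next
    case (plus S T)
    then show ?case by (simp add: Dplus A_plus)
  next
    case (scale c S)
    then show ?case by (simp add: Dscale A_scale)
  qed
  have word_Leibniz: "?d (u @ w) = (\<lambda>x. ?d u (W w x) + W u (?d w x))" for u w
    by (induction u) (simp_all add: word_operator_Nil word_operator_Cons word_operator_append
        bounded_clinear_add[OF Y_bounded] add.assoc)
  have Leibniz: "D (S \<circ> T) = (\<lambda>x. (D S \<circ> T) x + (S \<circ> D T) x)" if S: "S \<in> A" and T: "T \<in> A" for S T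
    using S
  proof (induction rule: A_induct)
    case (word u)
    show ?case
      using T
    proof (induction rule: A_induct)
      case (word w)
      show ?case by (simp only: word_operator_append[symmetric] DW word_Leibniz o_apply)
    next
      case (plus T T')
      have "W u \<circ> (\<lambda>x. T x + T' x) = (\<lambda>x. (W u \<circ> T) x + (W u \<circ> T') x)"
        by (rule ext) (simp add: bounded_clinear_add[OF W_bounded])
      moreover have "D (\<lambda>x. (W u \<circ> T) x + (W u \<circ> T') x) = (\<lambda>x. D (W u \<circ> T) x + D (W u \<circ> T') x)"
        by (rule Dplus) (intro A_comp W_in plus.hyps)+
      ultimately have eq: "D (W u \<circ> (\<lambda>x. T x + T' x)) = (\<lambda>x. D (W u \<circ> T) x + D (W u \<circ> T') x)" by (simp only:)
      show ?case unfolding eq plus.IH Dplus[OF plus.hyps]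
        by (rule ext) (simp add: bounded_clinear_add[OF W_bounded]
            bounded_clinear_add[OF A_bounded[OF DA[OF W_in]]])
    next
      case (scale c T)
      have "W u \<circ> (\<lambda>x. c *\<^sub>C T x) = (\<lambda>x. c *\<^sub>C (W u \<circ> T) x)"
        by (rule ext) (simp add: bounded_clinear_scaleC[OF W_bounded])
      moreover have "D (\<lambda>x. c *\<^sub>C (W u \<circ> T) x) = (\<lambda>x. c *\<^sub>C D (W u \<circ> T) x)"
        by (rule Dscale) (intro A_comp W_in scale.hyps)
      ultimately have eq: "D (W u \<circ> (\<lambda>x. c *\<^sub>C T x)) = (\<lambda>x. c *\<^sub>C D (W u \<circ> T) x)" by (simp only:)
      show ?case unfolding eq scale.IH Dscale[OF scale.hyps]
        by (rule ext) (simp add: bounded_clinear_scaleC[OF W_bounded] scaleC_add_right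
            bounded_clinear_scaleC[OF A_bounded[OF DA[OF W_in]]])
    qed
  next
    case (plus S S')
    have "(\<lambda>x. S x + S' x) \<circ> T = (\<lambda>x. (S \<circ> T) x + (S' \<circ> T) x)" by (rule ext) simp
    moreover have "D (\<lambda>x. (S \<circ> T) x + (S' \<circ> T) x) = (\<lambda>x. D (S \<circ> T) x + D (S' \<circ> T) x)"
      by (rule Dplus) (intro A_comp T plus.hyps)+
    ultimately have eq: "D ((\<lambda>x. S x + S' x) \<circ> T) = (\<lambda>x. D (S \<circ> T) x + D (S' \<circ> T) x)" by (simp only:)
    show ?case unfolding eq plus.IH Dplus[OF plus.hyps] by (rule ext) simp
  next
    case (scale c S)
    have "(\<lambda>x. c *\<^sub>C S x) \<circ> T = (\<lambda>x. c *\<^sub>C (S \<circ> T) x)" by (rule ext) simp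
    moreover have "D (\<lambda>x. c *\<^sub>C (S \<circ> T) x) = (\<lambda>x. c *\<^sub>C D (S \<circ> T) x)"
      by (rule Dscale) (intro A_comp T scale.hyps)
    ultimately have eq: "D ((\<lambda>x. c *\<^sub>C S x) \<circ> T) = (\<lambda>x. c *\<^sub>C D (S \<circ> T) x)" by (simp only:)
    show ?case unfolding eq scale.IH Dscale[OF scale.hyps] by (rule ext) (simp add: scaleC_add_right)
  qed
  have "D \<in> A \<rightarrow>\<^sub>E A"
  proof (rule PiE_I)
    show "D S \<in> A" if "S \<in> A" for S by (rule DA[OF that])
    show "D S = undefined" if "S \<notin> A" for S using that by (simp add: D_def)
  qed
  moreover have "D (Y j) = K j" for j
  proof -
    have "Y j = W [j]" by (simp only: word_operator_Nil word_operator_Cons comp_id)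
    then have "D (Y j) = ?d [j]" by (simp only: DW)
    also have "\<dots> = K j" by (simp add: word_operator_Nil bounded_clinear_zero[OF Y_bounded])
    finally show ?thesis .
  qed
  ultimately show ?thesis unfolding derivation_on_def
    using Dplus Dscale Leibniz by (intro exI[of _ D]) simp
qed

abbreviation D :: "('a \<Rightarrow> 'a) \<Rightarrow> 'a \<Rightarrow> 'a" where "D \<equiv> vect_derivation Y K"

lemma vect_derivation: "derivation_on A D \<and> (\<forall>j. D (Y j) = K j)"
proof -
  from derivation_exists obtain E where E: "derivation_on A E \<and> (\<forall>j. E (Y j) = K j)" by (rule exE)
  have "\<exists>!D. derivation_on A D \<and> (\<forall>j. D (Y j) = K j)"
  proof (rule ex1I)
    show "derivation_on A E \<and> (\<forall>j. E (Y j) = K j)" by (rule E)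
    fix F assume F: "derivation_on A F \<and> (\<forall>j. F (Y j) = K j)"
    show "F = E" by (rule derivation_unique) (use F E in simp_all)
  qed
  from theI'[OF this] show ?thesis unfolding vect_derivation_def .
qed

lemma D_Y: "D (Y j) = K j"
  and D_in: "S \<in> A \<Longrightarrow> D S \<in> A"
  and D_plus: "S \<in> A \<Longrightarrow> T \<in> A \<Longrightarrow> D (\<lambda>x. S x + T x) = (\<lambda>x. D S x + D T x)"
  and D_scale: "S \<in> A \<Longrightarrow> D (\<lambda>x. c *\<^sub>C S x) = (\<lambda>x. c *\<^sub>C D S x)"
  and D_comp: "S \<in> A \<Longrightarrow> T \<in> A \<Longrightarrow> D (S \<circ> T) = (\<lambda>x. (D S \<circ> T) x + (S \<circ> D T) x)"
  using vect_derivation unfolding derivation_on_def by (auto simp: PiE_iff)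

lemma D_zero: "D (\<lambda>x. 0) = (\<lambda>x. 0)"
  using D_scale[OF A_id, of 0] by simp

lemma D_id: "D id = (\<lambda>x. 0)"
proof -
  have "D id = (\<lambda>x. D id x + D id x)" using D_comp[OF A_id A_id] by simp
  then have "D id x = D id x + D id x" for x by (rule fun_cong)
  then show ?thesis by (simp add: fun_eq_iff)
qed

lemma D_word: "D (W w) = word_derivative Y K w"
proof (induction w)
  case (Cons j w)
  show ?case unfolding word_operator_Cons D_comp[OF Y_in W_in] D_Y Cons by (rule ext) simp
qed (simp only: word_operator_Nil word_derivative.simps D_id)

text \<open>The adjoint reverses the two terms of the Leibniz rule, so both sides agree on words as
  soon as they agree on the self-adjoint generators, whose images \<open>K j\<close> are
  self-adjoint too.\<close>

lemma D_adj: "S \<in> A \<Longrightarrow> D (adj S) = adj (D S)"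
proof (induction rule: A_induct)
  case (word w)
  show ?case
  proof (induction w)
    case Nil
    have "adj (\<lambda>x::'a. 0::'a) = (\<lambda>x. 0)" by (rule adj_unique) simp
    then show ?case by (simp only: word_operator_Nil adj_id D_id)
  next
    case (Cons j w)
    have "D (adj (W (j # w))) = D (adj (W w) \<circ> Y j)"
      by (simp only: word_operator_Cons adj_comp[OF Y_bounded W_bounded] Y_adj)
    also have "\<dots> = (\<lambda>x. (adj (D (W w)) \<circ> Y j) x + (adj (W w) \<circ> K j) x)"
      by (simp only: D_comp[OF A_adj[OF W_in] Y_in] Cons D_Y)
    also have "\<dots> = (\<lambda>x. adj (Y j \<circ> D (W w)) x + adj (K j \<circ> W w) x)"
      by (simp only: adj_comp[OF Y_bounded A_bounded[OF D_in[OF W_in]]] adj_comp[OF A_bounded[OF K_in] W_bounded] Y_adj K_adj)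
    also have "\<dots> = adj (\<lambda>x. (Y j \<circ> D (W w)) x + (K j \<circ> W w) x)"
      by (rule adj_plus[symmetric]) (intro A_bounded A_comp Y_in D_in W_in K_in)+
    also have "\<dots> = adj (D (W (j # w)))"
      by (simp only: word_operator_Cons D_comp[OF Y_in W_in] D_Y add.commute)
    finally show ?case .
  qed
next
  case (plus S T)
  then show ?case by (simp add: adj_plus A_bounded D_plus A_adj D_in)
next
  case (scale c S)
  then show ?case by (simp add: adj_scale A_bounded D_scale A_adj D_in)
qed

lemma D_power_in: "S \<in> A \<Longrightarrow> (D ^^ k) S \<in> A"
  by (induction k) (simp_all add: D_in)

lemma D_power_adj: "S \<in> A \<Longrightarrow> (D ^^ k) (adj S) = adj ((D ^^ k) S)"
  by (induction k) (simp_all add: D_adj D_power_in)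

lemma D_power_plus: "S \<in> A \<Longrightarrow> T \<in> A \<Longrightarrow> (D ^^ k) (\<lambda>x. S x + T x) = (\<lambda>x. (D ^^ k) S x + (D ^^ k) T x)"
  by (induction k) (simp_all add: D_plus D_power_in)

lemma D_power_scale: "S \<in> A \<Longrightarrow> (D ^^ k) (\<lambda>x. c *\<^sub>C S x) = (\<lambda>x. c *\<^sub>C (D ^^ k) S x)"
  by (induction k) (simp_all add: D_scale D_power_in)

text \<open>Each application of \<open>D\<close> replaces one of the at most \<open>p\<close> letters of a word by some \<open>K j\<close>,
  hence multiplies weights by \<open>p\<close> and a constant, and raises degrees by a constant.\<close>

lemma D_analytic:
  "\<exists>B>0. \<forall>S\<in>A. \<exists>C\<ge>0. \<forall>k v. norm ((D ^^ k) S v) \<le> C * fact k * B ^ k * norm v"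
proof -
  have "\<forall>j. \<exists>c. \<forall>v. norm (Y j v) \<le> c * norm v" using bounded_clinear_bound[OF Y_bounded] by metis
  from choice[OF this] obtain c where c: "\<And>j v. norm (Y j v) \<le> c j * norm v" by auto
  \<comment> \<open>\<open>R\<close> dominates the norm of every \<open>Y j\<close>, so weights
    dominate operator norms. The summand 1 gives R at least 1, which lets a missing letter be paid
    for by another factor \<open>R\<close>.\<close>
  define R where "R = 1 + (\<Sum>j\<in>UNIV. \<bar>c j\<bar>)"
  have R1: "R \<ge> 1" by (simp add: R_def sum_nonneg)
  have YR: "norm (Y j v) \<le> R * norm v" for j v
  proof -
    have "c j \<le> R" using member_le_sum[of j UNIV "\<lambda>j. \<bar>c j\<bar>"] by (simp add: R_def)
    then show ?thesis using c[of j v] mult_right_mono[of "c j" R "norm v"] by simp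
  qed
  have WR: "norm (W w v) \<le> R ^ length w * norm v" for w v
  proof (induction w)
    case (Cons j w)
    have "norm (W (j # w) v) \<le> R * norm (W w v)" using YR by (simp add: word_operator_Cons)
    also have "\<dots> \<le> R * (R ^ length w * norm v)" using R1 Cons by (intro mult_left_mono) auto
    finally show ?case by simp
  qed (simp add: word_operator_Nil)
  have wnorm: "norm (S v) \<le> c * norm v" if "weighted Y R p c S" for p c S v
    using that
  proof (induction rule: weighted.induct)
    case (word w)
    show ?case by (rule WR)
  next
    case (plus p c S d T)
    show ?case using norm_triangle_ineq[of "S v" "T v"] plus.IH by (simp add: distrib_right)
  next
    case (scale p c S k)
    show ?case using scale.IH mult_left_mono[OF scale.IH norm_ge_zero[of k]] by (simp add: mult.assoc)
  next
    case (mono p c S q d)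
    show ?case using mono.IH mult_right_mono[OF mono.hyps(3) norm_ge_zero[of v]] by simp
  qed
  have AR: "A = {S. \<exists>p c. weighted Y R p c S}" by (rule generated_algebra_weighted) (use R1 in simp)
  have "\<forall>j. \<exists>p. \<exists>c. weighted Y R p c (K j)" using K_in AR by auto
  from choice[OF this] obtain pK where "\<forall>j. \<exists>c. weighted Y R (pK j) c (K j)" by (rule exE)
  from choice[OF this] obtain cK where pcK: "\<forall>j. weighted Y R (pK j) (cK j) (K j)" by (rule exE)
  \<comment> \<open>The degree growth bound is kept at least 1 so that p + i d is at most d (p + i +
    1) in the product estimate below.\<close>
  define d where "d = 1 + (\<Sum>j\<in>UNIV. pK j)"
  define \<kappa> where "\<kappa> = (\<Sum>j\<in>UNIV. cK j)"
  have cK0: "cK j \<ge> 0" for j by (rule weighted_nonneg[OF pcK[rule_format]]) (use R1 in simp)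
  have \<kappa>0: "\<kappa> \<ge> 0" unfolding \<kappa>_def by (intro sum_nonneg) (rule cK0)
  have KR: "weighted Y R d \<kappa> (K j)" for j
  proof (rule weighted.mono[OF pcK[rule_format]])
    show "pK j \<le> d" using member_le_sum[of j UNIV pK] by (simp add: d_def)
    show "cK j \<le> \<kappa>" using member_le_sum[of j UNIV cK] cK0 by (simp add: \<kappa>_def)
  qed
  \<comment> \<open>Each of the \<open>length w\<close> Leibniz terms trades one letter for some
    \<open>K j\<close> of weight at most \<open>\<kappa>\<close>; the lost power of \<open>R\<close>
    is restored for a uniform bound.\<close>
  have wd: "weighted Y R (length w + d) (real (length w) * \<kappa> * R ^ length w) (word_derivative Y K w)" for w
  proof (induction w)
    case Nil
    have "weighted Y R 0 0 (\<lambda>x. 0)" using weighted.scale[OF weighted.word[of Y R "[]"], of 0] by simp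
    then show ?case unfolding word_derivative.simps by (rule weighted.mono) simp_all
  next
    case (Cons j w)
    have 1: "weighted Y R (d + length w) (\<kappa> * R ^ length w) (K j \<circ> W w)"
      by (rule weighted_comp[OF KR weighted.word]) (use R1 in simp)
    have 2: "weighted Y R (length [j] + (length w + d)) (R ^ length [j] * (real (length w) * \<kappa> * R ^ length w)) (W [j] \<circ> word_derivative Y K w)"
      by (rule weighted_word_comp[OF Cons]) (use R1 in simp)
    have a1: "weighted Y R (length (j # w) + d) (\<kappa> * R ^ length w) (K j \<circ> W w)"
      by (rule weighted.mono[OF 1]) simp_all
    have a2: "weighted Y R (length (j # w) + d) (R * (real (length w) * \<kappa> * R ^ length w)) (Y j \<circ> word_derivative Y K w)"
      using 2 by (simp add: add.assoc word_operator_Nil word_operator_Cons)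
    have "\<kappa> * R ^ length w \<le> \<kappa> * R ^ Suc (length w)"
      using \<kappa>0 R1 by (intro mult_left_mono power_increasing) auto
    then have le: "\<kappa> * R ^ length w + R * (real (length w) * \<kappa> * R ^ length w)
      \<le> real (length (j # w)) * \<kappa> * R ^ length (j # w)" by (simp add: algebra_simps)
    have "weighted Y R (length (j # w) + d) (real (length (j # w)) * \<kappa> * R ^ length (j # w))
        (\<lambda>x. (K j \<circ> W w) x + (Y j \<circ> word_derivative Y K w) x)"
      by (rule weighted.mono[OF weighted.plus[OF a1 a2] order_refl le])
    then show ?case by simp
  qed
  have wD: "weighted Y R (p + d) (real p * \<kappa> * c) (D S)" if "weighted Y R p c S" for p c S
    using that
  proof (induction rule: weighted.induct)
    case (word w)
    show ?case using wd[of w] by (simp add: D_word)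
  next
    case (plus p c S e T)
    have "S \<in> A" "T \<in> A" using plus.hyps AR by auto
    then show ?case using weighted.plus[OF plus.IH] by (simp add: D_plus distrib_left)
  next
    case (scale p c S k)
    have "S \<in> A" using scale.hyps AR by auto
    then show ?case using weighted.scale[OF scale.IH, of k] by (simp add: D_scale mult_ac)
  next
    case (mono p c S q e)
    have c0: "c \<ge> 0" using weighted_nonneg[OF mono.hyps(1)] R1 by simp
    have "real p * \<kappa> * c \<le> real q * \<kappa> * e"
      using mono.hyps c0 \<kappa>0 by (intro mult_mono) auto
    then show ?case by (intro weighted.mono[OF mono.IH]) (use mono.hyps in auto)
  qed
  have wDk: "weighted Y R (p + k * d) (c * (\<Prod>i<k. \<kappa> * real (p + i * d))) ((D ^^ k) S)" if S: "weighted Y R p c S" for p c S k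
  proof (induction k)
    case 0
    show ?case using S by simp
  next
    case (Suc k)
    show ?case using wD[OF Suc] by (simp add: mult_ac add_ac)
  qed
  \<comment> \<open>After pulling out d the product is (p + k)! / p!, that is k! times a binomial
    coefficient, and the latter is at most 2^(p + k).\<close>
  have prod: "(\<Prod>i<k. \<kappa> * real (p + i * d)) \<le> 2 ^ p * fact k * (2 * \<kappa> * real d) ^ k" for p k
  proof -
    have fact_prod: "fact (p + k) = fact p * (\<Prod>i<k. real (Suc (p + i)))" for k
      by (induction k) (simp_all add: algebra_simps)
    have "fact p * (\<Prod>i<k. real (Suc (p + i))) = fact k * fact p * real ((p + k) choose k)"
    proof -
      have "fact k * fact p * ((p + k) choose k) = (fact (p + k) :: nat)"
        using binomial_fact_lemma[of k "p + k"] by simp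
      then have "real (fact k * fact p * ((p + k) choose k)) = real (fact (p + k))" by (rule arg_cong)
      then have "fact k * fact p * real ((p + k) choose k) = fact (p + k)"
        by (simp only: of_nat_mult of_nat_fact)
      then show ?thesis by (simp only: fact_prod)
    qed
    then have "(\<Prod>i<k. real (Suc (p + i))) = fact k * real ((p + k) choose k)" by simp
    also have "\<dots> \<le> fact k * 2 ^ (p + k)"
    proof (rule mult_left_mono)
      have "(p + k) choose k \<le> 2 ^ (p + k)" by (rule binomial_le_pow2)
      then have "real ((p + k) choose k) \<le> real (2 ^ (p + k))" by (rule of_nat_mono)
      then show "real ((p + k) choose k) \<le> 2 ^ (p + k)" by simp
    qed simp
    finally have P: "(\<Prod>i<k. real (Suc (p + i))) \<le> fact k * 2 ^ (p + k)" .
    have "(\<Prod>i<k. \<kappa> * real (p + i * d)) \<le> (\<Prod>i<k. (\<kappa> * real d) * real (Suc (p + i)))"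
    proof (rule prod_mono, intro conjI)
      fix i
      show "0 \<le> \<kappa> * real (p + i * d)" using \<kappa>0 by simp
      have "p + i * d \<le> p * d + i * d" by (simp add: d_def)
      also have "\<dots> \<le> d * Suc (p + i)" by (simp add: algebra_simps)
      finally have "real (p + i * d) \<le> real (d * Suc (p + i))" by (rule of_nat_mono)
      then have "real (p + i * d) \<le> real d * real (Suc (p + i))" by (simp only: of_nat_mult)
      from mult_left_mono[OF this \<kappa>0] show "\<kappa> * real (p + i * d) \<le> (\<kappa> * real d) * real (Suc (p + i))"
        by (simp only: mult.assoc)
    qed
    also have "\<dots> = (\<kappa> * real d) ^ k * (\<Prod>i<k. real (Suc (p + i)))" by (simp add: prod.distrib)
    also have "\<dots> \<le> (\<kappa> * real d) ^ k * (fact k * 2 ^ (p + k))"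
      using P \<kappa>0 by (intro mult_left_mono) auto
    also have "\<dots> = 2 ^ p * fact k * (2 * \<kappa> * real d) ^ k" by (simp add: power_add power_mult_distrib mult_ac)
    finally show ?thesis .
  qed
  \<comment> \<open>The 2 comes from the binomial bound; the summand 1 keeps the rate positive even
    when all \<open>K j\<close> vanish.\<close>
  define B where "B = 2 * \<kappa> * real d + 1"
  have B: "B > 0" "2 * \<kappa> * real d \<le> B" "0 \<le> 2 * \<kappa> * real d" using \<kappa>0 by (simp_all add: B_def add_nonneg_pos)
  have "\<exists>C\<ge>0. \<forall>k v. norm ((D ^^ k) S v) \<le> C * fact k * B ^ k * norm v" if S: "S \<in> A" for S
  proof -
    obtain p c where w: "weighted Y R p c S" using S AR by auto
    have c0: "c \<ge> 0" using weighted_nonneg[OF w] R1 by simp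
    have "norm ((D ^^ k) S v) \<le> (c * 2 ^ p) * fact k * B ^ k * norm v" for k v
    proof -
      have "norm ((D ^^ k) S v) \<le> c * (\<Prod>i<k. \<kappa> * real (p + i * d)) * norm v" by (rule wnorm[OF wDk[OF w]])
      also have "\<dots> \<le> c * (2 ^ p * fact k * (2 * \<kappa> * real d) ^ k) * norm v"
        by (intro mult_right_mono mult_left_mono prod c0) simp
      also have "\<dots> \<le> c * (2 ^ p * fact k * B ^ k) * norm v"
        by (intro mult_right_mono mult_left_mono c0 power_mono B) simp_all
      finally show ?thesis by (simp add: mult_ac)
    qed
    then show ?thesis using c0 by (intro exI[of _ "c * 2 ^ p"]) simp
  qed
  then show ?thesis using B(1) by (intro exI[of _ B]) simp
qed

end

section \<open>Unitary groups and their generators\<close>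

text \<open>A product majorant gives absolute summability over all pairs, so rows and diagonals have
  the same sum. The isometry, the group law and multiplicativity of the flow are all instances of
  this rearrangement.\<close>

lemma double_series_diagonal:
  fixes f :: "nat \<Rightarrow> nat \<Rightarrow> 'b::banach"
  assumes f: "\<And>i j. norm (f i j) \<le> p i * q j"
    and p: "summable p" "\<And>i. p i \<ge> 0" and q: "summable q" "\<And>j. q j \<ge> 0"
  shows "(\<lambda>k. \<Sum>i\<le>k. f i (k - i)) sums suminf (\<lambda>i. suminf (f i))"
proof -
  have pq: "(\<lambda>(i, j). p i * q j) summable_on (Sigma UNIV (\<lambda>_. UNIV))"
  proof (rule summable_on_SigmaI[where g = "\<lambda>i. p i * suminf q"])
    show "((\<lambda>j. case (i, j) of (i, j) \<Rightarrow> p i * q j) has_sum p i * suminf q) UNIV" for i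
      unfolding prod.case
      by (rule norm_summable_imp_has_sum) (use p q in \<open>auto intro: summable_mult sums_mult summable_sums simp: abs_mult\<close>)
    show "(\<lambda>i. p i * suminf q) summable_on UNIV"
      by (rule norm_summable_imp_summable_on)
         (use p suminf_nonneg[OF q] in \<open>auto intro: summable_mult2 simp: abs_mult\<close>)
  qed (use p q in simp)
  have "norm (case x of (i, j) \<Rightarrow> p i * q j) = (case x of (i, j) \<Rightarrow> p i * q j)" for x
    using p(2) q(2) by (simp add: split_beta)
  then have "(\<lambda>x. norm (case x of (i, j) \<Rightarrow> p i * q j)) summable_on (Sigma UNIV (\<lambda>_. UNIV))"
    using pq by simp
  then have "(\<lambda>x. norm (case x of (i, j) \<Rightarrow> f i j)) summable_on (Sigma UNIV (\<lambda>_. UNIV))"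
    by (rule Infinite_Sum.abs_summable_on_comparison_test) (use f p(2) q(2) in \<open>auto simp: abs_mult\<close>)
  then have sum: "(\<lambda>(i, j). f i j) summable_on (Sigma UNIV (\<lambda>_. UNIV))" by (rule Infinite_Sum.abs_summable_summable)
  have row: "summable (\<lambda>j. norm (f i j))" for i
    by (rule summable_comparison_test'[where N = 0 and g = "\<lambda>j. p i * q j"])
       (use f q in \<open>auto intro: summable_mult\<close>)
  have iterate: "(\<lambda>x. infsum (F x) (B x)) sums infsum (\<lambda>(x, y). F x y) (Sigma UNIV B)"
    if "(\<lambda>(x, y). F x y) summable_on (Sigma UNIV B)" for F :: "nat \<Rightarrow> nat \<Rightarrow> 'b" and B
    using has_sum_imp_sums[OF has_sum_infsum[OF summable_on_Sigma_banach[OF that]]]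
    by (simp only: infsum_Sigma'_banach[OF that])
  have "infsum (f i) UNIV = suminf (f i)" for i
    by (rule infsumI[OF norm_summable_imp_has_sum[OF row summable_sums[OF summable_norm_cancel[OF row]]]])
  then have S: "suminf (\<lambda>i. suminf (f i)) = infsum (\<lambda>(i, j). f i j) (Sigma UNIV (\<lambda>_. UNIV))"
    using sums_unique[OF iterate[OF sum]] by simp
  \<comment> \<open>The pair (i, j) is sent to its diagonal i + j together with its row i, which
    parametrises the triangular index set.\<close>
  have bij: "((\<lambda>(k, i). f i (k - i)) has_sum s) (Sigma UNIV (\<lambda>k. {..k}))
      \<longleftrightarrow> ((\<lambda>(i, j). f i j) has_sum s) (Sigma UNIV (\<lambda>_. UNIV))" for s
    by (rule has_sum_reindex_bij_witness[where i = "\<lambda>(i, j). (i + j, i)" and j = "\<lambda>(k, i). (i, k - i)"]) auto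
  have hs: "((\<lambda>(k, i). f i (k - i)) has_sum suminf (\<lambda>i. suminf (f i))) (Sigma UNIV (\<lambda>k. {..k}))"
    unfolding bij S by (rule has_sum_infsum[OF sum])
  have "(\<lambda>k. infsum (\<lambda>i. f i (k - i)) {..k}) sums suminf (\<lambda>i. suminf (f i))"
    using iterate[of "\<lambda>k i. f i (k - i)" "\<lambda>k. {..k}", OF has_sum_imp_summable[OF hs]]
    by (simp only: infsumI[OF hs])
  then show ?thesis by simp
qed

lemma funpow_comp_commute:
  assumes "f \<circ> g = g \<circ> (f :: 'b \<Rightarrow> 'b)" shows "(f \<circ> g) ^^ n = (f ^^ n) \<circ> (g ^^ n)"
proof -
  define h where "h = f \<circ> g"
  have h: "h x = f (g x)" for x by (simp add: h_def)
  have c: "f (g x) = g (f x)" for x using fun_cong[OF assms, of x] by simp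
  have fg: "(f ^^ n) (g x) = g ((f ^^ n) x)" for x n by (induction n) (simp_all add: c)
  have "(h ^^ n) x = (f ^^ n) ((g ^^ n) x)" for x
    by (induction n) (simp_all add: h fg)
  then show ?thesis unfolding h_def[symmetric] by (intro ext) simp
qed

text \<open>\<open>U t\<close> is the N-th power of u (t / N) for N large; two subdivisions agree
  because both agree with their common refinement. The last conjunct lets any property of
  \<open>u\<close> that is stable under powers pass to \<open>U\<close>.\<close>

lemma local_group_extension:
  fixes u :: "real \<Rightarrow> 'b \<Rightarrow> 'b"
  assumes r: "r > 0" and u0: "u 0 = id"
    and grp: "\<And>s t. \<bar>s\<bar> < r \<Longrightarrow> \<bar>t\<bar> < r \<Longrightarrow> u (s + t) = u s \<circ> u t"
  shows "\<exists>U. (\<forall>s t. U (s + t) = U s \<circ> U t) \<and> (\<forall>t. \<bar>t\<bar> < r \<longrightarrow> U t = u t)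
    \<and> (\<forall>t. \<exists>n s. \<bar>s\<bar> < r \<and> U t = (u s) ^^ n)"
proof -
  have mult: "u (real n * s) = (u s) ^^ n" if "\<bar>real n * s\<bar> < r" for n s
    using that
  proof (induction n)
    case 0
    then show ?case by (simp add: u0 id_def)
  next
    case (Suc n)
    have "\<bar>real n * s\<bar> \<le> \<bar>real (Suc n) * s\<bar>" "\<bar>s\<bar> \<le> \<bar>real (Suc n) * s\<bar>"
      by (auto simp: abs_mult intro!: mult_right_mono) (simp add: mult_le_cancel_right1)
    then have lt: "\<bar>real n * s\<bar> < r" "\<bar>s\<bar> < r" using Suc.prems by linarith+
    have "u (real (Suc n) * s) = u (s + real n * s)" by (simp add: distrib_right add.commute)
    also have "\<dots> = u s \<circ> u (real n * s)" by (rule grp[OF lt(2,1)])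
    also have "\<dots> = (u s) ^^ Suc n" by (simp only: Suc.IH[OF lt(1)] funpow.simps)
    finally show ?case .
  qed
  have refine: "(u (t / (real N * real M))) ^^ (M * N) = (u (t / real N)) ^^ N"
    if "N > 0" "M > 0" "\<bar>t\<bar> / real N < r" for N M t
  proof -
    have eq: "real M * (t / (real N * real M)) = t / real N" using that(2) by simp
    have "\<bar>real M * (t / (real N * real M))\<bar> < r" unfolding eq using that(3) by simp
    from mult[OF this] have "u (t / real N) = (u (t / (real N * real M))) ^^ M" unfolding eq .
    then show ?thesis by (simp only: funpow_mult)
  qed
  \<comment> \<open>One more than the integer part of |t| / r makes the pieces strictly shorter than
    \<open>r\<close>.\<close>
  define N0 where "N0 t = nat \<lfloor>\<bar>t\<bar> / r\<rfloor> + 1" for t :: real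
  have N0: "N0 t > 0" "\<bar>t\<bar> / real (N0 t) < r" for t
  proof -
    have pos: "real (N0 t) > 0" by (simp add: N0_def)
    have "\<bar>t\<bar> / r < real (N0 t)" unfolding N0_def using r by (simp add: of_nat_nat) linarith
    then have "\<bar>t\<bar> < real (N0 t) * r" by (simp only: pos_divide_less_eq[OF r])
    then show "\<bar>t\<bar> / real (N0 t) < r" by (simp only: pos_divide_less_eq[OF pos] mult.commute)
  qed (simp add: N0_def)
  define U where "U t = (u (t / real (N0 t))) ^^ (N0 t)" for t
  have U: "U t = (u (t / real N)) ^^ N" if N: "N > 0" "\<bar>t\<bar> / real N < r" for N t
  proof -
    have "U t = (u (t / (real (N0 t) * real N))) ^^ (N * N0 t)" unfolding U_def by (rule refine[OF N0(1) N(1) N0(2), symmetric])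
    also have "\<dots> = (u (t / (real N * real (N0 t)))) ^^ (N0 t * N)" by (simp only: mult.commute)
    also have "\<dots> = (u (t / real N)) ^^ N" by (rule refine[OF N(1) N0(1) N(2)])
    finally show ?thesis .
  qed
  have "U (s + t) = U s \<circ> U t" for s t
  proof -
    define N where "N = N0 (\<bar>s\<bar> + \<bar>t\<bar>)"
    have N: "N > 0" "(\<bar>s\<bar> + \<bar>t\<bar>) / real N < r" using N0[of "\<bar>s\<bar> + \<bar>t\<bar>"] by (simp_all add: N_def)
    have le: "\<bar>s\<bar> / real N \<le> (\<bar>s\<bar> + \<bar>t\<bar>) / real N" "\<bar>t\<bar> / real N \<le> (\<bar>s\<bar> + \<bar>t\<bar>) / real N"
      "\<bar>s + t\<bar> / real N \<le> (\<bar>s\<bar> + \<bar>t\<bar>) / real N"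
      by (auto intro!: divide_right_mono)
    then have lt: "\<bar>s\<bar> / real N < r" "\<bar>t\<bar> / real N < r" "\<bar>s + t\<bar> / real N < r" using N(2) by linarith+
    then have lt': "\<bar>s / real N\<bar> < r" "\<bar>t / real N\<bar> < r" by simp_all
    have c: "u (s / real N) \<circ> u (t / real N) = u (t / real N) \<circ> u (s / real N)"
      using grp[OF lt'] grp[OF lt'(2,1)] by (simp only: add.commute)
    have "U (s + t) = (u (s / real N) \<circ> u (t / real N)) ^^ N"
      unfolding U[OF N(1) lt(3)] add_divide_distrib by (simp only: grp[OF lt'])
    also have "\<dots> = U s \<circ> U t"
      unfolding U[OF N(1) lt(1)] U[OF N(1) lt(2)] by (rule funpow_comp_commute[OF c])
    finally show ?thesis .
  qed
  moreover have "U t = u t" if "\<bar>t\<bar> < r" for t using U[of 1 t] that by (simp add: fun_eq_iff)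
  moreover have "\<exists>n s. \<bar>s\<bar> < r \<and> U t = (u s) ^^ n" for t
    using N0[of t] U_def[of t] by (intro exI[of _ "N0 t"] exI[of _ "t / real (N0 t)"]) simp
  ultimately show ?thesis by (intro exI[of _ U] conjI allI impI)
qed

lemma unitaryD:
  assumes "unitary U"
  shows "bounded_clinear U" "surj U" "cinner (U x) (U y) = cinner x y" "norm (U x) = norm x"
proof -
  show 1: "bounded_clinear U" "surj U" "\<And>x y. cinner (U x) (U y) = cinner x y" using assms by (auto simp: unitary_def)
  have "(norm (U x))\<^sup>2 = (norm x)\<^sup>2" by (simp only: norm_sq_cinner 1(3))
  then show "norm (U x) = norm x" by (simp add: power2_eq_iff_nonneg)
qed

lemma unitary_id: "unitary id"
  by (simp add: unitary_def bounded_clinear_id)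

lemma unitary_comp: assumes U: "unitary U" and V: "unitary V" shows "unitary (U \<circ> V)"
  unfolding unitary_def
  using bounded_clinear_comp[OF unitaryD(1)[OF U] unitaryD(1)[OF V]] comp_surj[OF unitaryD(2)[OF V] unitaryD(2)[OF U]]
  by (simp add: unitaryD(3)[OF U] unitaryD(3)[OF V])

lemma unitary_groupD:
  assumes "unitary_group U"
  shows "unitary (U t)" "U 0 = id" "U (s + t) = U s \<circ> U t" "continuous_on UNIV (\<lambda>t. U t x)"
    "U t (U (- t) x) = x" "U (- t) (U t x) = x" "U (s + t) x = U s (U t x)"
proof -
  show 1: "unitary (U t)" "U 0 = id" "U (s + t) = U s \<circ> U t" "continuous_on UNIV (\<lambda>t. U t x)" for s t x
    using assms by (auto simp: unitary_group_def)
  show "U (s + t) x = U s (U t x)" using fun_cong[OF 1(3)[of s t], of x] by simp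
  show "U t (U (- t) x) = x" using fun_cong[OF 1(3)[of t "-t"], of x] by (simp add: 1(2))
  show "U (- t) (U t x) = x" using fun_cong[OF 1(3)[of "-t" t], of x] by (simp add: 1(2))
qed

lemma unitary_group_cinner:
  assumes "unitary_group U" shows "cinner (U t x) y = cinner x (U (- t) y)"
  using unitaryD(3)[OF unitary_groupD(1)[OF assms, of t], of x "U (- t) y"] by (simp add: unitary_groupD(5)[OF assms])

text \<open>The group law carries the difference quotient at \<open>t\<close> back to 0, and
  \<open>U t\<close> preserves its error.\<close>

lemma generator_has_vector_derivative:
  assumes U: "unitary_group U" and g: "(\<xi>, \<zeta>) \<in> generator U"
  shows "((\<lambda>s. U s \<xi>) has_vector_derivative U t \<zeta>) (at t)"
  unfolding has_vector_derivative_def has_derivative_at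
proof
  show "bounded_linear (\<lambda>h. h *\<^sub>R U t \<zeta>)" by (rule bounded_linear_scaleR_left)
  have lim: "((\<lambda>h. norm ((U h \<xi> - \<xi>) /\<^sub>R h - \<zeta>)) \<longlongrightarrow> norm (\<zeta> - \<zeta>)) (at 0)"
    using g unfolding generator_def by (intro tendsto_norm tendsto_diff tendsto_const) simp
  have bt: "bounded_clinear (U t)" by (rule unitaryD(1)[OF unitary_groupD(1)[OF U]])
  have "norm ((U h \<xi> - \<xi>) /\<^sub>R h - \<zeta>) = norm (U (t + h) \<xi> - U t \<xi> - h *\<^sub>R U t \<zeta>) / norm h" if h: "h \<noteq> 0" for h
  proof -
    have "U (t + h) \<xi> - U t \<xi> - h *\<^sub>R U t \<zeta> = U t (U h \<xi> - \<xi> - h *\<^sub>R \<zeta>)"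
      by (simp add: unitary_groupD(7)[OF U] bounded_clinear_diff[OF bt] scaleR_scaleC bounded_clinear_scaleC[OF bt])
    then have "norm (U (t + h) \<xi> - U t \<xi> - h *\<^sub>R U t \<zeta>) = norm (U h \<xi> - \<xi> - h *\<^sub>R \<zeta>)"
      by (simp only: unitaryD(4)[OF unitary_groupD(1)[OF U]])
    also have "U h \<xi> - \<xi> - h *\<^sub>R \<zeta> = h *\<^sub>R ((U h \<xi> - \<xi>) /\<^sub>R h - \<zeta>)" using h by (simp add: scaleR_diff_right)
    also have "norm \<dots> = \<bar>h\<bar> * norm ((U h \<xi> - \<xi>) /\<^sub>R h - \<zeta>)" by (rule norm_scaleR)
    finally show ?thesis using h by simp
  qed
  then have "\<forall>\<^sub>F h in at 0. norm ((U h \<xi> - \<xi>) /\<^sub>R h - \<zeta>) = norm (U (t + h) \<xi> - U t \<xi> - h *\<^sub>R U t \<zeta>) / norm h"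
    by (simp add: eventually_at_filter)
  from Lim_transform_eventually[OF lim this]
  show "((\<lambda>h. norm (U (t + h) \<xi> - U t \<xi> - h *\<^sub>R U t \<zeta>) / norm h) \<longlongrightarrow> 0) (at 0)" by simp
qed

text \<open>This is the derivative at 0 of the constant function taking t to the inner product of
  \<open>U t \<xi>\<close> and \<open>U t \<xi>'\<close>.\<close>

lemma generator_antisymmetric:
  assumes U: "unitary_group U" and g: "(\<xi>, \<zeta>) \<in> generator U" "(\<xi>', \<zeta>') \<in> generator U"
  shows "cinner \<zeta> \<xi>' = - cinner \<xi> \<zeta>'"
proof -
  have "((\<lambda>t. cinner (U t \<xi>) (U t \<xi>')) has_vector_derivative (cinner (U 0 \<xi>) (U 0 \<zeta>') + cinner (U 0 \<zeta>) (U 0 \<xi>'))) (at 0)"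
    by (rule bounded_bilinear.has_vector_derivative[OF bounded_bilinear_cinner])
       (rule generator_has_vector_derivative[OF U g(1)] generator_has_vector_derivative[OF U g(2)])+
  moreover have "((\<lambda>t. cinner (U t \<xi>) (U t \<xi>')) has_vector_derivative 0) (at 0)"
    by (simp add: unitaryD(3)[OF unitary_groupD(1)[OF U]])
  ultimately have "cinner (U 0 \<xi>) (U 0 \<zeta>') + cinner (U 0 \<zeta>) (U 0 \<xi>') = 0"
    by (rule vector_derivative_unique_at)
  then show ?thesis by (simp add: unitary_groupD(2)[OF U] eq_neg_iff_add_eq_0 add.commute)
qed

lemma generator_invariant:
  assumes U: "unitary_group U" and g: "(\<xi>, \<zeta>) \<in> generator U"
  shows "(U t \<xi>, U t \<zeta>) \<in> generator U"
proof -
  have bt: "bounded_clinear (U t)" by (rule unitaryD(1)[OF unitary_groupD(1)[OF U]])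
  have "((\<lambda>h. U t ((U h \<xi> - \<xi>) /\<^sub>R h)) \<longlongrightarrow> U t \<zeta>) (at 0)"
    by (rule bounded_clinear_tendsto[OF bt]) (use g in \<open>simp add: generator_def\<close>)
  moreover have "U t ((U h \<xi> - \<xi>) /\<^sub>R h) = (U h (U t \<xi>) - U t \<xi>) /\<^sub>R h" for h
    using unitary_groupD(7)[OF U, of t h \<xi>] unitary_groupD(7)[OF U, of h t \<xi>]
    by (simp add: scaleR_scaleC bounded_clinear_scaleC[OF bt] bounded_clinear_diff[OF bt] add.commute)
  ultimately show ?thesis by (simp add: generator_def)
qed

text \<open>The linearised mean value inequality bounds U t \<xi> - \<xi> - t \<zeta> by |t| times
  the oscillation of s to U s \<zeta>. This estimate survives the limit of the pairs and is then
  divided by t.\<close>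

lemma generator_closed:
  assumes U: "unitary_group U" shows "closed (generator U)"
  unfolding closed_sequential_limits
proof (intro allI impI, elim conjE)
  fix x and l :: "'a \<times> 'a"
  assume x: "\<forall>n. x n \<in> generator U" and lim: "x \<longlonglongrightarrow> l"
  define \<xi> \<zeta> where "\<xi> = fst l" and "\<zeta> = snd l"
  define X Z where "X n = fst (x n)" and "Z n = snd (x n)" for n
  have X: "X \<longlonglongrightarrow> \<xi>" and Z: "Z \<longlonglongrightarrow> \<zeta>"
    unfolding X_def[abs_def] Z_def[abs_def] \<xi>_def \<zeta>_def using tendsto_fst[OF lim] tendsto_snd[OF lim] by simp_all
  have XZ: "(X n, Z n) \<in> generator U" for n using x by (simp add: X_def Z_def)
  have un: "norm (U s v) = norm v" for s v by (rule unitaryD(4)[OF unitary_groupD(1)[OF U]])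
  have bU: "bounded_clinear (U s)" for s by (rule unitaryD(1)[OF unitary_groupD(1)[OF U]])
  have "((\<lambda>t. (U t \<xi> - \<xi>) /\<^sub>R t) \<longlongrightarrow> \<zeta>) (at 0)"
  proof (rule tendstoI)
    fix e :: real assume e: "e > 0"
    have "\<exists>d>0. \<forall>s\<in>UNIV. dist s 0 < d \<longrightarrow> dist (U s \<zeta>) (U 0 \<zeta>) < e / 2"
      using unitary_groupD(4)[OF U, of \<zeta>, unfolded continuous_on_iff, rule_format, of 0 "e / 2"] e by simp
    then obtain d where d: "d > 0" "\<And>s. \<bar>s\<bar> < d \<Longrightarrow> norm (U s \<zeta> - \<zeta>) < e / 2"
      by (auto simp: dist_norm unitary_groupD(2)[OF U])
    have main: "norm (U t \<xi> - \<xi> - t *\<^sub>R \<zeta>) \<le> \<bar>t\<bar> * (e / 2)" if t: "\<bar>t\<bar> < d" for t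
    proof (rule LIMSEQ_le)
      show "(\<lambda>n. norm (U t (X n) - X n - t *\<^sub>R Z n)) \<longlonglongrightarrow> norm (U t \<xi> - \<xi> - t *\<^sub>R \<zeta>)"
        by (intro tendsto_intros bounded_clinear_tendsto[OF bU] X Z)
      have "(\<lambda>n. \<bar>t\<bar> * (e / 2 + 2 * norm (Z n - \<zeta>))) \<longlonglongrightarrow> \<bar>t\<bar> * (e / 2 + 2 * norm (\<zeta> - \<zeta>))"
        by (intro tendsto_intros Z)
      then show "(\<lambda>n. \<bar>t\<bar> * (e / 2 + 2 * norm (Z n - \<zeta>))) \<longlonglongrightarrow> \<bar>t\<bar> * (e / 2)" by simp
      \<comment> \<open>The factor 2 pays for replacing \<open>Z n\<close> by its limit once at
        \<open>s\<close> and once at 0.\<close>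
      have "norm (U t (X n) - U 0 (X n) - (t - 0) *\<^sub>R U 0 (Z n)) \<le> norm (t - 0) * (e / 2 + 2 * norm (Z n - \<zeta>))" for n
      proof (rule vector_differentiable_bound_linearization[where S = "closed_segment 0 t"])
        show "((\<lambda>s. U s (X n)) has_vector_derivative U s (Z n)) (at s within closed_segment 0 t)" for s
          by (rule has_vector_derivative_at_within[OF generator_has_vector_derivative[OF U XZ]])
        show "norm (U s (Z n) - U 0 (Z n)) \<le> e / 2 + 2 * norm (Z n - \<zeta>)" if s: "s \<in> closed_segment 0 t" for s
        proof -
          have "\<bar>s\<bar> < d" using s t unfolding closed_segment_eq_real_ivl by (auto split: if_splits)
          from d(2)[OF this] have 1: "norm (U s \<zeta> - \<zeta>) < e / 2" .
          have "U s (Z n) - Z n = U s (Z n - \<zeta>) + (U s \<zeta> - \<zeta>) - (Z n - \<zeta>)"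
            by (simp add: bounded_clinear_diff[OF bU])
          then have "norm (U s (Z n) - Z n) \<le> norm (U s (Z n - \<zeta>)) + norm (U s \<zeta> - \<zeta>) + norm (Z n - \<zeta>)"
            using norm_triangle_ineq4[of "U s (Z n - \<zeta>) + (U s \<zeta> - \<zeta>)" "Z n - \<zeta>"]
              norm_triangle_ineq[of "U s (Z n - \<zeta>)" "U s \<zeta> - \<zeta>"] by simp
          then show ?thesis using 1 by (simp add: un unitary_groupD(2)[OF U])
        qed
      qed simp_all
      then show "\<exists>N. \<forall>n\<ge>N. norm (U t (X n) - X n - t *\<^sub>R Z n) \<le> \<bar>t\<bar> * (e / 2 + 2 * norm (Z n - \<zeta>))"
        by (simp add: unitary_groupD(2)[OF U])
    qed
    have "dist ((U t \<xi> - \<xi>) /\<^sub>R t) \<zeta> < e" if t: "t \<noteq> 0" "\<bar>t\<bar> < d" for t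
    proof -
      have "U t \<xi> - \<xi> - t *\<^sub>R \<zeta> = t *\<^sub>R ((U t \<xi> - \<xi>) /\<^sub>R t - \<zeta>)" using t(1) by (simp add: scaleR_diff_right)
      then have "norm (U t \<xi> - \<xi> - t *\<^sub>R \<zeta>) = \<bar>t\<bar> * norm ((U t \<xi> - \<xi>) /\<^sub>R t - \<zeta>)" by (simp only: norm_scaleR)
      then have "\<bar>t\<bar> * norm ((U t \<xi> - \<xi>) /\<^sub>R t - \<zeta>) \<le> \<bar>t\<bar> * (e / 2)" using main[OF t(2)] by simp
      then have "norm ((U t \<xi> - \<xi>) /\<^sub>R t - \<zeta>) \<le> e / 2" using t(1) by (simp add: mult_le_cancel_left)
      then show ?thesis using e by (simp add: dist_norm)
    qed
    then show "\<forall>\<^sub>F t in at 0. dist ((U t \<xi> - \<xi>) /\<^sub>R t) \<zeta> < e"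
      unfolding eventually_at using d(1) by (intro exI[of _ d]) (simp add: dist_norm)
  qed
  then show "l \<in> generator U" by (simp add: generator_def \<xi>_def \<zeta>_def split_beta)
qed

text \<open>By antisymmetry of the common generator the inner product of \<open>U t \<xi>\<close>
  with \<open>V t \<xi>'\<close> has derivative zero; hence \<open>V (- t) \<circ> U t\<close> is
  the identity when tested on a dense domain.\<close>

lemma unitary_group_unique:
  assumes U: "unitary_group U" and V: "unitary_group V" and eq: "generator U = generator V"
    and dense: "closure (Domain (generator U)) = UNIV"
  shows "U = V"
proof
  fix t
  have bU: "bounded_clinear (U t)" by (rule unitaryD(1)[OF unitary_groupD(1)[OF U]])
  have bV: "bounded_clinear (V s)" for s by (rule unitaryD(1)[OF unitary_groupD(1)[OF V]])
  have const: "cinner (U t \<xi>) (V t \<xi>') = cinner \<xi> \<xi>'" if g: "(\<xi>, \<zeta>) \<in> generator U" "(\<xi>', \<zeta>') \<in> generator U" for \<xi> \<zeta> \<xi>' \<zeta>'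
  proof -
    have g': "(\<xi>', \<zeta>') \<in> generator V" using g(2) eq by simp
    have "((\<lambda>t. cinner (U t \<xi>) (V t \<xi>')) has_derivative (\<lambda>h. 0)) (at s within UNIV)" for s
    proof -
      have "((\<lambda>t. cinner (U t \<xi>) (V t \<xi>')) has_vector_derivative (cinner (U s \<xi>) (V s \<zeta>') + cinner (U s \<zeta>) (V s \<xi>'))) (at s)"
        by (rule bounded_bilinear.has_vector_derivative[OF bounded_bilinear_cinner
              generator_has_vector_derivative[OF U g(1)] generator_has_vector_derivative[OF V g']])
      moreover have "cinner (U s \<zeta>) (V s \<xi>') = - cinner (U s \<xi>) (V s \<zeta>')"
        by (rule generator_antisymmetric[OF V]) (use generator_invariant[OF U g(1)] generator_invariant[OF V g'] eq in simp_all)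
      ultimately show ?thesis by (simp add: has_vector_derivative_def)
    qed
    from has_derivative_zero_unique[OF convex_UNIV this UNIV_I UNIV_I, of t 0]
    show ?thesis by (simp add: unitary_groupD(2)[OF U] unitary_groupD(2)[OF V])
  qed
  show "U t = V t"
  proof (rule bounded_clinear_eq_on_dense[OF bU bV dense])
    fix \<xi> assume "\<xi> \<in> Domain (generator U)"
    then obtain \<zeta> where g: "(\<xi>, \<zeta>) \<in> generator U" by (rule DomainE)
    have "V (- t) (U t \<xi> - V t \<xi>) = 0"
    proof (rule dense_orthogonal_zero[OF dense])
      fix \<xi>' assume "\<xi>' \<in> Domain (generator U)"
      then obtain \<zeta>' where g': "(\<xi>', \<zeta>') \<in> generator U" by (rule DomainE)
      have "cinner (U t \<xi> - V t \<xi>) (V t \<xi>') = 0"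
        using const[OF g g'] unitaryD(3)[OF unitary_groupD(1)[OF V, of t], of \<xi> \<xi>'] by (simp add: cinner_diff_left)
      then have "cinner (V t \<xi>') (U t \<xi> - V t \<xi>) = 0" using cinner_commute[of "V t \<xi>'" "U t \<xi> - V t \<xi>"] by simp
      then show "cinner \<xi>' (V (- t) (U t \<xi> - V t \<xi>)) = 0" by (simp only: unitary_group_cinner[OF V])
    qed
    then have "norm (U t \<xi> - V t \<xi>) = 0" using unitaryD(4)[OF unitary_groupD(1)[OF V], of "- t" "U t \<xi> - V t \<xi>"] by simp
    then show "U t \<xi> = V t \<xi>" by simp
  qed
qed

text \<open>Identifies the definite description with a group that has been constructed explicitly;
  selfadjointness supplies the dense domain on which uniqueness rests.\<close>

lemma exp_i_eqI:
  assumes H: "selfadjoint_operator H" and U: "unitary_group U"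
    and gen: "generator U = {(\<xi>, \<i> *\<^sub>C \<zeta>) | \<xi> \<zeta>. (\<xi>, \<zeta>) \<in> H}"
  shows "exp_i H = U"
  unfolding exp_i_def
proof (rule the_equality)
  show "unitary_group U \<and> generator U = {(\<xi>, \<i> *\<^sub>C \<zeta>) | \<xi> \<zeta>. (\<xi>, \<zeta>) \<in> H}" using U gen by (rule conjI)
  fix V assume V: "unitary_group V \<and> generator V = {(\<xi>, \<i> *\<^sub>C \<zeta>) | \<xi> \<zeta>. (\<xi>, \<zeta>) \<in> H}"
  have "Domain (generator V) = Domain H" using V by (auto simp: Domain_iff)
  moreover have "closure (Domain H) = UNIV"
    using H unfolding selfadjoint_operator_def densely_defined_operator_def by simp
  ultimately have dense: "closure (Domain (generator V)) = UNIV" by simp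
  show "V = U" by (rule unitary_group_unique[OF _ U _ dense]) (use V gen in simp_all)
qed

lemma closure_prod_sequences:
  fixes G :: "('l::complex_hilbert \<times> 'l) set"
  assumes "(u, v) \<in> closure G"
  obtains p q where "\<And>n. (p n, q n) \<in> G" "p \<longlonglongrightarrow> u" "q \<longlonglongrightarrow> v"
proof -
  obtain f where f: "\<forall>n. f n \<in> G" "f \<longlonglongrightarrow> (u, v)" using assms unfolding closure_sequential by (elim exE conjE)
  show thesis
    by (rule that[of "\<lambda>n. fst (f n)" "\<lambda>n. snd (f n)"]) (use f tendsto_fst[OF f(2)] tendsto_snd[OF f(2)] in simp_all)
qed

text \<open>The criterion by dense ranges of G + i and G - i. The first range gives the solution
  that the adjoint pair is compared with, the second shows that the two coincide.\<close>

theorem essentially_selfadjoint: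
  fixes G :: "('l::complex_hilbert \<times> 'l) set"
  assumes zero: "(0, 0) \<in> G"
    and plus: "\<And>u v u' v'. (u, v) \<in> G \<Longrightarrow> (u', v') \<in> G \<Longrightarrow> (u + u', v + v') \<in> G"
    and scale: "\<And>c u v. (u, v) \<in> G \<Longrightarrow> (c *\<^sub>C u, c *\<^sub>C v) \<in> G"
    and dense: "closure (Domain G) = UNIV"
    and sym: "\<And>u v u' v'. (u, v) \<in> G \<Longrightarrow> (u', v') \<in> G \<Longrightarrow> cinner v u' = cinner u v'"
    and range: "closure {v + \<i> *\<^sub>C u | u v. (u, v) \<in> G} = UNIV" "closure {v - \<i> *\<^sub>C u | u v. (u, v) \<in> G} = UNIV"
  shows "selfadjoint_operator (closure G)"
proof -
  define C where "C = closure G"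
  have GC: "G \<subseteq> C" unfolding C_def by (rule closure_subset)
  have Cplus: "(u + u', v + v') \<in> C" if c: "(u, v) \<in> C" "(u', v') \<in> C" for u v u' v'
  proof -
    obtain p q where pq: "\<And>n. (p n, q n) \<in> G" "p \<longlonglongrightarrow> u" "q \<longlonglongrightarrow> v"
      using c(1) unfolding C_def by (rule closure_prod_sequences) (rule that)
    obtain p' q' where pq': "\<And>n. (p' n, q' n) \<in> G" "p' \<longlonglongrightarrow> u'" "q' \<longlonglongrightarrow> v'"
      using c(2) unfolding C_def by (rule closure_prod_sequences) (rule that)
    show ?thesis unfolding C_def closure_sequential
      by (intro exI[of _ "\<lambda>n. (p n + p' n, q n + q' n)"] conjI allI plus pq pq' tendsto_Pair tendsto_add)
  qed
  have Cscale: "(c *\<^sub>C u, c *\<^sub>C v) \<in> C" if uv: "(u, v) \<in> C" for c u v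
  proof -
    obtain p q where pq: "\<And>n. (p n, q n) \<in> G" "p \<longlonglongrightarrow> u" "q \<longlonglongrightarrow> v"
      using uv unfolding C_def by (rule closure_prod_sequences) (rule that)
    show ?thesis unfolding C_def closure_sequential
      by (intro exI[of _ "\<lambda>n. (c *\<^sub>C p n, c *\<^sub>C q n)"] conjI allI scale pq tendsto_Pair
          bounded_linear.tendsto[OF bounded_linear_scaleC])
  qed
  have symGC: "cinner v u' = cinner u v'" if c: "(u, v) \<in> G" "(u', v') \<in> C" for u v u' v'
  proof -
    obtain p q where pq: "\<And>n. (p n, q n) \<in> G" "p \<longlonglongrightarrow> u'" "q \<longlonglongrightarrow> v'"
      using c(2) unfolding C_def by (rule closure_prod_sequences) (rule that)
    have "(\<lambda>n. cinner v (p n)) \<longlonglongrightarrow> cinner v u'" "(\<lambda>n. cinner u (q n)) \<longlonglongrightarrow> cinner u v'"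
      by (intro tendsto_cinner tendsto_const pq)+
    then show ?thesis using sym[OF c(1) pq(1)] LIMSEQ_unique by simp
  qed
  have symC: "cinner v u' = cinner u v'" if c: "(u, v) \<in> C" "(u', v') \<in> C" for u v u' v'
  proof -
    obtain p q where pq: "\<And>n. (p n, q n) \<in> G" "p \<longlonglongrightarrow> u" "q \<longlonglongrightarrow> v"
      using c(1) unfolding C_def by (rule closure_prod_sequences) (rule that)
    have "(\<lambda>n. cinner (q n) u') \<longlonglongrightarrow> cinner v u'" "(\<lambda>n. cinner (p n) v') \<longlonglongrightarrow> cinner u v'"
      by (intro tendsto_cinner tendsto_const pq)+
    then show ?thesis using symGC[OF pq(1) c(2)] LIMSEQ_unique by simp
  qed
  have sv: "v = v'" if c: "(u, v) \<in> C" "(u, v') \<in> C" for u v v'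
  proof -
    have "v - v' = 0"
    proof (rule dense_orthogonal_zero[OF dense])
      fix x assume "x \<in> Domain G"
      then obtain y where y: "(x, y) \<in> G" by (rule DomainE)
      show "cinner x (v - v') = 0"
        using symGC[OF y c(1)] symGC[OF y c(2)] by (simp add: cinner_diff_right)
    qed
    then show ?thesis by simp
  qed
  have "closure (Domain C) = UNIV" using closure_mono[OF Domain_mono[OF GC]] dense by auto
  moreover have "single_valued C" using sv by (auto intro!: single_valuedI)
  ultimately have dd: "densely_defined_operator C"
    unfolding densely_defined_operator_def using Cplus Cscale GC zero by auto
  have "C \<subseteq> graph_adjoint C" unfolding graph_adjoint_def using symC by auto
  moreover have "(\<xi>, \<zeta>) \<in> C" if adj: "(\<xi>, \<zeta>) \<in> graph_adjoint C" for \<xi> \<zeta>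
  proof -
    have adj: "cinner v \<xi> = cinner u \<zeta>" if "(u, v) \<in> C" for u v
      using adj that by (auto simp: graph_adjoint_def)
    \<comment> \<open>For a pair in the adjoint, this vector is approximated in the range of G + i;
      the corresponding pairs of \<open>G\<close> will converge to some (u, v) in the closure with v
      + i u equal to it.\<close>
    have "\<zeta> + \<i> *\<^sub>C \<xi> \<in> closure {v + \<i> *\<^sub>C u | u v. (u, v) \<in> G}" using range(1) by simp
    then obtain f where f: "\<forall>n. f n \<in> {v + \<i> *\<^sub>C u | u v. (u, v) \<in> G}" "f \<longlonglongrightarrow> \<zeta> + \<i> *\<^sub>C \<xi>"
      unfolding closure_sequential by (elim exE conjE)
    have "\<forall>n. \<exists>p. p \<in> G \<and> f n = snd p + \<i> *\<^sub>C fst p" using f(1) by force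
    from choice[OF this] obtain p where p: "\<forall>n. p n \<in> G \<and> f n = snd (p n) + \<i> *\<^sub>C fst (p n)" by (rule exE)
    have pG: "(fst (p n), snd (p n)) \<in> G" for n using p by simp
    \<comment> \<open>Symmetry makes the inner product of \<open>v\<close> and \<open>u\<close>
      real, so the cross term vanishes. Convergence in the range thus forces convergence of both
      components.\<close>
    have iso: "(norm (v + \<i> *\<^sub>C u))\<^sup>2 = (norm v)\<^sup>2 + (norm u)\<^sup>2" if "(u, v) \<in> G" for u v
    proof -
      have "cinner v u = cinner u v" by (rule sym[OF that that])
      then have "cnj (cinner v u) = cinner v u" using cinner_commute[of u v] by simp
      then have "Im (cinner v u) = 0" by (simp add: complex_eq_iff)
      then show ?thesis by (simp add: norm_add_sq cinner_scaleC_right)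
    qed
    have diffG: "(fst (p m) - fst (p n), snd (p m) - snd (p n)) \<in> G" for m n
      using plus[OF pG[of m] scale[OF pG[of n], of "- 1"]] by simp
    have le: "norm (fst (p m) - fst (p n)) \<le> norm (f m - f n)" "norm (snd (p m) - snd (p n)) \<le> norm (f m - f n)" for m n
    proof -
      have "f m - f n = (snd (p m) - snd (p n)) + \<i> *\<^sub>C (fst (p m) - fst (p n))"
        using p by (simp add: scaleC_diff_right)
      then have eq: "(norm (f m - f n))\<^sup>2 = (norm (snd (p m) - snd (p n)))\<^sup>2 + (norm (fst (p m) - fst (p n)))\<^sup>2"
        using iso[OF diffG] by simp
      show "norm (fst (p m) - fst (p n)) \<le> norm (f m - f n)" "norm (snd (p m) - snd (p n)) \<le> norm (f m - f n)"
        by (rule power2_le_imp_le; simp add: eq)+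
    qed
    have "Cauchy f" by (rule LIMSEQ_imp_Cauchy[OF f(2)])
    have "Cauchy g" if "\<And>m n. norm (g m - g n) \<le> norm (f m - f n)" for g :: "nat \<Rightarrow> 'l"
    proof (rule CauchyI)
      fix e :: real assume "e > 0"
      then obtain N where "\<forall>m\<ge>N. \<forall>n\<ge>N. norm (f m - f n) < e" using CauchyD[OF \<open>Cauchy f\<close>] by blast
      then show "\<exists>N. \<forall>m\<ge>N. \<forall>n\<ge>N. norm (g m - g n) < e" using that le_less_trans by blast
    qed
    from this[OF le(1)] this[OF le(2)] obtain u v where uv: "(\<lambda>n. fst (p n)) \<longlonglongrightarrow> u" "(\<lambda>n. snd (p n)) \<longlonglongrightarrow> v"
      unfolding Cauchy_convergent_iff convergent_def by (elim exE)
    have uvC: "(u, v) \<in> C" unfolding C_def closure_sequential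
      by (intro exI[of _ p] conjI) (use p tendsto_Pair[OF uv] in simp_all)
    have "(\<lambda>n. snd (p n) + \<i> *\<^sub>C fst (p n)) \<longlonglongrightarrow> v + \<i> *\<^sub>C u"
      by (intro tendsto_add uv bounded_linear.tendsto[OF bounded_linear_scaleC])
    moreover have "(\<lambda>n. snd (p n) + \<i> *\<^sub>C fst (p n)) = f" using p by auto
    ultimately have fl: "v + \<i> *\<^sub>C u = \<zeta> + \<i> *\<^sub>C \<xi>" using LIMSEQ_unique[OF f(2)] by simp
    \<comment> \<open>The two pairs have the same image under G + i, so their second components
      differ by -i d; testing against \<open>G\<close> makes \<open>d\<close> orthogonal to the
      range of G - i.\<close>
    define d where "d = \<xi> - u"
    have zv: "\<zeta> - v = - (\<i> *\<^sub>C d)" using fl by (simp add: d_def scaleC_diff_right algebra_simps)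
    have "d = 0"
    proof (rule dense_orthogonal_zero[OF range(2)])
      fix x assume "x \<in> {v - \<i> *\<^sub>C u | u v. (u, v) \<in> G}"
      then obtain u' v' where x: "x = v' - \<i> *\<^sub>C u'" "(u', v') \<in> G" by auto
      have C': "(u', v') \<in> C" using x(2) GC by auto
      have "cinner v' d = cinner u' (\<zeta> - v)"
        using adj[OF C'] symC[OF C' uvC] by (simp add: d_def cinner_diff_right)
      then show "cinner x d = 0" unfolding zv x(1) by (simp add: cinner_simps)
    qed
    then have "\<xi> = u" "\<zeta> = v" using zv by (simp_all add: d_def)
    then show ?thesis using uvC by simp
  qed
  ultimately have "graph_adjoint C = C" by auto
  then show ?thesis using dd unfolding selfadjoint_operator_def C_def by simp
qed

text \<open>A selfadjoint operator has no proper symmetric extension: antisymmetry puts every pair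
  of the generator, up to the factor i, into the adjoint of the closure, which is the
  closure.\<close>

lemma generator_eq_closure:
  assumes U: "unitary_group U" and sa: "selfadjoint_operator (closure G)"
    and G: "\<And>\<xi> \<zeta>. (\<xi>, \<zeta>) \<in> G \<Longrightarrow> (\<xi>, \<i> *\<^sub>C \<zeta>) \<in> generator U"
  shows "generator U = {(\<xi>, \<i> *\<^sub>C \<zeta>) | \<xi> \<zeta>. (\<xi>, \<zeta>) \<in> closure G}"
proof -
  have sub: "(\<xi>, \<i> *\<^sub>C \<zeta>) \<in> generator U" if c: "(\<xi>, \<zeta>) \<in> closure G" for \<xi> \<zeta>
  proof -
    obtain p q where pq: "\<And>n. (p n, q n) \<in> G" "p \<longlonglongrightarrow> \<xi>" "q \<longlonglongrightarrow> \<zeta>"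
      using c by (rule closure_prod_sequences) (rule that)
    show ?thesis
      by (rule closed_sequentially[OF generator_closed[OF U], of "\<lambda>n. (p n, \<i> *\<^sub>C q n)"])
         (intro G pq tendsto_Pair bounded_linear.tendsto[OF bounded_linear_scaleC])+
  qed
  moreover have "\<exists>\<zeta>'. \<zeta> = \<i> *\<^sub>C \<zeta>' \<and> (\<xi>, \<zeta>') \<in> closure G" if g: "(\<xi>, \<zeta>) \<in> generator U" for \<xi> \<zeta>
  proof (intro exI conjI)
    show "\<zeta> = \<i> *\<^sub>C ((- \<i>) *\<^sub>C \<zeta>)" by (simp add: scaleC_scaleC)
    have "cinner v \<xi> = cinner u ((- \<i>) *\<^sub>C \<zeta>)" if "(u, v) \<in> closure G" for u v
    proof -
      have "\<i> * cinner v \<xi> = - cinner u \<zeta>"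
        using generator_antisymmetric[OF U sub[OF that] g] by (simp add: cinner_scaleC_left)
      then have "- \<i> * (\<i> * cinner v \<xi>) = - \<i> * - cinner u \<zeta>" by (rule arg_cong)
      then show ?thesis by (simp add: cinner_scaleC_right)
    qed
    then have "(\<xi>, (- \<i>) *\<^sub>C \<zeta>) \<in> graph_adjoint (closure G)" by (auto simp: graph_adjoint_def)
    then show "(\<xi>, (- \<i>) *\<^sub>C \<zeta>) \<in> closure G" using sa unfolding selfadjoint_operator_def by simp
  qed
  ultimately show ?thesis by auto
qed

section \<open>The flow of the derivation\<close>

lemma commutant_bounded: "T \<in> commutant X \<Longrightarrow> bounded_clinear T"
  and commutant_comp: "T \<in> commutant X \<Longrightarrow> S \<in> X \<Longrightarrow> T \<circ> S = S \<circ> T"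
  by (simp_all add: commutant_def)

lemma commutant_antimono: "X \<subseteq> Z \<Longrightarrow> commutant Z \<subseteq> commutant X"
  unfolding commutant_def by auto

lemma subset_bicommutant:
  assumes "\<And>S. S \<in> X \<Longrightarrow> bounded_clinear S" shows "X \<subseteq> commutant (commutant X)"
proof
  fix S assume S: "S \<in> X"
  have "S \<circ> T = T \<circ> S" if "T \<in> commutant X" for T using commutant_comp[OF that S] by (rule sym)
  then show "S \<in> commutant (commutant X)"
    unfolding commutant_def[of "commutant X"] using assms[OF S] by simp
qed

lemma commutant_unital_subalgebra:
  assumes X: "\<And>S. S \<in> X \<Longrightarrow> bounded_clinear S" shows "unital_subalgebra (commutant X)"
  unfolding unital_subalgebra_def
proof (intro conjI ballI allI)
  show "bounded_clinear S" if "S \<in> commutant X" for S by (rule commutant_bounded[OF that])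
  show "id \<in> commutant X" by (simp add: commutant_def bounded_clinear_id)
  fix S assume S: "S \<in> commutant X"
  have cS: "S (x y) = x (S y)" if "x \<in> X" for x y using fun_cong[OF commutant_comp[OF S that], of y] by simp
  show "(\<lambda>x. c *\<^sub>C S x) \<in> commutant X" for c
    unfolding commutant_def using commutant_bounded[OF S]
    by (auto intro!: ext bounded_clinear_scale simp: cS bounded_clinear_scaleC[OF X])
  fix T assume T: "T \<in> commutant X"
  have cT: "T (x y) = x (T y)" if "x \<in> X" for x y using fun_cong[OF commutant_comp[OF T that], of y] by simp
  show "(\<lambda>x. S x + T x) \<in> commutant X"
    unfolding commutant_def using commutant_bounded[OF S] commutant_bounded[OF T]
    by (auto intro!: ext bounded_clinear_plus simp: cS cT bounded_clinear_add[OF X])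
  show "S \<circ> T \<in> commutant X"
    unfolding commutant_def using commutant_bounded[OF S] commutant_bounded[OF T]
    by (auto intro!: ext bounded_clinear_comp simp: cS cT)
qed

lemma commutant_adj:
  assumes X: "\<And>S. S \<in> X \<Longrightarrow> bounded_clinear S" "\<And>S. S \<in> X \<Longrightarrow> adj S \<in> X" and T: "T \<in> commutant X"
  shows "adj T \<in> commutant X"
proof -
  have bT: "bounded_clinear T" by (rule commutant_bounded[OF T])
  have "adj T \<circ> S = S \<circ> adj T" if S: "S \<in> X" for S
  proof -
    have "adj (T \<circ> adj S) = adj (adj S \<circ> T)" using commutant_comp[OF T X(2)[OF S]] by simp
    then show ?thesis
      by (simp only: adj_comp[OF bT X(1)[OF X(2)[OF S]]] adj_comp[OF X(1)[OF X(2)[OF S]] bT] adj_adj[OF X(1)[OF S]])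
  qed
  then show ?thesis unfolding commutant_def using bounded_clinear_adj[OF bT] by simp
qed

text \<open>The threefold commutant collapses to the commutant, so the bicommutant equals its own
  bicommutant.\<close>

lemma von_neumann_bicommutant:
  assumes X: "\<And>S. S \<in> X \<Longrightarrow> bounded_clinear S" "\<And>S. S \<in> X \<Longrightarrow> adj S \<in> X"
  shows "von_neumann_algebra (commutant (commutant X))"
proof -
  have c1: "commutant (commutant (commutant Z)) = commutant Z" if "\<And>S. S \<in> Z \<Longrightarrow> bounded_clinear S"
    for Z :: "('a \<Rightarrow> 'a) set"
  proof
    show "commutant (commutant (commutant Z)) \<subseteq> commutant Z"
      by (rule commutant_antimono[OF subset_bicommutant[OF that]])
    show "commutant Z \<subseteq> commutant (commutant (commutant Z))"
      by (rule subset_bicommutant[OF commutant_bounded])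
  qed
  have a1: "adj T \<in> commutant X" if "T \<in> commutant X" for T by (rule commutant_adj[OF X that])
  have a2: "adj T \<in> commutant (commutant X)" if "T \<in> commutant (commutant X)" for T
    by (rule commutant_adj[OF commutant_bounded a1 that])
  show ?thesis unfolding von_neumann_algebra_def
    using commutant_unital_subalgebra[OF commutant_bounded[of _ X]] a2 by (simp add: c1[OF X(1)])
qed

text \<open>Pascal's rule for iterated Leibniz expansions. The family \<open>a\<close> is left
  abstract because it serves both for inner products and for products of operators.\<close>

lemma binomial_sum_Suc:
  fixes a :: "nat \<Rightarrow> nat \<Rightarrow> 'b::real_vector"
  shows "(\<Sum>i\<le>Suc k. real (Suc k choose i) *\<^sub>R a i (Suc k - i)) =
    (\<Sum>i\<le>k. real (k choose i) *\<^sub>R a (Suc i) (k - i)) + (\<Sum>i\<le>k. real (k choose i) *\<^sub>R a i (Suc (k - i)))"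
proof -
  have 1: "(\<Sum>i\<le>Suc k. real (Suc k choose i) *\<^sub>R a i (Suc k - i))
    = a 0 (Suc k) + (\<Sum>i\<le>k. real (Suc k choose Suc i) *\<^sub>R a (Suc i) (k - i))"
    by (simp only: sum.atMost_Suc_shift binomial_n_0 of_nat_1 scaleR_one diff_zero diff_Suc_Suc)
  have 2: "real (Suc k choose Suc i) *\<^sub>R a (Suc i) (k - i) =
    real (k choose i) *\<^sub>R a (Suc i) (k - i) + real (k choose Suc i) *\<^sub>R a (Suc i) (k - i)" for i
    by (simp add: scaleR_add_left)
  have "(\<Sum>i\<le>Suc k. real (k choose i) *\<^sub>R a i (Suc k - i))
    = a 0 (Suc k) + (\<Sum>i\<le>k. real (k choose Suc i) *\<^sub>R a (Suc i) (k - i))"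
    by (simp only: sum.atMost_Suc_shift binomial_n_0 of_nat_1 scaleR_one diff_zero diff_Suc_Suc)
  moreover have "(\<Sum>i\<le>Suc k. real (k choose i) *\<^sub>R a i (Suc k - i)) = (\<Sum>i\<le>k. real (k choose i) *\<^sub>R a i (Suc k - i))"
    by simp
  moreover have "(\<Sum>i\<le>k. real (k choose i) *\<^sub>R a i (Suc k - i)) = (\<Sum>i\<le>k. real (k choose i) *\<^sub>R a i (Suc (k - i)))"
    by (rule sum.cong) (simp_all add: Suc_diff_le)
  ultimately have 3: "a 0 (Suc k) + (\<Sum>i\<le>k. real (k choose Suc i) *\<^sub>R a (Suc i) (k - i))
    = (\<Sum>i\<le>k. real (k choose i) *\<^sub>R a i (Suc (k - i)))" by simp
  show ?thesis unfolding 1 2 sum.distrib 3[symmetric] by simp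
qed

lemma exp_coefficient_mult:
  assumes "i \<le> k"
  shows "(t ^ i / fact i) * (t ^ (k - i) / fact (k - i)) = (t ^ k / fact k) * real (k choose i)"
proof -
  have "t ^ i * t ^ (k - i) = t ^ k" using assms by (simp add: power_add[symmetric])
  then have "(t ^ i / fact i) * (t ^ (k - i) / fact (k - i)) = t ^ k / (fact i * fact (k - i))" by simp
  then show ?thesis by (simp add: binomial_fact[OF assms])
qed

lemma linear_extension_sum:
  "finite I \<Longrightarrow> linear_extension f (\<Sum>k\<in>I. Poly_Mapping.single (g k) 1) = (\<lambda>x. \<Sum>k\<in>I. f (g k) x)"
proof (induction I rule: finite_induct)
  case empty
  show ?case by (simp add: linear_extension_def)
next
  case (insert k I)
  then show ?case by (simp add: linear_extension_plus linear_extension_single)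
qed

section \<open>Density of the polynomials and vanishing of the trace on derivatives\<close>

locale tracial_derivation = tracial_algebra M \<tau> \<eta> + derivation_data Y K
  for M :: "('a::complex_hilbert \<Rightarrow> 'a) set" and \<tau> and \<eta> :: "('a \<Rightarrow> 'a) \<Rightarrow> 'l::complex_hilbert"
    and Y K :: "'n::finite \<Rightarrow> 'a \<Rightarrow> 'a" +
  assumes Y_in_M: "Y j \<in> M"
    and generates: "von_neumann_algebra hull range Y = M"
    and preserving: "trace_preserving \<tau> Y K"
begin

lemma A_M: "S \<in> A \<Longrightarrow> S \<in> M"
proof -
  have "A \<subseteq> M" unfolding generated_algebra_def by (rule hull_minimal) (use Y_in_M M_sub in auto)
  then show "S \<in> A \<Longrightarrow> S \<in> M" by (rule subsetD)
qed

text \<open>\<open>M\<close> lies in the bicommutant of the generators, where polynomials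
  approximate in the ultrastrong seminorm that dominates the trace norm.\<close>

lemma \<eta>_A_dense: "closure (\<eta> ` A) = UNIV"
proof -
  have bY: "bounded_clinear S" "adj S \<in> range Y" if "S \<in> range Y" for S
    using that Y_bounded Y_adj by auto
  have "range Y \<subseteq> commutant (commutant (range Y))" by (rule subset_bicommutant) (rule bY(1))
  moreover have "von_neumann_algebra (commutant (commutant (range Y)))"
    by (rule von_neumann_bicommutant) (rule bY; assumption)+
  ultimately have "von_neumann_algebra hull range Y \<subseteq> commutant (commutant (range Y))"
    by (rule hull_minimal)
  then have bic: "M \<subseteq> commutant (commutant (range Y))" unfolding generates .
  obtain \<Xi> C where C: "C \<ge> 0" "square_summable \<Xi>" "\<forall>T\<in>M. (norm (\<eta> T))\<^sup>2 \<le> C * suminf (\<lambda>n. (norm (T (\<Xi> n)))\<^sup>2)"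
    using norm_\<eta>_ultrastrong_bound by (elim exE conjE)
  have "\<eta> x \<in> closure (\<eta> ` A)" if x: "x \<in> M" for x
    unfolding closure_approachable
  proof (intro allI impI)
    fix e :: real assume e: "e > 0"
    \<comment> \<open>Dividing by C + 1 keeps the quotient defined and the final inequality strict
      when \<open>C\<close> is 0.\<close>
    define e' where "e' = e\<^sup>2 / (C + 1)"
    have e': "e' > 0" using e C(1) by (simp add: e'_def)
    obtain a where a: "a \<in> A" "suminf (\<lambda>n. (norm (x (\<Xi> n) - a (\<Xi> n)))\<^sup>2) < e'"
      using bicommutant_approx[OF bY A_sub _ subsetD[OF bic x] C(2)[unfolded square_summable_def] e'] Y_in by auto
    have T: "(\<lambda>v. x v - a v) \<in> M" by (rule M_diff[OF x A_M[OF a(1)]])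
    have "(norm (\<eta> x - \<eta> a))\<^sup>2 \<le> C * suminf (\<lambda>n. (norm (x (\<Xi> n) - a (\<Xi> n)))\<^sup>2)"
      using C(3)[rule_format, OF T] \<eta>_diff[OF x A_M[OF a(1)]] by simp
    also have "\<dots> \<le> C * e'" using a(2) C(1) by (intro mult_left_mono) auto
    also have "\<dots> < (C + 1) * e'" using e' by (simp add: distrib_right)
    also have "\<dots> = e\<^sup>2" using C(1) by (simp add: e'_def)
    finally have "norm (\<eta> x - \<eta> a) < e" using e by (simp add: power2_less_imp_less)
    then show "\<exists>y\<in>\<eta> ` A. dist y (\<eta> x) < e"
      using a(1) by (intro bexI[of _ "\<eta> a"]) (simp_all add: dist_norm norm_minus_commute)
  qed
  then have "\<eta> ` M \<subseteq> closure (\<eta> ` A)" by (auto elim!: imageE)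
  then have "closure (\<eta> ` M) \<subseteq> closure (\<eta> ` A)" by (rule closure_minimal) simp
  then show ?thesis using \<eta>_dense by auto
qed

lemma eq_on_\<eta>_A:
  assumes "bounded_clinear S" "bounded_clinear T" "\<And>a. a \<in> A \<Longrightarrow> S (\<eta> a) = T (\<eta> a)"
  shows "S = T"
  by (rule bounded_clinear_eq_on_dense[OF assms(1,2) \<eta>_A_dense]) (use assms(3) in \<open>auto elim!: imageE\<close>)

lemma \<tau>_sum:
  assumes "finite I" "\<And>k. k \<in> I \<Longrightarrow> S k \<in> M"
  shows "(\<lambda>x. \<Sum>k\<in>I. S k x) \<in> M \<and> \<tau> (\<lambda>x. \<Sum>k\<in>I. S k x) = (\<Sum>k\<in>I. \<tau> (S k))"
  using assms
proof (induction I rule: finite_induct)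
  case empty
  show ?case by (simp add: M_zero \<tau>_zero)
next
  case (insert k I)
  have IH: "(\<lambda>x. \<Sum>k\<in>I. S k x) \<in> M" "\<tau> (\<lambda>x. \<Sum>k\<in>I. S k x) = (\<Sum>k\<in>I. \<tau> (S k))"
    using insert.IH insert.prems by auto
  have Sk: "S k \<in> M" by (rule insert.prems) simp
  show ?case using insert.hyps M_plus[OF Sk IH(1)] \<tau>_plus[OF Sk IH(1)] by (simp add: IH(2))
qed

text \<open>The prefix \<open>u\<close> collects the letters already passed, so that the induction
  on \<open>w\<close> can be applied with the first letter moved to it.\<close>

lemma \<tau>_word_derivative:
  "\<tau> (W u \<circ> word_derivative Y K w)
    = (\<Sum>k<length w. \<tau> (W u \<circ> (W (take k w) \<circ> (K (w ! k) \<circ> W (drop (Suc k) w)))))"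
proof (induction w arbitrary: u)
  case Nil
  have "W u \<circ> word_derivative Y K [] = (\<lambda>x. 0)"
    by (rule ext) (simp add: bounded_clinear_zero[OF W_bounded])
  then show ?case by (simp add: \<tau>_zero)
next
  case (Cons j w)
  have 1: "W u \<circ> (K j \<circ> W w) \<in> M" "W (u @ [j]) \<circ> word_derivative Y K w \<in> M"
    by (intro A_M A_comp W_in K_in word_derivative_in)+
  have "W u \<circ> word_derivative Y K (j # w) = (\<lambda>x. (W u \<circ> (K j \<circ> W w)) x + (W (u @ [j]) \<circ> word_derivative Y K w) x)"
    by (rule ext) (simp add: bounded_clinear_add[OF W_bounded] word_operator_append word_operator_Cons word_operator_Nil)
  then have "\<tau> (W u \<circ> word_derivative Y K (j # w)) = \<tau> (W u \<circ> (K j \<circ> W w)) + \<tau> (W (u @ [j]) \<circ> word_derivative Y K w)"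
    by (simp only: \<tau>_plus[OF 1])
  also have "W u \<circ> (K j \<circ> W w) = W u \<circ> (W (take 0 (j # w)) \<circ> (K ((j # w) ! 0) \<circ> W (drop (Suc 0) (j # w))))"
    by (simp only: take_0 word_operator_Nil id_comp nth_Cons_0 drop_Suc_Cons drop_0)
  also have "\<tau> (W (u @ [j]) \<circ> word_derivative Y K w)
      = (\<Sum>k<length w. \<tau> (W u \<circ> (W (take (Suc k) (j # w)) \<circ> (K ((j # w) ! Suc k) \<circ> W (drop (Suc (Suc k)) (j # w))))))"
    unfolding Cons
    by (simp only: word_operator_append word_operator_Cons word_operator_Nil comp_id comp_assoc
        take_Suc_Cons nth_Cons_Suc drop_Suc_Cons)
  finally show ?case by (simp only: list.size(4) add.commute[of _ "Suc 0"] plus_1_eq_Suc One_nat_def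
        sum.lessThan_Suc_shift add_Suc add_0)
qed

text \<open>Traciality rotates each Leibniz term until the factor \<open>K\<close> stands last; the
  letters before it then form the rotated word of the cyclic derivative. Grouping positions by their
  letter yields the sum over the variables.\<close>

lemma \<tau>_D_word: "\<tau> (D (W w)) = 0"
proof -
  define g where "g k = drop (Suc k) w @ take k w" for k
  have cyc: "\<tau> (W [] \<circ> (W (take k w) \<circ> (K (w ! k) \<circ> W (drop (Suc k) w)))) = \<tau> (W (g k) \<circ> K (w ! k))" for k
  proof -
    have "\<tau> ((W (take k w) \<circ> K (w ! k)) \<circ> W (drop (Suc k) w)) = \<tau> (W (drop (Suc k) w) \<circ> (W (take k w) \<circ> K (w ! k)))"
      by (rule \<tau>_commute) (intro A_M A_comp W_in K_in)+
    then show ?thesis by (simp only: g_def word_operator_append word_operator_Nil id_comp comp_assoc)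
  qed
  have "\<tau> (nc_eval Y (cyclic_derivative j (Poly_Mapping.single w 1)) \<circ> K j)
      = (\<Sum>k | k \<in> {..<length w} \<and> w ! k = j. \<tau> (W (g k) \<circ> K (w ! k)))" for j
  proof -
    let ?I = "{k. k \<in> {..<length w} \<and> w ! k = j}"
    have fin: "finite ?I" by simp
    have "cyclic_derivative j (Poly_Mapping.single w 1) = (\<Sum>k\<in>?I. Poly_Mapping.single (g k) 1)"
      unfolding cyclic_derivative_def g_def by simp
    then have "nc_eval Y (cyclic_derivative j (Poly_Mapping.single w 1)) \<circ> K j = (\<lambda>x. \<Sum>k\<in>?I. (W (g k) \<circ> K j) x)"
      by (intro ext) (simp add: nc_eval_linear_extension linear_extension_sum)
    then have "\<tau> (nc_eval Y (cyclic_derivative j (Poly_Mapping.single w 1)) \<circ> K j) = (\<Sum>k\<in>?I. \<tau> (W (g k) \<circ> K j))"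
      using \<tau>_sum[OF fin, of "\<lambda>k. W (g k) \<circ> K j"] A_M[OF A_comp[OF W_in K_in]] by simp
    also have "\<dots> = (\<Sum>k\<in>?I. \<tau> (W (g k) \<circ> K (w ! k)))" by (rule sum.cong) auto
    finally show ?thesis .
  qed
  then have "(\<Sum>j\<in>UNIV. \<Sum>k | k \<in> {..<length w} \<and> w ! k = j. \<tau> (W (g k) \<circ> K (w ! k))) = 0"
    using preserving[unfolded trace_preserving_def, rule_format, of "Poly_Mapping.single w 1"] by simp
  then have "(\<Sum>k<length w. \<tau> (W (g k) \<circ> K (w ! k))) = 0"
    using sum.group[of "{..<length w}" "UNIV :: 'n set" "\<lambda>k. w ! k" "\<lambda>k. \<tau> (W (g k) \<circ> K (w ! k))"] by simp
  moreover have "\<tau> (D (W w)) = \<tau> (W [] \<circ> word_derivative Y K w)"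
    by (simp only: D_word word_operator_Nil id_comp)
  ultimately show ?thesis by (simp only: \<tau>_word_derivative cyc)
qed

lemma \<tau>_D: "S \<in> A \<Longrightarrow> \<tau> (D S) = 0"
proof (induction rule: A_induct)
  case (word w)
  show ?case by (rule \<tau>_D_word)
next
  case (plus S T)
  then show ?case using \<tau>_plus[OF A_M[OF D_in] A_M[OF D_in], of S T] by (simp add: D_plus)
next
  case (scale c S)
  then show ?case using \<tau>_scale[OF A_M[OF D_in], of S c] by (simp add: D_scale)
qed

text \<open>This is \<tau> (D (adj T \<circ> S)) = 0 after expansion by the Leibniz rule.\<close>

lemma D_antisymmetric:
  assumes S: "S \<in> A" and T: "T \<in> A"
  shows "cinner (\<eta> (D S)) (\<eta> T) + cinner (\<eta> S) (\<eta> (D T)) = 0"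
proof -
  have M: "adj T \<circ> D S \<in> M" "adj (D T) \<circ> S \<in> M"
    using S T by (simp_all only: A_M A_comp A_adj D_in)
  have "cinner (\<eta> (D S)) (\<eta> T) + cinner (\<eta> S) (\<eta> (D T)) = \<tau> (adj (D T) \<circ> S) + \<tau> (adj T \<circ> D S)"
    using S T by (simp only: cinner_\<eta>[OF A_M A_M] D_in add.commute)
  also have "\<dots> = \<tau> (\<lambda>x. (adj (D T) \<circ> S) x + (adj T \<circ> D S) x)" by (rule \<tau>_plus[OF M(2,1), symmetric])
  also have "\<dots> = \<tau> (D (adj T \<circ> S))" by (simp only: D_comp[OF A_adj[OF T] S] D_adj[OF T])
  also have "\<dots> = 0" by (rule \<tau>_D) (intro A_comp A_adj S T)
  finally show ?thesis .
qed

text \<open>Fixed once and for all, so that the time interval defined from it depends on no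
  polynomial.\<close>

definition rate :: real where
  "rate = (SOME B. B > 0 \<and> (\<forall>S\<in>A. \<exists>C\<ge>0. \<forall>k v. norm ((D ^^ k) S v) \<le> C * fact k * B ^ k * norm v))"

lemma rate: "rate > 0" "S \<in> A \<Longrightarrow> \<exists>C\<ge>0. \<forall>k v. norm ((D ^^ k) S v) \<le> C * fact k * rate ^ k * norm v"
proof -
  have "rate > 0 \<and> (\<forall>S\<in>A. \<exists>C\<ge>0. \<forall>k v. norm ((D ^^ k) S v) \<le> C * fact k * rate ^ k * norm v)"
    unfolding rate_def by (rule someI_ex) (rule D_analytic)
  then show "rate > 0" "S \<in> A \<Longrightarrow> \<exists>C\<ge>0. \<forall>k v. norm ((D ^^ k) S v) \<le> C * fact k * rate ^ k * norm v" by auto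
qed

section \<open>The exponential series of the derivation\<close>

definition flow_term :: "real \<Rightarrow> ('a \<Rightarrow> 'a) \<Rightarrow> nat \<Rightarrow> 'l" where
  "flow_term t S k = (t ^ k / fact k) *\<^sub>R \<eta> ((D ^^ k) S)"

definition flow :: "real \<Rightarrow> ('a \<Rightarrow> 'a) \<Rightarrow> 'l" where
  "flow t S = suminf (flow_term t S)"

text \<open>For |t| below twice the radius the flow series has ratio below 1/2, so it covers s + t
  for s, t inside the radius. Inside the radius itself the ratio is below 1/4, which absorbs the
  doubling by binomial coefficients in the group law.\<close>

definition radius :: real where "radius = 1 / (4 * rate)"

lemma radius: "radius > 0" "\<bar>t\<bar> < 2 * radius \<Longrightarrow> \<bar>t\<bar> * rate < 1 / 2" "\<bar>t\<bar> < radius \<Longrightarrow> \<bar>t\<bar> * rate < 1 / 4"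
  using rate(1) by (simp_all add: radius_def field_simps)

definition flow_bound :: "('a \<Rightarrow> 'a) \<Rightarrow> real" where
  "flow_bound S = (SOME C. C \<ge> 0 \<and> (\<forall>k v. norm ((D ^^ k) S v) \<le> C * fact k * rate ^ k * norm v))"

lemma flow_bound:
  assumes S: "S \<in> A"
  shows "flow_bound S \<ge> 0" "norm ((D ^^ k) S v) \<le> flow_bound S * fact k * rate ^ k * norm v"
    "norm (\<eta> ((D ^^ k) S)) \<le> flow_bound S * fact k * rate ^ k" "norm (flow_term t S k) \<le> flow_bound S * (\<bar>t\<bar> * rate) ^ k"
proof -
  have C: "flow_bound S \<ge> 0 \<and> (\<forall>k v. norm ((D ^^ k) S v) \<le> flow_bound S * fact k * rate ^ k * norm v)"
    unfolding flow_bound_def by (rule someI_ex) (rule rate(2)[OF S])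
  then show C0: "flow_bound S \<ge> 0" and "norm ((D ^^ k) S v) \<le> flow_bound S * fact k * rate ^ k * norm v" by auto
  show 1: "norm (\<eta> ((D ^^ k) S)) \<le> flow_bound S * fact k * rate ^ k" for k
    by (rule norm_\<eta>_le[OF A_M[OF D_power_in[OF S]]]) (use C rate(1) in simp_all)
  have "norm (flow_term t S k) = (\<bar>t\<bar> ^ k / fact k) * norm (\<eta> ((D ^^ k) S))"
    by (simp add: flow_term_def power_abs)
  also have "\<dots> \<le> (\<bar>t\<bar> ^ k / fact k) * (flow_bound S * fact k * rate ^ k)" by (rule mult_left_mono[OF 1]) simp
  also have "\<dots> = flow_bound S * (\<bar>t\<bar> * rate) ^ k" by (simp add: power_mult_distrib)
  finally show "norm (flow_term t S k) \<le> flow_bound S * (\<bar>t\<bar> * rate) ^ k" .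
qed

lemma summable_flow_bound: "\<bar>t\<bar> < 2 * radius \<Longrightarrow> summable (\<lambda>k. C * (\<bar>t\<bar> * rate) ^ k)"
  using radius(2)[of t] rate(1) by (intro summable_mult summable_geometric) simp

lemma summable_flow:
  assumes t: "\<bar>t\<bar> < 2 * radius" and S: "S \<in> A"
  shows "summable (flow_term t S)"
  by (rule summable_comparison_test'[where N = 0, OF summable_flow_bound[OF t] flow_bound(4)[OF S]])

lemma flow_term_plus:
  "S \<in> A \<Longrightarrow> T \<in> A \<Longrightarrow> flow_term t (\<lambda>x. S x + T x) = (\<lambda>k. flow_term t S k + flow_term t T k)"
  unfolding flow_term_def
  by (rule ext) (simp add: D_power_plus \<eta>_plus[OF A_M[OF D_power_in] A_M[OF D_power_in]] scaleR_add_right)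

lemma flow_term_scale: "S \<in> A \<Longrightarrow> flow_term t (\<lambda>x. c *\<^sub>C S x) = (\<lambda>k. c *\<^sub>C flow_term t S k)"
  unfolding flow_term_def
  by (rule ext) (simp add: D_power_scale \<eta>_scale[OF A_M[OF D_power_in]] scaleR_scaleC scaleC_scaleC mult.commute)

lemma flow_plus: "\<bar>t\<bar> < 2 * radius \<Longrightarrow> S \<in> A \<Longrightarrow> T \<in> A \<Longrightarrow> flow t (\<lambda>x. S x + T x) = flow t S + flow t T"
  unfolding flow_def using suminf_add[OF summable_flow summable_flow, of t S t T]
  by (simp add: flow_term_plus)

lemma flow_scale: "\<bar>t\<bar> < 2 * radius \<Longrightarrow> S \<in> A \<Longrightarrow> flow t (\<lambda>x. c *\<^sub>C S x) = c *\<^sub>C flow t S"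
  unfolding flow_def using bounded_linear.suminf[OF bounded_linear_scaleC summable_flow, of t S c]
  by (simp add: flow_term_scale)

text \<open>Formally the derivative of order k + 1 at t = 0 of the inner product of the flows of
  \<open>S\<close> and \<open>T\<close>. Pascal's rule splits it into the same expression for (D S,
  T) and (S, D T); the case of order one is antisymmetry.\<close>

lemma binomial_antisymmetric:
  assumes "S \<in> A" "T \<in> A"
  shows "(\<Sum>i\<le>Suc k. real (Suc k choose i) *\<^sub>R cinner (\<eta> ((D ^^ i) S)) (\<eta> ((D ^^ (Suc k - i)) T))) = 0"
  using assms
proof (induction k arbitrary: S T)
  case 0
  then show ?case using D_antisymmetric[of S T] by (simp add: add.commute)
next
  case (Suc k)
  have p: "(D ^^ i) (D S) = (D ^^ Suc i) S" for i S by (simp only: funpow_Suc_right o_apply)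
  have "(\<Sum>i\<le>Suc k. real (Suc k choose i) *\<^sub>R cinner (\<eta> ((D ^^ Suc i) S)) (\<eta> ((D ^^ (Suc k - i)) T))) = 0"
    using Suc.IH[OF D_in[OF Suc.prems(1)] Suc.prems(2)] by (simp only: p)
  moreover have "(\<Sum>i\<le>Suc k. real (Suc k choose i) *\<^sub>R cinner (\<eta> ((D ^^ i) S)) (\<eta> ((D ^^ Suc (Suc k - i)) T))) = 0"
    using Suc.IH[OF Suc.prems(1) D_in[OF Suc.prems(2)]] by (simp only: p)
  ultimately show ?case
    using binomial_sum_Suc[of "Suc k" "\<lambda>i j. cinner (\<eta> ((D ^^ i) S)) (\<eta> ((D ^^ j) T))"] by simp
qed

text \<open>In the Cauchy product of the two series every coefficient of positive order vanishes,
  leaving the term of order zero.\<close>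

lemma flow_isometric:
  assumes t: "\<bar>t\<bar> < 2 * radius" and S: "S \<in> A" and T: "T \<in> A"
  shows "cinner (flow t S) (flow t T) = cinner (\<eta> S) (\<eta> T)"
proof -
  define C where "C = flow_bound S"
  note C = flow_bound(1,4)[OF S, folded C_def]
  define E where "E = flow_bound T"
  note E = flow_bound(1,4)[OF T, folded E_def]
  have q: "\<bar>t\<bar> * rate \<ge> 0" using rate(1) by simp
  define f where "f i j = cinner (flow_term t S i) (flow_term t T j)" for i j
  have "(\<lambda>k. \<Sum>i\<le>k. f i (k - i)) sums suminf (\<lambda>i. suminf (f i))"
  proof (rule double_series_diagonal[where p = "\<lambda>k. C * (\<bar>t\<bar> * rate) ^ k" and q = "\<lambda>k. E * (\<bar>t\<bar> * rate) ^ k"])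
    show "norm (f i j) \<le> C * (\<bar>t\<bar> * rate) ^ i * (E * (\<bar>t\<bar> * rate) ^ j)" for i j
      unfolding f_def
      by (rule order_trans[OF norm_cinner_le mult_mono[OF C(2) E(2)]]) (use C(1) q in simp_all)
  qed (use summable_flow_bound[OF t] C(1) E(1) q in simp_all)
  moreover have "suminf (f i) = cinner (flow_term t S i) (flow t T)" for i
    unfolding f_def[abs_def] flow_def
    by (rule bounded_linear.suminf[OF bounded_bilinear.bounded_linear_right[OF bounded_bilinear_cinner] summable_flow[OF t T], symmetric])
  moreover have "suminf (\<lambda>i. cinner (flow_term t S i) (flow t T)) = cinner (flow t S) (flow t T)"
    unfolding flow_def[of t S]
    by (rule bounded_linear.suminf[OF bounded_bilinear.bounded_linear_left[OF bounded_bilinear_cinner] summable_flow[OF t S], symmetric])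
  ultimately have s1: "(\<lambda>k. \<Sum>i\<le>k. f i (k - i)) sums cinner (flow t S) (flow t T)" by simp
  have diag: "(\<Sum>i\<le>k. f i (k - i)) = (t ^ k / fact k) *\<^sub>R
      (\<Sum>i\<le>k. real (k choose i) *\<^sub>R cinner (\<eta> ((D ^^ i) S)) (\<eta> ((D ^^ (k - i)) T)))" for k
    unfolding scaleR_sum_right
  proof (rule sum.cong[OF refl])
    fix i assume "i \<in> {..k}"
    then have i: "i \<le> k" by simp
    have "f i (k - i) = ((t ^ i / fact i) * (t ^ (k - i) / fact (k - i))) *\<^sub>R cinner (\<eta> ((D ^^ i) S)) (\<eta> ((D ^^ (k - i)) T))"
      unfolding f_def flow_term_def
      by (simp only: bounded_bilinear.scaleR_left[OF bounded_bilinear_cinner]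
          bounded_bilinear.scaleR_right[OF bounded_bilinear_cinner] scaleR_scaleR mult.commute)
    also have "\<dots> = (t ^ k / fact k) *\<^sub>R real (k choose i) *\<^sub>R cinner (\<eta> ((D ^^ i) S)) (\<eta> ((D ^^ (k - i)) T))"
      by (simp only: exp_coefficient_mult[OF i] scaleR_scaleR)
    finally show "f i (k - i) = (t ^ k / fact k) *\<^sub>R real (k choose i) *\<^sub>R cinner (\<eta> ((D ^^ i) S)) (\<eta> ((D ^^ (k - i)) T))" .
  qed
  have "(\<Sum>i\<le>k. f i (k - i)) = 0" if "k \<noteq> 0" for k
  proof -
    obtain m where m: "k = Suc m" using \<open>k \<noteq> 0\<close> not0_implies_Suc by auto
    show ?thesis unfolding diag unfolding m binomial_antisymmetric[OF S T] by simp
  qed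
  then have "(\<lambda>k. \<Sum>i\<le>k. f i (k - i)) sums (\<Sum>k\<in>{0}. \<Sum>i\<le>k. f i (k - i))"
    by (intro sums_finite) simp_all
  moreover have "(\<Sum>k\<in>{0::nat}. \<Sum>i\<le>k. f i (k - i)) = cinner (\<eta> S) (\<eta> T)" by (simp add: f_def flow_term_def)
  ultimately show ?thesis using s1 sums_unique2 by simp
qed

lemma norm_flow: "\<bar>t\<bar> < 2 * radius \<Longrightarrow> S \<in> A \<Longrightarrow> norm (flow t S) = norm (\<eta> S)"
proof -
  assume "\<bar>t\<bar> < 2 * radius" "S \<in> A"
  then have "(norm (flow t S))\<^sup>2 = (norm (\<eta> S))\<^sup>2" by (simp only: norm_sq_cinner flow_isometric)
  then show ?thesis by (simp add: power2_eq_iff_nonneg)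
qed

text \<open>The quadratic remainder serves twice: it gives strong continuity of the group at 0 and
  the derivative of the group on polynomials.\<close>

lemma flow_expansion:
  assumes S: "S \<in> A"
  shows "\<exists>C\<ge>0. \<forall>t. \<bar>t\<bar> < 2 * radius \<longrightarrow> norm (flow t S - \<eta> S - t *\<^sub>R \<eta> (D S)) \<le> C * t\<^sup>2"
proof -
  define C where "C = flow_bound S"
  note C = flow_bound(1,4)[OF S, folded C_def]
  have "norm (flow t S - \<eta> S - t *\<^sub>R \<eta> (D S)) \<le> (2 * C * rate\<^sup>2) * t\<^sup>2" if t: "\<bar>t\<bar> < 2 * radius" for t
  proof -
    have q: "\<bar>t\<bar> * rate \<ge> 0" "\<bar>t\<bar> * rate < 1 / 2" using rate(1) radius(2)[OF t] by simp_all
    have "flow t S = suminf (\<lambda>k. flow_term t S (k + 2)) + (\<Sum>k<2. flow_term t S k)"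
      unfolding flow_def by (rule suminf_split_initial_segment[OF summable_flow[OF t S]])
    then have "flow t S - \<eta> S - t *\<^sub>R \<eta> (D S) = suminf (\<lambda>k. flow_term t S (k + 2))"
      by (simp add: flow_term_def numeral_2_eq_2)
    also have "norm \<dots> \<le> suminf (\<lambda>k. (C * (\<bar>t\<bar> * rate)\<^sup>2) * (\<bar>t\<bar> * rate) ^ k)"
    proof (rule norm_suminf_le)
      show "norm (flow_term t S (k + 2)) \<le> (C * (\<bar>t\<bar> * rate)\<^sup>2) * (\<bar>t\<bar> * rate) ^ k" for k
      proof -
        have eq: "C * (\<bar>t\<bar> * rate) ^ (k + 2) = (C * (\<bar>t\<bar> * rate)\<^sup>2) * (\<bar>t\<bar> * rate) ^ k"
          by (simp only: power_add mult_ac)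
        show ?thesis using C(2)[where t = t and k = "k + 2"] unfolding eq .
      qed
      show "summable (\<lambda>k. (C * (\<bar>t\<bar> * rate)\<^sup>2) * (\<bar>t\<bar> * rate) ^ k)" by (rule summable_flow_bound[OF t])
    qed
    also have "\<dots> = (C * (\<bar>t\<bar> * rate)\<^sup>2) * (1 / (1 - \<bar>t\<bar> * rate))"
    proof -
      have "norm (\<bar>t\<bar> * rate) < 1" using q by simp
      then show ?thesis using suminf_mult[OF summable_geometric] suminf_geometric by metis
    qed
    \<comment> \<open>The ratio is below 1/2, so the geometric sum is at most 2.\<close>
    also have "\<dots> \<le> (C * (\<bar>t\<bar> * rate)\<^sup>2) * 2"
      using q C(1) by (intro mult_left_mono) (simp_all add: field_simps)
    also have "\<dots> = (2 * C * rate\<^sup>2) * t\<^sup>2" by (simp add: power_mult_distrib)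
    finally show ?thesis .
  qed
  moreover have "2 * C * rate\<^sup>2 \<ge> 0" using C(1) by simp
  ultimately show ?thesis by (intro exI[of _ "2 * C * rate\<^sup>2"]) simp
qed

lemma flow_zero: "S \<in> A \<Longrightarrow> flow 0 S = \<eta> S"
proof -
  assume "S \<in> A"
  from flow_expansion[OF this] obtain C where
    "\<forall>t. \<bar>t\<bar> < 2 * radius \<longrightarrow> norm (flow t S - \<eta> S - t *\<^sub>R \<eta> (D S)) \<le> C * t\<^sup>2" by (elim exE conjE)
  from this[rule_format, of 0] show ?thesis using radius(1) by simp
qed

section \<open>The unitary group extending the flow\<close>

definition flow_op :: "real \<Rightarrow> 'l \<Rightarrow> 'l" where
  "flow_op t = (SOME F. bounded_clinear F \<and> (\<forall>S\<in>A. F (\<eta> S) = flow t S) \<and> (\<forall>x. norm (F x) \<le> 1 * norm x))"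

lemma flow_op:
  assumes t: "\<bar>t\<bar> < 2 * radius"
  shows "bounded_clinear (flow_op t)" "S \<in> A \<Longrightarrow> flow_op t (\<eta> S) = flow t S"
proof -
  have "\<exists>F. bounded_clinear F \<and> (\<forall>S\<in>A. F (\<eta> S) = flow t S) \<and> (\<forall>x. norm (F x) \<le> 1 * norm x)"
  proof (rule extend_from_dense[OF \<eta>_A_dense])
    show "\<exists>k\<in>A. \<eta> k = \<eta> S + \<eta> T \<and> flow t k = flow t S + flow t T" if ST: "S \<in> A" "T \<in> A" for S T
      by (intro bexI[of _ "\<lambda>x. S x + T x"] conjI \<eta>_plus flow_plus A_M A_plus t ST)
    show "\<exists>k\<in>A. \<eta> k = c *\<^sub>C \<eta> S \<and> flow t k = c *\<^sub>C flow t S" if S: "S \<in> A" for c S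
      by (intro bexI[of _ "\<lambda>x. c *\<^sub>C S x"] conjI \<eta>_scale flow_scale A_M A_scale t S)
    show "norm (flow t S) \<le> 1 * norm (\<eta> S)" if "S \<in> A" for S using norm_flow[OF t that] by simp
  qed
  from someI_ex[OF this] show "bounded_clinear (flow_op t)" "S \<in> A \<Longrightarrow> flow_op t (\<eta> S) = flow t S"
    unfolding flow_op_def[symmetric] by simp_all
qed

text \<open>The isometry identity on polynomials says that
  \<open>adj (flow_op t) \<circ> flow_op t\<close> is the identity on a dense set; in this form it
  extends by continuity.\<close>

lemma flow_op_cinner:
  assumes t: "\<bar>t\<bar> < 2 * radius"
  shows "cinner (flow_op t x) (flow_op t y) = cinner x y"
proof -
  have b: "bounded_clinear (flow_op t)" by (rule flow_op(1)[OF t])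
  have "adj (flow_op t) \<circ> flow_op t = id"
  proof (rule eq_on_\<eta>_A)
    fix S assume S: "S \<in> A"
    have "adj (flow_op t) (flow_op t (\<eta> S)) - \<eta> S = 0"
    proof (rule dense_orthogonal_zero[OF \<eta>_A_dense])
      fix v assume "v \<in> \<eta> ` A"
      then obtain T where T: "v = \<eta> T" "T \<in> A" by (rule imageE)
      have "cinner v (adj (flow_op t) (flow_op t (\<eta> S))) = cinner (flow_op t v) (flow_op t (\<eta> S))"
        by (rule cinner_adj[OF b, symmetric])
      then show "cinner v (adj (flow_op t) (flow_op t (\<eta> S)) - \<eta> S) = 0"
        unfolding T(1) by (simp add: cinner_diff_right flow_op(2)[OF t] S T(2) flow_isometric[OF t])
    qed
    then show "(adj (flow_op t) \<circ> flow_op t) (\<eta> S) = id (\<eta> S)" by simp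
  qed (intro bounded_clinear_comp bounded_clinear_adj b bounded_clinear_id)+
  from fun_cong[OF this, of y] have "adj (flow_op t) (flow_op t y) = y" by simp
  then show ?thesis by (simp add: cinner_adj[OF b])
qed

lemma flow_op_zero: "flow_op 0 = id"
  by (rule eq_on_\<eta>_A) (use radius(1) in \<open>simp_all add: flow_op flow_zero bounded_clinear_id\<close>)

text \<open>The bounded operator \<open>flow_op s\<close> acts termwise on the series of the flow at
  \<open>t\<close>; regrouping the double series by total order and the binomial theorem give the
  series at s + t.\<close>

lemma flow_op_add:
  assumes s: "\<bar>s\<bar> < radius" and t: "\<bar>t\<bar> < radius"
  shows "flow_op (s + t) = flow_op s \<circ> flow_op t"
proof -
  have s2: "\<bar>s\<bar> < 2 * radius" and t2: "\<bar>t\<bar> < 2 * radius" and st2: "\<bar>s + t\<bar> < 2 * radius" using s t by linarith+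
  have bs: "bounded_clinear (flow_op s)" by (rule flow_op(1)[OF s2])
  show ?thesis
  proof (rule eq_on_\<eta>_A)
    fix S assume S: "S \<in> A"
    define C where "C = flow_bound S"
    note C = flow_bound(1,3)[OF S, folded C_def]
    define f where "f j i = ((t ^ j / fact j) * (s ^ i / fact i)) *\<^sub>R \<eta> ((D ^^ (i + j)) S)" for j i
    have q: "\<bar>s\<bar> * rate \<ge> 0" "\<bar>t\<bar> * rate \<ge> 0" "\<bar>s\<bar> * rate < 1 / 4" "\<bar>t\<bar> * rate < 1 / 4"
      using rate(1) radius(3)[OF s] radius(3)[OF t] by simp_all
    have "(\<lambda>k. \<Sum>j\<le>k. f j (k - j)) sums suminf (\<lambda>j. suminf (f j))"
    proof (rule double_series_diagonal[where p = "\<lambda>j. C * (2 * (\<bar>t\<bar> * rate)) ^ j" and q = "\<lambda>i. (2 * (\<bar>s\<bar> * rate)) ^ i"])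
      show "norm (f j i) \<le> C * (2 * (\<bar>t\<bar> * rate)) ^ j * (2 * (\<bar>s\<bar> * rate)) ^ i" for j i
      proof -
        \<comment> \<open>Derivatives of order i + j grow like (i + j)!, whereas the coefficients
          divide only by i! j!; the quotient is a binomial coefficient and doubles both
          ratios.\<close>
        have ch: "fact (i + j) / (fact j * fact i) \<le> (2::real) ^ (i + j)"
        proof -
          have "fact (i + j) / (fact j * fact i) = real ((i + j) choose j)" by (simp add: binomial_fact)
          also have "\<dots> \<le> real (2 ^ (i + j))" by (rule of_nat_mono[OF binomial_le_pow2])
          finally show ?thesis by simp
        qed
        have "norm (f j i) = ((\<bar>t\<bar> ^ j / fact j) * (\<bar>s\<bar> ^ i / fact i)) * norm (\<eta> ((D ^^ (i + j)) S))"
          by (simp add: f_def power_abs abs_mult)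
        also have "\<dots> \<le> ((\<bar>t\<bar> ^ j / fact j) * (\<bar>s\<bar> ^ i / fact i)) * (C * fact (i + j) * rate ^ (i + j))"
          by (rule mult_left_mono[OF C(2)]) simp
        also have "\<dots> = (C * (\<bar>t\<bar> * rate) ^ j * (\<bar>s\<bar> * rate) ^ i) * (fact (i + j) / (fact j * fact i))"
          by (simp add: power_mult_distrib power_add)
        also have "\<dots> \<le> (C * (\<bar>t\<bar> * rate) ^ j * (\<bar>s\<bar> * rate) ^ i) * 2 ^ (i + j)"
          by (rule mult_left_mono[OF ch]) (use C(1) q in simp)
        also have "\<dots> = C * (2 * (\<bar>t\<bar> * rate)) ^ j * (2 * (\<bar>s\<bar> * rate)) ^ i"
          by (simp add: power_mult_distrib power_add mult_ac)
        finally show ?thesis .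
      qed
      have g: "norm (2 * (\<bar>t\<bar> * rate)) < 1" "norm (2 * (\<bar>s\<bar> * rate)) < 1" using q by simp_all
      show "summable (\<lambda>j. C * (2 * (\<bar>t\<bar> * rate)) ^ j)" by (rule summable_mult[OF summable_geometric[OF g(1)]])
      show "summable (\<lambda>i. (2 * (\<bar>s\<bar> * rate)) ^ i)" by (rule summable_geometric[OF g(2)])
      show "0 \<le> C * (2 * (\<bar>t\<bar> * rate)) ^ j" for j using q C(1) by simp
      show "0 \<le> (2 * (\<bar>s\<bar> * rate)) ^ j" for j using q by simp
    qed
    moreover have inner: "suminf (f j) = flow_op s (flow_term t S j)" for j
    proof -
      have DS: "(D ^^ j) S \<in> A" by (rule D_power_in[OF S])
      have "f j = (\<lambda>i. (t ^ j / fact j) *\<^sub>R flow_term s ((D ^^ j) S) i)"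
        by (rule ext) (simp add: f_def flow_term_def funpow_add)
      then have "suminf (f j) = (t ^ j / fact j) *\<^sub>R flow s ((D ^^ j) S)"
        unfolding flow_def using suminf_scaleR_right[OF summable_flow[OF s2 DS]] by simp
      also have "\<dots> = flow_op s (flow_term t S j)"
        by (simp add: flow_term_def scaleR_scaleC bounded_clinear_scaleC[OF bs] flow_op(2)[OF s2 DS])
      finally show ?thesis .
    qed
    moreover have "suminf (\<lambda>j. flow_op s (flow_term t S j)) = flow_op s (flow t S)"
      unfolding flow_def
      by (rule bounded_linear.suminf[OF bounded_clinear_bounded_linear[OF bs] summable_flow[OF t2 S], symmetric])
    ultimately have s1: "(\<lambda>k. \<Sum>j\<le>k. f j (k - j)) sums flow_op s (flow t S)" by simp
    have "(\<Sum>j\<le>k. f j (k - j)) = flow_term (s + t) S k" for k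
    proof -
      have "(\<Sum>j\<le>k. f j (k - j)) = (\<Sum>j\<le>k. ((t ^ j / fact j) * (s ^ (k - j) / fact (k - j))) *\<^sub>R \<eta> ((D ^^ k) S))"
        by (rule sum.cong) (simp_all add: f_def)
      also have "\<dots> = (\<Sum>j\<le>k. (t ^ j / fact j) * (s ^ (k - j) / fact (k - j))) *\<^sub>R \<eta> ((D ^^ k) S)"
        by (rule scaleR_sum_left[symmetric])
      also have "(\<Sum>j\<le>k. (t ^ j / fact j) * (s ^ (k - j) / fact (k - j))) = (t + s) ^ k / fact k"
      proof -
        have "(t + s) ^ k / fact k = (\<Sum>j\<le>k. real (k choose j) * t ^ j * s ^ (k - j) / fact k)"
          unfolding binomial_ring by (rule sum_divide_distrib)
        also have "\<dots> = (\<Sum>j\<le>k. (t ^ j / fact j) * (s ^ (k - j) / fact (k - j)))"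
          by (rule sum.cong) (simp_all add: binomial_fact)
        finally show ?thesis by simp
      qed
      finally show ?thesis by (simp only: flow_term_def add.commute)
    qed
    then have "(\<lambda>k. \<Sum>j\<le>k. f j (k - j)) = flow_term (s + t) S" by (rule ext)
    then have "flow (s + t) S = flow_op s (flow t S)" using s1 unfolding flow_def by (simp add: sums_iff)
    then show "flow_op (s + t) (\<eta> S) = (flow_op s \<circ> flow_op t) (\<eta> S)"
      by (simp add: flow_op(2)[OF st2 S] flow_op(2)[OF t2 S])
  qed (intro bounded_clinear_comp flow_op(1) s2 t2 st2)+
qed

lemma flow_op_unitary:
  assumes t: "\<bar>t\<bar> < radius" shows "unitary (flow_op t)"
proof -
  have t2: "\<bar>t\<bar> < 2 * radius" "\<bar>- t\<bar> < radius" using t by linarith+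
  have "flow_op t (flow_op (- t) x) = x" for x
    using fun_cong[OF flow_op_add[OF t t2(2)], of x] by (simp add: flow_op_zero)
  then have "surj (flow_op t)" by (rule surjI)
  then show ?thesis unfolding unitary_def using flow_op(1)[OF t2(1)] flow_op_cinner[OF t2(1)] by simp
qed

lemma flow_group_exists:
  "\<exists>U. unitary_group U \<and> (\<forall>t. \<bar>t\<bar> < radius \<longrightarrow> U t = flow_op t) \<and> (\<forall>t. \<exists>n s. \<bar>s\<bar> < radius \<and> U t = (flow_op s) ^^ n)"
proof -
  have "\<exists>U. (\<forall>s t. U (s + t) = U s \<circ> U t) \<and> (\<forall>t. \<bar>t\<bar> < radius \<longrightarrow> U t = flow_op t)
    \<and> (\<forall>t. \<exists>n s. \<bar>s\<bar> < radius \<and> U t = (flow_op s) ^^ n)"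
    by (rule local_group_extension[OF radius(1) flow_op_zero flow_op_add])
  then obtain U where U: "\<forall>s t. U (s + t) = U s \<circ> U t" "\<forall>t. \<bar>t\<bar> < radius \<longrightarrow> U t = flow_op t"
    "\<forall>t. \<exists>n s. \<bar>s\<bar> < radius \<and> U t = (flow_op s) ^^ n" by (elim exE conjE)
  have upow: "unitary (V ^^ n)" if "unitary V" for V :: "'l \<Rightarrow> 'l" and n
    by (induction n) (simp_all only: funpow.simps unitary_id unitary_comp[OF that])
  have uU: "unitary (U t)" for t
  proof -
    obtain n s where ns: "\<bar>s\<bar> < radius" "U t = (flow_op s) ^^ n" using U(3)[rule_format, of t] by (elim exE conjE)
    show ?thesis unfolding ns(2) by (rule upow[OF flow_op_unitary[OF ns(1)]])
  qed
  have U0: "U 0 = id" using U(2) radius(1) by (simp add: flow_op_zero)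
  \<comment> \<open>The operators are isometric, so strong continuity at 0 only has to be checked on
    polynomials, where the quadratic remainder applies.\<close>
  have seq0: "(\<lambda>n. U (s n) v) \<longlonglongrightarrow> v" if s: "s \<longlonglongrightarrow> 0" for s :: "nat \<Rightarrow> real" and v
  proof -
    have "(\<lambda>n. U (s n) v) \<longlonglongrightarrow> id v"
    proof (rule bounded_clinear_strong_limit[OF _ bounded_clinear_id _ \<eta>_A_dense])
      show "bounded_clinear (U (s n))" for n by (rule unitaryD(1)[OF uU])
      show "norm (U (s n) x) \<le> 1 * norm x" for n x using unitaryD(4)[OF uU] by simp
      fix x assume "x \<in> \<eta> ` A"
      then obtain S where S: "x = \<eta> S" "S \<in> A" by (rule imageE)
      obtain C where C: "\<forall>t. \<bar>t\<bar> < 2 * radius \<longrightarrow> norm (flow t S - \<eta> S - t *\<^sub>R \<eta> (D S)) \<le> C * t\<^sup>2"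
        using flow_expansion[OF S(2)] by (elim exE conjE)
      have "\<forall>\<^sub>F n in sequentially. norm (s n) < radius"
        using order_tendstoD(2)[OF tendsto_norm[OF s], of radius] radius(1) by simp
      then have ev: "\<forall>\<^sub>F n in sequentially. norm (U (s n) x - x) \<le> C * (s n)\<^sup>2 + \<bar>s n\<bar> * norm (\<eta> (D S))"
      proof (rule eventually_mono)
        fix n assume n: "norm (s n) < radius"
        then have n2: "\<bar>s n\<bar> < 2 * radius" by simp
        have "U (s n) x = flow (s n) S" using U(2) n flow_op(2)[OF n2 S(2)] by (simp add: S(1))
        then have "U (s n) x - x = (flow (s n) S - \<eta> S - s n *\<^sub>R \<eta> (D S)) + s n *\<^sub>R \<eta> (D S)" by (simp add: S(1))
        then have "norm (U (s n) x - x) \<le> norm (flow (s n) S - \<eta> S - s n *\<^sub>R \<eta> (D S)) + norm (s n *\<^sub>R \<eta> (D S))"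
          using norm_triangle_ineq[of "flow (s n) S - \<eta> S - s n *\<^sub>R \<eta> (D S)" "s n *\<^sub>R \<eta> (D S)"] by simp
        then show "norm (U (s n) x - x) \<le> C * (s n)\<^sup>2 + \<bar>s n\<bar> * norm (\<eta> (D S))"
          using C[rule_format, OF n2] by simp
      qed
      have "(\<lambda>n. C * (s n)\<^sup>2 + \<bar>s n\<bar> * norm (\<eta> (D S))) \<longlonglongrightarrow> C * 0\<^sup>2 + \<bar>0\<bar> * norm (\<eta> (D S))"
        by (intro tendsto_intros s)
      then have "(\<lambda>n. C * (s n)\<^sup>2 + \<bar>s n\<bar> * norm (\<eta> (D S))) \<longlonglongrightarrow> 0" by simp
      from Lim_null_comparison[OF ev this] have "(\<lambda>n. U (s n) x - x) \<longlonglongrightarrow> 0" .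
      then show "(\<lambda>n. U (s n) x) \<longlonglongrightarrow> id x" using LIM_zero_cancel[of "\<lambda>n. U (s n) x" x] by simp
    qed
    then show ?thesis by simp
  qed
  have "continuous_on UNIV (\<lambda>t. U t v)" for v
    unfolding continuous_on_sequentially
  proof (intro allI ballI impI, elim conjE)
    fix x :: "nat \<Rightarrow> real" and a assume x: "x \<longlonglongrightarrow> a"
    have "(\<lambda>n. x n - a) \<longlonglongrightarrow> 0" using x by (simp add: LIM_zero_iff)
    from bounded_clinear_tendsto[OF unitaryD(1)[OF uU] seq0[OF this, of v], of a]
    have "(\<lambda>n. U a (U (x n - a) v)) \<longlonglongrightarrow> U a v" .
    moreover have "U a (U (x n - a) v) = U (x n) v" for n
      using fun_cong[OF U(1)[rule_format, of a "x n - a"], of v] by simp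
    ultimately show "((\<lambda>t. U t v) \<circ> x) \<longlonglongrightarrow> U a v" by (simp add: comp_def)
  qed
  then have "unitary_group U" unfolding unitary_group_def using uU U0 U(1) by simp
  then show ?thesis using U(2,3) by (intro exI[of _ U]) simp
qed

section \<open>Essential selfadjointness and identification of the generator\<close>

definition G0 :: "('l \<times> 'l) set" where
  "G0 = {(\<eta> S, (- \<i>) *\<^sub>C \<eta> (D S)) | S. S \<in> A}"

lemma G0_cases:
  assumes "(u, v) \<in> G0"
  obtains S where "S \<in> A" "u = \<eta> S" "v = (- \<i>) *\<^sub>C \<eta> (D S)"
  using assms unfolding G0_def mem_Collect_eq prod.inject by (elim exE conjE)

lemma G0_selfadjoint: "selfadjoint_operator (closure G0)"
proof (rule essentially_selfadjoint)
  show "(0, 0) \<in> G0" unfolding G0_def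
    by (intro CollectI exI[of _ "\<lambda>x. 0"]) (simp add: \<eta>_zero D_zero A_zero)
  show "(u + u', v + v') \<in> G0" if uv: "(u, v) \<in> G0" "(u', v') \<in> G0" for u v u' v'
  proof -
    obtain S where S: "S \<in> A" "u = \<eta> S" "v = (- \<i>) *\<^sub>C \<eta> (D S)" using uv(1) by (rule G0_cases)
    obtain T where T: "T \<in> A" "u' = \<eta> T" "v' = (- \<i>) *\<^sub>C \<eta> (D T)" using uv(2) by (rule G0_cases)
    show ?thesis unfolding G0_def
      by (intro CollectI exI[of _ "\<lambda>x. S x + T x"])
         (simp add: S T \<eta>_plus[OF A_M A_M] D_plus D_in A_plus scaleC_add_right)
  qed
  show "(c *\<^sub>C u, c *\<^sub>C v) \<in> G0" if uv: "(u, v) \<in> G0" for c u v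
  proof -
    obtain S where S: "S \<in> A" "u = \<eta> S" "v = (- \<i>) *\<^sub>C \<eta> (D S)" using uv by (rule G0_cases)
    show ?thesis unfolding G0_def
      by (intro CollectI exI[of _ "\<lambda>x. c *\<^sub>C S x"])
         (simp add: S \<eta>_scale[OF A_M] D_scale D_in A_scale scaleC_scaleC mult.commute)
  qed
  have "Domain G0 = \<eta> ` A" unfolding G0_def by auto
  then show "closure (Domain G0) = UNIV" by (simp only: \<eta>_A_dense)
  show "cinner v u' = cinner u v'" if uv: "(u, v) \<in> G0" "(u', v') \<in> G0" for u v u' v'
  proof -
    obtain S where S: "S \<in> A" "u = \<eta> S" "v = (- \<i>) *\<^sub>C \<eta> (D S)" using uv(1) by (rule G0_cases)
    obtain T where T: "T \<in> A" "u' = \<eta> T" "v' = (- \<i>) *\<^sub>C \<eta> (D T)" using uv(2) by (rule G0_cases)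
    have "cinner (\<eta> (D S)) (\<eta> T) = - cinner (\<eta> S) (\<eta> (D T))"
      using D_antisymmetric[OF S(1) T(1)] by (simp only: eq_neg_iff_add_eq_0)
    then show ?thesis unfolding S T by (simp add: cinner_scaleC_left cinner_scaleC_right)
  qed
  \<comment> \<open>Both ranges have this form: \<open>\<mu>\<close> is -1 for addition of i and 1
    for its subtraction. Orthogonality to the range becomes an eigenvalue equation with real
    eigenvalue, which the exponential series turns into one for the adjoint of the flow.\<close>
  have key: "closure {(- \<i>) *\<^sub>C \<eta> (D S) + (- \<i> * of_real \<mu>) *\<^sub>C \<eta> S | S. S \<in> A} = UNIV" if \<mu>: "\<mu> \<noteq> 0" for \<mu> :: real
  proof (rule dense_if_orthogonal_trivial)
    let ?E = "{(- \<i>) *\<^sub>C \<eta> (D S) + (- \<i> * of_real \<mu>) *\<^sub>C \<eta> S | S. S \<in> A}"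
    show "csubspace ?E" unfolding csubspace_def
    proof (intro conjI ballI allI)
      show "0 \<in> ?E" by (intro CollectI exI[of _ "\<lambda>x. 0"]) (simp add: \<eta>_zero D_zero A_zero)
      fix x assume "x \<in> ?E"
      then obtain S where S: "S \<in> A" "x = (- \<i>) *\<^sub>C \<eta> (D S) + (- \<i> * of_real \<mu>) *\<^sub>C \<eta> S" by (elim CollectE exE conjE)
      show "c *\<^sub>C x \<in> ?E" for c
        by (intro CollectI exI[of _ "\<lambda>x. c *\<^sub>C S x"])
           (simp add: S \<eta>_scale[OF A_M] D_scale D_in A_scale scaleC_scaleC scaleC_add_right scaleC_diff_right mult_ac)
      fix y assume "y \<in> ?E"
      then obtain T where T: "T \<in> A" "y = (- \<i>) *\<^sub>C \<eta> (D T) + (- \<i> * of_real \<mu>) *\<^sub>C \<eta> T" by (elim CollectE exE conjE)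
      show "x + y \<in> ?E"
        by (intro CollectI exI[of _ "\<lambda>x. S x + T x"])
           (simp add: S T \<eta>_plus[OF A_M A_M] D_plus D_in A_plus scaleC_add_right)
    qed
    fix \<xi> assume orth: "\<And>f. f \<in> ?E \<Longrightarrow> cinner f \<xi> = 0"
    define \<nu> where "\<nu> = - \<mu>"
    have eig: "cinner (\<eta> (D S)) \<xi> = of_real \<nu> * cinner (\<eta> S) \<xi>" if S: "S \<in> A" for S
    proof -
      have "cinner ((- \<i>) *\<^sub>C \<eta> (D S) + (- \<i> * of_real \<mu>) *\<^sub>C \<eta> S) \<xi> = 0"
        by (rule orth) (use S in auto)
      then have "- \<i> * (cinner (\<eta> (D S)) \<xi> + of_real \<mu> * cinner (\<eta> S) \<xi>) = 0"
        by (simp add: cinner_add_left cinner_diff_left cinner_scaleC_left algebra_simps)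
      then show ?thesis by (simp add: eq_neg_iff_add_eq_0 \<nu>_def)
    qed
    have pow: "cinner (\<eta> ((D ^^ k) S)) \<xi> = of_real (\<nu> ^ k) * cinner (\<eta> S) \<xi>" if S: "S \<in> A" for S k
    proof (induction k)
      case (Suc k)
      have "cinner (\<eta> ((D ^^ Suc k) S)) \<xi> = of_real \<nu> * cinner (\<eta> ((D ^^ k) S)) \<xi>"
        using eig[OF D_power_in[OF S]] by simp
      then show ?case by (simp add: Suc)
    qed simp
    \<comment> \<open>Any positive time within the radius works: unitarity requires exp (t \<nu>) =
      1 unless the vector is zero, while neither t nor \<nu> vanishes.\<close>
    define t where "t = radius / 2"
    have t: "\<bar>t\<bar> < radius" "\<bar>t\<bar> < 2 * radius" "t > 0" using radius(1) by (simp_all add: t_def)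
    define m where "m = exp (t * \<nu>)"
    have bt: "bounded_clinear (flow_op t)" by (rule flow_op(1)[OF t(2)])
    have fl: "cinner (flow t S) \<xi> = of_real m * cinner (\<eta> S) \<xi>" if S: "S \<in> A" for S
    proof -
      have "(\<lambda>k. cinner (flow_term t S k) \<xi>) sums cinner (flow t S) \<xi>"
        unfolding flow_def
        by (rule bounded_linear.sums[OF bounded_bilinear.bounded_linear_left[OF bounded_bilinear_cinner] summable_sums[OF summable_flow[OF t(2) S]]])
      moreover have "cinner (flow_term t S k) \<xi> = of_real ((t * \<nu>) ^ k /\<^sub>R fact k) * cinner (\<eta> S) \<xi>" for k
        using pow[OF S, of k]
        by (simp add: flow_term_def scaleR_scaleC cinner_scaleC_left power_mult_distrib divide_inverse mult_ac)
      ultimately have "(\<lambda>k. of_real ((t * \<nu>) ^ k /\<^sub>R fact k) * cinner (\<eta> S) \<xi>) sums cinner (flow t S) \<xi>" by simp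
      moreover have "(\<lambda>k. of_real ((t * \<nu>) ^ k /\<^sub>R fact k) * cinner (\<eta> S) \<xi>) sums (of_real m * cinner (\<eta> S) \<xi>)"
        unfolding m_def by (intro sums_mult2 sums_of_real exp_converges)
      ultimately show ?thesis by (rule sums_unique2)
    qed
    have "adj (flow_op t) \<xi> - of_real m *\<^sub>C \<xi> = 0"
    proof (rule dense_orthogonal_zero[OF \<eta>_A_dense])
      fix v assume "v \<in> \<eta> ` A"
      then obtain S where S: "v = \<eta> S" "S \<in> A" by (rule imageE)
      have "cinner v (adj (flow_op t) \<xi>) = of_real m * cinner v \<xi>"
        using fl[OF S(2)] by (simp add: cinner_adj[OF bt, symmetric] S flow_op(2)[OF t(2)])
      then show "cinner v (adj (flow_op t) \<xi> - of_real m *\<^sub>C \<xi>) = 0"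
        by (simp add: cinner_diff_right cinner_scaleC_right)
    qed
    then have adjm: "adj (flow_op t) \<xi> = of_real m *\<^sub>C \<xi>" by simp
    obtain x where x: "\<xi> = flow_op t x" using unitaryD(2)[OF flow_op_unitary[OF t(1)]] by (rule surjE)
    have "adj (flow_op t) (flow_op t x) = x"
    proof (rule cinner_ext)
      fix y
      show "cinner (adj (flow_op t) (flow_op t x)) y = cinner x y"
        using cinner_adj'[OF bt, of "flow_op t x" y] flow_op_cinner[OF t(2)] by simp
    qed
    then have "norm (adj (flow_op t) \<xi>) = norm \<xi>" using x unitaryD(4)[OF flow_op_unitary[OF t(1)], of x] by simp
    then have "m * norm \<xi> = norm \<xi>" unfolding adjm by (simp add: m_def)
    moreover have "m \<noteq> 1" using t(3) \<mu> by (simp add: m_def \<nu>_def)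
    ultimately show "\<xi> = 0" by simp
  qed
  have inG0: "(\<eta> S, (- \<i>) *\<^sub>C \<eta> (D S)) \<in> G0" if "S \<in> A" for S
    unfolding G0_def by (intro CollectI exI[of _ S] conjI refl that)
  have "{(- \<i>) *\<^sub>C \<eta> (D S) + (- \<i> * of_real (- 1)) *\<^sub>C \<eta> S | S. S \<in> A} \<subseteq> {v + \<i> *\<^sub>C u | u v. (u, v) \<in> G0}"
  proof
    fix x assume "x \<in> {(- \<i>) *\<^sub>C \<eta> (D S) + (- \<i> * of_real (- 1)) *\<^sub>C \<eta> S | S. S \<in> A}"
    then obtain S where S: "x = (- \<i>) *\<^sub>C \<eta> (D S) + (- \<i> * of_real (- 1)) *\<^sub>C \<eta> S" "S \<in> A"
      by (elim CollectE exE conjE)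
    have "x = (- \<i>) *\<^sub>C \<eta> (D S) + \<i> *\<^sub>C \<eta> S" unfolding S(1) by simp
    then show "x \<in> {v + \<i> *\<^sub>C u | u v. (u, v) \<in> G0}"
      using inG0[OF S(2)] by (intro CollectI exI[of _ "\<eta> S"] exI[of _ "(- \<i>) *\<^sub>C \<eta> (D S)"] conjI)
  qed
  note sub = closure_mono[OF this]
  have "closure {(- \<i>) *\<^sub>C \<eta> (D S) + (- \<i> * of_real (- 1)) *\<^sub>C \<eta> S | S. S \<in> A} = UNIV" by (rule key) simp
  with sub show "closure {v + \<i> *\<^sub>C u | u v. (u, v) \<in> G0} = UNIV" by (simp only: top.extremum_unique)
  have "{(- \<i>) *\<^sub>C \<eta> (D S) + (- \<i> * of_real 1) *\<^sub>C \<eta> S | S. S \<in> A} \<subseteq> {v - \<i> *\<^sub>C u | u v. (u, v) \<in> G0}"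
  proof
    fix x assume "x \<in> {(- \<i>) *\<^sub>C \<eta> (D S) + (- \<i> * of_real 1) *\<^sub>C \<eta> S | S. S \<in> A}"
    then obtain S where S: "x = (- \<i>) *\<^sub>C \<eta> (D S) + (- \<i> * of_real 1) *\<^sub>C \<eta> S" "S \<in> A"
      by (elim CollectE exE conjE)
    have "x = (- \<i>) *\<^sub>C \<eta> (D S) - \<i> *\<^sub>C \<eta> S" unfolding S(1) by simp
    then show "x \<in> {v - \<i> *\<^sub>C u | u v. (u, v) \<in> G0}"
      using inG0[OF S(2)] by (intro CollectI exI[of _ "\<eta> S"] exI[of _ "(- \<i>) *\<^sub>C \<eta> (D S)"] conjI)
  qed
  note sub = closure_mono[OF this]
  have "closure {(- \<i>) *\<^sub>C \<eta> (D S) + (- \<i> * of_real 1) *\<^sub>C \<eta> S | S. S \<in> A} = UNIV" by (rule key) simp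
  with sub show "closure {v - \<i> *\<^sub>C u | u v. (u, v) \<in> G0} = UNIV" by (simp only: top.extremum_unique)
qed

lemma G0_generator:
  assumes U: "unitary_group U" "\<And>t. \<bar>t\<bar> < radius \<Longrightarrow> U t = flow_op t" and g: "(\<xi>, \<zeta>) \<in> G0"
  shows "(\<xi>, \<i> *\<^sub>C \<zeta>) \<in> generator U"
proof -
  obtain S where S: "S \<in> A" "\<xi> = \<eta> S" "\<zeta> = (- \<i>) *\<^sub>C \<eta> (D S)" using g by (rule G0_cases)
  have \<zeta>: "\<i> *\<^sub>C \<zeta> = \<eta> (D S)" by (simp add: S(3) scaleC_scaleC)
  obtain C where C: "C \<ge> 0" "\<forall>t. \<bar>t\<bar> < 2 * radius \<longrightarrow> norm (flow t S - \<eta> S - t *\<^sub>R \<eta> (D S)) \<le> C * t\<^sup>2"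
    using flow_expansion[OF S(1)] by (elim exE conjE)
  have le: "norm ((U t \<xi> - \<xi>) /\<^sub>R t - \<eta> (D S)) \<le> C * \<bar>t\<bar>" if t: "t \<noteq> 0" "\<bar>t\<bar> < radius" for t
  proof -
    have t2: "\<bar>t\<bar> < 2 * radius" using t(2) by simp
    have "U t \<xi> = flow t S" by (simp add: U(2)[OF t(2)] S(2) flow_op(2)[OF t2 S(1)])
    then have "(U t \<xi> - \<xi>) /\<^sub>R t - \<eta> (D S) = inverse t *\<^sub>R (flow t S - \<eta> S - t *\<^sub>R \<eta> (D S))"
      using t(1) by (simp add: S(2) scaleR_diff_right)
    then have "norm ((U t \<xi> - \<xi>) /\<^sub>R t - \<eta> (D S)) = inverse \<bar>t\<bar> * norm (flow t S - \<eta> S - t *\<^sub>R \<eta> (D S))"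
      by simp
    also have "\<dots> \<le> inverse \<bar>t\<bar> * (C * t\<^sup>2)" by (rule mult_left_mono[OF C(2)[rule_format, OF t2]]) simp
    also have "\<dots> = C * \<bar>t\<bar>"
    proof -
      have "t\<^sup>2 = \<bar>t\<bar> * \<bar>t\<bar>" by (simp add: power2_eq_square)
      then have "inverse \<bar>t\<bar> * (C * t\<^sup>2) = (inverse \<bar>t\<bar> * \<bar>t\<bar>) * (C * \<bar>t\<bar>)" by (simp only: mult_ac)
      also have "inverse \<bar>t\<bar> * \<bar>t\<bar> = 1" using t(1) by simp
      finally show ?thesis by (simp only: mult_1_left)
    qed
    finally show ?thesis .
  qed
  have "((\<lambda>t. (U t \<xi> - \<xi>) /\<^sub>R t - \<eta> (D S)) \<longlongrightarrow> 0) (at 0)"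
  proof (rule Lim_null_comparison)
    show "\<forall>\<^sub>F t in at 0. norm ((U t \<xi> - \<xi>) /\<^sub>R t - \<eta> (D S)) \<le> C * \<bar>t\<bar>"
      unfolding eventually_at using radius(1) le by (intro exI[of _ radius]) (simp add: dist_norm)
    have "((\<lambda>t. C * \<bar>t\<bar>) \<longlongrightarrow> C * \<bar>0\<bar>) (at 0)" by (intro tendsto_intros)
    then show "((\<lambda>t. C * \<bar>t\<bar>) \<longlongrightarrow> 0) (at (0::real))" by simp
  qed
  then show ?thesis unfolding generator_def \<zeta> by (simp add: LIM_zero_iff)
qed

end

section \<open>Implementation of automorphisms\<close>

text \<open>Here r = (1 + b^2)^(-1). Expanding the squared norm of v + b (b v) shows that 1 + b^2 is
  bounded below, so it is injective and its inverse is continuous; positivity leaves no vector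
  orthogonal to its range.\<close>

lemma selfadjoint_resolvent:
  fixes b :: "'a::complex_hilbert \<Rightarrow> 'a"
  assumes b: "bounded_clinear b" "adj b = b"
  shows "\<exists>r. bounded_clinear r \<and> adj r = r \<and> (\<forall>v. r v + b (b (r v)) = v) \<and> (\<forall>v. r (v + b (b v)) = v)
    \<and> (\<forall>v. norm (r v) \<le> norm v) \<and> (\<forall>v. norm (b (r v)) \<le> 1/2 * norm v)"
proof -
  define q where "q v = v + b (b v)" for v
  have bq: "bounded_clinear q"
    using bounded_clinear_plus[OF bounded_clinear_id bounded_clinear_comp[OF b(1) b(1)]] by (simp add: q_def[abs_def])
  have sym: "cinner (b u) v = cinner u (b v)" for u v using cinner_adj[OF b(1), of u v] by (simp add: b(2))
  have qsym: "cinner (q u) v = cinner u (q v)" for u v by (simp add: q_def cinner_simps sym)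
  have qn: "(norm (q v))\<^sup>2 = (norm v)\<^sup>2 + 2 * (norm (b v))\<^sup>2 + (norm (b (b v)))\<^sup>2" for v
    unfolding q_def norm_add_sq by (simp add: norm_sq_cinner[of "b v"] sym)
  have q1: "norm v \<le> norm (q v)" for v
    by (rule power2_le_imp_le) (simp_all add: qn)
  \<comment> \<open>Cauchy-Schwarz and the inequality between arithmetic and geometric means bound 2
    |b v|^2 by |v|^2 + |b (b v)|^2. Together with the middle term of \<open>qn\<close> this gives 4
    |b v|^2, hence the norm 1/2 of b (1 + b^2)^(-1).\<close>
  have q2: "2 * norm (b v) \<le> norm (q v)" for v
  proof (rule power2_le_imp_le)
    have "(norm (b v))\<^sup>2 = Re (cinner v (b (b v)))" by (simp add: norm_sq_cinner sym)
    also have "\<dots> \<le> norm v * norm (b (b v))" using complex_Re_le_cmod norm_cinner_le by (rule order_trans)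
    finally have "2 * (norm (b v))\<^sup>2 \<le> (norm v)\<^sup>2 + (norm (b (b v)))\<^sup>2"
      using sum_squares_bound[of "norm v" "norm (b (b v))"] by linarith
    then show "(2 * norm (b v))\<^sup>2 \<le> (norm (q v))\<^sup>2" by (simp add: qn power_mult_distrib)
  qed simp
  have "csubspace (range q)"
    unfolding csubspace_def
  proof (intro conjI ballI allI)
    show "0 \<in> range q" by (rule range_eqI[of _ _ 0]) (simp add: bounded_clinear_zero[OF bq])
    show "x + y \<in> range q" if xy: "x \<in> range q" "y \<in> range q" for x y
    proof -
      obtain u where u: "x = q u" using xy(1) by (rule rangeE)
      obtain v where v: "y = q v" using xy(2) by (rule rangeE)
      show ?thesis by (rule range_eqI[of _ _ "u + v"]) (simp add: u v bounded_clinear_add[OF bq])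
    qed
    show "c *\<^sub>C x \<in> range q" if x: "x \<in> range q" for c x
    proof -
      obtain u where u: "x = q u" using x by (rule rangeE)
      show ?thesis by (rule range_eqI[of _ _ "c *\<^sub>C u"]) (simp add: u bounded_clinear_scaleC[OF bq])
    qed
  qed
  then have dense: "closure (range q) = UNIV"
  proof (rule dense_if_orthogonal_trivial)
    fix x assume orth: "\<And>f. f \<in> range q \<Longrightarrow> cinner f x = 0"
    have "cinner (q x) x = 0" by (rule orth) simp
    moreover have "Re (cinner (q x) x) = (norm x)\<^sup>2 + (norm (b x))\<^sup>2"
      by (simp add: q_def cinner_add_left norm_sq_cinner sym)
    ultimately show "x = 0" by (simp add: add_nonneg_eq_0_iff)
  qed
  have surj: "\<exists>u. q u = v" for v
  proof -
    have "v \<in> closure (range q)" using dense by simp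
    then obtain f where f: "\<forall>n. f n \<in> range q" "f \<longlonglongrightarrow> v" unfolding closure_sequential by (elim exE conjE)
    have "\<forall>n. \<exists>u. f n = q u" using f(1) by auto
    from choice[OF this] obtain u where u: "\<forall>n. f n = q (u n)" by (rule exE)
    have "Cauchy u"
    proof (rule CauchyI)
      fix e :: real assume "e > 0"
      then obtain N where N: "\<forall>m\<ge>N. \<forall>n\<ge>N. norm (f m - f n) < e"
        using CauchyD[OF LIMSEQ_imp_Cauchy[OF f(2)]] by blast
      have "norm (u m - u n) \<le> norm (f m - f n)" for m n
        using q1[of "u m - u n"] u by (simp add: bounded_clinear_diff[OF bq])
      then show "\<exists>N. \<forall>m\<ge>N. \<forall>n\<ge>N. norm (u m - u n) < e" using N le_less_trans by blast
    qed
    then obtain l where l: "u \<longlonglongrightarrow> l" unfolding Cauchy_convergent_iff convergent_def by (rule exE)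
    have "(\<lambda>n. q (u n)) \<longlonglongrightarrow> q l" by (rule bounded_clinear_tendsto[OF bq l])
    moreover have "(\<lambda>n. q (u n)) = f" using u by auto
    ultimately have "q l = v" using LIMSEQ_unique[OF f(2)] by simp
    then show ?thesis by (rule exI)
  qed
  then have "\<forall>v. \<exists>u. q u = v" by (rule allI)
  from choice[OF this] obtain r where qr: "\<forall>v. q (r v) = v" by (rule exE)
  have inj: "u = v" if "q u = q v" for u v
    using q1[of "u - v"] that by (simp add: bounded_clinear_diff[OF bq])
  have rq: "r (q v) = v" for v by (rule inj) (simp add: qr)
  have br: "bounded_clinear r"
  proof (rule bounded_clinearI[of _ 1])
    show "r (x + y) = r x + r y" for x y by (rule inj) (simp add: qr bounded_clinear_add[OF bq])
    show "r (c *\<^sub>C x) = c *\<^sub>C r x" for c x by (rule inj) (simp add: qr bounded_clinear_scaleC[OF bq])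
    show "norm (r x) \<le> 1 * norm x" for x using q1[of "r x"] by (simp add: qr)
  qed
  have "adj r = r"
  proof (rule adj_unique)
    show "cinner (r x) y = cinner x (r y)" for x y using qsym[of "r x" "r y"] by (simp add: qr)
  qed
  moreover have "norm (r v) \<le> norm v" for v using q1[of "r v"] by (simp add: qr)
  moreover have "norm (b (r v)) \<le> 1/2 * norm v" for v
  proof -
    have "2 * norm (b (r v)) \<le> norm v" using q2[of "r v"] by (simp only: qr)
    then show ?thesis by linarith
  qed
  ultimately show ?thesis using br qr rq by (intro exI[of _ r]) (simp add: q_def)
qed

context tracial_algebra begin

text \<open>This solves \<open>x = 2 z / (1 + z\<^sup>2)\<close>: \<open>z\<close> is the fixed point of the contraction
  \<open>z \<mapsto> x (1 + z\<^sup>2) / 2\<close>.\<close>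

lemma cayley_preimage:
  assumes x: "x \<in> M" "adj x = x" "\<And>v. norm (x v) \<le> 1/2 * norm v"
  shows "\<exists>z\<in>M. adj z = z \<and> (\<forall>v. x (v + z (z v)) = 2 *\<^sub>C z v)"
proof -
  have bx: "bounded_clinear x" by (rule M_bounded[OF x(1)])
  have xsym: "cinner (x u) v = cinner u (x v)" for u v using cinner_adj[OF bx, of u v] by (simp add: x(2))
  define X where "X = Blinfun x"
  have X: "blinfun_apply X = x" unfolding X_def by (rule bounded_linear_Blinfun_apply[OF bounded_clinear_bounded_linear[OF bx]])
  \<comment> \<open>With this bound and the factor 1/2 in the map, the unit ball is mapped into
    itself and the Lipschitz constant on it is at most 1/2.\<close>
  have nX: "norm X \<le> 1/2"
  proof (rule norm_blinfun_bound)
    show "norm (blinfun_apply X u) \<le> 1/2 * norm u" for u unfolding X by (rule x(3))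
  qed simp
  \<comment> \<open>The Banach space at hand consists of real-linear maps, so self-adjointness,
    complex linearity and membership in \<open>M\<close> are imposed as closed conditions that the
    fixed point inherits. Commutation with \<open>x\<close> in \<open>S3\<close> is what keeps x (1
    + z^2) self-adjoint.\<close>
  define S1 where "S1 = {z :: 'a \<Rightarrow>\<^sub>L 'a. \<forall>u v. cinner (blinfun_apply z u) v = cinner u (blinfun_apply z v)}"
  define S2 where "S2 = {z :: 'a \<Rightarrow>\<^sub>L 'a. \<forall>c u. blinfun_apply z (c *\<^sub>C u) = c *\<^sub>C blinfun_apply z u}"
  define S3 where "S3 = {z :: 'a \<Rightarrow>\<^sub>L 'a. \<forall>u. blinfun_apply z (x u) = x (blinfun_apply z u)}"
  define S4 where "S4 = {z :: 'a \<Rightarrow>\<^sub>L 'a. \<forall>T\<in>commutant M. \<forall>u. blinfun_apply z (T u) = T (blinfun_apply z u)}"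
  define S where "S = cball 0 1 \<inter> S1 \<inter> S2 \<inter> S3 \<inter> S4"
  have ev: "continuous_on UNIV (\<lambda>z :: 'a \<Rightarrow>\<^sub>L 'a. blinfun_apply z u)" for u
    by (rule linear_continuous_on[OF blinfun.bounded_linear_left])
  have evT: "continuous_on UNIV (\<lambda>z :: 'a \<Rightarrow>\<^sub>L 'a. T (blinfun_apply z u))" if T: "bounded_linear T" for T :: "'a \<Rightarrow> 'a" and u
    by (rule linear_continuous_on[OF bounded_linear_compose[OF T blinfun.bounded_linear_left]])
  have "closed S1" unfolding S1_def
    by (intro closed_Collect_all closed_Collect_eq continuous_on_cinner ev continuous_on_const)
  moreover have "closed S2" unfolding S2_def
    by (intro closed_Collect_all closed_Collect_eq ev evT bounded_linear_scaleC)
  moreover have "closed S3" unfolding S3_def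
    by (intro closed_Collect_all closed_Collect_eq ev evT bounded_clinear_bounded_linear[OF bx])
  moreover have "closed S4"
  proof -
    have "S4 = (\<Inter>T\<in>commutant M. {z. \<forall>u. blinfun_apply z (T u) = T (blinfun_apply z u)})" unfolding S4_def by auto
    moreover have "closed {z. \<forall>u. blinfun_apply z (T u) = T (blinfun_apply z u)}" if T: "T \<in> commutant M" for T
      by (intro closed_Collect_all closed_Collect_eq ev evT bounded_clinear_bounded_linear[OF commutant_bounded[OF T]])
    ultimately show ?thesis by (auto intro!: closed_INT)
  qed
  ultimately have "closed S" unfolding S_def by (intro closed_Int closed_cball)
  then have complete: "complete S" by (simp add: complete_eq_closed)
  have "0 \<in> S" unfolding S_def S1_def S2_def S3_def S4_def
    by (simp add: bounded_clinear_zero[OF bx] bounded_clinear_zero[OF commutant_bounded])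
  then have nonempty: "S \<noteq> {}" by auto
  define \<Phi> where "\<Phi> z = (1/2) *\<^sub>R (X o\<^sub>L (id_blinfun + (z o\<^sub>L z)))" for z :: "'a \<Rightarrow>\<^sub>L 'a"
  have \<Phi>: "blinfun_apply (\<Phi> z) u = (1/2) *\<^sub>C x (u + blinfun_apply z (blinfun_apply z u))" for z u
    by (simp add: \<Phi>_def X plus_blinfun.rep_eq scaleR_blinfun.rep_eq scaleR_scaleC)
  have XM: "norm (X o\<^sub>L B) \<le> 1/2 * norm B" for B
    by (rule order_trans[OF norm_blinfun_compose mult_right_mono[OF nX]]) simp
  have maps: "\<Phi> ` S \<subseteq> S"
  proof
    fix w assume "w \<in> \<Phi> ` S"
    then obtain z where z: "w = \<Phi> z" "z \<in> S" by (rule imageE)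
    have z0: "norm z \<le> 1" using z(2) by (simp add: S_def)
    have z1: "cinner (blinfun_apply z u) v = cinner u (blinfun_apply z v)" for u v using z(2) by (simp add: S_def S1_def)
    have z2: "blinfun_apply z (c *\<^sub>C u) = c *\<^sub>C blinfun_apply z u" for c u using z(2) by (simp add: S_def S2_def)
    have z3: "blinfun_apply z (x u) = x (blinfun_apply z u)" for u using z(2) by (simp add: S_def S3_def)
    have z4: "blinfun_apply z (T u) = T (blinfun_apply z u)" if "T \<in> commutant M" for T u
      using z(2) that by (simp add: S_def S4_def)
    have "norm (\<Phi> z) \<le> 1"
    proof -
      have "norm (id_blinfun + (z o\<^sub>L z)) \<le> norm (id_blinfun :: 'a \<Rightarrow>\<^sub>L 'a) + norm (z o\<^sub>L z)" by (rule norm_triangle_ineq)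
      also have "\<dots> \<le> 1 + 1"
      proof (rule add_mono)
        show "norm (id_blinfun :: 'a \<Rightarrow>\<^sub>L 'a) \<le> 1" by (rule norm_blinfun_bound) simp_all
        have "norm (z o\<^sub>L z) \<le> norm z * norm z" by (rule norm_blinfun_compose)
        also have "\<dots> \<le> 1 * 1" using z0 by (intro mult_mono) simp_all
        finally show "norm (z o\<^sub>L z) \<le> 1" by simp
      qed
      finally have "norm (X o\<^sub>L (id_blinfun + (z o\<^sub>L z))) \<le> 1" using XM[of "id_blinfun + (z o\<^sub>L z)"] by simp
      then show ?thesis by (simp add: \<Phi>_def)
    qed
    moreover have "\<Phi> z \<in> S1"
      unfolding S1_def by (simp add: \<Phi> cinner_scaleC_left cinner_scaleC_right cinner_add_left cinner_add_right xsym z1 z3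
          bounded_clinear_add[OF bx])
    moreover have "\<Phi> z \<in> S2"
      unfolding S2_def by (simp add: \<Phi> z2 bounded_clinear_scaleC[OF bx] scaleC_scaleC mult.commute flip: scaleC_add_right)
    moreover have "\<Phi> z \<in> S3"
      unfolding S3_def by (simp add: \<Phi> z3 bounded_clinear_scaleC[OF bx] bounded_clinear_add[OF bx])
    moreover have "\<Phi> z \<in> S4" unfolding S4_def
    proof (intro CollectI ballI allI)
      fix T u assume T: "T \<in> commutant M"
      have bT: "bounded_clinear T" by (rule commutant_bounded[OF T])
      have xT: "x (T v) = T (x v)" for v using fun_cong[OF commutant_comp[OF T x(1)], of v] by simp
      show "blinfun_apply (\<Phi> z) (T u) = T (blinfun_apply (\<Phi> z) u)"
        unfolding \<Phi> by (simp add: z4[OF T] xT bounded_clinear_scaleC[OF bT] flip: bounded_clinear_add[OF bT])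
    qed
    ultimately show "w \<in> S" unfolding S_def z(1) by simp
  qed
  have "\<exists>!z\<in>S. \<Phi> z = z"
  proof (rule Banach_fix[OF complete nonempty _ _ maps, where c = "1/2"])
    fix z w assume zw: "z \<in> S" "w \<in> S"
    have nz: "norm z \<le> 1" "norm w \<le> 1" using zw by (simp_all add: S_def)
    have "(id_blinfun + (z o\<^sub>L z)) - (id_blinfun + (w o\<^sub>L w)) = (z o\<^sub>L (z - w)) + ((z - w) o\<^sub>L w)"
      by (rule blinfun_eqI) (simp add: plus_blinfun.rep_eq minus_blinfun.rep_eq blinfun.diff_right)
    moreover have "\<Phi> z - \<Phi> w = (1/2) *\<^sub>R (X o\<^sub>L ((id_blinfun + (z o\<^sub>L z)) - (id_blinfun + (w o\<^sub>L w))))"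
      unfolding \<Phi>_def
      by (simp only: scaleR_diff_right bounded_bilinear.diff_right[OF bounded_bilinear_blinfun_compose])
    ultimately have "norm (\<Phi> z - \<Phi> w) = 1/2 * norm (X o\<^sub>L ((z o\<^sub>L (z - w)) + ((z - w) o\<^sub>L w)))" by simp
    also have "\<dots> \<le> 1/2 * (1/2 * norm ((z o\<^sub>L (z - w)) + ((z - w) o\<^sub>L w)))" by (rule mult_left_mono[OF XM]) simp
    finally have 1: "norm (\<Phi> z - \<Phi> w) \<le> 1/2 * (1/2 * norm ((z o\<^sub>L (z - w)) + ((z - w) o\<^sub>L w)))" .
    have 2: "norm ((z o\<^sub>L (z - w)) + ((z - w) o\<^sub>L w)) \<le> norm (z - w) + norm (z - w)"
    proof (rule order_trans[OF norm_triangle_ineq add_mono])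
      show "norm (z o\<^sub>L (z - w)) \<le> norm (z - w)"
        using norm_blinfun_compose[of z "z - w"] mult_right_mono[OF nz(1) norm_ge_zero[of "z - w"]] by simp
      show "norm ((z - w) o\<^sub>L w) \<le> norm (z - w)"
        using norm_blinfun_compose[of "z - w" w] mult_left_mono[OF nz(2) norm_ge_zero[of "z - w"]] by simp
    qed
    show "dist (\<Phi> z) (\<Phi> w) \<le> 1/2 * dist z w" unfolding dist_norm using 1 2 by linarith
  qed simp_all
  then obtain z where z: "z \<in> S" "\<Phi> z = z" by (elim ex1E conjE)
  define y where "y = blinfun_apply z"
  have by0: "bounded_clinear y" unfolding bounded_clinear_def y_def
    using z(1) by (simp add: blinfun.bounded_linear_right S_def S2_def)
  have "adj y = y" by (rule adj_unique) (use z(1) in \<open>simp add: y_def S_def S1_def\<close>)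
  moreover have "y \<in> M"
  proof (rule M_bicommutant[OF by0])
    fix T assume "T \<in> commutant M"
    then show "y \<circ> T = T \<circ> y" using z(1) by (intro ext) (simp add: y_def S_def S4_def)
  qed
  moreover have "x (v + y (y v)) = 2 *\<^sub>C y v" for v
  proof -
    have "y v = (1/2) *\<^sub>C x (v + y (y v))" using \<Phi>[of z v] unfolding z(2) y_def .
    then have "2 *\<^sub>C y v = 2 *\<^sub>C ((1/2) *\<^sub>C x (v + y (y v)))" by (rule arg_cong)
    then show ?thesis by (simp add: scaleC_scaleC)
  qed
  ultimately show ?thesis by (intro bexI[of _ y]) simp_all
qed

text \<open>\<open>r\<close> is (1 + b^2)^(-1); the transform b / (1 + b^2) then appears as
  \<open>b \<circ> r\<close>.\<close>

definition is_resolvent :: "('a \<Rightarrow> 'a) \<Rightarrow> ('a \<Rightarrow> 'a) \<Rightarrow> bool" where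
  "is_resolvent b r \<longleftrightarrow> r \<in> M \<and> (\<forall>v. r v + b (b (r v)) = v) \<and> (\<forall>v. r (v + b (b v)) = v)
    \<and> (\<forall>v. norm (r v) \<le> norm v) \<and> (\<forall>v. norm (b (r v)) \<le> 1/2 * norm v)"

lemma resolvent_exists:
  assumes b: "b \<in> M" "adj b = b" shows "\<exists>r. is_resolvent b r"
proof -
  obtain r where r: "bounded_clinear r" "\<forall>v. r v + b (b (r v)) = v" "\<forall>v. r (v + b (b v)) = v"
    "\<forall>v. norm (r v) \<le> norm v" "\<forall>v. norm (b (r v)) \<le> 1/2 * norm v"
    using selfadjoint_resolvent[OF M_bounded[OF b(1)] b(2)] by (elim exE conjE)
  have "r \<in> M"
  proof (rule M_bicommutant[OF r(1)])
    fix T assume T: "T \<in> commutant M"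
    have bT: "bounded_clinear T" by (rule commutant_bounded[OF T])
    have Tb: "b (T v) = T (b v)" for v using fun_cong[OF commutant_comp[OF T b(1)], of v] by simp
    have "r (T v) = T (r v)" for v
    proof -
      have "T v = T (r v) + b (b (T (r v)))"
        using arg_cong[OF r(2)[rule_format, of v], of T] by (simp add: bounded_clinear_add[OF bT] Tb)
      then show ?thesis using r(3) by simp
    qed
    then show "r \<circ> T = T \<circ> r" by (intro ext) simp
  qed
  then show ?thesis using r(2-5) unfolding is_resolvent_def by (intro exI[of _ r]) simp
qed

lemma resolvent_commute:
  assumes b: "b \<in> M" and r: "is_resolvent b r" shows "b (r v) = r (b v)"
proof -
  have bb: "bounded_clinear b" by (rule M_bounded[OF b])
  have r1: "r v + b (b (r v)) = v" and r2: "r (w + b (b w)) = w" for w using r by (simp_all add: is_resolvent_def)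
  have "r (b v) = r (b (r v + b (b (r v))))" by (simp only: r1)
  also have "\<dots> = r (b (r v) + b (b (b (r v))))" by (simp only: bounded_clinear_add[OF bb])
  also have "\<dots> = b (r v)" by (rule r2)
  finally show ?thesis by (rule sym)
qed

text \<open>The resolvent identity a r - z s = r (a - z) s - (a r) (a - z) (z s) isolates the
  difference between bounded factors. Left and right multiplication bounds give the constant 1 +
  1/4, rounded up to 2.\<close>

lemma cayley_lipschitz:
  assumes a: "a \<in> M" and z: "z \<in> M" and ra: "is_resolvent a r" and rz: "is_resolvent z s"
  shows "norm (\<eta> (a \<circ> r) - \<eta> (z \<circ> s)) \<le> 2 * norm (\<eta> a - \<eta> z)"
proof -
  define d where "d = (\<lambda>x. a x - z x)"
  have dM: "d \<in> M" unfolding d_def by (rule M_diff[OF a z])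
  have r: "r \<in> M" "\<And>v. norm (r v) \<le> 1 * norm v" "\<And>v. norm ((a \<circ> r) v) \<le> 1/2 * norm v" "\<And>v. r (v + a (a v)) = v"
    using ra by (simp_all add: is_resolvent_def)
  have s: "s \<in> M" "\<And>v. norm (s v) \<le> 1 * norm v" "\<And>v. norm ((z \<circ> s) v) \<le> 1/2 * norm v" "\<And>v. s v + z (z (s v)) = v"
    using rz by (simp_all add: is_resolvent_def)
  have br: "bounded_clinear r" and bd: "bounded_clinear a" by (rule M_bounded[OF r(1)], rule M_bounded[OF a])
  have M1: "d \<circ> s \<in> M" "r \<circ> (d \<circ> s) \<in> M" "a \<circ> r \<in> M" "z \<circ> s \<in> M" "d \<circ> (z \<circ> s) \<in> M" "(a \<circ> r) \<circ> (d \<circ> (z \<circ> s)) \<in> M"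
    by (intro M_comp dM r(1) s(1) a z)+
  have eq: "(\<lambda>v. (a \<circ> r) v - (z \<circ> s) v) = (\<lambda>v. (r \<circ> (d \<circ> s)) v - ((a \<circ> r) \<circ> (d \<circ> (z \<circ> s))) v)"
  proof
    fix v
    define w where "w = s v"
    have v: "v = w + z (z w)" using s(4)[of v] by (simp add: w_def)
    have "z w = r (z w) + r (a (a (z w)))" using r(4)[of "z w"] by (simp add: bounded_clinear_add[OF br])
    then have "a (r v) - z w = r (a w) + r (a (z (z w))) - (r (z w) + r (a (a (z w))))"
      using v by (simp add: resolvent_commute[OF a ra] bounded_clinear_add[OF br] bounded_clinear_add[OF bd])
    also have "\<dots> = r (a w - z w) - a (r (a (z w) - z (z w)))"
      by (simp add: resolvent_commute[OF a ra] bounded_clinear_diff[OF br] bounded_clinear_diff[OF bd])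
    finally show "(a \<circ> r) v - (z \<circ> s) v = (r \<circ> (d \<circ> s)) v - ((a \<circ> r) \<circ> (d \<circ> (z \<circ> s))) v"
      by (simp add: w_def d_def)
  qed
  have "\<eta> (a \<circ> r) - \<eta> (z \<circ> s) = \<eta> (r \<circ> (d \<circ> s)) - \<eta> ((a \<circ> r) \<circ> (d \<circ> (z \<circ> s)))"
    using \<eta>_diff[OF M1(3,4)] \<eta>_diff[OF M1(2,6)] by (simp only: eq)
  then have "norm (\<eta> (a \<circ> r) - \<eta> (z \<circ> s)) \<le> norm (\<eta> (r \<circ> (d \<circ> s))) + norm (\<eta> ((a \<circ> r) \<circ> (d \<circ> (z \<circ> s))))"
    by (simp only: norm_triangle_ineq4)
  also have "\<dots> \<le> 1 * (1 * norm (\<eta> d)) + 1/2 * (1/2 * norm (\<eta> d))"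
  proof (rule add_mono)
    show "norm (\<eta> (r \<circ> (d \<circ> s))) \<le> 1 * (1 * norm (\<eta> d))"
      by (rule order_trans[OF norm_\<eta>_mult_le[OF r(1) M1(1) _ r(2)] mult_left_mono[OF norm_\<eta>_right_mult_le[OF dM s(1) _ s(2)]]]) simp_all
    show "norm (\<eta> ((a \<circ> r) \<circ> (d \<circ> (z \<circ> s)))) \<le> 1/2 * (1/2 * norm (\<eta> d))"
      by (rule order_trans[OF norm_\<eta>_mult_le[OF M1(3,5) _ r(3)] mult_left_mono[OF norm_\<eta>_right_mult_le[OF dM M1(4) _ s(3)]]]) simp_all
  qed
  also have "\<dots> \<le> 2 * norm (\<eta> d)" by simp
  also have "\<eta> d = \<eta> a - \<eta> z" unfolding d_def by (rule \<eta>_diff[OF a z])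
  finally show ?thesis .
qed

text \<open>At \<open>\<eta> T\<close> the vector \<open>L (y n) (\<eta> T)\<close> is the right
  multiplication by \<open>T\<close> of \<open>\<eta> (y n)\<close>, hence converges; the uniform
  bound extends this to all vectors.\<close>

lemma L_strong_limit:
  assumes y: "\<And>n. y n \<in> M" "\<And>n v. norm (y n v) \<le> c * norm v" "c \<ge> 0" and w: "w \<in> M"
    and lim: "(\<lambda>n. \<eta> (y n)) \<longlonglongrightarrow> \<eta> w"
  shows "(\<lambda>n. L (y n) v) \<longlonglongrightarrow> L w v"
proof (rule bounded_clinear_strong_limit[OF _ L_bounded[OF w] _ \<eta>_dense])
  show "bounded_clinear (L (y n))" for n by (rule L_bounded[OF y(1)])
  show "norm (L (y n) x) \<le> c * norm x" for n x by (rule left_mult_bound[OF y(1) y(3) y(2)])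
  fix x assume "x \<in> \<eta> ` M"
  then obtain T where T: "x = \<eta> T" "T \<in> M" by (rule imageE)
  obtain R where R: "bounded_clinear R" "\<forall>S\<in>M. R (\<eta> S) = \<eta> (S \<circ> T)"
    using right_mult_exists[OF T(2)] by (elim exE conjE)
  have "(\<lambda>n. R (\<eta> (y n))) \<longlonglongrightarrow> R (\<eta> w)" by (rule bounded_clinear_tendsto[OF R(1) lim])
  then show "(\<lambda>n. L (y n) x) \<longlonglongrightarrow> L w x"
    using R(2) y(1) w T(2) by (simp add: T(1) L_\<eta>)
qed

text \<open>An operator carrying a to b carries 1 + a^2 to 1 + b^2, hence also their inverses and
  the products with them.\<close>

lemma resolvent_intertwine:
  assumes u: "bounded_clinear u" and a: "a \<in> M" and b: "b \<in> M" and ra: "is_resolvent a r" and rb: "is_resolvent b s"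
    and ab: "\<And>v. u (L a v) = L b (u v)"
  shows "u (L (a \<circ> r) v) = L (b \<circ> s) (u v)"
proof -
  have r: "r \<in> M" "\<And>v. r v + a (a (r v)) = v" using ra by (simp_all add: is_resolvent_def)
  have s: "s \<in> M" "\<And>v. s (v + b (b v)) = v" using rb by (simp_all add: is_resolvent_def)
  have aar: "a \<circ> (a \<circ> r) \<in> M" and sbb: "s \<circ> (b \<circ> b) \<in> M" by (intro M_comp a b r(1) s(1))+
  have "(\<lambda>v. r v + (a \<circ> (a \<circ> r)) v) = id" by (rule ext) (simp add: r(2))
  then have "L (\<lambda>v. r v + (a \<circ> (a \<circ> r)) v) = id" by (simp only: L_id)
  then have "(\<lambda>v. L r v + L (a \<circ> (a \<circ> r)) v) = id" by (simp only: L_plus[OF r(1) aar])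
  from fun_cong[OF this] have Lr: "L r v + L a (L a (L r v)) = v" for v
    by (simp add: L_comp a r(1) M_comp)
  have "(\<lambda>v. s v + (s \<circ> (b \<circ> b)) v) = id"
    by (rule ext) (use s(2) in \<open>simp add: bounded_clinear_add[OF M_bounded[OF s(1)]]\<close>)
  then have "L (\<lambda>v. s v + (s \<circ> (b \<circ> b)) v) = id" by (simp only: L_id)
  then have "(\<lambda>v. L s v + L (s \<circ> (b \<circ> b)) v) = id" by (simp only: L_plus[OF s(1) sbb])
  from fun_cong[OF this] have Ls: "L s v + L s (L b (L b v)) = v" for v
    by (simp add: L_comp b s(1) M_comp)
  define w where "w = L r v"
  have "u v = u (w + L a (L a w))" using Lr[of v] by (simp add: w_def)
  also have "\<dots> = u w + L b (L b (u w))" by (simp add: bounded_clinear_add[OF u] ab)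
  finally have "L s (u v) = u w" using Ls[of "u w"] by (simp add: bounded_clinear_add[OF L_bounded[OF s(1)]])
  then show ?thesis using a b r(1) s(1) by (simp add: L_comp ab w_def)
qed

text \<open>A Kaplansky type argument: the approximants \<open>2 a / (1 + a\<^sup>2)\<close> and their images are uniformly bounded,
  so that the images converge in \<open>M\<close>.\<close>

theorem implemented_by_unitary:
  assumes u: "unitary u" and u1: "u (\<eta> id) = \<eta> id"
    and B: "B \<subseteq> M" "closure (\<eta> ` B) = UNIV" "\<And>a. a \<in> B \<Longrightarrow> (\<lambda>x. (1/2) *\<^sub>C (a x + adj a x)) \<in> B"
    and uB: "\<And>a. a \<in> B \<Longrightarrow> adj a = a \<Longrightarrow> \<exists>b\<in>M. adj b = b \<and> (\<forall>v. u (L a v) = L b (u v))"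
    and x: "x \<in> M"
  shows "\<exists>y\<in>M. \<forall>v. u (L x v) = L y (u v)"
proof -
  have bu: "bounded_clinear u" by (rule unitaryD(1)[OF u])
  define good where "good x \<longleftrightarrow> x \<in> M \<and> (\<exists>y\<in>M. \<forall>v. u (L x v) = L y (u v))" for x
  have good_plus: "good (\<lambda>v. x v + y v)" if g: "good x" "good y" for x y
  proof -
    obtain x' where x': "x' \<in> M" "\<forall>v. u (L x v) = L x' (u v)" using g(1) unfolding good_def by (elim conjE bexE)
    obtain y' where y': "y' \<in> M" "\<forall>v. u (L y v) = L y' (u v)" using g(2) unfolding good_def by (elim conjE bexE)
    have M: "x \<in> M" "y \<in> M" using g by (simp_all add: good_def)
    show ?thesis unfolding good_def
      by (intro conjI M_plus M bexI[of _ "\<lambda>v. x' v + y' v"] M_plus x'(1) y'(1))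
         (simp add: L_plus[OF M] L_plus[OF x'(1) y'(1)] bounded_clinear_add[OF bu] x'(2) y'(2))
  qed
  have good_scale: "good (\<lambda>v. c *\<^sub>C x v)" if g: "good x" for c x
  proof -
    obtain x' where x': "x' \<in> M" "\<forall>v. u (L x v) = L x' (u v)" using g unfolding good_def by (elim conjE bexE)
    have M: "x \<in> M" using g by (simp add: good_def)
    show ?thesis unfolding good_def
      by (intro conjI M_scale M bexI[of _ "\<lambda>v. c *\<^sub>C x' v"] M_scale x'(1))
         (simp add: L_scale[OF M] L_scale[OF x'(1)] bounded_clinear_scaleC[OF bu] x'(2))
  qed
  have good_cayley: "good (z \<circ> r)" if z: "z \<in> M" "adj z = z" and r: "is_resolvent z r" for z r
  proof -
    have rM: "r \<in> M" using r by (simp add: is_resolvent_def)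
    have zr: "z \<circ> r \<in> M" by (rule M_comp[OF z(1) rM])
    have "\<exists>a. a \<in> B \<and> adj a = a \<and> norm (\<eta> a - \<eta> z) < 1 / real (Suc n)" for n
    proof -
      have "\<eta> z \<in> closure (\<eta> ` B)" using B(2) by simp
      then obtain v where v: "v \<in> \<eta> ` B" "dist v (\<eta> z) < 1 / real (Suc n)"
        unfolding closure_approachable by (elim allE[of _ "1 / real (Suc n)"] impE bexE) simp_all
      obtain a where a: "v = \<eta> a" "a \<in> B" using v(1) by (rule imageE)
      have aM: "a \<in> M" using a(2) B(1) by auto
      have ba: "bounded_clinear a" by (rule M_bounded[OF aM])
      \<comment> \<open>The self-adjoint part is no worse an approximation: \<open>z\<close> is
        self-adjoint and the adjoint is isometric for the trace norm.\<close>
      define h where "h = (\<lambda>x. (1/2) *\<^sub>C (a x + adj a x))"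
      have hB: "h \<in> B" unfolding h_def by (rule B(3)[OF a(2)])
      have "adj h = h"
        unfolding h_def adj_scale[OF bounded_clinear_plus[OF ba bounded_clinear_adj[OF ba]]]
          adj_plus[OF ba bounded_clinear_adj[OF ba]] adj_adj[OF ba] by (simp add: add.commute)
      moreover have "norm (\<eta> h - \<eta> z) < 1 / real (Suc n)"
      proof -
        define d where "d = (\<lambda>x. a x - z x)"
        have dM: "d \<in> M" unfolding d_def by (rule M_diff[OF aM z(1)])
        have hM: "h \<in> M" using hB B(1) by auto
        have adjd: "adj d = (\<lambda>x. adj a x - z x)"
        proof (rule adj_unique)
          have "cinner (z x) y = cinner x (z y)" for x y using cinner_adj[OF M_bounded[OF z(1)], of x y] by (simp add: z(2))
          then show "cinner (d x) y = cinner x (adj a y - z y)" for x y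
            unfolding d_def by (simp add: cinner_diff_left cinner_diff_right cinner_adj[OF ba])
        qed
        have two: "(1/2) *\<^sub>C z x + (1/2) *\<^sub>C z x = z x" for x by (simp add: scaleC_add_left[symmetric])
        have "(\<lambda>x. h x - z x) = (\<lambda>x. (1/2) *\<^sub>C (d x + adj d x))"
        proof
          fix x
          have "(1/2) *\<^sub>C (d x + adj d x) = h x - ((1/2) *\<^sub>C z x + (1/2) *\<^sub>C z x)"
            unfolding adjd by (simp add: h_def d_def scaleC_add_right scaleC_diff_right)
          then show "h x - z x = (1/2) *\<^sub>C (d x + adj d x)" by (simp only: two)
        qed
        then have "\<eta> h - \<eta> z = (1/2) *\<^sub>C (\<eta> d + \<eta> (adj d))"
          using \<eta>_diff[OF hM z(1)] \<eta>_scale[OF M_plus[OF dM M_adj[OF dM]], of "1/2"] \<eta>_plus[OF dM M_adj[OF dM]] by simp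
        then have "norm (\<eta> h - \<eta> z) = 1/2 * norm (\<eta> d + \<eta> (adj d))" by (simp add: norm_divide)
        also have "\<dots> \<le> 1/2 * (norm (\<eta> d) + norm (\<eta> (adj d)))" by (rule mult_left_mono[OF norm_triangle_ineq]) simp
        also have "\<dots> = norm (\<eta> d)" by (simp add: norm_\<eta>_adj[OF dM])
        also have "\<eta> d = \<eta> a - \<eta> z" unfolding d_def by (rule \<eta>_diff[OF aM z(1)])
        finally show ?thesis using v(2) by (simp add: a(1) dist_norm)
      qed
      ultimately show ?thesis using hB by (intro exI[of _ h]) simp
    qed
    then have "\<forall>n. \<exists>a. a \<in> B \<and> adj a = a \<and> norm (\<eta> a - \<eta> z) < 1 / real (Suc n)" by (rule allI)
    from choice[OF this] obtain a where a0: "\<forall>n. a n \<in> B \<and> adj (a n) = a n \<and> norm (\<eta> (a n) - \<eta> z) < 1 / real (Suc n)" by (rule exE)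
    have a: "a n \<in> M" "adj (a n) = a n" "norm (\<eta> (a n) - \<eta> z) < 1 / real (Suc n)" "a n \<in> B" for n
      using a0 B(1) by auto
    have "\<forall>n. \<exists>b. b \<in> M \<and> adj b = b \<and> (\<forall>v. u (L (a n) v) = L b (u v))"
      using uB[OF a(4) a(2)] by auto
    from choice[OF this] obtain b where b0: "\<forall>n. b n \<in> M \<and> adj (b n) = b n \<and> (\<forall>v. u (L (a n) v) = L (b n) (u v))" by (rule exE)
    have b: "b n \<in> M" "adj (b n) = b n" "u (L (a n) v) = L (b n) (u v)" for n v using b0 by auto
    have "\<forall>n. \<exists>r. is_resolvent (a n) r" using resolvent_exists[OF a(1,2)] by auto
    from choice[OF this] obtain ra where ra: "\<forall>n. is_resolvent (a n) (ra n)" by (rule exE)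
    have "\<forall>n. \<exists>r. is_resolvent (b n) r" using resolvent_exists[OF b(1,2)] by auto
    from choice[OF this] obtain rb where rb: "\<forall>n. is_resolvent (b n) (rb n)" by (rule exE)
    have raM: "ra n \<in> M" and rbM: "rb n \<in> M" for n using ra rb by (simp_all add: is_resolvent_def)
    define f where "f n = a n \<circ> ra n" for n
    define y where "y n = b n \<circ> rb n" for n
    have fM: "f n \<in> M" and yM: "y n \<in> M" for n unfolding f_def y_def by (intro M_comp a b raM rbM)+
    have fb: "norm (f n v) \<le> 1/2 * norm v" for n v using ra by (simp add: f_def is_resolvent_def)
    have yb: "norm (y n v) \<le> 1/2 * norm v" for n v using rb by (simp add: y_def is_resolvent_def)
    have uf: "u (L (f n) v) = L (y n) (u v)" for n v
      unfolding f_def y_def by (rule resolvent_intertwine[OF bu a(1) b(1) ra[rule_format] rb[rule_format] b(3)])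
    have flim: "(\<lambda>n. \<eta> (f n)) \<longlonglongrightarrow> \<eta> (z \<circ> r)"
    proof -
      have "(\<lambda>n. \<eta> (f n) - \<eta> (z \<circ> r)) \<longlonglongrightarrow> 0"
      proof (rule Lim_null_comparison)
        have "norm (\<eta> (f n) - \<eta> (z \<circ> r)) \<le> 2 * (1 / real (Suc n))" for n
          using cayley_lipschitz[OF a(1) z(1) ra[rule_format] r, of n] a(3)[of n] unfolding f_def by linarith
        then show "\<forall>\<^sub>F n in sequentially. norm (\<eta> (f n) - \<eta> (z \<circ> r)) \<le> 2 * (1 / real (Suc n))" by (simp only: eventually_True)
        have "(\<lambda>n. 2 * (1 / real (Suc n))) \<longlonglongrightarrow> 2 * 0" by (intro tendsto_mult tendsto_const LIMSEQ_Suc[OF lim_1_over_n])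
        then show "(\<lambda>n. 2 * (1 / real (Suc n))) \<longlonglongrightarrow> 0" by simp
      qed
      then show ?thesis by (simp only: LIM_zero_iff)
    qed
    \<comment> \<open>Because \<open>u\<close> fixes \<open>\<eta> id\<close>, intertwining
      evaluated there identifies \<open>\<eta> (y n)\<close> with \<open>u (\<eta> (f n))\<close>,
      so the images converge in L2; being bounded, they have their limit in
      \<open>M\<close>.\<close>
    have ylim: "(\<lambda>n. \<eta> (y n)) \<longlonglongrightarrow> u (\<eta> (z \<circ> r))"
    proof -
      have "\<eta> (y n) = u (\<eta> (f n))" for n
      proof -
        have "\<eta> (y n) = L (y n) (u (\<eta> id))" by (simp only: u1 L_\<eta>[OF yM M_id] comp_id)
        also have "\<dots> = u (L (f n) (\<eta> id))" by (rule uf[symmetric])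
        finally show ?thesis by (simp only: L_\<eta>[OF fM M_id] comp_id)
      qed
      then show ?thesis using bounded_clinear_tendsto[OF bu flim] by simp
    qed
    obtain w where w: "w \<in> M" "\<eta> w = u (\<eta> (z \<circ> r))" using bounded_\<eta>_complete[OF yM yb _ ylim] by auto
    have "u (L (z \<circ> r) v) = L w (u v)" for v
    proof (rule LIMSEQ_unique)
      have "(\<lambda>n. u (L (f n) v)) \<longlonglongrightarrow> u (L (z \<circ> r) v)"
        by (rule bounded_clinear_tendsto[OF bu L_strong_limit[OF fM fb _ zr flim]]) simp
      then show "(\<lambda>n. L (y n) (u v)) \<longlonglongrightarrow> u (L (z \<circ> r) v)" by (simp only: uf)
      show "(\<lambda>n. L (y n) (u v)) \<longlonglongrightarrow> L w (u v)"
        by (rule L_strong_limit[OF yM yb _ w(1)]) (use ylim w(2) in simp_all)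
    qed
    then show ?thesis unfolding good_def using zr w(1) by auto
  qed
  have good_sa: "good x" if x: "x \<in> M" "adj x = x" for x
  proof -
    obtain C where C: "C > 0" "\<forall>v. norm (x v) \<le> C * norm v" using bounded_clinear_bound[OF M_bounded[OF x(1)]] by (elim exE conjE)
    \<comment> \<open>Scaling brings the norm down to 1/2, as the fixed-point construction of a
      preimage requires; linearity undoes the scaling afterwards.\<close>
    define k where "k = 1 / (2 * C)"
    define x' where "x' = (\<lambda>v. complex_of_real k *\<^sub>C x v)"
    have k: "k > 0" using C(1) by (simp add: k_def)
    have x': "x' \<in> M" "adj x' = x'" unfolding x'_def by (rule M_scale[OF x(1)]) (simp add: adj_scale[OF M_bounded[OF x(1)]] x(2))
    have nx: "norm (x' v) \<le> 1/2 * norm v" for v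
    proof -
      have "norm (x' v) = k * norm (x v)" using k by (simp add: x'_def)
      also have "\<dots> \<le> k * (C * norm v)" using C(2) k by (intro mult_left_mono) auto
      also have "\<dots> = 1/2 * norm v" using C(1) by (simp add: k_def)
      finally show ?thesis .
    qed
    obtain z where z: "z \<in> M" "adj z = z" "\<forall>v. x' (v + z (z v)) = 2 *\<^sub>C z v"
      using cayley_preimage[OF x' nx] by (elim bexE conjE)
    obtain r where r: "is_resolvent z r" using resolvent_exists[OF z(1,2)] by (rule exE)
    have "x' v = 2 *\<^sub>C (z \<circ> r) v" for v
      using z(3)[rule_format, of "r v"] r by (simp add: is_resolvent_def)
    then have "x v = complex_of_real (1/k) *\<^sub>C (2 *\<^sub>C (z \<circ> r) v)" for v
    proof -
      assume *: "\<And>v. x' v = 2 *\<^sub>C (z \<circ> r) v"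
      have "complex_of_real (1/k) *\<^sub>C x' v = x v" using k by (simp add: x'_def scaleC_scaleC)
      then show ?thesis by (simp only: *)
    qed
    then have "x = (\<lambda>v. complex_of_real (1/k) *\<^sub>C (2 *\<^sub>C (z \<circ> r) v))" by (rule ext)
    moreover have "good (\<lambda>v. complex_of_real (1/k) *\<^sub>C (2 *\<^sub>C (z \<circ> r) v))"
      by (intro good_scale good_cayley z r)
    ultimately show ?thesis by simp
  qed
  have bx: "bounded_clinear x" "bounded_clinear (adj x)" by (rule M_bounded[OF x], rule M_bounded[OF M_adj[OF x]])
  define h where "h = (\<lambda>v. x v + adj x v)"
  \<comment> \<open>With these self-adjoint operators, x = h / 2 - i k / 2.\<close>
  define k where "k = (\<lambda>v. \<i> *\<^sub>C x v + (- \<i>) *\<^sub>C adj x v)"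
  have "good h"
  proof (rule good_sa)
    show "h \<in> M" unfolding h_def by (intro M_plus M_adj x)
    show "adj h = h" unfolding h_def adj_plus[OF bx] adj_adj[OF bx(1)] by (simp add: add.commute)
  qed
  moreover have "good k"
  proof (rule good_sa)
    show "k \<in> M" unfolding k_def by (intro M_plus M_scale M_adj x)
    show "adj k = k" unfolding k_def adj_plus[OF bounded_clinear_scale[OF bx(1)] bounded_clinear_scale[OF bx(2)]]
        adj_scale[OF bx(1)] adj_scale[OF bx(2)] adj_adj[OF bx(1)] by (rule ext) simp
  qed
  ultimately have "good (\<lambda>v. (1/2) *\<^sub>C h v + (- \<i> / 2) *\<^sub>C k v)" by (intro good_plus good_scale)
  moreover have "(\<lambda>v. (1/2) *\<^sub>C h v + (- \<i> / 2) *\<^sub>C k v) = x"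
  proof
    fix v
    have "(1/2) *\<^sub>C h v + (- \<i> / 2) *\<^sub>C k v = (1/2) *\<^sub>C x v + (1/2) *\<^sub>C x v"
      by (simp add: h_def k_def scaleC_add_right scaleC_diff_right scaleC_scaleC)
    also have "\<dots> = x v" by (simp add: scaleC_add_left[symmetric])
    finally show "(1/2) *\<^sub>C h v + (- \<i> / 2) *\<^sub>C k v = x v" .
  qed
  ultimately show ?thesis by (simp add: good_def)
qed

end

section \<open>The flow as a homomorphism on polynomials, and the automorphism group\<close>

context tracial_derivation begin

text \<open>The partial sums are polynomials bounded in operator norm, so their L2 limit comes from
  an element of \<open>M\<close>. Self-adjointness passes to the limit because the adjoint is
  isometric in L2.\<close>

lemma flow_element:
  assumes t: "\<bar>t\<bar> < 2 * radius" and S: "S \<in> A"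
  shows "\<exists>y\<in>M. \<eta> y = flow t S \<and> (adj S = S \<longrightarrow> adj y = y)"
proof -
  define p where "p n = (\<lambda>v. \<Sum>k<n. complex_of_real (t ^ k / fact k) *\<^sub>C (D ^^ k) S v)" for n :: nat
  have p0: "p 0 = (\<lambda>v. 0)" by (simp add: p_def)
  have pSuc: "p (Suc n) = (\<lambda>v. p n v + complex_of_real (t ^ n / fact n) *\<^sub>C (D ^^ n) S v)" for n
    by (simp add: p_def)
  have DA: "(D ^^ k) S \<in> A" for k by (rule D_power_in[OF S])
  have pA: "p n \<in> A" for n
  proof (induction n)
    case 0
    show ?case unfolding p0 by (rule A_zero)
  next
    case (Suc n)
    show ?case unfolding pSuc by (intro A_plus A_scale Suc DA)
  qed
  have pM: "p n \<in> M" for n by (rule A_M[OF pA])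
  have \<eta>p: "\<eta> (p n) = (\<Sum>k<n. flow_term t S k)" for n
  proof (induction n)
    case 0
    show ?case by (simp add: p0 \<eta>_zero)
  next
    case (Suc n)
    have "\<eta> (p (Suc n)) = \<eta> (p n) + complex_of_real (t ^ n / fact n) *\<^sub>C \<eta> ((D ^^ n) S)"
      unfolding pSuc by (simp only: \<eta>_plus[OF pM M_scale[OF A_M[OF DA]]] \<eta>_scale[OF A_M[OF DA]])
    then show ?case by (simp add: Suc flow_term_def scaleR_scaleC)
  qed
  have q: "\<bar>t\<bar> * rate \<ge> 0" "\<bar>t\<bar> * rate < 1 / 2" using rate(1) radius(2)[OF t] by simp_all
  have fb: "flow_bound S \<ge> 0" by (rule flow_bound(1)[OF S])
  \<comment> \<open>The ratio |t| * rate is below 1/2 and the geometric series with ratio 1/2 sums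
    to 2.\<close>
  have pb: "norm (p n v) \<le> (2 * flow_bound S) * norm v" for n v
  proof -
    have "norm (p n v) \<le> (\<Sum>k<n. norm (complex_of_real (t ^ k / fact k) *\<^sub>C (D ^^ k) S v))"
      unfolding p_def by (rule norm_sum)
    also have "\<dots> \<le> (\<Sum>k<n. flow_bound S * norm v * (1/2) ^ k)"
    proof (rule sum_mono)
      fix k
      have "norm (complex_of_real (t ^ k / fact k) *\<^sub>C (D ^^ k) S v) = (\<bar>t\<bar> ^ k / fact k) * norm ((D ^^ k) S v)"
        by (simp add: norm_divide norm_power)
      also have "\<dots> \<le> (\<bar>t\<bar> ^ k / fact k) * (flow_bound S * fact k * rate ^ k * norm v)"
        by (rule mult_left_mono[OF flow_bound(2)[OF S]]) simp
      also have "\<dots> = flow_bound S * norm v * (\<bar>t\<bar> * rate) ^ k" by (simp add: power_mult_distrib)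
      also have "\<dots> \<le> flow_bound S * norm v * (1/2) ^ k"
        using q fb by (intro mult_left_mono power_mono) simp_all
      finally show "norm (complex_of_real (t ^ k / fact k) *\<^sub>C (D ^^ k) S v) \<le> flow_bound S * norm v * (1/2) ^ k" .
    qed
    also have "\<dots> = flow_bound S * norm v * (\<Sum>k<n. (1/2) ^ k)" by (rule sum_distrib_left[symmetric])
    also have "\<dots> \<le> flow_bound S * norm v * 2"
    proof (rule mult_left_mono)
      have "(\<Sum>k<n. (1/2::real) ^ k) \<le> suminf (\<lambda>k. (1/2) ^ k)"
        by (rule sum_le_suminf) (simp_all add: summable_geometric)
      also have "\<dots> = 2" using suminf_geometric[of "1/2::real"] by simp
      finally show "(\<Sum>k<n. (1/2::real) ^ k) \<le> 2" .
    qed (use fb in simp)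
    finally show ?thesis by (simp add: mult_ac)
  qed
  have lim: "(\<lambda>n. \<eta> (p n)) \<longlonglongrightarrow> flow t S"
    unfolding \<eta>p flow_def by (rule summable_LIMSEQ[OF summable_flow[OF t S]])
  obtain y where y: "y \<in> M" "\<eta> y = flow t S" using bounded_\<eta>_complete[OF pM pb _ lim] fb by auto
  have "adj y = y" if sa: "adj S = S"
  proof (rule \<eta>_inj[OF M_adj[OF y(1)] y(1)])
    have Dsa: "adj ((D ^^ k) S) = (D ^^ k) S" for k using D_power_adj[OF S, of k] sa by simp
    have psa: "adj (p n) = p n" for n
    proof (induction n)
      case 0
      show ?case unfolding p0 by (rule adj_unique) simp
    next
      case (Suc n)
      show ?case unfolding pSuc adj_plus[OF M_bounded[OF pM] bounded_clinear_scale[OF A_bounded[OF DA]]]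
          adj_scale[OF A_bounded[OF DA]] Suc Dsa by simp
    qed
    have "norm (\<eta> (p n) - \<eta> (adj y)) = norm (\<eta> (p n) - \<eta> y)" for n
    proof -
      have d: "(\<lambda>v. p n v - y v) \<in> M" by (rule M_diff[OF pM y(1)])
      have "adj (\<lambda>v. p n v - y v) = (\<lambda>v. p n v - adj y v)"
      proof (rule adj_unique)
        fix u v
        have "cinner (p n u) v = cinner u (p n v)" using cinner_adj[OF M_bounded[OF pM[of n]], of u v] by (simp add: psa)
        then show "cinner (p n u - y u) v = cinner u (p n v - adj y v)"
          by (simp add: cinner_diff_left cinner_diff_right cinner_adj[OF M_bounded[OF y(1)]])
      qed
      then have "\<eta> (p n) - \<eta> (adj y) = \<eta> (adj (\<lambda>v. p n v - y v))" by (simp only: \<eta>_diff[OF pM M_adj[OF y(1)]])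
      then show ?thesis by (simp only: norm_\<eta>_adj[OF d] \<eta>_diff[OF pM y(1)])
    qed
    moreover have "(\<lambda>n. norm (\<eta> (p n) - \<eta> y)) \<longlonglongrightarrow> 0"
      using lim unfolding y(2)[symmetric] by (intro tendsto_norm_zero) (simp only: LIM_zero_iff)
    ultimately have "(\<lambda>n. norm (\<eta> (p n) - \<eta> (adj y))) \<longlonglongrightarrow> 0" by simp
    then have "(\<lambda>n. \<eta> (p n) - \<eta> (adj y)) \<longlonglongrightarrow> 0" by (rule tendsto_norm_zero_cancel)
    then have "(\<lambda>n. \<eta> (p n)) \<longlonglongrightarrow> \<eta> (adj y)" by (simp only: LIM_zero_iff)
    then show "\<eta> (adj y) = \<eta> y" using LIMSEQ_unique[OF _ lim] y(2) by simp
  qed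
  then show ?thesis using y by (intro bexI[of _ y]) simp_all
qed

text \<open>Stated after applying \<open>\<eta>\<close>, so that the sum lives in a real vector
  space, where the abstract form of Pascal's rule applies.\<close>

lemma D_power_Leibniz:
  assumes "S \<in> A" "T \<in> A"
  shows "\<eta> ((D ^^ k) (S \<circ> T)) = (\<Sum>i\<le>k. real (k choose i) *\<^sub>R \<eta> ((D ^^ i) S \<circ> (D ^^ (k - i)) T))"
  using assms
proof (induction k arbitrary: S T)
  case 0
  show ?case by simp
next
  case (Suc k)
  note S = Suc.prems(1) and T = Suc.prems(2)
  have p: "(D ^^ i) (D S) = (D ^^ Suc i) S" for i S by (simp only: funpow_Suc_right o_apply)
  have A1: "D S \<circ> T \<in> A" "S \<circ> D T \<in> A" by (intro A_comp D_in S T)+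
  have "(D ^^ Suc k) (S \<circ> T) = (D ^^ k) (\<lambda>x. (D S \<circ> T) x + (S \<circ> D T) x)"
    unfolding p[symmetric] by (simp only: D_comp[OF S T])
  also have "\<dots> = (\<lambda>x. (D ^^ k) (D S \<circ> T) x + (D ^^ k) (S \<circ> D T) x)" by (rule D_power_plus[OF A1])
  finally have "\<eta> ((D ^^ Suc k) (S \<circ> T)) = \<eta> ((D ^^ k) (D S \<circ> T)) + \<eta> ((D ^^ k) (S \<circ> D T))"
    by (simp only: \<eta>_plus[OF A_M[OF D_power_in[OF A1(1)]] A_M[OF D_power_in[OF A1(2)]]])
  also have "\<dots> = (\<Sum>i\<le>k. real (k choose i) *\<^sub>R \<eta> ((D ^^ Suc i) S \<circ> (D ^^ (k - i)) T))
      + (\<Sum>i\<le>k. real (k choose i) *\<^sub>R \<eta> ((D ^^ i) S \<circ> (D ^^ Suc (k - i)) T))"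
    by (simp only: Suc.IH[OF D_in[OF S] T] Suc.IH[OF S D_in[OF T]] p)
  also have "\<dots> = (\<Sum>i\<le>Suc k. real (Suc k choose i) *\<^sub>R \<eta> ((D ^^ i) S \<circ> (D ^^ (Suc k - i)) T))"
    by (rule binomial_sum_Suc[of k "\<lambda>i j. \<eta> ((D ^^ i) S \<circ> (D ^^ j) T)", symmetric])
  finally show ?case .
qed

text \<open>The inner sum of the Cauchy product is left multiplication applied to the flow of
  \<open>T\<close>. Rewriting it as right multiplication \<open>R\<close> by the element behind that
  flow makes it continuous in the remaining factor, so the outer sum can be taken as well.\<close>

lemma flow_multiplicative:
  assumes t: "\<bar>t\<bar> < 2 * radius" and S: "S \<in> A" and T: "T \<in> A" and y: "y \<in> M" "\<eta> y = flow t S"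
  shows "flow t (S \<circ> T) = L y (flow t T)"
proof -
  obtain y' where y': "y' \<in> M" "\<eta> y' = flow t T" using flow_element[OF t T] by auto
  obtain R where R: "bounded_clinear R" "\<forall>x\<in>M. R (\<eta> x) = \<eta> (x \<circ> y')" using right_mult_exists[OF y'(1)] by (elim exE conjE)
  have q: "\<bar>t\<bar> * rate \<ge> 0" using rate(1) by simp
  have DS: "(D ^^ i) S \<in> A" and DT: "(D ^^ i) T \<in> A" for i by (rule D_power_in[OF S], rule D_power_in[OF T])
  define f where "f i j = ((t ^ i / fact i) * (t ^ j / fact j)) *\<^sub>R \<eta> ((D ^^ i) S \<circ> (D ^^ j) T)" for i j
  have fL: "f i j = (t ^ i / fact i) *\<^sub>R L ((D ^^ i) S) (flow_term t T j)" for i j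
  proof -
    have "L ((D ^^ i) S) (flow_term t T j) = (t ^ j / fact j) *\<^sub>R \<eta> ((D ^^ i) S \<circ> (D ^^ j) T)"
      unfolding flow_term_def scaleR_scaleC
      by (simp only: bounded_clinear_scaleC[OF L_bounded[OF A_M[OF DS]]] L_\<eta>[OF A_M[OF DS] A_M[OF DT]])
    then show ?thesis by (simp add: f_def)
  qed
  have "(\<lambda>k. \<Sum>i\<le>k. f i (k - i)) sums suminf (\<lambda>i. suminf (f i))"
  proof (rule double_series_diagonal[where p = "\<lambda>k. flow_bound S * (\<bar>t\<bar> * rate) ^ k" and q = "\<lambda>k. flow_bound T * (\<bar>t\<bar> * rate) ^ k"])
    show "norm (f i j) \<le> flow_bound S * (\<bar>t\<bar> * rate) ^ i * (flow_bound T * (\<bar>t\<bar> * rate) ^ j)" for i j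
    proof -
      have "norm (L ((D ^^ i) S) (flow_term t T j)) \<le> (flow_bound S * fact i * rate ^ i) * norm (flow_term t T j)"
        by (rule left_mult_bound[OF A_M[OF DS] _ flow_bound(2)[OF S]]) (use flow_bound(1)[OF S] rate(1) in simp)
      also have "\<dots> \<le> (flow_bound S * fact i * rate ^ i) * (flow_bound T * (\<bar>t\<bar> * rate) ^ j)"
        by (rule mult_left_mono[OF flow_bound(4)[OF T]]) (use flow_bound(1)[OF S] rate(1) in simp)
      finally have le: "norm (L ((D ^^ i) S) (flow_term t T j)) \<le> (flow_bound S * fact i * rate ^ i) * (flow_bound T * (\<bar>t\<bar> * rate) ^ j)" .
      have "norm (f i j) = (\<bar>t\<bar> ^ i / fact i) * norm (L ((D ^^ i) S) (flow_term t T j))"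
        unfolding fL by (simp add: power_abs)
      also have "\<dots> \<le> (\<bar>t\<bar> ^ i / fact i) * ((flow_bound S * fact i * rate ^ i) * (flow_bound T * (\<bar>t\<bar> * rate) ^ j))"
        by (rule mult_left_mono[OF le]) simp
      also have "\<dots> = flow_bound S * (\<bar>t\<bar> * rate) ^ i * (flow_bound T * (\<bar>t\<bar> * rate) ^ j)"
        by (simp add: power_mult_distrib)
      finally show ?thesis .
    qed
  qed (use summable_flow_bound[OF t] flow_bound(1)[OF S] flow_bound(1)[OF T] q in simp_all)
  moreover have "suminf (f i) = R (flow_term t S i)" for i
  proof -
    have "suminf (f i) = (t ^ i / fact i) *\<^sub>R L ((D ^^ i) S) (flow t T)"
    proof -
      have b: "bounded_linear (\<lambda>v. (t ^ i / fact i) *\<^sub>R L ((D ^^ i) S) v)"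
        by (rule bounded_linear_compose[OF bounded_linear_scaleR_right bounded_clinear_bounded_linear[OF L_bounded[OF A_M[OF DS]]]])
      have "f i = (\<lambda>j. (t ^ i / fact i) *\<^sub>R L ((D ^^ i) S) (flow_term t T j))" by (rule ext) (rule fL)
      then show ?thesis unfolding flow_def
        using bounded_linear.suminf[OF b summable_flow[OF t T]] by simp
    qed
    also have "L ((D ^^ i) S) (flow t T) = R (\<eta> ((D ^^ i) S))"
      using R(2) A_M[OF DS[of i]] by (simp add: y'(2)[symmetric] L_\<eta> y'(1))
    finally show ?thesis by (simp add: flow_term_def scaleR_scaleC bounded_clinear_scaleC[OF R(1)])
  qed
  moreover have "suminf (\<lambda>i. R (flow_term t S i)) = R (flow t S)"
    unfolding flow_def
    by (rule bounded_linear.suminf[OF bounded_clinear_bounded_linear[OF R(1)] summable_flow[OF t S], symmetric])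
  ultimately have s1: "(\<lambda>k. \<Sum>i\<le>k. f i (k - i)) sums R (flow t S)" by simp
  have "(\<Sum>i\<le>k. f i (k - i)) = flow_term t (S \<circ> T) k" for k
    unfolding flow_term_def D_power_Leibniz[OF S T] scaleR_sum_right scaleR_scaleR
    by (rule sum.cong) (simp_all only: f_def exp_coefficient_mult atMost_iff)
  then have "(\<lambda>k. \<Sum>i\<le>k. f i (k - i)) = flow_term t (S \<circ> T)" by (rule ext)
  then have "flow t (S \<circ> T) = R (flow t S)" using s1 unfolding flow_def by (simp add: sums_iff)
  also have "\<dots> = \<eta> (y \<circ> y')" using R(2) y by (simp add: y(2)[symmetric])
  also have "\<dots> = L y (flow t T)" by (simp add: y'(2)[symmetric] L_\<eta> y(1) y'(1))
  finally show ?thesis .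
qed

text \<open>On \<open>\<eta> T\<close> with \<open>T\<close> a polynomial this is multiplicativity
  of the flow; density of the polynomials does the rest.\<close>

lemma flow_op_left_mult:
  assumes t: "\<bar>t\<bar> < 2 * radius" and S: "S \<in> A" "adj S = S"
  shows "\<exists>y\<in>M. adj y = y \<and> (\<forall>v. flow_op t (L S v) = L y (flow_op t v))"
proof -
  obtain y where y: "y \<in> M" "\<eta> y = flow t S" "adj y = y" using flow_element[OF t S(1)] S(2) by auto
  have "flow_op t \<circ> L S = L y \<circ> flow_op t"
  proof (rule eq_on_\<eta>_A)
    fix T assume T: "T \<in> A"
    show "(flow_op t \<circ> L S) (\<eta> T) = (L y \<circ> flow_op t) (\<eta> T)"
      using flow_multiplicative[OF t S(1) T y(1,2)]
      by (simp only: o_apply L_\<eta>[OF A_M[OF S(1)] A_M[OF T]] flow_op(2)[OF t T] flow_op(2)[OF t A_comp[OF S(1) T]])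
  qed (intro bounded_clinear_comp flow_op(1)[OF t] L_bounded A_M S(1) y(1))+
  from fun_cong[OF this] have "flow_op t (L S v) = L y (flow_op t v)" for v by simp
  then show ?thesis using y by (intro bexI[of _ y]) simp_all
qed

lemma flow_op_fixes_unit:
  assumes t: "\<bar>t\<bar> < 2 * radius" shows "flow_op t (\<eta> id) = \<eta> id"
proof -
  have "(D ^^ k) (\<lambda>x. 0) = (\<lambda>x. 0)" for k by (induction k) (simp_all add: D_zero)
  then have "(D ^^ Suc k) id = (\<lambda>x. 0)" for k by (simp only: funpow_Suc_right o_apply D_id)
  then have z: "flow_term t id k = 0" if "k \<noteq> 0" for k
    using that by (cases k) (simp_all only: flow_term_def \<eta>_zero scaleR_zero_right)
  have "flow t id = (\<Sum>k\<in>{0}. flow_term t id k)" unfolding flow_def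
    by (rule suminf_finite) (simp_all add: z)
  then have "flow t id = \<eta> id" by (simp add: flow_term_def)
  then show ?thesis by (simp add: flow_op(2)[OF t A_id])
qed

lemma flow_op_implements:
  assumes t: "\<bar>t\<bar> < radius" and x: "x \<in> M"
  shows "\<exists>y\<in>M. \<forall>v. flow_op t (L x v) = L y (flow_op t v)"
proof -
  have t2: "\<bar>t\<bar> < 2 * radius" using t by simp
  show ?thesis
  proof (rule implemented_by_unitary[OF flow_op_unitary[OF t] flow_op_fixes_unit[OF t2] _ \<eta>_A_dense _ _ x])
    show "A \<subseteq> M" using A_M by auto
    show "(\<lambda>x. (1/2) *\<^sub>C (a x + adj a x)) \<in> A" if "a \<in> A" for a
      by (intro A_scale A_plus A_adj that)
    show "\<exists>b\<in>M. adj b = b \<and> (\<forall>v. flow_op t (L a v) = L b (flow_op t v))" if "a \<in> A" "adj a = a" for a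
      by (rule flow_op_left_mult[OF t2 that])
  qed
qed

theorem vect_derivation_exponentiates: "exponentiates M \<tau> \<eta> A D"
proof -
  obtain U where U: "unitary_group U" "\<forall>t. \<bar>t\<bar> < radius \<longrightarrow> U t = flow_op t"
    "\<forall>t. \<exists>n s. \<bar>s\<bar> < radius \<and> U t = (flow_op s) ^^ n"
    using flow_group_exists by (elim exE conjE)
  have gen: "generator U = {(\<xi>, \<i> *\<^sub>C \<zeta>) | \<xi> \<zeta>. (\<xi>, \<zeta>) \<in> closure G0}"
    by (rule generator_eq_closure[OF U(1) G0_selfadjoint G0_generator[OF U(1)]]) (use U(2) in simp_all)
  have exp: "exp_i (closure G0) = U" by (rule exp_i_eqI[OF G0_selfadjoint U(1) gen])
  \<comment> \<open>Implementation is known within the radius and is stable under composition, so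
    powers bring it to every time.\<close>
  have pow: "\<exists>y\<in>M. \<forall>v. (flow_op s ^^ n) (L x v) = L y ((flow_op s ^^ n) v)" if s: "\<bar>s\<bar> < radius" and x: "x \<in> M" for n s x
  proof (induction n)
    case 0
    show ?case by (rule bexI[OF _ x]) simp
  next
    case (Suc n)
    then obtain y where y: "y \<in> M" "\<forall>v. (flow_op s ^^ n) (L x v) = L y ((flow_op s ^^ n) v)" by (elim bexE)
    obtain z where z: "z \<in> M" "\<forall>v. flow_op s (L y v) = L z (flow_op s v)" using flow_op_implements[OF s y(1)] by (elim bexE)
    show ?case by (rule bexI[OF _ z(1)]) (simp add: y(2) z(2))
  qed
  have "\<exists>y. y \<in> M \<and> (\<forall>v. U t (L x v) = L y (U t v))" if x: "x \<in> M" for t x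
  proof -
    obtain n s where ns: "\<bar>s\<bar> < radius" "U t = (flow_op s) ^^ n" using U(3)[rule_format, of t] by (elim exE conjE)
    show ?thesis unfolding ns(2) using pow[OF ns(1) x, of n] by (elim bexE) (intro exI conjI)
  qed
  \<comment> \<open>One choice over pairs of a time and an operator yields the whole family; the
    guard makes the statement total, since nothing is claimed outside \<open>M\<close>.\<close>
  then have "\<forall>p. \<exists>y. snd p \<in> M \<longrightarrow> y \<in> M \<and> (\<forall>v. U (fst p) (L (snd p) v) = L y (U (fst p) v))" by auto
  from choice[OF this] obtain \<alpha>' where
    \<alpha>': "\<forall>p. snd p \<in> M \<longrightarrow> \<alpha>' p \<in> M \<and> (\<forall>v. U (fst p) (L (snd p) v) = L (\<alpha>' p) (U (fst p) v))" by (rule exE)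
  define \<alpha> where "\<alpha> t x = \<alpha>' (t, x)" for t x
  have \<alpha>M: "\<alpha> t x \<in> M" and \<alpha>U: "U t (L x v) = L (\<alpha> t x) (U t v)" if "x \<in> M" for t x v
    using \<alpha>'[rule_format, of "(t, x)"] that by (simp_all add: \<alpha>_def)
  have inv: "U t (U (- t) v) = v" "U (- t) (U t v) = v" for t v by (rule unitary_groupD(5)[OF U(1)], rule unitary_groupD(6)[OF U(1)])
  have bU: "bounded_clinear (U t)" for t by (rule unitaryD(1)[OF unitary_groupD(1)[OF U(1)]])
  have L\<alpha>: "L (\<alpha> t x) v = U t (L x (U (- t) v))" if x: "x \<in> M" for t x v
    using \<alpha>U[OF x, of t "U (- t) v"] by (simp add: inv)
  \<comment> \<open>Every algebraic law of the family is transported to operators on L2, where it is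
    conjugation by a unitary, and pulled back because \<open>L\<close> is injective on
    \<open>M\<close>.\<close>
  have eqI: "x = y" if "x \<in> M" "y \<in> M" "\<And>v. L x v = L y v" for x y
    by (rule L_inj[OF that(1,2)]) (rule ext, rule that(3))
  have add: "\<alpha> (s + t) x = \<alpha> s (\<alpha> t x)" if x: "x \<in> M" for s t x
  proof (rule eqI)
    fix v
    have "- (s + t) = - t + - s" by simp
    then have "U (- (s + t)) v = U (- t) (U (- s) v)" by (simp only: unitary_groupD(7)[OF U(1)])
    then show "L (\<alpha> (s + t) x) v = L (\<alpha> s (\<alpha> t x)) v"
      by (simp only: L\<alpha>[OF x] L\<alpha>[OF \<alpha>M[OF x]] unitary_groupD(7)[OF U(1), of s t])
  qed (intro \<alpha>M x)+
  have zero: "\<alpha> 0 x = x" if x: "x \<in> M" for x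
    by (rule eqI) (simp_all add: \<alpha>M x L\<alpha> unitary_groupD(2)[OF U(1)])
  \<comment> \<open>The trace is the vector state of \<open>\<eta> id\<close>, so its invariance
    rests on this fixed vector.\<close>
  have Uid: "U t (\<eta> id) = \<eta> id" for t
  proof -
    obtain n s where ns: "\<bar>s\<bar> < radius" "U t = (flow_op s) ^^ n" using U(3)[rule_format, of t] by (elim exE conjE)
    have "((flow_op s) ^^ n) (\<eta> id) = \<eta> id" using ns(1) by (induction n) (simp_all add: flow_op_fixes_unit)
    then show ?thesis by (simp only: ns(2))
  qed
  have "trace_preserving_automorphism_group M \<tau> \<alpha>"
    unfolding trace_preserving_automorphism_group_def
  proof (intro conjI allI ballI)
    fix t
    show "bij_betw (\<alpha> t) M M"
    proof (rule bij_betwI[where g = "\<alpha> (- t)"])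
      show "\<alpha> t \<in> M \<rightarrow> M" "\<alpha> (- t) \<in> M \<rightarrow> M" using \<alpha>M by auto
      show "\<alpha> (- t) (\<alpha> t x) = x" if "x \<in> M" for x using add[OF that, of "- t" t] zero[OF that] by simp
      show "\<alpha> t (\<alpha> (- t) x) = x" if "x \<in> M" for x using add[OF that, of t "- t"] zero[OF that] by simp
    qed
    fix S assume S: "S \<in> M"
    show "\<alpha> t (\<lambda>x. c *\<^sub>C S x) = (\<lambda>x. c *\<^sub>C \<alpha> t S x)" for c
    proof (rule eqI)
      show "L (\<alpha> t (\<lambda>x. c *\<^sub>C S x)) v = L (\<lambda>x. c *\<^sub>C \<alpha> t S x) v" for v
        by (simp add: L\<alpha>[OF M_scale[OF S]] L_scale[OF S] L_scale[OF \<alpha>M[OF S]] L\<alpha>[OF S] bounded_clinear_scaleC[OF bU])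
    qed (intro \<alpha>M M_scale S)+
    show "\<alpha> t (adj S) = adj (\<alpha> t S)"
    proof (rule eqI)
      show "L (\<alpha> t (adj S)) v = L (adj (\<alpha> t S)) v" for v
      proof (rule cinner_ext)
        fix w
        have "cinner (L (\<alpha> t (adj S)) v) w = cinner (L (adj S) (U (- t) v)) (U (- t) w)"
          by (simp only: L\<alpha>[OF M_adj[OF S]] unitary_group_cinner[OF U(1)])
        also have "\<dots> = cinner (U (- t) v) (L S (U (- t) w))"
          by (simp only: L_adj[OF S] cinner_adj'[OF L_bounded[OF S]])
        also have "\<dots> = cinner v (L (\<alpha> t S) w)"
          using unitary_group_cinner[OF U(1), of "- t" v "L S (U (- t) w)"] by (simp add: L\<alpha>[OF S])
        also have "\<dots> = cinner (L (adj (\<alpha> t S)) v) w"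
          by (simp only: L_adj[OF \<alpha>M[OF S]] cinner_adj'[OF L_bounded[OF \<alpha>M[OF S]]])
        finally show "cinner (L (\<alpha> t (adj S)) v) w = cinner (L (adj (\<alpha> t S)) v) w" .
      qed
    qed (intro \<alpha>M M_adj S)+
    show "\<tau> (\<alpha> t S) = \<tau> S"
    proof -
      have "\<tau> (\<alpha> t S) = cinner (L (\<alpha> t S) (\<eta> id)) (\<eta> id)"
        using \<tau>_eq_cinner[OF \<alpha>M[OF S]] L_\<eta>[OF \<alpha>M[OF S] M_id] by (simp only: comp_id)
      also have "\<dots> = cinner (L S (\<eta> id)) (\<eta> id)" by (simp only: L\<alpha>[OF S] Uid unitary_group_cinner[OF U(1)])
      also have "\<dots> = \<tau> S" using \<tau>_eq_cinner[OF S] L_\<eta>[OF S M_id] by (simp only: comp_id)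
      finally show ?thesis .
    qed
    fix T assume T: "T \<in> M"
    show "\<alpha> t (\<lambda>x. S x + T x) = (\<lambda>x. \<alpha> t S x + \<alpha> t T x)"
    proof (rule eqI)
      show "L (\<alpha> t (\<lambda>x. S x + T x)) v = L (\<lambda>x. \<alpha> t S x + \<alpha> t T x) v" for v
        by (simp add: L\<alpha>[OF M_plus[OF S T]] L_plus[OF S T] L_plus[OF \<alpha>M[OF S] \<alpha>M[OF T]] L\<alpha>[OF S] L\<alpha>[OF T]
            bounded_clinear_add[OF bU])
    qed (intro \<alpha>M M_plus S T)+
    show "\<alpha> t (S \<circ> T) = \<alpha> t S \<circ> \<alpha> t T"
    proof (rule eqI)
      show "L (\<alpha> t (S \<circ> T)) v = L (\<alpha> t S \<circ> \<alpha> t T) v" for v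
        by (simp add: L\<alpha>[OF M_comp[OF S T]] L_comp[OF S T] L_comp[OF \<alpha>M[OF S] \<alpha>M[OF T]] L\<alpha>[OF S] L\<alpha>[OF T] inv)
    qed (intro \<alpha>M M_comp S T)+
  next
    show "\<alpha> 0 S = S" if "S \<in> M" for S by (rule zero[OF that])
    show "\<alpha> (s + t) S = \<alpha> s (\<alpha> t S)" if "S \<in> M" for s t S by (rule add[OF that])
  qed
  moreover have "L (\<alpha> t S) = exp_i (closure G0) t \<circ> L S \<circ> exp_i (closure G0) (- t)" if "S \<in> M" for t S
    unfolding exp by (rule ext) (simp add: L\<alpha>[OF that])
  ultimately have "\<exists>\<alpha>. (\<forall>t. \<forall>S\<in>M. L (\<alpha> t S) = exp_i (closure G0) t \<circ> L S \<circ> exp_i (closure G0) (- t))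
      \<and> trace_preserving_automorphism_group M \<tau> \<alpha>" by (intro exI[of _ \<alpha>] conjI allI ballI)
  then show ?thesis unfolding exponentiates_def Let_def G0_def[symmetric] using G0_selfadjoint by (intro conjI)
qed

end

theorem theorem3p8:
  fixes M :: "('a::complex_hilbert \<Rightarrow> 'a) set"
    and \<tau> :: "('a \<Rightarrow> 'a) \<Rightarrow> complex"
    and \<eta> :: "('a \<Rightarrow> 'a) \<Rightarrow> 'l::complex_hilbert"
    and Y K :: "'n::finite \<Rightarrow> 'a \<Rightarrow> 'a"
  assumes "von_neumann_algebra M"
    and "normal_faithful_trace_state M \<tau>"
    and "L2_completion M \<tau> \<eta>"
    and "\<And>j. Y j \<in> M"
    and "\<And>j. adj (Y j) = Y j"
    and "algebraically_free Y"
    and "von_neumann_algebra hull range Y = M"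
    and "\<And>j. K j \<in> generated_algebra Y"
    and "\<And>j. adj (K j) = K j"
    and "trace_preserving \<tau> Y K"
  shows "exponentiates M \<tau> \<eta> (generated_algebra Y) (vect_derivation Y K)"
proof -
  have "bounded_clinear (Y j)" for j
    using assms(1,4) unfolding von_neumann_algebra_def unital_subalgebra_def by simp
  then interpret tracial_derivation M \<tau> \<eta> Y K
    by unfold_locales (use assms in simp_all)
  show ?thesis by (rule vect_derivation_exponentiates)
qed

end
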